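(* Let $n,d$ be positive integers with $n\ge 2d$. Let $\boldsymbol{X}=\langle X_i:i\in[n]^d\rangle$ be a random tensor and $\boldsymbol{\theta}=\langle\theta_i:i\in[n]^d\rangle$ a deterministic real tensor which satisfy the following. (A1) $\mathbb{E}[X_i]=0$, $\mathbb{E}[X_i^2]\le 1$ and $\mathbb{E}[|X_i|^3]<\infty$ for every $i\in[n]^d$. (A2) $\boldsymbol{X}$ is symmetric, exchangeable and its diagonal terms vanish. (A3) $\boldsymbol{\theta}$ is symmetric and its diagonal terms vanish. Assume that $|||\boldsymbol{\theta}|||_1=1$. Set $\kappa:=20\,d^3\,18^d\,(2d)!$ and $B:=\mathbb{E}\Big[\big(\frac1{n^d}\sum_{i\in[n]^d}X_i\big)^2\Big]$, and let $\alpha\in(0,1)$ be such that $$\delta_1\ \ge\ \max\Big\{\mathrm{osc}(\boldsymbol{X})^\alpha,\ B^\alpha,\ \Big(\frac{\kappa}{n}\Big)^\alpha\Big\}.$$ Then, setting $\sigma^2:=\mathrm{Var}(\langle\boldsymbol{\theta},\boldsymbol{X}\rangle)$ where $\langle\boldsymbol{\theta},\boldsymbol{X}\rangle:=\sum_{i\in[n]^d}\theta_iX_i$, we have $$d_K\big(\langle\boldsymbol{\theta},\boldsymbol{X}\rangle,\mathcal{N}(0,\sigma^2)\big)\le E_1+E_2+E_3$$ where $$E_1:=5\,\mathrm{osc}(\boldsymbol{X})^{1-\alpha}+5|\delta_0|^{1-\alpha}+\Big|\frac{\delta_0}{d^2\delta_1}\big(|||\boldsymbol{\theta}|||_0^2-1\big)\Big|+\frac{6\kappa}{n^{1-\alpha}}+4\,\frac{|||\boldsymbol{\theta}|||_0^2}{n},$$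 $$E_2:=2^{36}\,\frac{\mathbb{E}\big[|X_{(1,\dots,d)}|^3\big]}{\delta_1^{3/2}}\ \sum_{j=1}^n\Big|\sum_{i\in[n]^d,\ i(1)=j}\theta_i\Big|^3,$$ $$E_3:=3\kappa\,\frac{1}{d\sqrt{\delta_1}}\sum_{s=2}^d\binom ds\sqrt{s!}\,\sqrt{\Sigma_s+\frac{16d^22^d}{n}}\ |||\boldsymbol{\theta}|||_s.$$
   Context: $[n]=\{1,\dots,n\}$; elements $i\in[n]^d$ are viewed as functions $[d]\to[n]$ with $r$-th entry $i(r)$. An index $i\in[n]^d$ is diagonal if its entries are not pairwise distinct; a tensor has vanishing diagonal terms if its entry at every diagonal index is $0$. A tensor indexed by $[n]^d$ is symmetric if its entry at $(i_1,\dots,i_d)$ equals its entry at $(i_{\tau(1)},\dots,i_{\tau(d)})$ for every permutation $\tau$ of $[d]$. A random tensor $\boldsymbol{X}$ (a family of real random variables on a common probability space) is exchangeable if for every permutation $\pi$ of $[n]$ the random tensors $\boldsymbol{X}$ and $\langle X_{\pi\circ i}:i\in[n]^d\rangle$ have the same distribution, where $\pi\circ i=(\pi(i_1),\dots,\pi(i_d))$. Seminorms: $|||\boldsymbol{\theta}|||_0:=\big|\sum_{i\in[n]^d}\theta_i\big|$ and, for $s\in\{1,\dots,d\}$, $|||\boldsymbol{\theta}|||_s:=\Big(\sum_{j\in[n]^s}\big(\sum_{i}\theta_i\big)^2\Big)^{1/2}$, where the inner sum is over all $i\in[n]^d$ with $i(r)=j(r)$ for every $r\in[s]$. Parameters of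 $\boldsymbol{X}$: for $s\in\{1,\dots,d\}$, $\delta_s:=\mathbb{E}[X_{(1,\dots,d)}X_{(1,\dots,s,d+1,\dots,2d-s)}]$; $\delta_0:=\mathbb{E}[X_{(1,\dots,d)}X_{(d+1,\dots,2d)}]$; for $s\in\{0,\dots,d\}$, $\Sigma_s:=\sum_{t=0}^s\binom st(-1)^{s-t}\delta_t$. The oscillation is $$\mathrm{osc}(\boldsymbol{X}):=\mathbb{E}\Big|\frac1n\sum_{j=1}^n\Big(\frac1{n^{d-1}}\sum_{i\in[n]^d,\ i(1)=j}X_i\Big)^2-\delta_1\Big|.$$ $d_K(X,Y):=\sup_{x\in\mathbb{R}}|\mathbb{P}(X\le x)-\mathbb{P}(Y\le x)|$ is the Kolmogorov distance, and $\mathcal{N}(0,\sigma^2)$ is a normal random variable with mean $0$ and variance $\sigma^2$ (constant $0$ if $\sigma=0$). *)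

theory Defs
  imports "HOL-Probability.Probability" "HOL-Combinatorics.Permutations"
begin

(* [n]^d as the extensional functions from {1..d} to {1..n}.  The entry of a tensor at an
   argument outside this set is irrelevant to every notion below. *)
definition tensor_idx :: "nat \<Rightarrow> nat \<Rightarrow> (nat \<Rightarrow> nat) set" where
  "tensor_idx n d = {1..d} \<rightarrow>\<^sub>E {1..n}"

definition diagonal_idx :: "nat \<Rightarrow> (nat \<Rightarrow> nat) \<Rightarrow> bool" where
  "diagonal_idx d i \<longleftrightarrow> \<not> inj_on i {1..d}"

definition vanishing_diagonal :: "nat \<Rightarrow> nat \<Rightarrow> ((nat \<Rightarrow> nat) \<Rightarrow> real) \<Rightarrow> bool" where
  "vanishing_diagonal n d T \<longleftrightarrow> (\<forall>i\<in>tensor_idx n d. diagonal_idx d i \<longrightarrow> T i = 0)"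

(* A permutation of {1..d} fixes everything else, so i \<circ> \<tau> is again extensional. *)
definition symmetric_tensor :: "nat \<Rightarrow> nat \<Rightarrow> ((nat \<Rightarrow> nat) \<Rightarrow> real) \<Rightarrow> bool" where
  "symmetric_tensor n d T \<longleftrightarrow>
     (\<forall>\<tau>. \<tau> permutes {1..d} \<longrightarrow> (\<forall>i\<in>tensor_idx n d. T i = T (i \<circ> \<tau>)))"

(* A random tensor is a family X of random variables, X i \<omega> being the entry at i. *)
definition random_tensor ::
  "'a measure \<Rightarrow> nat \<Rightarrow> nat \<Rightarrow> ((nat \<Rightarrow> nat) \<Rightarrow> 'a \<Rightarrow> real) \<Rightarrow> bool" where
  "random_tensor M n d X \<longleftrightarrow> prob_space M \<and> (\<forall>i\<in>tensor_idx n d. X i \<in> borel_measurable M)"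

definition tensor_law ::
  "'a measure \<Rightarrow> nat \<Rightarrow> nat \<Rightarrow> ((nat \<Rightarrow> nat) \<Rightarrow> 'a \<Rightarrow> real) \<Rightarrow> ((nat \<Rightarrow> nat) \<Rightarrow> real) measure" where
  "tensor_law M n d X =
     distr M (PiM (tensor_idx n d) (\<lambda>_. borel)) (\<lambda>\<omega>. \<lambda>i\<in>tensor_idx n d. X i \<omega>)"

(* compose {1..d} \<pi> i is the extensional version of \<pi> \<circ> i. *)
definition exchangeable ::
  "'a measure \<Rightarrow> nat \<Rightarrow> nat \<Rightarrow> ((nat \<Rightarrow> nat) \<Rightarrow> 'a \<Rightarrow> real) \<Rightarrow> bool" where
  "exchangeable M n d X \<longleftrightarrow>
     (\<forall>\<pi>. \<pi> permutes {1..n} \<longrightarrow>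
        tensor_law M n d X = tensor_law M n d (\<lambda>i. X (compose {1..d} \<pi> i)))"

definition tensor_seminorm :: "nat \<Rightarrow> nat \<Rightarrow> nat \<Rightarrow> ((nat \<Rightarrow> nat) \<Rightarrow> real) \<Rightarrow> real" where
  "tensor_seminorm n d s \<theta> =
     (if s = 0 then \<bar>\<Sum>i\<in>tensor_idx n d. \<theta> i\<bar>
      else sqrt (\<Sum>j\<in>tensor_idx n s.
             (\<Sum>i\<in>{i\<in>tensor_idx n d. \<forall>r\<in>{1..s}. i r = j r}. \<theta> i)\<^sup>2))"

definition tensor_inner ::
  "nat \<Rightarrow> nat \<Rightarrow> ((nat \<Rightarrow> nat) \<Rightarrow> real) \<Rightarrow> ((nat \<Rightarrow> nat) \<Rightarrow> real) \<Rightarrow> real" where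
  "tensor_inner n d \<theta> x = (\<Sum>i\<in>tensor_idx n d. \<theta> i * x i)"

definition base_idx :: "nat \<Rightarrow> nat \<Rightarrow> nat" where
  "base_idx d = (\<lambda>r\<in>{1..d}. r)"

(* (1, \<dots>, s, d+1, \<dots>, 2d-s) for s \<le> d; for s = 0 this is (d+1, \<dots>, 2d).
   It lies in [n]^d because n \<ge> 2d in all uses. *)
definition shifted_idx :: "nat \<Rightarrow> nat \<Rightarrow> nat \<Rightarrow> nat" where
  "shifted_idx d s = (\<lambda>r\<in>{1..d}. if r \<le> s then r else d + (r - s))"

definition corr ::
  "'a measure \<Rightarrow> nat \<Rightarrow> ((nat \<Rightarrow> nat) \<Rightarrow> 'a \<Rightarrow> real) \<Rightarrow> nat \<Rightarrow> real" where
  "corr M d X s = (\<integral>\<omega>. X (base_idx d) \<omega> * X (shifted_idx d s) \<omega> \<partial>M)"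

definition corr_Sigma ::
  "'a measure \<Rightarrow> nat \<Rightarrow> ((nat \<Rightarrow> nat) \<Rightarrow> 'a \<Rightarrow> real) \<Rightarrow> nat \<Rightarrow> real" where
  "corr_Sigma M d X s =
     (\<Sum>t=0..s. real (s choose t) * (-1) ^ (s - t) * corr M d X t)"

definition oscillation ::
  "'a measure \<Rightarrow> nat \<Rightarrow> nat \<Rightarrow> ((nat \<Rightarrow> nat) \<Rightarrow> 'a \<Rightarrow> real) \<Rightarrow> real" where
  "oscillation M n d X =
     (\<integral>\<omega>. \<bar>1 / real n * (\<Sum>j=1..n.
              (1 / real n ^ (d - 1) * (\<Sum>i\<in>{i\<in>tensor_idx n d. i 1 = j}. X i \<omega>))\<^sup>2)
           - corr M d X 1\<bar> \<partial>M)"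

(* Distance between laws on the line; d_K(X,Y) is obtained from the laws of X and Y. *)
definition kolmogorov_dist :: "real measure \<Rightarrow> real measure \<Rightarrow> real" where
  "kolmogorov_dist \<mu> \<nu> = (SUP x. \<bar>cdf \<mu> x - cdf \<nu> x\<bar>)"

(* The law N(0,v), parametrised by the variance; normal_density takes the standard deviation. *)
definition centered_normal :: "real \<Rightarrow> real measure" where
  "centered_normal v =
     (if v = 0 then return borel 0 else density lborel (normal_density 0 (sqrt v)))"

end

theory Submission
  imports Defs
begin

text \<open>By symmetry the inner product of \<open>\<theta>\<close> and \<open>X\<close> is a sum of \<open>a A * x A\<close> over the \<open>d\<close>-subsets \<open>A\<close> of
  \<open>{1..n}\<close>, and by exchangeability it has the law of the sum of \<open>a A * x (p ` A)\<close> for an independent uniformly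
  random permutation \<open>p\<close>.  Conditionally on \<open>x\<close>, projecting \<open>a\<close> onto the additive functions of \<open>A\<close>
  splits this sum into a linear permutation statistic (a sum of \<open>v k * X (p k)\<close>) and a remainder \<open>R\<close> without
  one-point marginals.  Stein's method with exchangeable transpositions bounds the Kolmogorov distance of the linear part
  to the normal law by its third moments; a concentration inequality for the linear part, itself a
  consequence of the Poincare inequality for transpositions, controls both the perturbation by \<open>R\<close> and the
  smoothness terms of Stein's method.  After averaging over \<open>x\<close>, the conditional variance is \<open>d\<^sup>2 \<delta>\<^sub>1\<close> up
  to the oscillation, and the second moment of \<open>R\<close> is a combination of the squared seminorms of order
  \<open>s \<ge> 2\<close> with coefficients \<open>\<Sigma>\<^sub>s\<close>.\<close>

section \<open>Averages over permutations\<close>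

text \<open>The field is only exchangeable, so all usable independence comes from the auxiliary
  permutation, and the distance compares distribution functions, so the Stein solution has a
  derivative with a jump. A swap of rows i, j changes the statistic by a product containing the
  values at i and j, on which the statistic itself depends. Conjugation by a double transposition
  moves these values to two further rows k, l, and summing over k, l turns the squared value
  differences into an almost deterministic quantity. The jump and the variation of the solution are
  then averaged with four rows frozen, hence the concentration inequality has to survive the
  deletion of four rows. Smallness is never assumed: when the claimed bound is at least 1 there is
  nothing to prove, and the opposite case supplies small third moments and a large n. The exponent
  \<alpha> serves to turn quotients by \<open>\<delta> 1\<close> into powers, the summand 16 d^2 2^d
  / n in E3 pays for a possibly negative \<open>\<Sigma>\<^sub>s\<close>, and the random centre left
  by conditioning costs only second order because the field has mean zero.\<close>

abbreviation swap :: "'a \<Rightarrow> 'a \<Rightarrow> 'a \<Rightarrow> 'a" where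
  "swap \<equiv> Transposition.transpose"

definition pavg :: "'a set \<Rightarrow> (('a \<Rightarrow> 'a) \<Rightarrow> real) \<Rightarrow> real" where
  "pavg I F = (\<Sum>p | p permutes I. F p) / fact (card I)"

lemma pavg_cong: "(\<And>p. p permutes I \<Longrightarrow> F p = G p) \<Longrightarrow> pavg I F = pavg I G"
  unfolding pavg_def by (metis (mono_tags, lifting) mem_Collect_eq sum.cong)

lemma pavg_mono: "(\<And>p. p permutes I \<Longrightarrow> F p \<le> G p) \<Longrightarrow> pavg I F \<le> pavg I G"
  unfolding pavg_def by (intro divide_right_mono sum_mono) auto

lemma pavg_nonneg: "(\<And>p. p permutes I \<Longrightarrow> 0 \<le> F p) \<Longrightarrow> 0 \<le> pavg I F"
  unfolding pavg_def by (intro divide_nonneg_nonneg sum_nonneg) auto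

lemma pavg_add: "pavg I (\<lambda>p. F p + G p) = pavg I F + pavg I G"
  unfolding pavg_def by (simp add: sum.distrib add_divide_distrib)

lemma pavg_diff: "pavg I (\<lambda>p. F p - G p) = pavg I F - pavg I G"
  unfolding pavg_def by (simp add: sum_subtractf diff_divide_distrib)

lemma pavg_cmult: "pavg I (\<lambda>p. c * F p) = c * pavg I F"
  unfolding pavg_def by (simp add: sum_distrib_left)

lemma pavg_minus: "pavg I (\<lambda>p. - F p) = - pavg I F"
  unfolding pavg_def by (simp add: sum_negf)

lemma pavg_multc: "pavg I (\<lambda>p. F p * c) = pavg I F * c"
  unfolding pavg_def by (simp add: sum_distrib_right)

lemma pavg_sum: "pavg I (\<lambda>p. \<Sum>x\<in>A. F x p) = (\<Sum>x\<in>A. pavg I (F x))"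
  unfolding pavg_def by (subst sum.swap) (simp add: sum_divide_distrib)

lemma pavg_const: "finite I \<Longrightarrow> pavg I (\<lambda>p. c) = c"
  unfolding pavg_def by (simp add: card_permutations)

lemma pavg_abs: "\<bar>pavg I F\<bar> \<le> pavg I (\<lambda>p. \<bar>F p\<bar>)"
  unfolding pavg_def by (simp add: divide_right_mono)

lemma pavg_comp_right:
  assumes "q permutes I"
  shows "pavg I (\<lambda>p. F (p \<circ> q)) = pavg I F"
proof -
  have "(\<Sum>p | p permutes I. F p) = (\<Sum>p | p permutes I. F (p \<circ> q))"
    by (rule sum_permutations_compose_right [OF assms])
  then show ?thesis by (simp add: pavg_def)
qed

lemma pavg_comp_left:
  assumes "q permutes I"
  shows "pavg I (\<lambda>p. F (q \<circ> p)) = pavg I F"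
proof -
  have "(\<Sum>p | p permutes I. F p) = (\<Sum>p | p permutes I. F (q \<circ> p))"
    by (rule setum_permutations_compose_left [OF assms])
  then show ?thesis by (simp add: pavg_def)
qed

text \<open>Tower rule: the inner average is the conditional mean of \<open>F\<close> given the
  values of \<open>p\<close> outside \<open>J\<close>. Each fixed \<open>s\<close> acts by right
  composition, which preserves the uniform law.\<close>

lemma pavg_pavg_subset:
  assumes "finite I" "J \<subseteq> I"
  shows "pavg I (\<lambda>p. pavg J (\<lambda>s. F (p \<circ> s))) = pavg I F"
proof -
  have fJ: "finite J" using assms finite_subset by blast
  have "pavg I (\<lambda>p. pavg J (\<lambda>s. F (p \<circ> s))) =
      pavg I (\<lambda>p. \<Sum>s | s permutes J. F (p \<circ> s)) / fact (card J)"
    unfolding pavg_def by (simp only: sum_divide_distrib divide_divide_eq_left mult.commute)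
  also have "\<dots> = pavg J (\<lambda>s. pavg I (\<lambda>p. F (p \<circ> s)))"
    unfolding pavg_sum by (simp only: pavg_def [of J])
  also have "\<dots> = pavg J (\<lambda>s. pavg I F)"
    by (rule pavg_cong, rule pavg_comp_right, erule permutes_subset) (rule assms(2))
  finally show ?thesis using fJ by (simp add: pavg_const)
qed

lemma pavg_Cauchy_Schwarz:
  "pavg I (\<lambda>p. \<bar>F p\<bar> * \<bar>G p\<bar>) \<le> sqrt (pavg I (\<lambda>p. (F p)\<^sup>2)) * sqrt (pavg I (\<lambda>p. (G p)\<^sup>2))"
proof -
  let ?P = "{p. p permutes I}" and ?N = "fact (card I) :: real"
  have "(\<Sum>p\<in>?P. \<bar>F p\<bar> * \<bar>G p\<bar>) \<le> L2_set F ?P * L2_set G ?P"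
    by (rule L2_set_mult_ineq)
  then have "pavg I (\<lambda>p. \<bar>F p\<bar> * \<bar>G p\<bar>) \<le> (L2_set F ?P * L2_set G ?P) / ?N"
    unfolding pavg_def by (intro divide_right_mono) auto
  also have "\<dots> = sqrt (pavg I (\<lambda>p. (F p)\<^sup>2)) * sqrt (pavg I (\<lambda>p. (G p)\<^sup>2))"
    unfolding pavg_def L2_set_def by (simp add: real_sqrt_divide)
  finally show ?thesis .
qed

lemma pavg_square_le:
  assumes "finite I" shows "(pavg I F)\<^sup>2 \<le> pavg I (\<lambda>p. (F p)\<^sup>2)"
proof -
  have "\<bar>pavg I F\<bar> \<le> pavg I (\<lambda>p. \<bar>F p\<bar> * \<bar>1\<bar>)" using pavg_abs by simp
  also have "\<dots> \<le> sqrt (pavg I (\<lambda>p. (F p)\<^sup>2)) * sqrt (pavg I (\<lambda>p. 1\<^sup>2))"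
    by (rule pavg_Cauchy_Schwarz)
  finally have "\<bar>pavg I F\<bar> \<le> sqrt (pavg I (\<lambda>p. (F p)\<^sup>2))" by (simp add: pavg_const assms)
  then show ?thesis by (metis abs_ge_zero power_mono power2_abs real_sqrt_pow2 pavg_nonneg zero_le_power2)
qed

lemma pavg_abs_le_sqrt:
  assumes "finite I" shows "pavg I (\<lambda>p. \<bar>F p\<bar>) \<le> sqrt (pavg I (\<lambda>p. (F p)\<^sup>2))"
  using pavg_Cauchy_Schwarz[of I F "\<lambda>_. 1"] assms by (simp add: pavg_const)

section \<open>Variance over permutations and the Poincare inequality for transpositions\<close>

definition pvar :: "'a set \<Rightarrow> (('a \<Rightarrow> 'a) \<Rightarrow> real) \<Rightarrow> real" where
  "pvar I F = pavg I (\<lambda>p. (F p - pavg I F)\<^sup>2)"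

text \<open>The value \<open>p m\<close> is uniform on \<open>I\<close>: composing with
  \<open>swap m i\<close> shows that the average does not depend on the position, and the sum over
  all positions is the same for every \<open>p\<close>.\<close>

lemma pavg_eval:
  assumes "finite I" "m \<in> I"
  shows "real (card I) * pavg I (\<lambda>p. h (p m)) = (\<Sum>k\<in>I. h k)"
proof -
  have "pavg I (\<lambda>p. h (p i)) = pavg I (\<lambda>p. h (p m))" if "i \<in> I" for i
  proof -
    have "pavg I (\<lambda>p. h ((p \<circ> swap m i) m)) = pavg I (\<lambda>p. h (p m))"
      by (rule pavg_comp_right [where F = "\<lambda>p. h (p m)"]) (use that assms permutes_swap_id in metis)
    then show ?thesis by simp
  qed
  then have "real (card I) * pavg I (\<lambda>p. h (p m)) = (\<Sum>i\<in>I. pavg I (\<lambda>p. h (p i)))" by simp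
  also have "\<dots> = pavg I (\<lambda>p. \<Sum>i\<in>I. h (p i))" by (simp add: pavg_sum)
  also have "\<dots> = pavg I (\<lambda>p. \<Sum>k\<in>I. h k)"
    by (intro pavg_cong) (simp add: sum.permute [where g = h, unfolded comp_def])
  finally show ?thesis using assms by (simp add: pavg_const)
qed

lemma sum_pairwise_diff_square:
  fixes g :: "'a \<Rightarrow> real"
  assumes "finite A"
  shows "(\<Sum>k\<in>A. \<Sum>l\<in>A. (g k - g l)\<^sup>2) = 2 * real (card A) * (\<Sum>k\<in>A. (g k)\<^sup>2) - 2 * (\<Sum>k\<in>A. g k)\<^sup>2"
proof -
  have "(\<Sum>k\<in>A. \<Sum>l\<in>A. (g k - g l)\<^sup>2) =
      (\<Sum>k\<in>A. real (card A) * (g k)\<^sup>2 - 2 * g k * (\<Sum>l\<in>A. g l) + (\<Sum>l\<in>A. (g l)\<^sup>2))"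
    by (simp add: power2_diff sum.distrib sum_subtractf sum_distrib_left mult.assoc)
  then show ?thesis
    by (simp add: sum.distrib sum_subtractf flip: sum_distrib_left sum_distrib_right)
      (simp add: power2_eq_square flip: sum_distrib_left)
qed

text \<open>\<open>G\<close> is the conditional mean of \<open>F\<close> given \<open>p m\<close>,
  hence a function \<open>g\<close> of a uniform point, and its variance is a multiple of the mean
  squared difference of two values of \<open>g\<close>. The values at \<open>p m\<close> and
  \<open>l\<close> are coupled by applying \<open>swap (p m) l\<close> to the same permutation, and
  Jensen's inequality moves the square inside the inner average.\<close>

lemma pvar_le_swap_stabiliser:
  fixes F :: "('a \<Rightarrow> 'a) \<Rightarrow> real"
  assumes fin: "finite I" and m: "m \<in> I"
  defines "G \<equiv> (\<lambda>p. pavg (I - {m}) (\<lambda>s. F (p \<circ> s)))"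
  shows "2 * real (card I) * pvar I G \<le> (\<Sum>i\<in>I. pavg I (\<lambda>p. (F p - F (p \<circ> swap m i))\<^sup>2))"
proof -
  let ?n = "real (card I)" and ?J = "I - {m}"
  define g where "g k = G (swap m k)" for k
  have n0: "?n > 0" using fin m card_gt_0_iff by fastforce
  \<comment> \<open>\<open>p\<close> is \<open>swap m (p m)\<close> after a permutation that fixes
    \<open>m\<close>; the inner average absorbs the latter, so only \<open>p m\<close>
    remains.\<close>
  have Gg: "G p = g (p m)" if p: "p permutes I" for p
  proof -
    let ?t = "swap m (p m)"
    have pm: "p m \<in> I" using p m permutes_in_image by metis
    have tI: "?t permutes I" using m pm permutes_swap_id by metis
    have s: "(?t \<circ> p) permutes ?J"
      by (rule permutes_superset[OF permutes_compose[OF p tI]]) (auto simp: m)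
    have "G p = pavg ?J (\<lambda>s. F (?t \<circ> ((?t \<circ> p) \<circ> s)))"
      unfolding G_def by (intro pavg_cong arg_cong[where f=F]) (auto simp: fun_eq_iff)
    also have "\<dots> = pavg ?J (\<lambda>s. F (?t \<circ> s))"
      by (rule pavg_comp_left[OF s, where F="\<lambda>s. F (?t \<circ> s)"])
    finally show ?thesis by (simp add: g_def G_def)
  qed
  have ev: "?n * pavg I (\<lambda>p. h (G p)) = (\<Sum>k\<in>I. h (g k))" for h :: "real \<Rightarrow> real"
  proof -
    have "pavg I (\<lambda>p. h (G p)) = pavg I (\<lambda>p. (h \<circ> g) (p m))" by (intro pavg_cong) (simp add: Gg)
    then show ?thesis using pavg_eval[OF fin m, of "h \<circ> g"] by simp
  qed
  define M where "M = pavg I G"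
  have M: "?n * M = (\<Sum>k\<in>I. g k)" using ev[of "\<lambda>x. x"] by (simp add: M_def)
  have "?n * pvar I G = (\<Sum>k\<in>I. (g k - M)\<^sup>2)"
    using ev[of "\<lambda>x. (x - M)\<^sup>2"] by (simp add: pvar_def M_def)
  also have "\<dots> = (\<Sum>k\<in>I. (g k)\<^sup>2) - 2 * M * (\<Sum>k\<in>I. g k) + ?n * M\<^sup>2"
    by (simp add: power2_diff sum.distrib sum_subtractf sum_distrib_left[symmetric]
        sum_distrib_right[symmetric] algebra_simps)
  also have "\<dots> = (\<Sum>k\<in>I. (g k)\<^sup>2) - ?n * M\<^sup>2"
    by (simp add: M[symmetric] power2_eq_square algebra_simps)
  finally have v: "?n * pvar I G = (\<Sum>k\<in>I. (g k)\<^sup>2) - ?n * M\<^sup>2" .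
  have "2 * ?n * (?n * pvar I G) = (\<Sum>k\<in>I. \<Sum>l\<in>I. (g k - g l)\<^sup>2)"
    unfolding v sum_pairwise_diff_square[OF fin] M[symmetric]
    by (simp add: power2_eq_square algebra_simps)
  also have "\<dots> = ?n * pavg I (\<lambda>p. \<Sum>l\<in>I. (g (p m) - g l)\<^sup>2)"
    using pavg_eval[OF fin m, of "\<lambda>k. \<Sum>l\<in>I. (g k - g l)\<^sup>2"] by simp
  finally have "2 * ?n * pvar I G = pavg I (\<lambda>p. \<Sum>l\<in>I. (g (p m) - g l)\<^sup>2)" using n0 by simp
  also have "\<dots> \<le> pavg I (\<lambda>p. pavg ?J (\<lambda>s. \<Sum>l\<in>I. (F (p \<circ> s) - F (swap ((p \<circ> s) m) l \<circ> (p \<circ> s)))\<^sup>2))"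
  proof (rule pavg_mono)
    fix p assume p: "p permutes I"
    have "(g (p m) - g l)\<^sup>2 \<le> pavg ?J (\<lambda>s. (F (p \<circ> s) - F (swap ((p \<circ> s) m) l \<circ> (p \<circ> s)))\<^sup>2)"
      if l: "l \<in> I" for l
    proof -
      have pm: "p m \<in> I" using p m permutes_in_image by metis
      let ?q = "swap (p m) l \<circ> p"
      have q: "?q permutes I" using p pm l by (intro permutes_compose permutes_swap_id)
      have "g l = G ?q" using Gg[OF q] by simp
      then have "g (p m) - g l = pavg ?J (\<lambda>s. F (p \<circ> s) - F (?q \<circ> s))"
        using Gg[OF p] by (simp add: G_def pavg_diff)
      then have "(g (p m) - g l)\<^sup>2 \<le> pavg ?J (\<lambda>s. (F (p \<circ> s) - F (?q \<circ> s))\<^sup>2)"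
        using pavg_square_le[of ?J] fin by simp
      also have "\<dots> = pavg ?J (\<lambda>s. (F (p \<circ> s) - F (swap ((p \<circ> s) m) l \<circ> (p \<circ> s)))\<^sup>2)"
        by (intro pavg_cong) (auto simp: permutes_def comp_assoc)
      finally show ?thesis .
    qed
    then have "(\<Sum>l\<in>I. (g (p m) - g l)\<^sup>2) \<le> (\<Sum>l\<in>I. pavg ?J (\<lambda>s. (F (p \<circ> s) - F (swap ((p \<circ> s) m) l \<circ> (p \<circ> s)))\<^sup>2))"
      by (rule sum_mono)
    then show "(\<Sum>l\<in>I. (g (p m) - g l)\<^sup>2) \<le> pavg ?J (\<lambda>s. \<Sum>l\<in>I. (F (p \<circ> s) - F (swap ((p \<circ> s) m) l \<circ> (p \<circ> s)))\<^sup>2)"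
      by (simp add: pavg_sum)
  qed
  also have "\<dots> = pavg I (\<lambda>p. \<Sum>l\<in>I. (F p - F (swap (p m) l \<circ> p))\<^sup>2)"
    using pavg_pavg_subset[OF fin, of ?J "\<lambda>p. \<Sum>l\<in>I. (F p - F (swap (p m) l \<circ> p))\<^sup>2"] by simp
  \<comment> \<open>Exchanging the values \<open>p m\<close>, \<open>p i\<close> after
    \<open>p\<close> is the same as exchanging the positions \<open>m\<close>, \<open>i\<close>
    before it.\<close>
  also have "\<dots> = pavg I (\<lambda>p. \<Sum>i\<in>I. (F p - F (p \<circ> swap m i))\<^sup>2)"
  proof (rule pavg_cong)
    fix p assume p: "p permutes I"
    have "(\<Sum>l\<in>I. (F p - F (swap (p m) l \<circ> p))\<^sup>2) = (\<Sum>i\<in>I. (F p - F (swap (p m) (p i) \<circ> p))\<^sup>2)"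
      using sum.permute[OF p, of "\<lambda>l. (F p - F (swap (p m) l \<circ> p))\<^sup>2"] by (simp add: comp_def)
    also have "\<dots> = (\<Sum>i\<in>I. (F p - F (p \<circ> swap m i))\<^sup>2)"
    proof (intro sum.cong refl)
      fix i
      have "inj p" using p permutes_inj by blast
      then have "swap (p m) (p i) \<circ> p = p \<circ> swap m i"
        by (auto simp: fun_eq_iff Transposition.transpose_def inj_eq)
      then show "(F p - F (swap (p m) (p i) \<circ> p))\<^sup>2 = (F p - F (p \<circ> swap m i))\<^sup>2" by simp
    qed
    finally show "(\<Sum>l\<in>I. (F p - F (swap (p m) l \<circ> p))\<^sup>2) = (\<Sum>i\<in>I. (F p - F (p \<circ> swap m i))\<^sup>2)" .
  qed
  finally show ?thesis by (simp add: pavg_sum)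
qed

text \<open>Law of total variance for conditioning on the value at \<open>m\<close>.\<close>

lemma pvar_split_stabiliser:
  fixes F :: "('a \<Rightarrow> 'a) \<Rightarrow> real" and m :: 'a
  assumes fin: "finite I"
  defines "G \<equiv> (\<lambda>p. pavg (I - {m}) (\<lambda>s. F (p \<circ> s)))"
  shows "pvar I F = pavg I (\<lambda>p. pvar (I - {m}) (\<lambda>s. F (p \<circ> s))) + pvar I G"
proof -
  let ?J = "I - {m}"
  have fJ: "finite ?J" using fin by simp
  define M where "M = pavg I F"
  have M': "pavg I G = M"
    unfolding G_def M_def by (rule pavg_pavg_subset) (use fin in auto)
  have "pvar I F = pavg I (\<lambda>p. pavg ?J (\<lambda>s. (F (p \<circ> s) - M)\<^sup>2))"
    using pavg_pavg_subset[OF fin, of ?J "\<lambda>p. (F p - M)\<^sup>2"] by (simp add: pvar_def M_def)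
  also have "\<dots> = pavg I (\<lambda>p. pvar ?J (\<lambda>s. F (p \<circ> s)) + (G p - M)\<^sup>2)"
  proof (rule pavg_cong)
    fix p
    have "pavg ?J (\<lambda>s. (F (p \<circ> s) - M)\<^sup>2) =
      pavg ?J (\<lambda>s. (F (p \<circ> s) - G p)\<^sup>2 + (2 * (G p - M) * (F (p \<circ> s) - G p) + (G p - M)\<^sup>2))"
      by (rule pavg_cong) (simp add: power2_eq_square algebra_simps)
    also have "\<dots> = pvar ?J (\<lambda>s. F (p \<circ> s)) + (2 * (G p - M) * (G p - G p) + (G p - M)\<^sup>2)"
      unfolding pavg_add pavg_cmult pavg_diff pavg_const[OF fJ] pvar_def G_def by simp
    finally show "pavg ?J (\<lambda>s. (F (p \<circ> s) - M)\<^sup>2) = pvar ?J (\<lambda>s. F (p \<circ> s)) + (G p - M)\<^sup>2" by simp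
  qed
  finally show ?thesis by (simp add: pavg_add pvar_def M')
qed

text \<open>Induction on the size: for every \<open>m\<close> the law of total variance splits off
  the row \<open>m\<close>, the induction hypothesis handles the other rows, and averaging over
  \<open>m\<close> restores the symmetry. For linear statistics equality holds with \<open>4\<close>
  in place of \<open>2\<close>, so the constant is within a factor 2 of the best one.\<close>

lemma pvar_le_transpositions:
  assumes "finite I"
  shows "2 * real (card I) * pvar I F \<le> (\<Sum>i\<in>I. \<Sum>j\<in>I. pavg I (\<lambda>p. (F p - F (p \<circ> swap i j))\<^sup>2))"
  using assms
proof (induction "card I" arbitrary: I F)
  case 0
  then show ?case by simp
next
  case (Suc k)
  let ?n = "real (card I)"
  define e where "e i j = pavg I (\<lambda>p. (F p - F (p \<circ> swap i j))\<^sup>2)" for i j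
  define W where "W = (\<Sum>i\<in>I. \<Sum>j\<in>I. e i j)"
  have e0: "e i j \<ge> 0" for i j unfolding e_def by (rule pavg_nonneg) simp
  have W0: "W \<ge> 0" unfolding W_def by (intro sum_nonneg e0)
  have eii: "e i i = 0" for i unfolding e_def using Suc.prems by (simp add: pavg_const)
  have esym: "e i j = e j i" for i j unfolding e_def by (simp add: transpose_commute)
  show ?case
  proof (cases "k = 0")
    case True
    then have c1: "card I = 1" using Suc by simp
    then obtain m where I: "I = {m}" using card_1_singletonE by metis
    have "pvar I F = 0" unfolding pvar_def I pavg_def by simp
    then show ?thesis using W0 by (simp add: W_def e_def)
  next
    case False
    define r where "r = real k"
    have nr: "?n = r + 1" using Suc by (simp add: r_def flip: Suc.hyps(2))
    have r0: "r > 0" using False by (simp add: r_def)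
    have step: "2 * (r * (r+1)) * pvar I F \<le> (r+1) * (\<Sum>i\<in>I-{m}. \<Sum>j\<in>I-{m}. e i j) + r * (\<Sum>i\<in>I. e m i)"
      if m: "m \<in> I" for m
    proof -
      let ?J = "I - {m}"
      have fJ: "finite ?J" and cJ: "k = card ?J" using Suc m by auto
      have "2 * r * pvar ?J (\<lambda>s. F (p \<circ> s)) \<le>
         (\<Sum>i\<in>?J. \<Sum>j\<in>?J. pavg ?J (\<lambda>s. (F (p \<circ> s) - F (p \<circ> s \<circ> swap i j))\<^sup>2))" for p
        using Suc.hyps(1)[OF cJ fJ, of "\<lambda>s. F (p \<circ> s)"] cJ by (simp add: r_def comp_assoc)
      then have "pavg I (\<lambda>p. 2 * r * pvar ?J (\<lambda>s. F (p \<circ> s))) \<le>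
         pavg I (\<lambda>p. (\<Sum>i\<in>?J. \<Sum>j\<in>?J. pavg ?J (\<lambda>s. (F (p \<circ> s) - F (p \<circ> s \<circ> swap i j))\<^sup>2)))"
        by (rule pavg_mono)
      also have "\<dots> = (\<Sum>i\<in>?J. \<Sum>j\<in>?J. e i j)"
        unfolding pavg_sum e_def
        by (intro sum.cong refl pavg_pavg_subset Suc.prems) (use Suc.prems in auto)
      finally have A: "2 * r * pavg I (\<lambda>p. pvar ?J (\<lambda>s. F (p \<circ> s))) \<le> (\<Sum>i\<in>?J. \<Sum>j\<in>?J. e i j)"
        by (simp only: pavg_cmult)
      have B: "2 * (r+1) * pvar I (\<lambda>p. pavg ?J (\<lambda>s. F (p \<circ> s))) \<le> (\<Sum>i\<in>I. e m i)"
        using pvar_le_swap_stabiliser[OF Suc.prems m, of F] unfolding e_def nr by simp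
      show ?thesis
        unfolding pvar_split_stabiliser[OF Suc.prems, of F m]
        using mult_left_mono[OF A, of "r+1"] mult_left_mono[OF B, of r] r0
        by (simp add: algebra_simps)
    qed
    \<comment> \<open>Summation over \<open>m\<close>: an ordered pair of distinct rows survives the
      deletion of \<open>m\<close> for all but two choices of \<open>m\<close>, which produces the
      factor \<open>r - 1\<close> below.\<close>
    have "(\<Sum>m\<in>I. 2 * (r * (r+1)) * pvar I F) \<le>
        (\<Sum>m\<in>I. (r+1) * (\<Sum>i\<in>I-{m}. \<Sum>j\<in>I-{m}. e i j) + r * (\<Sum>i\<in>I. e m i))"
      by (rule sum_mono) (use step in blast)
    also have "\<dots> = (r+1) * (\<Sum>m\<in>I. \<Sum>i\<in>I-{m}. \<Sum>j\<in>I-{m}. e i j) + r * W"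
      by (simp add: sum.distrib sum_distrib_left W_def)
    also have "(\<Sum>m\<in>I. \<Sum>i\<in>I-{m}. \<Sum>j\<in>I-{m}. e i j) = (\<Sum>m\<in>I. W - 2 * (\<Sum>j\<in>I. e m j))"
    proof (intro sum.cong refl)
      fix m assume m: "m \<in> I"
      have "(\<Sum>i\<in>I-{m}. \<Sum>j\<in>I-{m}. e i j) = (\<Sum>i\<in>I-{m}. (\<Sum>j\<in>I. e i j) - e i m)"
        using Suc.prems m by (simp add: sum_diff1)
      also have "\<dots> = (\<Sum>i\<in>I. (\<Sum>j\<in>I. e i j) - e i m) - ((\<Sum>j\<in>I. e m j) - e m m)"
        using Suc.prems m by (simp add: sum_diff1)
      also have "\<dots> = W - 2 * (\<Sum>j\<in>I. e m j)"
        using eii esym by (simp add: sum_subtractf W_def)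
      finally show "(\<Sum>i\<in>I-{m}. \<Sum>j\<in>I-{m}. e i j) = W - 2 * (\<Sum>j\<in>I. e m j)" .
    qed
    also have "(\<Sum>m\<in>I. W - 2 * (\<Sum>j\<in>I. e m j)) = (r - 1) * W"
      using nr by (simp add: sum_subtractf W_def[symmetric] sum_distrib_left[symmetric] algebra_simps)
    finally have "(r+1) * (2 * (r * (r+1)) * pvar I F) \<le> (r+1) * ((r-1) * W) + r * W"
      by (simp add: nr)
    \<comment> \<open>\<open>(r + 1) * (r - 1) + r\<close> is \<open>r * (r + 1) - 1\<close>, so the
      induction closes with one \<open>W\<close> to spare.\<close>
    also have "\<dots> \<le> r * (r+1) * W" using W0 r0 by (simp add: algebra_simps)
    finally have "(r * (r+1)) * (2 * (r+1) * pvar I F) \<le> (r * (r+1)) * W" by (simp add: algebra_simps)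
    then have "2 * (r+1) * pvar I F \<le> W" using r0 by simp
    then show ?thesis by (simp add: nr W_def e_def)
  qed
qed

section \<open>Linear permutation statistics\<close>

definition dpow :: "'a set \<Rightarrow> ('a \<Rightarrow> real) \<Rightarrow> nat \<Rightarrow> real" where
  "dpow I b k = (\<Sum>i\<in>I. \<Sum>j\<in>I. \<bar>b i - b j\<bar> ^ k)"

definition stat :: "'a set \<Rightarrow> ('a \<Rightarrow> real) \<Rightarrow> ('a \<Rightarrow> real) \<Rightarrow> ('a \<Rightarrow> 'a) \<Rightarrow> real" where
  "stat I b c p = (\<Sum>i\<in>I. b i * c (p i))"

definition stat_mean :: "'a set \<Rightarrow> ('a \<Rightarrow> real) \<Rightarrow> ('a \<Rightarrow> real) \<Rightarrow> real" where
  "stat_mean I b c = (\<Sum>i\<in>I. b i) * (\<Sum>i\<in>I. c i) / real (card I)"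

definition stat_var :: "'a set \<Rightarrow> ('a \<Rightarrow> real) \<Rightarrow> ('a \<Rightarrow> real) \<Rightarrow> real" where
  "stat_var I b c = dpow I b 2 * dpow I c 2 / (4 * real (card I) ^ 2 * (real (card I) - 1))"

text \<open>Equals the sum over all pairs of the mean cubed change under a swap, divided by
  \<open>4 * card I\<close>; \<open>stat_var\<close> is the same with squares, see
  \<open>sum_pavg_dpow\<close>.\<close>

definition stat_third :: "'a set \<Rightarrow> ('a \<Rightarrow> real) \<Rightarrow> ('a \<Rightarrow> real) \<Rightarrow> real" where
  "stat_third I b c = dpow I b 3 * dpow I c 3 / (4 * real (card I) ^ 2 * (real (card I) - 1))"

text \<open>Dirichlet form of the transposition walk, normalised so that it equals the variance on
  linear statistics.\<close>

definition dirichlet :: "'a set \<Rightarrow> (('a \<Rightarrow> 'a) \<Rightarrow> real) \<Rightarrow> real" where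
  "dirichlet I R = (\<Sum>i\<in>I. \<Sum>j\<in>I. pavg I (\<lambda>p. (R p - R (p \<circ> swap i j))\<^sup>2)) / (4 * real (card I))"

lemma dpow_nonneg: "0 \<le> dpow I b k"
  unfolding dpow_def by (intro sum_nonneg) auto

lemma stat_swap:
  assumes "finite I" "i \<in> I" "j \<in> I"
  shows "stat I b c p - stat I b c (p \<circ> swap i j) = (b i - b j) * (c (p i) - c (p j))"
proof (cases "i = j")
  case True
  then show ?thesis by simp
next
  case False
  let ?J = "I - {i} - {j}"
  have e: "(\<Sum>k\<in>I. f k) = f i + (f j + (\<Sum>k\<in>?J. f k))" for f :: "'a \<Rightarrow> real"
    using assms False by (simp add: sum.remove [of I i] sum.remove [of "I - {i}" j])
  have "(\<Sum>k\<in>?J. b k * c (p (swap i j k))) = (\<Sum>k\<in>?J. b k * c (p k))"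
    by (intro sum.cong) (auto simp: Transposition.transpose_def)
  then show ?thesis unfolding stat_def e by (simp add: algebra_simps)
qed

text \<open>Regression property of the exchangeable pair: averaged over a uniform ordered pair of
  rows, one swap pulls the statistic towards its mean by the proportion
  \<open>2 / card I\<close>.\<close>

lemma sum_stat_swap:
  assumes "finite I" "p permutes I"
  shows "(\<Sum>i\<in>I. \<Sum>j\<in>I. (b i - b j) * (c (p i) - c (p j))) =
    2 * real (card I) * (stat I b c p - stat_mean I b c)"
proof (cases "I = {}")
  case True
  then show ?thesis by simp
next
  case False
  then have n: "real (card I) > 0" using assms by (simp add: card_gt_0_iff)
  have c: "(\<Sum>i\<in>I. c (p i)) = (\<Sum>i\<in>I. c i)"
    using sum.permute[OF assms(2), of c] by (simp add: comp_def)
  have "(\<Sum>i\<in>I. \<Sum>j\<in>I. (b i - b j) * (c (p i) - c (p j))) =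
     (\<Sum>i\<in>I. real (card I) * (b i * c (p i)) - b i * (\<Sum>j\<in>I. c (p j)) - (\<Sum>j\<in>I. b j) * c (p i)
       + stat I b c p)"
    by (simp add: left_diff_distrib right_diff_distrib sum.distrib sum_subtractf sum_distrib_left sum_distrib_right stat_def)
  also have "\<dots> = 2 * real (card I) * stat I b c p - 2 * ((\<Sum>i\<in>I. b i) * (\<Sum>i\<in>I. c i))"
    by (simp add: sum.distrib sum_subtractf c stat_def flip: sum_distrib_left sum_distrib_right)
  also have "\<dots> = 2 * real (card I) * (stat I b c p - stat_mean I b c)"
    using n by (simp add: stat_mean_def right_diff_distrib)
  finally show ?thesis .
qed

text \<open>Stein identity of the exchangeable pair: the increment changes sign under
  \<open>swap i j\<close>, so half of its product with \<open>h\<close> can be moved to the swapped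
  permutation, which produces the difference of \<open>h\<close>.\<close>

lemma pavg_stat_mult:
  assumes fin: "finite I"
  shows "pavg I (\<lambda>p. (stat I b c p - stat_mean I b c) * h p) =
    (\<Sum>i\<in>I. \<Sum>j\<in>I. pavg I (\<lambda>p. (b i - b j) * (c (p i) - c (p j)) * (h p - h (p \<circ> swap i j)))) / (4 * real (card I))"
proof (cases "I = {}")
  case True
  then show ?thesis by (simp add: stat_def stat_mean_def pavg_const)
next
  case False
  let ?n = "real (card I)"
  have n: "?n > 0" using fin False by (simp add: card_gt_0_iff)
  define d where "d i j p = (b i - b j) * (c (p i) - c (p j))" for i j p
  have sw: "pavg I (\<lambda>p. d i j p * h (p \<circ> swap i j)) = - pavg I (\<lambda>p. d i j p * h p)"
    if ij: "i \<in> I" "j \<in> I" for i j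
  proof -
    have "pavg I (\<lambda>p. d i j p * h (p \<circ> swap i j)) =
        pavg I (\<lambda>p. d i j (p \<circ> swap i j) * h (p \<circ> swap i j \<circ> swap i j))"
      using pavg_comp_right[OF permutes_swap_id[OF ij], of "\<lambda>p. d i j p * h (p \<circ> swap i j)"] by simp
    also have "\<dots> = pavg I (\<lambda>p. (- 1) * (d i j p * h p))"
      by (rule pavg_cong) (simp add: comp_assoc d_def algebra_simps)
    finally show ?thesis by (simp add: pavg_minus)
  qed
  have "2 * ?n * pavg I (\<lambda>p. (stat I b c p - stat_mean I b c) * h p) =
     pavg I (\<lambda>p. 2 * ?n * (stat I b c p - stat_mean I b c) * h p)"
    by (simp add: mult.assoc flip: pavg_cmult)
  also have "\<dots> = pavg I (\<lambda>p. \<Sum>i\<in>I. \<Sum>j\<in>I. d i j p * h p)"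
    by (rule pavg_cong) (simp add: sum_stat_swap[OF fin, symmetric] sum_distrib_right d_def)
  also have "\<dots> = (\<Sum>i\<in>I. \<Sum>j\<in>I. pavg I (\<lambda>p. d i j p * h p))" by (simp add: pavg_sum)
  finally have e: "2 * ?n * pavg I (\<lambda>p. (stat I b c p - stat_mean I b c) * h p) = \<dots>" .
  have "(\<Sum>i\<in>I. \<Sum>j\<in>I. pavg I (\<lambda>p. d i j p * (h p - h (p \<circ> swap i j)))) =
     (\<Sum>i\<in>I. \<Sum>j\<in>I. 2 * pavg I (\<lambda>p. d i j p * h p))"
    by (intro sum.cong refl) (simp add: right_diff_distrib pavg_diff sw)
  also have "\<dots> = 4 * ?n * pavg I (\<lambda>p. (stat I b c p - stat_mean I b c) * h p)"
    using e by (simp flip: sum_distrib_left)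
  finally show ?thesis using n by (simp add: d_def)
qed

lemma pavg_pair:
  assumes fin: "finite I" and ij: "i \<in> I" "j \<in> I" "i \<noteq> j" and h0: "\<And>k. h k k = 0"
  shows "real (card I) * (real (card I) - 1) * pavg I (\<lambda>p. h (p i) (p j)) = (\<Sum>k\<in>I. \<Sum>l\<in>I. h k l)"
proof -
  let ?n = "real (card I)" and ?v = "pavg I (\<lambda>p. h (p i) (p j))"
  have v: "pavg I (\<lambda>p. h (p k) (p l)) = ?v" if kl: "k \<in> I" "l \<in> I" "k \<noteq> l" for k l
  proof -
    \<comment> \<open>\<open>j1\<close> is the image of \<open>j\<close> under the first
      transposition; the second one carries it to \<open>l\<close> and leaves \<open>k\<close>
      alone.\<close>
    define j1 where "j1 = swap i k j"
    have j1: "j1 \<in> I" "j1 \<noteq> k" using ij kl by (auto simp: j1_def Transposition.transpose_def)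
    let ?q = "swap j1 l \<circ> swap i k"
    have q: "?q permutes I" using ij kl j1 by (intro permutes_compose permutes_swap_id)
    have "?q i = k" "?q j = l" using j1 kl by (auto simp: Transposition.transpose_def j1_def)
    then show ?thesis using pavg_comp_right[OF q, of "\<lambda>p. h (p i) (p j)"] by simp
  qed
  have "(\<Sum>k\<in>I. \<Sum>l\<in>I. pavg I (\<lambda>p. h (p k) (p l))) = (\<Sum>k\<in>I. \<Sum>l\<in>I. if k = l then 0 else ?v)"
    by (intro sum.cong refl) (use v h0 fin in \<open>auto simp: pavg_const\<close>)
  also have "\<dots> = (\<Sum>k\<in>I. \<Sum>l\<in>I. ?v - (if k = l then ?v else 0))" by (intro sum.cong refl) auto
  also have "\<dots> = (\<Sum>k\<in>I. ?n * ?v - ?v)"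
    using fin by (intro sum.cong refl) (simp add: sum_subtractf sum.delta)
  also have "\<dots> = ?n * (?n - 1) * ?v" by (simp add: algebra_simps)
  finally have a: "?n * (?n - 1) * ?v = (\<Sum>k\<in>I. \<Sum>l\<in>I. pavg I (\<lambda>p. h (p k) (p l)))" by simp
  have "(\<Sum>k\<in>I. \<Sum>l\<in>I. pavg I (\<lambda>p. h (p k) (p l))) = pavg I (\<lambda>p. \<Sum>k\<in>I. \<Sum>l\<in>I. h (p k) (p l))"
    by (simp add: pavg_sum)
  also have "\<dots> = pavg I (\<lambda>p. \<Sum>k\<in>I. \<Sum>l\<in>I. h k l)"
  proof (rule pavg_cong)
    fix p assume p: "p permutes I"
    have "(\<Sum>k\<in>I. \<Sum>l\<in>I. h (p k) (p l)) = (\<Sum>k\<in>I. \<Sum>l\<in>I. h (p k) l)"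
    proof (rule sum.cong[OF refl])
      fix k
      show "(\<Sum>l\<in>I. h (p k) (p l)) = (\<Sum>l\<in>I. h (p k) l)"
        using sum.permute[OF p, of "h (p k)"] by (simp add: comp_def)
    qed
    also have "\<dots> = (\<Sum>k\<in>I. \<Sum>l\<in>I. h k l)"
      using sum.permute[OF p, of "\<lambda>k. \<Sum>l\<in>I. h k l"] by (simp add: comp_def)
    finally show "(\<Sum>k\<in>I. \<Sum>l\<in>I. h (p k) (p l)) = (\<Sum>k\<in>I. \<Sum>l\<in>I. h k l)" .
  qed
  finally show ?thesis using a fin by (simp add: pavg_const)
qed

lemma pavg_dpow:
  assumes "finite I" "i \<in> I" "j \<in> I" "i \<noteq> j" "k > 0"
  shows "pavg I (\<lambda>p. \<bar>c (p i) - c (p j)\<bar> ^ k) = dpow I c k / (real (card I) * (real (card I) - 1))"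
proof -
  have "card {i, j} \<le> card I" using assms by (intro card_mono) auto
  then have "card I \<ge> 2" using assms by simp
  then have "real (card I) * (real (card I) - 1) \<noteq> 0" by auto
  moreover have "real (card I) * (real (card I) - 1) * pavg I (\<lambda>p. \<bar>c (p i) - c (p j)\<bar> ^ k) = dpow I c k"
    using pavg_pair[OF assms(1-4), of "\<lambda>x y. \<bar>c x - c y\<bar> ^ k"] assms(5) by (simp add: dpow_def)
  ultimately show ?thesis by (intro eq_divide_imp) (simp_all only: mult.commute not_False_eq_True)
qed

lemma sum_pavg_dpow:
  assumes fin: "finite I" and k: "k > 0"
  shows "(\<Sum>i\<in>I. \<Sum>j\<in>I. pavg I (\<lambda>p. \<bar>(b i - b j) * (c (p i) - c (p j))\<bar> ^ k)) =
    dpow I b k * dpow I c k / (real (card I) * (real (card I) - 1))"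
proof -
  have "pavg I (\<lambda>p. \<bar>(b i - b j) * (c (p i) - c (p j))\<bar> ^ k) =
     \<bar>b i - b j\<bar> ^ k * (dpow I c k / (real (card I) * (real (card I) - 1)))" if "i \<in> I" "j \<in> I" for i j
    using pavg_dpow[OF fin that _ k, of c] k
    by (cases "i = j") (simp_all add: abs_mult power_mult_distrib pavg_cmult pavg_const fin zero_power)
  then have "(\<Sum>i\<in>I. \<Sum>j\<in>I. pavg I (\<lambda>p. \<bar>(b i - b j) * (c (p i) - c (p j))\<bar> ^ k)) =
      (\<Sum>i\<in>I. \<Sum>j\<in>I. \<bar>b i - b j\<bar> ^ k * (dpow I c k / (real (card I) * (real (card I) - 1))))"
    by (intro sum.cong refl)
  then show ?thesis by (simp add: dpow_def [of I b] flip: sum_distrib_right sum_divide_distrib)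
qed

lemma pavg_stat_variance:
  assumes fin: "finite I"
  shows "pavg I (\<lambda>p. (stat I b c p - stat_mean I b c)\<^sup>2) = stat_var I b c"
proof -
  have "pavg I (\<lambda>p. (stat I b c p - stat_mean I b c)\<^sup>2) =
     pavg I (\<lambda>p. (stat I b c p - stat_mean I b c) * (stat I b c p - stat_mean I b c))"
    by (simp add: power2_eq_square)
  also have "\<dots> = (\<Sum>i\<in>I. \<Sum>j\<in>I. pavg I (\<lambda>p. \<bar>(b i - b j) * (c (p i) - c (p j))\<bar> ^ 2)) / (4 * real (card I))"
    unfolding pavg_stat_mult[OF fin, of b c "\<lambda>p. stat I b c p - stat_mean I b c"]
    using stat_swap[OF fin, of _ _ b c]
    by (simp add: power2_eq_square)
  also have "(\<Sum>i\<in>I. \<Sum>j\<in>I. pavg I (\<lambda>p. \<bar>(b i - b j) * (c (p i) - c (p j))\<bar> ^ 2)) =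
     dpow I b 2 * dpow I c 2 / (real (card I) * (real (card I) - 1))"
    by (rule sum_pavg_dpow[OF fin]) simp
  finally show ?thesis
    by (simp add: stat_var_def power2_eq_square)
qed

section \<open>Concentration of a perturbed linear statistic\<close>

definition trunc_square :: "real \<Rightarrow> real \<Rightarrow> real" where
  "trunc_square \<delta> x = x * min x \<delta>"

text \<open>The square is continued linearly beyond \<delta>. The loss is controlled by a third
  moment; the gain is the Lipschitz constant, which lets second moments alone bound the fluctuations
  of the truncated energy.\<close>

lemma trunc_square_Lipschitz:
  assumes "0 \<le> x" "0 \<le> y" "0 \<le> \<delta>"
  shows "\<bar>trunc_square \<delta> x - trunc_square \<delta> y\<bar> \<le> 2 * \<delta> * \<bar>x - y\<bar>"
proof -
  have *: "\<bar>trunc_square \<delta> x - trunc_square \<delta> y\<bar> \<le> 2 * \<delta> * \<bar>x - y\<bar>"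
    if "0 \<le> x" "x \<le> y" for x y
  proof -
    consider "y \<le> \<delta>" | "x \<le> \<delta>" "\<delta> \<le> y" | "\<delta> \<le> x" using that by linarith
    then show ?thesis
    proof cases
      case 1
      have "trunc_square \<delta> x - trunc_square \<delta> y = (x + y) * (x - y)"
        using 1 that by (simp add: trunc_square_def algebra_simps)
      then have "\<bar>trunc_square \<delta> x - trunc_square \<delta> y\<bar> = (x + y) * \<bar>x - y\<bar>"
        using that by (simp add: abs_mult)
      also have "\<dots> \<le> 2 * \<delta> * \<bar>x - y\<bar>" using 1 that by (intro mult_right_mono) auto
      finally show ?thesis .
    next
      case 2
      have "trunc_square \<delta> y - trunc_square \<delta> x = \<delta> * (y - x) + x * (\<delta> - x)"
        using 2 that by (simp add: trunc_square_def algebra_simps)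
      moreover have "0 \<le> \<delta> * (y - x)" "0 \<le> x * (\<delta> - x)" using 2 that assms by auto
      moreover have "x * (\<delta> - x) \<le> \<delta> * (y - x)" using 2 that by (intro mult_mono) auto
      ultimately show ?thesis using that by (simp add: abs_if)
    next
      case 3
      have "trunc_square \<delta> x - trunc_square \<delta> y = \<delta> * (x - y)"
        using 3 that by (simp add: trunc_square_def algebra_simps)
      then show ?thesis using assms by (simp add: abs_mult mult_right_mono)
    qed
  qed
  show ?thesis
    using *[of x y] *[of y x] assms by (cases "x \<le> y") (auto simp: abs_minus_commute)
qed

text \<open>Beyond \<delta> the defect is a perfect square times a nonnegative factor, vanishing at
  \<open>x = 2 * \<delta>\<close>; this explains the constant 4.\<close>

lemma trunc_square_ge:
  assumes "0 \<le> x" "0 < \<delta>"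
  shows "trunc_square \<delta> x \<ge> x\<^sup>2 - x ^ 3 / (4 * \<delta>)"
proof (cases "x \<le> \<delta>")
  case True
  then show ?thesis using assms by (simp add: trunc_square_def power2_eq_square)
next
  case False
  have "trunc_square \<delta> x - (x\<^sup>2 - x ^ 3 / (4 * \<delta>)) = x * (2 * \<delta> - x)\<^sup>2 / (4 * \<delta>)"
    using assms False by (simp add: trunc_square_def field_simps power2_eq_square power3_eq_cube)
  moreover have "\<dots> \<ge> 0" using assms by simp
  ultimately show ?thesis by linarith
qed

definition clip :: "real \<Rightarrow> real \<Rightarrow> real" where
  "clip r s = max (- r) (min r s)"

lemma clip_bound: "0 \<le> r \<Longrightarrow> \<bar>clip r s\<bar> \<le> r"
  unfolding clip_def by (auto simp: min_def max_def)

lemma clip_Lipschitz: "0 \<le> r \<Longrightarrow> 0 \<le> r' \<Longrightarrow> \<bar>clip r s - clip r' s\<bar> \<le> \<bar>r - r'\<bar>"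
  unfolding clip_def by (auto simp: min_def max_def)

lemma clip_diff_nonneg: "0 \<le> r \<Longrightarrow> 0 \<le> (s - t) * (clip r s - clip r t)"
  unfolding clip_def by (cases "s \<le> t") (auto intro!: mult_nonneg_nonneg mult_nonpos_nonpos)

text \<open>The clipping level exceeds \<open>r\<close> by \<delta>, so a jump starting in [-r, r]
  is recorded at least up to length \<delta>; multiplied by the jump itself this gives the truncated
  square.\<close>

lemma clip_diff_ge:
  assumes "\<bar>s\<bar> \<le> r" "0 \<le> \<delta>"
  shows "trunc_square \<delta> \<bar>s - t\<bar> \<le> (s - t) * (clip (r + \<delta>) s - clip (r + \<delta>) t)"
proof -
  have c: "clip (r + \<delta>) s = s" using assms unfolding clip_def by auto
  show ?thesis
  proof (cases "t \<le> s")
    case True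
    then have "min (s - t) \<delta> \<le> s - clip (r + \<delta>) t" using assms unfolding clip_def by auto
    then show ?thesis using True by (simp add: c trunc_square_def mult_left_mono)
  next
    case False
    then have "min (t - s) \<delta> \<le> clip (r + \<delta>) t - s" using assms unfolding clip_def by auto
    then have "(t - s) * min (t - s) \<delta> \<le> (t - s) * (clip (r + \<delta>) t - s)"
      using False by (intro mult_left_mono) auto
    moreover have "\<bar>s - t\<bar> = t - s" using False by simp
    moreover have "(t - s) * (clip (r + \<delta>) t - s) = (s - t) * (s - clip (r + \<delta>) t)"
      by (simp add: algebra_simps)
    ultimately show ?thesis by (simp add: c trunc_square_def)
  qed
qed

text \<open>With the plain square in place of \<open>trunc_square\<close> its mean would be
  \<open>stat_var\<close>. It is what the Stein identity leaves when tested against a clipped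
  statistic.\<close>

definition swap_energy :: "'a set \<Rightarrow> ('a \<Rightarrow> real) \<Rightarrow> ('a \<Rightarrow> real) \<Rightarrow> real \<Rightarrow> ('a \<Rightarrow> 'a) \<Rightarrow> real" where
  "swap_energy I b c \<delta> p =
    (\<Sum>i\<in>I. \<Sum>j\<in>I. trunc_square \<delta> \<bar>(b i - b j) * (c (p i) - c (p j))\<bar>) / (4 * real (card I))"

lemma pavg_swap_energy_ge:
  assumes fin: "finite I" and \<delta>: "0 < \<delta>"
  shows "pavg I (swap_energy I b c \<delta>) \<ge> stat_var I b c - stat_third I b c / (4 * \<delta>)"
proof -
  let ?n = "real (card I)"
  let ?D = "\<lambda>i j p. \<bar>(b i - b j) * (c (p i) - c (p j))\<bar>"
  have sq: "?D i j p ^ 2 - ?D i j p ^ 3 / (4 * \<delta>) \<le> trunc_square \<delta> (?D i j p)" for i j p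
    using trunc_square_ge[OF _ \<delta>, of "?D i j p"] by simp
  have "(\<Sum>i\<in>I. \<Sum>j\<in>I. pavg I (\<lambda>p. ?D i j p ^ 2 - ?D i j p ^ 3 / (4 * \<delta>)))
     \<le> (\<Sum>i\<in>I. \<Sum>j\<in>I. pavg I (\<lambda>p. trunc_square \<delta> (?D i j p)))"
    by (intro sum_mono pavg_mono sq)
  moreover have "pavg I (\<lambda>p. ?D i j p ^ 2 - ?D i j p ^ 3 / (4 * \<delta>)) =
      pavg I (\<lambda>p. ?D i j p ^ 2) - pavg I (\<lambda>p. ?D i j p ^ 3) * (1 / (4 * \<delta>))" for i j
    by (simp only: pavg_diff divide_inverse pavg_multc mult_1_left)
  ultimately have "dpow I b 2 * dpow I c 2 / (?n * (?n - 1)) - (dpow I b 3 * dpow I c 3 / (?n * (?n - 1))) * (1 / (4 * \<delta>))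
     \<le> (\<Sum>i\<in>I. \<Sum>j\<in>I. pavg I (\<lambda>p. trunc_square \<delta> (?D i j p)))"
    by (simp only: sum_subtractf sum_distrib_right[symmetric] sum_pavg_dpow[OF fin] zero_less_numeral)
  then have "(dpow I b 2 * dpow I c 2 / (?n * (?n - 1)) - (dpow I b 3 * dpow I c 3 / (?n * (?n - 1))) * (1 / (4 * \<delta>))) / (4 * ?n)
     \<le> (\<Sum>i\<in>I. \<Sum>j\<in>I. pavg I (\<lambda>p. trunc_square \<delta> (?D i j p))) / (4 * ?n)"
    by (intro divide_right_mono) auto
  also have "\<dots> = pavg I (swap_energy I b c \<delta>)"
    unfolding swap_energy_def divide_inverse pavg_multc pavg_sum ..
  finally show ?thesis
    by (simp add: stat_var_def stat_third_def diff_divide_distrib power2_eq_square ac_simps)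
qed

lemma sum_square_le:
  fixes f :: "'a \<Rightarrow> real"
  shows "(\<Sum>i\<in>A. f i)\<^sup>2 \<le> real (card A) * (\<Sum>i\<in>A. (f i)\<^sup>2)"
  using Cauchy_Schwarz_ineq_sum[of "\<lambda>_. 1" f A] by simp

text \<open>A swap alters only the terms of the double sum that involve the rows \<open>i\<close>,
  \<open>j\<close>. The Lipschitz bound makes each change linear in the increment of
  \<open>c\<close>, and Cauchy-Schwarz turns the row sums into sums of squares.\<close>

lemma swap_energy_swap:
  assumes fin: "finite I" and \<delta>: "0 \<le> \<delta>" and ij: "i \<in> I" "j \<in> I"
  shows "(swap_energy I b c \<delta> p - swap_energy I b c \<delta> (p \<circ> swap i j))\<^sup>2 \<le>
    2 * \<delta>\<^sup>2 / real (card I) * (c (p i) - c (p j))\<^sup>2 *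
      ((\<Sum>m\<in>I. (b i - b m)\<^sup>2) + (\<Sum>m\<in>I. (b j - b m)\<^sup>2))"
proof (cases "i = j")
  case True
  then show ?thesis by simp
next
  case False
  let ?n = "real (card I)" and ?q = "p \<circ> swap i j"
  have n: "?n > 0" using fin ij by (auto simp: card_gt_0_iff)
  define e where "e = \<bar>c (p i) - c (p j)\<bar>"
  \<comment> \<open>\<open>u\<close> marks the two rows whose value changes; each of them moves by
    at most \<open>e\<close>.\<close>
  define u where "u k = (if k = i then 1 else 0) + (if k = j then 1 else 0 :: real)" for k
  have cu: "\<bar>c (p k) - c (?q k)\<bar> \<le> e * u k" for k
    by (auto simp: e_def u_def Transposition.transpose_def abs_minus_commute)
  have t: "\<bar>trunc_square \<delta> \<bar>(b k - b l) * (c (p k) - c (p l))\<bar> - trunc_square \<delta> \<bar>(b k - b l) * (c (?q k) - c (?q l))\<bar>\<bar>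
     \<le> 2 * \<delta> * (\<bar>b k - b l\<bar> * (e * u k + e * u l))" for k l
  proof -
    have "\<bar>\<bar>(b k - b l) * (c (p k) - c (p l))\<bar> - \<bar>(b k - b l) * (c (?q k) - c (?q l))\<bar>\<bar>
       = \<bar>b k - b l\<bar> * \<bar>\<bar>c (p k) - c (p l)\<bar> - \<bar>c (?q k) - c (?q l)\<bar>\<bar>"
      by (simp add: abs_mult flip: right_diff_distrib)
    also have "\<dots> \<le> \<bar>b k - b l\<bar> * (e * u k + e * u l)"
      using cu[of k] cu[of l] by (intro mult_left_mono) linarith+
    finally have "2 * \<delta> * \<bar>\<bar>(b k - b l) * (c (p k) - c (p l))\<bar> - \<bar>(b k - b l) * (c (?q k) - c (?q l))\<bar>\<bar>
      \<le> 2 * \<delta> * (\<bar>b k - b l\<bar> * (e * u k + e * u l))" using \<delta> by (intro mult_left_mono) auto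
    then show ?thesis
      using trunc_square_Lipschitz[OF _ _ \<delta>, of "\<bar>(b k - b l) * (c (p k) - c (p l))\<bar>" "\<bar>(b k - b l) * (c (?q k) - c (?q l))\<bar>"]
      by simp
  qed
  define w where "w k = (\<Sum>m\<in>I. \<bar>b k - b m\<bar>)" for k
  have us: "(\<Sum>k\<in>I. u k * f k) = f i + f j" for f
    using fin ij by (simp add: u_def distrib_right sum.distrib if_distrib[where f="\<lambda>x. x * _"] cong: if_cong)
  have "(\<Sum>k\<in>I. \<Sum>l\<in>I. 2 * \<delta> * (\<bar>b k - b l\<bar> * (e * u k + e * u l))) =
    2 * \<delta> * e * ((\<Sum>k\<in>I. \<Sum>l\<in>I. u k * \<bar>b k - b l\<bar>) + (\<Sum>k\<in>I. \<Sum>l\<in>I. u l * \<bar>b k - b l\<bar>))"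
    by (simp add: sum_distrib_left sum.distrib algebra_simps)
  also have "(\<Sum>k\<in>I. \<Sum>l\<in>I. u k * \<bar>b k - b l\<bar>) = w i + w j"
    by (simp add: w_def us flip: sum_distrib_left)
  also have "(\<Sum>k\<in>I. \<Sum>l\<in>I. u l * \<bar>b k - b l\<bar>) = w i + w j"
    by (subst sum.swap) (simp add: w_def us abs_minus_commute flip: sum_distrib_left)
  finally have tot: "(\<Sum>k\<in>I. \<Sum>l\<in>I. 2 * \<delta> * (\<bar>b k - b l\<bar> * (e * u k + e * u l))) = 4 * \<delta> * e * (w i + w j)"
    by (simp add: algebra_simps)
  have "swap_energy I b c \<delta> p - swap_energy I b c \<delta> ?q =
     (\<Sum>k\<in>I. \<Sum>l\<in>I. trunc_square \<delta> \<bar>(b k - b l) * (c (p k) - c (p l))\<bar> - trunc_square \<delta> \<bar>(b k - b l) * (c (?q k) - c (?q l))\<bar>) / (4 * ?n)"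
    unfolding swap_energy_def by (simp only: sum_subtractf diff_divide_distrib)
  then have "\<bar>swap_energy I b c \<delta> p - swap_energy I b c \<delta> ?q\<bar> =
     \<bar>\<Sum>k\<in>I. \<Sum>l\<in>I. trunc_square \<delta> \<bar>(b k - b l) * (c (p k) - c (p l))\<bar> - trunc_square \<delta> \<bar>(b k - b l) * (c (?q k) - c (?q l))\<bar>\<bar> / (4 * ?n)"
    by simp
  also have "\<dots> \<le> (4 * \<delta> * e * (w i + w j)) / (4 * ?n)"
    unfolding tot[symmetric]
    by (intro divide_right_mono order_trans[OF sum_abs] sum_mono t) auto
  also have "\<dots> = \<delta> * e / ?n * (w i + w j)" using n by simp
  finally have "(swap_energy I b c \<delta> p - swap_energy I b c \<delta> ?q)\<^sup>2 \<le> (\<delta> * e / ?n * (w i + w j))\<^sup>2"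
    by (metis abs_ge_zero power2_abs power_mono)
  also have "\<dots> = (\<delta> * e / ?n)\<^sup>2 * (w i + w j)\<^sup>2" by (rule power_mult_distrib)
  also have "\<dots> \<le> (\<delta> * e / ?n)\<^sup>2 * (2 * ?n * ((\<Sum>m\<in>I. (b i - b m)\<^sup>2) + (\<Sum>m\<in>I. (b j - b m)\<^sup>2)))"
  proof (intro mult_left_mono)
    have "(w k)\<^sup>2 \<le> ?n * (\<Sum>m\<in>I. (b k - b m)\<^sup>2)" for k
      using sum_square_le[of "\<lambda>m. \<bar>b k - b m\<bar>" I] by (simp add: w_def)
    from this[of i] this[of j] show "(w i + w j)\<^sup>2 \<le> 2 * ?n * ((\<Sum>m\<in>I. (b i - b m)\<^sup>2) + (\<Sum>m\<in>I. (b j - b m)\<^sup>2))"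
      using sum_squares_bound[of "w i" "w j"] by (simp add: power2_sum algebra_simps)
  qed simp
  also have "\<dots> = 2 * \<delta>\<^sup>2 / ?n * (c (p i) - c (p j))\<^sup>2 * ((\<Sum>m\<in>I. (b i - b m)\<^sup>2) + (\<Sum>m\<in>I. (b j - b m)\<^sup>2))"
    using n by (simp add: e_def power_mult_distrib power_divide power2_eq_square[of ?n])
  finally show ?thesis .
qed

text \<open>The Poincare inequality applied to the energy. Thanks to the truncation only second
  moments of \<open>b\<close> and \<open>c\<close> enter, where the untruncated energy would call
  for fourth moments.\<close>

lemma pvar_swap_energy:
  assumes fin: "finite I" and n2: "card I \<ge> 2" and \<delta>: "0 \<le> \<delta>"
  shows "pvar I (swap_energy I b c \<delta>) \<le> 8 * \<delta>\<^sup>2 * stat_var I b c"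
proof -
  let ?n = "real (card I)"
  have n: "?n > 1" using n2 by simp
  define \<beta> where "\<beta> i = (\<Sum>m\<in>I. (b i - b m)\<^sup>2)" for i
  have \<beta>0: "\<beta> i \<ge> 0" for i unfolding \<beta>_def by (intro sum_nonneg) auto
  define C where "C = dpow I c 2 / (?n * (?n - 1))"
  have C0: "C \<ge> 0" unfolding C_def using n dpow_nonneg[of I c 2] by simp
  have "pavg I (\<lambda>p. (swap_energy I b c \<delta> p - swap_energy I b c \<delta> (p \<circ> swap i j))\<^sup>2) \<le>
     2 * \<delta>\<^sup>2 / ?n * C * (\<beta> i + \<beta> j)" if ij: "i \<in> I" "j \<in> I" for i j
  proof -
    have "pavg I (\<lambda>p. (swap_energy I b c \<delta> p - swap_energy I b c \<delta> (p \<circ> swap i j))\<^sup>2) \<le>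
       pavg I (\<lambda>p. 2 * \<delta>\<^sup>2 / ?n * (c (p i) - c (p j))\<^sup>2 * (\<beta> i + \<beta> j))"
      unfolding \<beta>_def by (intro pavg_mono swap_energy_swap fin \<delta> ij)
    also have "\<dots> = 2 * \<delta>\<^sup>2 / ?n * pavg I (\<lambda>p. (c (p i) - c (p j))\<^sup>2) * (\<beta> i + \<beta> j)"
      by (simp only: pavg_cmult pavg_multc)
    also have "pavg I (\<lambda>p. (c (p i) - c (p j))\<^sup>2) \<le> C"
      using pavg_dpow[OF fin ij, of 2 c] C0 fin by (cases "i = j") (auto simp: C_def pavg_const)
    finally show ?thesis using n \<beta>0 by (simp add: mult_right_mono mult_left_mono divide_right_mono)
  qed
  then have "(\<Sum>i\<in>I. \<Sum>j\<in>I. pavg I (\<lambda>p. (swap_energy I b c \<delta> p - swap_energy I b c \<delta> (p \<circ> swap i j))\<^sup>2))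
     \<le> (\<Sum>i\<in>I. \<Sum>j\<in>I. 2 * \<delta>\<^sup>2 / ?n * C * (\<beta> i + \<beta> j))"
    by (intro sum_mono) auto
  also have "\<dots> = 2 * \<delta>\<^sup>2 / ?n * C * (2 * ?n * (\<Sum>i\<in>I. \<beta> i))"
    by (simp only: sum_distrib_left[symmetric]) (simp add: sum.distrib flip: sum_distrib_left)
  also have "(\<Sum>i\<in>I. \<beta> i) = dpow I b 2" by (simp add: \<beta>_def dpow_def)
  also have "2 * \<delta>\<^sup>2 / ?n * C * (2 * ?n * dpow I b 2) = 2 * ?n * (8 * \<delta>\<^sup>2 * stat_var I b c)"
    using n by (simp add: C_def stat_var_def field_simps power2_eq_square)
  finally have "2 * ?n * pvar I (swap_energy I b c \<delta>) \<le> 2 * ?n * (8 * \<delta>\<^sup>2 * stat_var I b c)"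
    using pvar_le_transpositions[OF fin, of "swap_energy I b c \<delta>"] by linarith
  then show ?thesis using n by (subst (asm) mult_le_cancel_left_pos) auto
qed

lemma dpow_pos_3:
  assumes "finite I" "dpow I b 2 > 0" shows "dpow I b 3 > 0"
proof -
  have "\<exists>i\<in>I. \<exists>j\<in>I. b i \<noteq> b j"
  proof (rule ccontr)
    assume "\<not> ?thesis"
    then have "b i = b j" if "i \<in> I" "j \<in> I" for i j using that by blast
    then have "\<bar>b i - b j\<bar> ^ 2 = 0" if "i \<in> I" "j \<in> I" for i j
      using that by (metis abs_zero diff_self zero_power2)
    then have "dpow I b 2 = 0" unfolding dpow_def by (intro sum.neutral ballI)
    then show False using assms by simp
  qed
  then obtain i j where ij: "i \<in> I" "j \<in> I" "b i \<noteq> b j" by auto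
  have "0 < \<bar>b i - b j\<bar> ^ 3" using ij by simp
  also have "\<dots> \<le> (\<Sum>j\<in>I. \<bar>b i - b j\<bar> ^ 3)"
    using ij assms by (intro member_le_sum) auto
  also have "\<dots> \<le> dpow I b 3"
    unfolding dpow_def using ij assms by (intro member_le_sum) (auto intro: sum_nonneg)
  finally show ?thesis .
qed

lemma stat_third_pos:
  assumes "finite I" "card I \<ge> 2" "stat_var I b c > 0" shows "stat_third I b c > 0"
proof -
  have "dpow I b 2 \<noteq> 0" "dpow I c 2 \<noteq> 0" using assms by (auto simp: stat_var_def)
  then have "dpow I b 2 > 0" "dpow I c 2 > 0" using dpow_nonneg[of I _ 2] by (metis antisym_conv2)+
  then have "dpow I b 3 > 0" "dpow I c 3 > 0" using dpow_pos_3 assms(1) by blast+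
  moreover have "4 * real (card I) ^ 2 * (real (card I) - 1) > 0" using assms(2) by simp
  ultimately show ?thesis unfolding stat_third_def by simp
qed

lemma sum_pavg_Cauchy_Schwarz:
  "(\<Sum>i\<in>I. \<Sum>j\<in>I. pavg K (\<lambda>p. \<bar>F i j p\<bar> * \<bar>G i j p\<bar>)) \<le>
    sqrt (\<Sum>i\<in>I. \<Sum>j\<in>I. pavg K (\<lambda>p. (F i j p)\<^sup>2)) * sqrt (\<Sum>i\<in>I. \<Sum>j\<in>I. pavg K (\<lambda>p. (G i j p)\<^sup>2))"
proof -
  let ?f = "\<lambda>x. sqrt (pavg K (\<lambda>p. (F (fst x) (snd x) p)\<^sup>2))"
  let ?g = "\<lambda>x. sqrt (pavg K (\<lambda>p. (G (fst x) (snd x) p)\<^sup>2))"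
  have nn: "0 \<le> pavg K (\<lambda>p. (H p)\<^sup>2)" for H by (rule pavg_nonneg) simp
  have "(\<Sum>i\<in>I. \<Sum>j\<in>I. pavg K (\<lambda>p. \<bar>F i j p\<bar> * \<bar>G i j p\<bar>)) =
      (\<Sum>x\<in>I\<times>I. pavg K (\<lambda>p. \<bar>F (fst x) (snd x) p\<bar> * \<bar>G (fst x) (snd x) p\<bar>))"
    by (simp add: sum.cartesian_product split_def)
  also have "\<dots> \<le> (\<Sum>x\<in>I\<times>I. \<bar>?f x\<bar> * \<bar>?g x\<bar>)"
    using pavg_Cauchy_Schwarz nn by (intro sum_mono) simp
  also have "\<dots> \<le> L2_set ?f (I \<times> I) * L2_set ?g (I \<times> I)" by (rule L2_set_mult_ineq)
  also have "\<dots> = sqrt (\<Sum>i\<in>I. \<Sum>j\<in>I. pavg K (\<lambda>p. (F i j p)\<^sup>2)) * sqrt (\<Sum>i\<in>I. \<Sum>j\<in>I. pavg K (\<lambda>p. (G i j p)\<^sup>2))"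
    using nn by (simp add: L2_set_def sum.cartesian_product split_def)
  finally show ?thesis .
qed

text \<open>The Stein identity is tested against the statistic clipped at the random level
  \<open>\<bar>R p\<bar> + \<delta>\<close>. From above, the test function is bounded by its level.
  From below, on the event in question every swap contributes its truncated square, so the energy
  appears, and its fluctuation is small by the Poincare inequality. Since \<open>R\<close> may
  depend on \<open>p\<close>, its increments enter through the Dirichlet form.\<close>

lemma stat_concentration:
  assumes fin: "finite I" and n2: "card I \<ge> 2" and v: "stat_var I b c > 0"
  defines "\<sigma> \<equiv> sqrt (stat_var I b c)"
  shows "pavg I (\<lambda>p. of_bool (\<bar>stat I b c p - z\<bar> \<le> \<bar>R p\<bar>)) \<le>
    2 * (sqrt (pavg I (\<lambda>p. (R p)\<^sup>2)) + sqrt (dirichlet I R)) / \<sigma> + 4 * stat_third I b c / \<sigma> ^ 3"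
proof -
  let ?n = "real (card I)"
  have n: "?n > 1" using n2 by simp
  have \<sigma>: "\<sigma> > 0" "\<sigma>\<^sup>2 = stat_var I b c" using v by (auto simp: \<sigma>_def)
  define \<Gamma> where "\<Gamma> = stat_third I b c"
  have \<Gamma>: "\<Gamma> > 0" unfolding \<Gamma>_def by (rule stat_third_pos) fact+
  \<comment> \<open>With this \<delta> the truncation loss \<open>\<Gamma> / (4 * \<delta>)\<close>
    is exactly half of the variance.\<close>
  define \<delta> where "\<delta> = \<Gamma> / (2 * \<sigma>\<^sup>2)"
  have \<delta>: "\<delta> > 0" using \<Gamma> \<sigma>(1) by (simp add: \<delta>_def)
  define S where "S = stat I b c"
  define T where "T p = S p - stat_mean I b c" for p
  define h where "h p = clip (\<bar>R p\<bar> + \<delta>) (S p - z)" for p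
  define A where "A p = (of_bool (\<bar>S p - z\<bar> \<le> \<bar>R p\<bar>) :: real)" for p
  define Q where "Q = swap_energy I b c \<delta>"
  define P where "P = pavg I A"
  define \<rho> where "\<rho> = sqrt (pavg I (\<lambda>p. (R p)\<^sup>2))"
  define \<epsilon> where "\<epsilon> = sqrt (dirichlet I R)"
  have sdT: "sqrt (pavg I (\<lambda>p. (T p)\<^sup>2)) = \<sigma>"
    unfolding T_def S_def \<sigma>_def pavg_stat_variance[OF fin] ..
  have up: "pavg I (\<lambda>p. T p * h p) \<le> \<sigma> * \<rho> + \<sigma> * \<delta>"
  proof -
    have "pavg I (\<lambda>p. T p * h p) \<le> pavg I (\<lambda>p. \<bar>T p\<bar> * \<bar>R p\<bar> + \<delta> * \<bar>T p\<bar>)"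
    proof (rule pavg_mono)
      fix p
      have "T p * h p \<le> \<bar>T p\<bar> * \<bar>h p\<bar>" using abs_ge_self[of "T p * h p"] by (simp add: abs_mult)
      also have "\<dots> \<le> \<bar>T p\<bar> * (\<bar>R p\<bar> + \<delta>)"
        using clip_bound[of "\<bar>R p\<bar> + \<delta>"] \<delta> by (intro mult_left_mono) (auto simp: h_def)
      finally show "T p * h p \<le> \<bar>T p\<bar> * \<bar>R p\<bar> + \<delta> * \<bar>T p\<bar>" by (simp add: algebra_simps)
    qed
    also have "\<dots> = pavg I (\<lambda>p. \<bar>T p\<bar> * \<bar>R p\<bar>) + \<delta> * pavg I (\<lambda>p. \<bar>T p\<bar>)"
      by (simp only: pavg_add pavg_cmult)
    also have "\<dots> \<le> \<sigma> * \<rho> + \<delta> * \<sigma>"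
      using pavg_Cauchy_Schwarz[of I T R] pavg_abs_le_sqrt[OF fin, of T] \<delta>
      by (intro add_mono mult_left_mono) (auto simp: sdT \<rho>_def)
    finally show ?thesis by (simp add: mult.commute)
  qed
  define D where "D i j p = (b i - b j) * (c (p i) - c (p j))" for i j p
  \<comment> \<open>The increment of \<open>h\<close> is split in two: the statistic moves at a
    fixed level, which gives the truncated square on the event and something nonnegative off it;
    then the level moves, which costs at most the increment of \<open>R\<close>.\<close>
  have lo: "trunc_square \<delta> \<bar>D i j p\<bar> * A p - \<bar>D i j p\<bar> * \<bar>R p - R (p \<circ> swap i j)\<bar>
      \<le> D i j p * (h p - h (p \<circ> swap i j))" if ij: "i \<in> I" "j \<in> I" for i j p
  proof -
    let ?q = "p \<circ> swap i j"
    have D: "D i j p = (S p - z) - (S ?q - z)" using stat_swap[OF fin ij, of b c p] by (simp add: D_def S_def)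
    let ?x = "clip (\<bar>R p\<bar> + \<delta>) (S ?q - z)"
    have 1: "trunc_square \<delta> \<bar>D i j p\<bar> * A p \<le> D i j p * (h p - ?x)"
      unfolding D h_def A_def
      using clip_diff_ge[of "S p - z" "\<bar>R p\<bar>" \<delta> "S ?q - z"] clip_diff_nonneg[of "\<bar>R p\<bar> + \<delta>" "S p - z" "S ?q - z"] \<delta>
      by auto
    have "\<bar>D i j p * (?x - h ?q)\<bar> \<le> \<bar>D i j p\<bar> * \<bar>R p - R ?q\<bar>"
      unfolding abs_mult h_def
      using clip_Lipschitz[of "\<bar>R p\<bar> + \<delta>" "\<bar>R ?q\<bar> + \<delta>" "S ?q - z"] \<delta>
        abs_triangle_ineq3[of "R p" "R ?q"]
      by (intro mult_left_mono) auto
    then have "- (\<bar>D i j p\<bar> * \<bar>R p - R ?q\<bar>) \<le> D i j p * (?x - h ?q)" by linarith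
    with 1 show ?thesis by (simp add: algebra_simps)
  qed
  have "(\<Sum>i\<in>I. \<Sum>j\<in>I. pavg I (\<lambda>p. trunc_square \<delta> \<bar>D i j p\<bar> * A p)) / (4 * ?n)
     - (\<Sum>i\<in>I. \<Sum>j\<in>I. pavg I (\<lambda>p. \<bar>D i j p\<bar> * \<bar>R p - R (p \<circ> swap i j)\<bar>)) / (4 * ?n)
     = (\<Sum>i\<in>I. \<Sum>j\<in>I. pavg I (\<lambda>p. trunc_square \<delta> \<bar>D i j p\<bar> * A p - \<bar>D i j p\<bar> * \<bar>R p - R (p \<circ> swap i j)\<bar>)) / (4 * ?n)"
    by (simp add: pavg_diff sum_subtractf diff_divide_distrib)
  also have "\<dots> \<le> (\<Sum>i\<in>I. \<Sum>j\<in>I. pavg I (\<lambda>p. D i j p * (h p - h (p \<circ> swap i j)))) / (4 * ?n)"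
    by (intro divide_right_mono sum_mono pavg_mono lo) auto
  also have "\<dots> = pavg I (\<lambda>p. T p * h p)"
    unfolding T_def S_def D_def pavg_stat_mult[OF fin] ..
  finally have main: "(\<Sum>i\<in>I. \<Sum>j\<in>I. pavg I (\<lambda>p. trunc_square \<delta> \<bar>D i j p\<bar> * A p)) / (4 * ?n)
     - (\<Sum>i\<in>I. \<Sum>j\<in>I. pavg I (\<lambda>p. \<bar>D i j p\<bar> * \<bar>R p - R (p \<circ> swap i j)\<bar>)) / (4 * ?n) \<le> \<sigma> * \<rho> + \<sigma> * \<delta>"
    using up by linarith
  have QA: "(\<Sum>i\<in>I. \<Sum>j\<in>I. pavg I (\<lambda>p. trunc_square \<delta> \<bar>D i j p\<bar> * A p)) / (4 * ?n) = pavg I (\<lambda>p. Q p * A p)"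
    unfolding Q_def swap_energy_def D_def divide_inverse
    by (simp only: pavg_sum[symmetric] pavg_multc[symmetric] sum_distrib_right mult.assoc mult.commute [of "A _"])
  have "(\<Sum>i\<in>I. \<Sum>j\<in>I. pavg I (\<lambda>p. \<bar>D i j p\<bar> * \<bar>R p - R (p \<circ> swap i j)\<bar>)) / (4 * ?n)
    \<le> (sqrt (\<Sum>i\<in>I. \<Sum>j\<in>I. pavg I (\<lambda>p. (D i j p)\<^sup>2)) *
       sqrt (\<Sum>i\<in>I. \<Sum>j\<in>I. pavg I (\<lambda>p. (R p - R (p \<circ> swap i j))\<^sup>2))) / (4 * ?n)"
    by (intro divide_right_mono sum_pavg_Cauchy_Schwarz) auto
  also have "\<dots> = sqrt ((\<Sum>i\<in>I. \<Sum>j\<in>I. pavg I (\<lambda>p. (D i j p)\<^sup>2)) / (4 * ?n)) * \<epsilon>"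
    using n by (simp add: \<epsilon>_def dirichlet_def real_sqrt_divide)
  also have "(\<Sum>i\<in>I. \<Sum>j\<in>I. pavg I (\<lambda>p. (D i j p)\<^sup>2)) / (4 * ?n) = \<sigma>\<^sup>2"
    using sum_pavg_dpow[OF fin, of 2 b c]
    by (simp add: D_def \<sigma>(2) stat_var_def) (simp add: power2_eq_square)
  finally have RR: "(\<Sum>i\<in>I. \<Sum>j\<in>I. pavg I (\<lambda>p. \<bar>D i j p\<bar> * \<bar>R p - R (p \<circ> swap i j)\<bar>)) / (4 * ?n) \<le> \<sigma> * \<epsilon>"
    using \<sigma>(1) by (simp only: real_sqrt_unique less_imp_le)
  have A01: "\<bar>A p\<bar> \<le> 1" "A p \<ge> 0" for p by (auto simp: A_def)
  have P0: "P \<ge> 0" unfolding P_def by (intro pavg_nonneg A01)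
  define q where "q = pavg I Q"
  have q: "q \<ge> \<sigma>\<^sup>2 / 2"
    using pavg_swap_energy_ge[OF fin \<delta>, of b c] \<Gamma> \<sigma>(1)
    by (simp add: q_def Q_def \<delta>_def flip: \<Gamma>_def \<sigma>(2))
  \<comment> \<open>The energy is replaced by its mean \<open>q\<close>, so that it factors out of
    the expectation over the event.\<close>
  have "q * P - pavg I (\<lambda>p. Q p * A p) = pavg I (\<lambda>p. (q - Q p) * A p)"
    by (simp add: P_def left_diff_distrib pavg_diff pavg_cmult)
  also have "\<dots> \<le> pavg I (\<lambda>p. \<bar>Q p - q\<bar>)"
  proof (rule pavg_mono)
    fix p
    have "(q - Q p) * A p \<le> \<bar>q - Q p\<bar> * \<bar>A p\<bar>" using abs_ge_self[of "(q - Q p) * A p"] by (simp add: abs_mult)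
    also have "\<dots> \<le> \<bar>q - Q p\<bar> * 1" using A01 by (intro mult_left_mono) auto
    finally show "(q - Q p) * A p \<le> \<bar>Q p - q\<bar>" by simp
  qed
  also have "\<dots> \<le> sqrt (pvar I Q)"
    using pavg_abs_le_sqrt[OF fin, of "\<lambda>p. Q p - q"] by (simp add: pvar_def q_def)
  also have "\<dots> \<le> sqrt ((3 * \<delta> * \<sigma>)\<^sup>2)"
  proof (rule real_sqrt_le_mono)
    have "pvar I Q \<le> 8 * \<delta>\<^sup>2 * \<sigma>\<^sup>2"
      using pvar_swap_energy[OF fin n2, of \<delta> b c] \<delta> by (simp add: Q_def \<sigma>)
    also have "\<dots> \<le> (3 * \<delta> * \<sigma>)\<^sup>2" by (simp add: power_mult_distrib mult_right_mono)
    finally show "pvar I Q \<le> (3 * \<delta> * \<sigma>)\<^sup>2" .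
  qed
  also have "\<dots> = 3 * \<delta> * \<sigma>" using \<delta> \<sigma> by simp
  finally have "q * P \<le> pavg I (\<lambda>p. Q p * A p) + 3 * \<delta> * \<sigma>" by simp
  moreover have "\<sigma>\<^sup>2 / 2 * P \<le> q * P" using q P0 by (rule mult_right_mono)
  \<comment> \<open>\<open>4 * \<delta>\<close> collects \<open>\<delta>\<close> from the upper
    bound and \<open>3 * \<delta>\<close> from the fluctuation of the energy.\<close>
  ultimately have "\<sigma>\<^sup>2 / 2 * P \<le> \<sigma> * (\<rho> + \<epsilon> + 4 * \<delta>)"
    using main RR unfolding QA by (simp add: algebra_simps)
  then have "\<sigma> / 2 * P \<le> \<rho> + \<epsilon> + 4 * \<delta>"
    using \<sigma>(1) by (simp add: power2_eq_square mult.assoc)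
  then have "P \<le> 2 * (\<rho> + \<epsilon>) / \<sigma> + 8 * \<delta> / \<sigma>" using \<sigma>(1) by (simp add: field_simps)
  also have "8 * \<delta> / \<sigma> = 4 * \<Gamma> / \<sigma> ^ 3" by (simp add: \<delta>_def power2_eq_square power3_eq_cube)
  finally show ?thesis by (simp only: P_def A_def [abs_def] S_def \<rho>_def \<epsilon>_def \<Gamma>_def)
qed

section \<open>Stein's equation for the normal law\<close>

abbreviation \<phi> :: "real \<Rightarrow> real" where
  "\<phi> \<equiv> std_normal_density"

definition \<Phi> :: "real \<Rightarrow> real" where
  "\<Phi> = cdf std_normal_distribution"

lemma \<phi>_eq: "\<phi> x = exp (- (x\<^sup>2) / 2) / sqrt (2 * pi)"
  by (simp add: std_normal_density_def)

lemma \<phi>_pos: "\<phi> x > 0"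
  by (simp add: \<phi>_eq)

lemma \<phi>_le_1: "\<phi> x \<le> 1"
proof -
  have "exp (- (x\<^sup>2) / 2) \<le> 1" by simp
  also have "1 \<le> sqrt (2 * pi)" using pi_gt3 by simp
  finally show ?thesis by (simp add: \<phi>_eq divide_le_eq)
qed

lemma \<phi>_minus [simp]: "\<phi> (- x) = \<phi> x"
  by (simp add: \<phi>_eq)

lemma DERIV_\<phi> [derivative_intros]:
  assumes "(f has_field_derivative D) (at x)"
  shows "((\<lambda>x. \<phi> (f x)) has_field_derivative - f x * \<phi> (f x) * D) (at x)"
proof -
  define c where "c = 1 / sqrt (2 * pi)"
  have e: "\<phi> y = exp (- (y\<^sup>2 / 2)) * c" for y by (simp add: \<phi>_eq c_def)
  show ?thesis unfolding e
    by (auto intro!: derivative_eq_intros assms)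
qed

lemma continuous_\<phi>: "continuous_on A \<phi>"
  unfolding std_normal_density_def[abs_def] by (intro continuous_intros) auto

interpretation std: real_distribution std_normal_distribution
  by (rule real_dist_normal_dist)

lemma \<Phi>_nonneg: "0 \<le> \<Phi> x" and \<Phi>_le_1: "\<Phi> x \<le> 1"
  by (auto simp: \<Phi>_def std.cdf_nonneg std.cdf_bounded_prob)

lemma \<Phi>_mono: "x \<le> y \<Longrightarrow> \<Phi> x \<le> \<Phi> y"
  by (simp add: \<Phi>_def std.cdf_nondecreasing)

lemma \<Phi>_diff:
  assumes "x \<le> y" shows "\<Phi> y - \<Phi> x = (LBINT t=x..y. \<phi> t)"
proof (cases "x = y")
  case True
  then show ?thesis by (simp add: interval_integral_endpoints_same)
next
  case False
  then have xy: "x < y" using assms by simp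
  have "\<Phi> y - \<Phi> x = measure std_normal_distribution {x<..y}"
    unfolding \<Phi>_def using xy by (rule std.cdf_diff_eq)
  also have "\<dots> = (\<integral>t. indicator {x<..y} t \<partial>std_normal_distribution)"
    by (simp add: std.emeasure_eq_measure)
  also have "\<dots> = (\<integral>t. \<phi> t * indicator {x<..y} t \<partial>lborel)"
    by (subst integral_density) auto
  also have "\<dots> = (LBINT t=x..y. \<phi> t)"
    using assms by (simp add: interval_integral_Ioc set_lebesgue_integral_def mult.commute)
  finally show ?thesis .
qed

lemma DERIV_\<Phi>_at: "(\<Phi> has_field_derivative \<phi> x) (at x)"
proof -
  have "((\<lambda>u. LBINT t=x-1..u. \<phi> t) has_vector_derivative \<phi> x) (at x within {x-1..x+1})"
    by (rule interval_integral_FTC2) (auto intro: continuous_\<phi>)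
  then have "((\<lambda>u. LBINT t=x-1..u. \<phi> t) has_real_derivative \<phi> x) (at x)"
    unfolding has_real_derivative_iff_has_vector_derivative by (subst (asm) at_within_interior) auto
  then have "((\<lambda>u. \<Phi> (x-1) + (LBINT t=x-1..u. \<phi> t)) has_real_derivative \<phi> x) (at x)"
    by (auto intro!: derivative_eq_intros)
  then show ?thesis
  proof (rule has_field_derivative_transform_within_open[where S = "{x-1<..}"])
    fix u assume "u \<in> {x-1<..}"
    then show "\<Phi> (x-1) + (LBINT t=x-1..u. \<phi> t) = \<Phi> u" using \<Phi>_diff[of "x-1" u] by simp
  qed auto
qed

lemmas DERIV_\<Phi> [derivative_intros] = DERIV_\<Phi>_at [THEN DERIV_chain2]

lemma \<Phi>_at_top: "(\<Phi> \<longlongrightarrow> 1) at_top"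
  unfolding \<Phi>_def by (rule std.cdf_lim_at_top_prob)

lemma \<Phi>_at_bot: "(\<Phi> \<longlongrightarrow> 0) at_bot"
  unfolding \<Phi>_def by (rule std.cdf_lim_at_bot)

lemma \<Phi>_minus: "\<Phi> (- x) = 1 - \<Phi> x"
proof -
  have "((\<lambda>x. \<Phi> x + \<Phi> (- x)) has_field_derivative 0) (at x)" for x
    by (rule derivative_eq_intros refl | simp)+
  then have c: "\<Phi> x + \<Phi> (- x) = \<Phi> y + \<Phi> (- y)" for x y
    by (rule DERIV_isconst_all[rule_format])
  have "((\<lambda>y. \<Phi> y + \<Phi> (- y)) \<longlongrightarrow> 1 + 0) at_top"
    by (intro tendsto_add \<Phi>_at_top filterlim_compose[OF \<Phi>_at_bot] filterlim_uminus_at_bot_at_top)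
  moreover have "(\<lambda>y. \<Phi> y + \<Phi> (- y)) = (\<lambda>y. \<Phi> x + \<Phi> (- x))" using c by blast
  ultimately have "((\<lambda>y::real. \<Phi> x + \<Phi> (- x)) \<longlongrightarrow> 1) at_top" by simp
  then have "\<Phi> x + \<Phi> (- x) = 1" by (simp add: tendsto_const_iff)
  then show ?thesis by simp
qed

lemma inverse_at_bot: "((\<lambda>x::real. 1 / \<bar>x\<bar>) \<longlongrightarrow> 0) at_bot"
  by (rule tendsto_divide_0[OF tendsto_const])
    (rule filterlim_at_top_imp_at_infinity, simp add: filterlim_at_top eventually_at_bot_linorder, rule allI,
      rule_tac x = "- \<bar>Z\<bar>" in exI, auto)

text \<open>For negative \<open>w\<close> this is the tail bound
  \<open>\<Phi> w \<le> \<phi> w / \<bar>w\<bar>\<close>: the gap between the two sides vanishes at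
  minus infinity and has the positive derivative \<open>\<phi> w / w^2\<close>.\<close>

lemma Mills_upper: "w * \<Phi> w + \<phi> w \<ge> 0"
proof (cases "w < 0")
  case True
  define k where "k = (\<lambda>w. - \<Phi> w - \<phi> w / w)"
  have "\<exists>y. (k has_real_derivative y) (at x) \<and> 0 < y" if "x \<le> w" for x
  proof (intro exI conjI)
    have x: "x < 0" using that True by simp
    show "(k has_real_derivative \<phi> x / x\<^sup>2) (at x)"
      unfolding k_def using x
      by (auto intro!: derivative_eq_intros simp: power2_eq_square field_simps)
    show "0 < \<phi> x / x\<^sup>2" using x \<phi>_pos by simp
  qed
  moreover have "(k \<longlongrightarrow> 0) at_bot"
  proof -
    have "((\<lambda>w. \<phi> w / w) \<longlongrightarrow> 0) at_bot"
    proof (rule Lim_null_comparison[OF _ inverse_at_bot])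
      show "\<forall>\<^sub>F x in at_bot. norm (\<phi> x / x) \<le> 1 / \<bar>x\<bar>"
        using \<phi>_pos \<phi>_le_1 by (intro always_eventually) (auto simp: abs_divide intro!: divide_right_mono)
    qed
    from tendsto_diff[OF tendsto_minus[OF \<Phi>_at_bot] this] show ?thesis by (simp add: k_def)
  qed
  ultimately have "0 < k w" by (rule DERIV_pos_imp_increasing_at_bot)
  then have "w * (- \<Phi> w - \<phi> w / w) \<le> 0" using True by (simp add: k_def mult_nonpos_nonneg)
  then show ?thesis using True by (simp add: right_diff_distrib)
next
  case False
  then show ?thesis using \<Phi>_nonneg \<phi>_pos by (simp add: less_imp_le)
qed

text \<open>After division by \<open>1 + w^2\<close> the left side vanishes at minus infinity and
  has the positive derivative \<open>2 * \<phi> w / (1 + w^2)^2\<close>. The bound is made for the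
  monotonicity of \<open>w * mills w\<close>.\<close>

lemma Mills_lower: "(1 + w\<^sup>2) * \<Phi> w + w * \<phi> w \<ge> 0"
proof -
  define k where "k = (\<lambda>w. \<Phi> w + w * \<phi> w / (1 + w\<^sup>2))"
  have p: "1 + x\<^sup>2 > 0" for x :: real by (simp add: add_pos_nonneg)
  have "\<exists>y. (k has_real_derivative y) (at x) \<and> 0 < y" if "x \<le> w" for x
  proof (intro exI conjI)
    have x: "1 + x\<^sup>2 \<noteq> 0" using p[of x] by simp
    have "(k has_real_derivative \<phi> x + ((\<phi> x - x * (x * \<phi> x)) * (1 + x\<^sup>2) - x * \<phi> x * (2 * x)) / ((1 + x\<^sup>2) * (1 + x\<^sup>2))) (at x)"
      unfolding k_def using x
      by (auto intro!: derivative_eq_intros)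
    also have "\<phi> x + ((\<phi> x - x * (x * \<phi> x)) * (1 + x\<^sup>2) - x * \<phi> x * (2 * x)) / ((1 + x\<^sup>2) * (1 + x\<^sup>2)) = 2 * \<phi> x / (1 + x\<^sup>2)\<^sup>2"
      using x by (simp add: divide_simps) (simp add: power2_eq_square algebra_simps)
    finally show "(k has_real_derivative 2 * \<phi> x / (1 + x\<^sup>2)\<^sup>2) (at x)" .
    show "0 < 2 * \<phi> x / (1 + x\<^sup>2)\<^sup>2" using \<phi>_pos p[of x] by simp
  qed
  moreover have "(k \<longlongrightarrow> 0) at_bot"
  proof -
    have "((\<lambda>w. w * \<phi> w / (1 + w\<^sup>2)) \<longlongrightarrow> 0) at_bot"
    proof (rule Lim_null_comparison[OF _ inverse_at_bot])
      have "norm (x * \<phi> x / (1 + x\<^sup>2)) \<le> 1 / \<bar>x\<bar>" for x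
      proof (cases "x = 0")
        case False
        have "\<bar>x\<bar> * \<bar>x * \<phi> x\<bar> = x\<^sup>2 * \<phi> x" using \<phi>_pos[of x] by (simp add: abs_mult power2_eq_square)
        also have "\<dots> \<le> x\<^sup>2 * 1" using \<phi>_le_1 by (intro mult_left_mono) auto
        also have "\<dots> \<le> 1 + x\<^sup>2" by simp
        finally show ?thesis using False p[of x] by (simp add: abs_divide field_simps)
      qed simp
      then show "\<forall>\<^sub>F x in at_bot. norm (x * \<phi> x / (1 + x\<^sup>2)) \<le> 1 / \<bar>x\<bar>" by (intro always_eventually) auto
    qed
    from tendsto_add[OF \<Phi>_at_bot this] show ?thesis by (simp add: k_def)
  qed
  ultimately have "0 < k w" by (rule DERIV_pos_imp_increasing_at_bot)
  then show ?thesis using p[of w] by (simp add: k_def field_simps)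
qed

section \<open>The solution of Stein's equation in terms of the Mills ratio\<close>

definition mills :: "real \<Rightarrow> real" where
  "mills w = \<Phi> w / \<phi> w"

lemma mills_nonneg: "0 \<le> mills w"
  unfolding mills_def using \<Phi>_nonneg \<phi>_pos by (simp add: less_imp_le)

lemma DERIV_mills_at: "(mills has_field_derivative 1 + w * mills w) (at w)"
proof -
  have "((\<lambda>w. \<Phi> w / \<phi> w) has_field_derivative (\<phi> w * \<phi> w - \<Phi> w * (- w * \<phi> w)) / (\<phi> w * \<phi> w)) (at w)"
    using \<phi>_pos[of w] by (auto intro!: derivative_eq_intros)
  also have "(\<phi> w * \<phi> w - \<Phi> w * (- w * \<phi> w)) / (\<phi> w * \<phi> w) = 1 + w * mills w"
    using \<phi>_pos[of w] by (simp add: mills_def field_simps)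
  finally show ?thesis unfolding mills_def[abs_def] .
qed

lemmas DERIV_mills [derivative_intros] = DERIV_mills_at [THEN DERIV_chain2]

lemma mills_times_ge: "- 1 \<le> w * mills w"
  using Mills_upper[of w] \<phi>_pos[of w] by (simp add: mills_def field_simps)

text \<open>The derivative is the left side of \<open>Mills_lower\<close> divided by the
  density.\<close>

lemma mills_times_mono:
  assumes "v \<le> w" shows "v * mills v \<le> w * mills w"
proof (rule DERIV_nonneg_imp_nondecreasing[OF assms])
  fix x
  have "((\<lambda>x. x * mills x) has_real_derivative mills x + x * (1 + x * mills x)) (at x)"
    by (auto intro!: derivative_eq_intros)
  moreover have "mills x + x * (1 + x * mills x) = ((1 + x\<^sup>2) * \<Phi> x + x * \<phi> x) / \<phi> x"
    using \<phi>_pos[of x] by (simp add: mills_def field_simps power2_eq_square)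
  moreover have "\<dots> \<ge> 0" using Mills_lower[of x] \<phi>_pos[of x] by simp
  ultimately show "\<exists>y. ((\<lambda>x. x * mills x) has_real_derivative y) (at x) \<and> 0 \<le> y" by auto
qed

text \<open>The bounded solution f of f'(w) - w f(w) = 1[w \<le> z] - \<Phi>(z). Both branches use
  the left-tail Mills ratio, the right one after a reflection, so that every estimate is needed on
  one side only.\<close>

definition stein :: "real \<Rightarrow> real \<Rightarrow> real" where
  "stein z w = (if w \<le> z then mills w * (1 - \<Phi> z) else mills (- w) * \<Phi> z)"

definition stein_g :: "real \<Rightarrow> real \<Rightarrow> real" where
  "stein_g z w = w * stein z w"

text \<open>Defined by Stein's equation instead of by differentiation, so it also has a value at the
  kink, namely the left derivative. It splits into the monotone \<open>stein_g\<close> and a single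
  jump, and the later estimates rest on this splitting.\<close>

definition stein' :: "real \<Rightarrow> real \<Rightarrow> real" where
  "stein' z w = stein_g z w + of_bool (w \<le> z) - \<Phi> z"

lemma stein_at: "mills z * (1 - \<Phi> z) = mills (- z) * \<Phi> z"
  by (simp add: mills_def \<Phi>_minus)

lemma stein_ge: "z \<le> w \<Longrightarrow> stein z w = mills (- w) * \<Phi> z"
  using stein_at by (auto simp: stein_def)

lemma stein_minus: "stein (- z) (- w) = stein z w"
  by (cases "w \<le> z") (auto simp: stein_def stein_ge \<Phi>_minus stein_at)

lemma stein_g_minus: "stein_g (- z) (- w) = - stein_g z w"
  by (simp add: stein_g_def stein_minus)

lemma stein_g_mono:
  assumes "v \<le> w" shows "stein_g z v \<le> stein_g z w"
proof -
  have 1: "stein_g z v \<le> stein_g z w" if "v \<le> w" "w \<le> z" for v w z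
  proof -
    have "v * mills v * (1 - \<Phi> z) \<le> w * mills w * (1 - \<Phi> z)"
      using mills_times_mono[OF that(1)] \<Phi>_le_1[of z] by (intro mult_right_mono) auto
    then show ?thesis using that by (simp add: stein_g_def stein_def mult.assoc)
  qed
  have 2: "stein_g z v \<le> stein_g z w" if "v \<le> w" "z \<le> v" for v w
    using 1[of "- w" "- v" "- z"] that by (simp add: stein_g_minus)
  consider "w \<le> z" | "z \<le> v" | "v \<le> z" "z \<le> w" by linarith
  then show ?thesis
    using 1[of v w z] 2[of v w] 1[of v z z] 2[of z w] assms by cases auto
qed

lemma stein_g_abs_le_1: "\<bar>stein_g z w\<bar> \<le> 1"
proof -
  have *: "\<bar>stein_g z w\<bar> \<le> 1" if wz: "w \<le> z" for z w
  proof -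
    have e: "stein_g z w = w * mills w * (1 - \<Phi> z)" using wz by (simp add: stein_g_def stein_def)
    have a: "0 \<le> 1 - \<Phi> z" "1 - \<Phi> z \<le> 1" using \<Phi>_nonneg \<Phi>_le_1 by auto
    have "- (1 - \<Phi> z) \<le> stein_g z w"
      using mult_right_mono[OF mills_times_ge[of w] a(1)] e by simp
    then have lo: "- 1 \<le> stein_g z w" using a by linarith
    have "stein_g z w \<le> 1"
    proof (cases "w \<le> 0")
      case True
      then have "stein_g z w \<le> 0" unfolding e using mills_nonneg a by (intro mult_nonpos_nonneg) auto
      then show ?thesis by simp
    next
      case False
      \<comment> \<open>As \<open>w \<le> z\<close>, the factor \<open>1 - \<Phi> z\<close> may be
        enlarged to \<open>\<Phi> (- w)\<close>; this exchanges the Mills ratio at \<open>w\<close>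
        for the one at \<open>- w\<close>, which \<open>mills_times_ge\<close> controls.\<close>
      have "stein_g z w \<le> w * mills w * (1 - \<Phi> w)"
        unfolding e using False wz \<Phi>_mono[OF wz] mills_nonneg by (intro mult_left_mono) auto
      also have "\<dots> = \<Phi> w * (w * mills (- w))" by (simp add: mills_def \<Phi>_minus)
      also have "\<dots> \<le> 1 * 1"
        using \<Phi>_nonneg \<Phi>_le_1 mills_times_ge[of "- w"] False mills_nonneg by (intro mult_mono) auto
      finally show ?thesis by simp
    qed
    with lo show ?thesis by simp
  qed
  show ?thesis using *[of w z] *[of "- w" "- z"] by (cases "w \<le> z") (auto simp: stein_g_minus)
qed

lemma stein'_abs_le_2: "\<bar>stein' z w\<bar> \<le> 2"
  using stein_g_abs_le_1[of z w] \<Phi>_nonneg[of z] \<Phi>_le_1[of z]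
  by (auto simp: stein'_def of_bool_def abs_if split: if_splits)

lemma DERIV_stein:
  assumes "w \<noteq> z" shows "(stein z has_field_derivative stein' z w) (at w)"
proof (cases "w < z")
  case True
  have "((\<lambda>w. mills w * (1 - \<Phi> z)) has_field_derivative stein' z w) (at w)"
    using True by (auto intro!: derivative_eq_intros simp: stein'_def stein_g_def stein_def algebra_simps)
  then show ?thesis
    by (rule has_field_derivative_transform_within_open[where S = "{..<z}"])
      (use True in \<open>auto simp: stein_def\<close>)
next
  case False
  have "((\<lambda>w. mills (- w) * \<Phi> z) has_field_derivative stein' z w) (at w)"
    using False assms by (auto intro!: derivative_eq_intros simp: stein'_def stein_g_def stein_def algebra_simps)
  then show ?thesis
    by (rule has_field_derivative_transform_within_open[where S = "{z<..}"])
      (use False assms in \<open>auto simp: stein_def\<close>)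
qed

lemma continuous_stein: "continuous_on A (stein z)"
proof -
  have c: "continuous_on B mills" for B
    using DERIV_mills_at by (metis DERIV_atLeastAtMost_imp_continuous_on DERIV_isCont continuous_at_imp_continuous_on)
  have "continuous_on ({..z} \<union> {z..}) (\<lambda>w. if w \<le> z then mills w * (1 - \<Phi> z) else mills (- w) * \<Phi> z)"
    by (rule continuous_on_cases) (auto intro!: continuous_intros continuous_on_compose2[OF c] simp: stein_at)
  moreover have "{..z} \<union> {z..} = UNIV" by auto
  ultimately have "continuous_on UNIV (stein z)" by (simp add: stein_def[abs_def])
  then show ?thesis by (rule continuous_on_subset) simp
qed

text \<open>On [x - r, x + r] the derivative varies by at most the increment of the monotone part,
  plus 1 if the jump at \<open>z\<close> falls into the interval; the mean value theorem does the
  rest. No second derivative is involved, and both error terms can be averaged by a concentration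
  bound.\<close>

lemma stein_increment:
  assumes "\<bar>u\<bar> \<le> r" "\<bar>v\<bar> \<le> r"
  shows "\<bar>stein z (x + u) - stein z (x + v) - (u - v) * stein' z x\<bar> \<le>
    \<bar>u - v\<bar> * (stein_g z (x + r) - stein_g z (x - r) + of_bool (\<bar>x - z\<bar> \<le> r))"
proof -
  define K where "K = stein_g z (x + r) - stein_g z (x - r) + of_bool (\<bar>x - z\<bar> \<le> r)"
  have d: "\<bar>stein' z \<xi> - stein' z x\<bar> \<le> K" if "x - r \<le> \<xi>" "\<xi> \<le> x + r" for \<xi>
  proof -
    have "stein_g z (x - r) \<le> stein_g z \<xi>" "stein_g z \<xi> \<le> stein_g z (x + r)"
      using that by (auto intro: stein_g_mono)
    moreover have "stein_g z (x - r) \<le> stein_g z x" "stein_g z x \<le> stein_g z (x + r)"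
      using assms by (auto intro: stein_g_mono)
    moreover have "\<bar>of_bool (\<xi> \<le> z) - of_bool (x \<le> z)\<bar> \<le> (of_bool (\<bar>x - z\<bar> \<le> r) :: real)"
      using that by (auto simp: of_bool_def)
    ultimately show ?thesis unfolding K_def stein'_def by linarith
  qed
  have smooth: "\<bar>stein z b - stein z a - (b - a) * stein' z x\<bar> \<le> (b - a) * K"
    if ab: "x - r \<le> a" "a \<le> b" "b \<le> x + r" "z \<le> a \<or> b \<le> z" for a b
  proof (cases "a = b")
    case False
    then have "a < b" using ab by simp
    moreover have "stein z differentiable (at y)" if "a < y" "y < b" for y
      using DERIV_stein[of y z] that ab real_differentiable_def by force
    ultimately obtain l \<xi> where \<xi>: "a < \<xi>" "\<xi> < b" "(stein z has_real_derivative l) (at \<xi>)"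
        "stein z b - stein z a = (b - a) * l"
      using MVT[of a b "stein z"] continuous_stein by blast
    have "l = stein' z \<xi>" using DERIV_unique[OF \<xi>(3) DERIV_stein] \<xi> ab by auto
    then have "stein z b - stein z a - (b - a) * stein' z x = (b - a) * (stein' z \<xi> - stein' z x)"
      using \<xi>(4) by (simp add: algebra_simps)
    then show ?thesis using d[of \<xi>] \<xi> ab by (simp add: abs_mult mult_left_mono)
  qed simp
  \<comment> \<open>If the kink lies strictly inside, the interval is cut at \<open>z\<close> and
    the two estimates add up, as \<open>stein z\<close> is continuous there.\<close>
  have all: "\<bar>stein z b - stein z a - (b - a) * stein' z x\<bar> \<le> (b - a) * K"
    if ab: "x - r \<le> a" "a \<le> b" "b \<le> x + r" for a b
  proof (cases "z \<le> a \<or> b \<le> z")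
    case True
    then show ?thesis using smooth ab by simp
  next
    case False
    then have "\<bar>stein z b - stein z z - (b - z) * stein' z x\<bar> \<le> (b - z) * K"
       "\<bar>stein z z - stein z a - (z - a) * stein' z x\<bar> \<le> (z - a) * K"
      using smooth[of z b] smooth[of a z] ab by auto
    then show ?thesis by (simp add: algebra_simps abs_le_iff)
  qed
  show ?thesis
  proof (cases "v \<le> u")
    case True
    then show ?thesis using all[of "x + v" "x + u"] assms by (simp add: K_def)
  next
    case False
    then have "\<bar>stein z (x + v) - stein z (x + u) - (v - u) * stein' z x\<bar> \<le> (v - u) * K"
      using all[of "x + u" "x + v"] assms by simp
    then show ?thesis using False by (simp add: K_def algebra_simps abs_le_iff)
  qed
qed

text \<open>Layer-cake: at each level only points within distance \<open>r\<close> of a single location contribute.\<close>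

lemma sum_mono_increment_le:
  fixes t :: "'b \<Rightarrow> real" and G :: "real \<Rightarrow> real"
  assumes fin: "finite P" and G: "\<And>v w. v \<le> w \<Longrightarrow> G v \<le> G w" "\<And>w. \<bar>G w\<bar> \<le> 1"
    and r: "0 \<le> r" and N: "\<And>w. (\<Sum>x\<in>P. of_bool (\<bar>t x - w\<bar> \<le> r)) \<le> N"
  shows "(\<Sum>x\<in>P. G (t x + r) - G (t x - r)) \<le> 2 * N"
proof -
  define J where "J x = {G (t x - r)<..G (t x + r)}" for x
  have N0: "0 \<le> N" using N[of 0] by (rule order_trans[rotated]) (intro sum_nonneg, simp)
  have pt: "(\<Sum>x\<in>P. indicator (J x) y) \<le> N * indicator {-1..1} y" for y :: real
  proof (cases "\<exists>x\<in>P. y \<in> J x")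
    case False
    then have "(\<Sum>x\<in>P. indicator (J x) y) = (0::real)" by (intro sum.neutral) auto
    then show ?thesis using N0 by simp
  next
    case True
    then obtain x where x: "y \<in> J x" by auto
    have y: "y \<in> {-1..1}" using x G(2)[of "t x - r"] G(2)[of "t x + r"] by (auto simp: J_def)
    \<comment> \<open>\<open>Inf W\<close> is the single location: every interval containing the
      level \<open>y\<close> has its \<open>t\<close> within \<open>r\<close> of it, so the
      hypothesis on \<open>N\<close> applies at this one point. All levels lie in [-1, 1], whence
      the factor 2 in the end.\<close>
    define W where "W = {w. y \<le> G w}"
    have ub: "t x + r \<in> W" "t x - r \<le> w" if "y \<in> J x" "w \<in> W" for x w
      using that G(1)[of w "t x - r"] by (auto simp: J_def W_def not_less[symmetric])
    have ne: "W \<noteq> {}" using x by (auto simp: J_def W_def)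
    have bdd: "bdd_below W" using ub(2)[OF x] by (rule bdd_belowI)
    have "\<bar>t x' - Inf W\<bar> \<le> r" if "y \<in> J x'" for x'
    proof -
      have "t x' + r \<in> W" using that by (auto simp: J_def W_def)
      then have "Inf W \<le> t x' + r" using bdd by (rule cInf_lower)
      moreover have "t x' - r \<le> Inf W" using ne ub(2)[OF that] by (intro cInf_greatest)
      ultimately show ?thesis by linarith
    qed
    then have "(\<Sum>x\<in>P. indicator (J x) y) \<le> (\<Sum>x\<in>P. of_bool (\<bar>t x - Inf W\<bar> \<le> r) :: real)"
      by (intro sum_mono) (auto simp: indicator_def)
    also have "\<dots> \<le> N" by (rule N)
    finally show ?thesis using y by simp
  qed
  have int: "integrable lborel (\<lambda>y. indicator (J x) y :: real)" for x
    unfolding J_def by (rule integrable_real_indicator) (auto simp: emeasure_lborel_Ioc G(1) r)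
  have "(\<Sum>x\<in>P. G (t x + r) - G (t x - r)) = (\<Sum>x\<in>P. (\<integral>y. indicator (J x) y \<partial>lborel))"
  proof (intro sum.cong refl)
    fix x
    have "G (t x - r) \<le> G (t x + r)" using r by (intro G) auto
    then show "G (t x + r) - G (t x - r) = (\<integral>y. indicator (J x) y \<partial>lborel)"
      by (simp add: J_def)
  qed
  also have "\<dots> = (\<integral>y. (\<Sum>x\<in>P. indicator (J x) y) \<partial>lborel)"
    by (subst Bochner_Integration.integral_sum) (auto intro: int)
  also have "\<dots> \<le> (\<integral>y. N * indicator {-1..1::real} y \<partial>lborel)"
    by (intro integral_mono pt integrable_mult_right Bochner_Integration.integrable_sum int integrable_real_indicator) auto
  also have "\<dots> = 2 * N" by simp
  finally show ?thesis .
qed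

text \<open>The maximum, at 1, is 1 / sqrt (2 pi e), about 0.242. The rational bounds 1.625 for exp
  (1/2) and 2.5 for sqrt (2 pi) suffice, since their product exceeds 4.\<close>

lemma abs_times_\<phi>_le: "\<bar>x\<bar> * \<phi> x \<le> 1 / 4"
proof -
  have "1.625 \<le> exp (1/2 :: real)" using exp_lower_Taylor_quadratic[of "1/2"] by (simp add: power2_eq_square)
  then have "1.625 * ((x\<^sup>2 + 1) / 2) \<le> exp (1/2) * exp ((x\<^sup>2 - 1) / 2)"
    using exp_ge_add_one_self[of "(x\<^sup>2 - 1) / 2"] by (intro mult_mono) (auto simp: field_simps)
  also have "\<dots> = exp (x\<^sup>2 / 2)" by (simp flip: exp_add add: field_simps)
  finally have 1: "1.625 * ((x\<^sup>2 + 1) / 2) \<le> exp (x\<^sup>2 / 2)" .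
  have "2 * \<bar>x\<bar> \<le> x\<^sup>2 + 1" using sum_squares_bound[of "\<bar>x\<bar>" 1] by simp
  then have 2: "1.625 * \<bar>x\<bar> \<le> exp (x\<^sup>2 / 2)" using 1 by simp
  have "sqrt (2.5\<^sup>2) \<le> sqrt (2 * pi)"
    using pi_approx(1) by (intro real_sqrt_le_mono) (simp add: power2_eq_square)
  then have 3: "2.5 \<le> sqrt (2 * pi)" by simp
  have "4 * \<bar>x\<bar> \<le> 2.5 * (1.625 * \<bar>x\<bar>)" by simp
  also have "\<dots> \<le> sqrt (2 * pi) * exp (x\<^sup>2 / 2)" using 2 3 by (intro mult_mono) auto
  finally show ?thesis by (simp add: \<phi>_eq exp_minus field_simps)
qed

lemma \<Phi>_MVT:
  obtains \<xi> where "min s t \<le> \<xi>" "\<xi> \<le> max s t" "\<Phi> s - \<Phi> t = (s - t) * \<phi> \<xi>"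
proof (cases s t rule: linorder_cases)
  case less
  from MVT2[OF less, of \<Phi> \<phi>] DERIV_\<Phi>_at obtain \<xi> where "s < \<xi>" "\<xi> < t" "\<Phi> t - \<Phi> s = (t - s) * \<phi> \<xi>" by blast
  then show ?thesis using that[of \<xi>] less by (simp add: algebra_simps)
next
  case equal
  then show ?thesis using that[of s] by simp
next
  case greater
  from MVT2[OF greater, of \<Phi> \<phi>] DERIV_\<Phi>_at obtain \<xi> where "t < \<xi>" "\<xi> < s" "\<Phi> s - \<Phi> t = (s - t) * \<phi> \<xi>" by blast
  then show ?thesis using that[of \<xi>] greater by simp
qed

lemma \<phi>_Lipschitz: "\<bar>\<phi> s - \<phi> t\<bar> \<le> \<bar>s - t\<bar> / 4"
proof -
  have *: "\<bar>\<phi> t - \<phi> s\<bar> \<le> (t - s) / 4" if "s < t" for s t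
  proof -
    have "(\<phi> has_real_derivative - x * \<phi> x) (at x)" for x
      by (auto intro!: derivative_eq_intros)
    from MVT2[OF that this] obtain \<xi> where "\<phi> t - \<phi> s = (t - s) * (- \<xi> * \<phi> \<xi>)" by blast
    then have "\<bar>\<phi> t - \<phi> s\<bar> = (t - s) * (\<bar>\<xi>\<bar> * \<phi> \<xi>)" using that \<phi>_pos[of \<xi>] by (simp add: abs_mult)
    also have "\<dots> \<le> (t - s) * (1/4)" using abs_times_\<phi>_le[of \<xi>] that by (intro mult_left_mono) auto
    finally show ?thesis by simp
  qed
  show ?thesis using *[of s t] *[of t s] by (cases s t rule: linorder_cases) (auto simp: abs_minus_commute)
qed

text \<open>Made for a random centred shift \<open>m\<close>: in the mean the linear term drops out
  and only the second moment of \<open>m\<close> is left.\<close>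

lemma \<Phi>_Taylor: "\<bar>\<Phi> (y - m) - \<Phi> y + m * \<phi> y\<bar> \<le> m\<^sup>2 / 4"
proof -
  obtain \<xi> where \<xi>: "min (y - m) y \<le> \<xi>" "\<xi> \<le> max (y - m) y" "\<Phi> (y - m) - \<Phi> y = (y - m - y) * \<phi> \<xi>"
    by (rule \<Phi>_MVT)
  have "\<bar>\<Phi> (y - m) - \<Phi> y + m * \<phi> y\<bar> = \<bar>m\<bar> * \<bar>\<phi> y - \<phi> \<xi>\<bar>"
    using \<xi>(3) by (simp add: abs_mult[symmetric] algebra_simps)
  also have "\<dots> \<le> \<bar>m\<bar> * (\<bar>m\<bar> / 4)"
    using \<phi>_Lipschitz[of y \<xi>] \<xi>(1,2) by (intro mult_left_mono) (auto simp: min_def max_def split: if_splits)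
  finally show ?thesis by (simp add: power2_eq_square)
qed

lemma \<Phi>_half: "\<Phi> 0 = 1/2"
  using \<Phi>_minus[of 0] by simp

text \<open>If the ratio is off by at least 3/4, both values lie on the same side of 1/2, and 1/2
  equals 2/3 of 3/4. Otherwise the mean value theorem and \<open>abs_times_\<phi>_le\<close> apply.
  The constant must stay below 3/4 to fit into \<open>error_budget\<close>.\<close>

lemma \<Phi>_scale:
  assumes V: "V > 0" and v: "v > 0"
  shows "\<bar>\<Phi> (x / sqrt V) - \<Phi> (x / sqrt v)\<bar> \<le> 2 / 3 * \<bar>V / v - 1\<bar>"
proof -
  define q where "q = V / v"
  define t where "t = x / sqrt v"
  define s where "s = 1 / sqrt q"
  have q: "q > 0" using V v by (simp add: q_def)
  have ts: "x / sqrt V = t * s" using V v by (simp add: t_def s_def q_def real_sqrt_divide)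
  have s: "s > 0" using q by (simp add: s_def)
  show ?thesis
  proof (cases "\<bar>q - 1\<bar> \<ge> 3/4")
    case True
    have "\<bar>\<Phi> (t * s) - \<Phi> t\<bar> \<le> 1/2"
    proof (cases "t \<ge> 0")
      case True
      then have "\<Phi> 0 \<le> \<Phi> t" "\<Phi> 0 \<le> \<Phi> (t * s)" using s by (auto intro!: \<Phi>_mono)
      then show ?thesis using \<Phi>_le_1[of t] \<Phi>_le_1[of "t * s"] unfolding \<Phi>_half by linarith
    next
      case False
      then have "\<Phi> t \<le> \<Phi> 0" "\<Phi> (t * s) \<le> \<Phi> 0" using s by (auto intro!: \<Phi>_mono simp: mult_nonpos_nonneg)
      then show ?thesis using \<Phi>_nonneg[of t] \<Phi>_nonneg[of "t * s"] unfolding \<Phi>_half by linarith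
    qed
    then show ?thesis using True by (simp add: ts t_def[symmetric] q_def[symmetric])
  next
    case False
    then have q4: "q > 1/4" by linarith
    define p where "p = sqrt q"
    have p: "p\<^sup>2 = q" "p > 0" using q by (auto simp: p_def)
    have "(1/2)\<^sup>2 < p\<^sup>2" using p(1) q4 by (simp add: power2_eq_square)
    then have p2: "p > 1/2" by (rule power_less_imp_less_base) (use p in simp)
    \<comment> \<open>\<open>m\<close> bounds the ratio of \<xi> to \<open>t\<close> from below, so
      that \<open>\<bar>t\<bar> * \<phi> \<xi>\<close> is at most
      \<open>1 / (4 * m)\<close>.\<close>
    define m where "m = min 1 s"
    have m: "m > 0" using s by (simp add: m_def)
    obtain \<xi> where \<xi>: "min (t * s) t \<le> \<xi>" "\<xi> \<le> max (t * s) t" "\<Phi> (t * s) - \<Phi> t = (t * s - t) * \<phi> \<xi>"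
      by (rule \<Phi>_MVT)
    have "\<bar>t\<bar> * m \<le> \<bar>\<xi>\<bar>"
    proof (cases "t \<ge> 0")
      case True
      then have "t * m \<le> min (t * s) t" by (simp add: m_def min_def mult_left_mono mult_left_le)
      then show ?thesis using True \<xi> by linarith
    next
      case False
      then have "max (t * s) t \<le> t * m"
        by (auto simp: m_def min_def max_def mult_le_cancel_left)
      then have "\<xi> \<le> t * m" using \<xi> by linarith
      moreover have "t * m \<le> 0" using False m by (simp add: mult_nonpos_nonneg)
      ultimately show ?thesis using False by (simp add: abs_if)
    qed
    then have "\<bar>t\<bar> * m * \<phi> \<xi> \<le> 1/4"
      using abs_times_\<phi>_le[of \<xi>] mult_right_mono[of "\<bar>t\<bar> * m" "\<bar>\<xi>\<bar>" "\<phi> \<xi>"] \<phi>_pos[of \<xi>] by linarith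
    then have tm: "\<bar>t\<bar> * \<phi> \<xi> \<le> 1 / (4 * m)" using m by (simp add: field_simps)
    have "\<bar>\<Phi> (t * s) - \<Phi> t\<bar> = \<bar>s - 1\<bar> * (\<bar>t\<bar> * \<phi> \<xi>)"
    proof -
      have "t * s - t = (s - 1) * t" by (simp add: algebra_simps)
      then show ?thesis unfolding \<xi>(3) using \<phi>_pos[of \<xi>] by (simp add: abs_mult)
    qed
    also have "\<dots> \<le> \<bar>s - 1\<bar> * (1 / (4 * m))" using tm by (rule mult_left_mono) simp
    also have "\<dots> \<le> 2 / 3 * \<bar>q - 1\<bar>"
    proof (cases "p \<le> 1")
      case True
      then have m1: "m = 1" "s \<ge> 1" using p by (auto simp: m_def s_def p_def[symmetric])
      have "\<bar>s - 1\<bar> * (1 / (4 * m)) = (1 - p) / p / 4" using m1 p by (simp add: s_def p_def[symmetric] field_simps)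
      also have "\<dots> \<le> (1 - p) * 2 / 4"
      proof -
        have "(1 - p) * 1 \<le> (1 - p) * (2 * p)" using p2 True by (intro mult_left_mono) auto
        then have "(1 - p) \<le> (1 - p) * 2 * p" by (simp add: algebra_simps)
        then have "(1 - p) / p \<le> (1 - p) * 2" using p(2) by (subst pos_divide_le_eq)
        then show ?thesis by (rule divide_right_mono) simp
      qed
      also have "\<dots> \<le> 2/3 * ((1 - p) * (1 + p))"
      proof -
        have "(1 - p) * 2 / 4 = (1 - p) * (1/2)" by simp
        also have "\<dots> \<le> (1 - p) * (2/3 * (1 + p))" using True p by (intro mult_left_mono) auto
        also have "\<dots> = 2/3 * ((1 - p) * (1 + p))" by (rule mult.left_commute)
        finally show ?thesis .
      qed
      also have "(1 - p) * (1 + p) = 1 - q" using p(1) by (simp add: power2_eq_square algebra_simps)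
      also have "\<dots> \<le> \<bar>q - 1\<bar>" by simp
      finally show ?thesis by simp
    next
      case False
      then have m1: "m = s" "s \<le> 1" using p by (auto simp: m_def s_def p_def[symmetric])
      have sp: "s = 1 / p" by (simp add: s_def p_def)
      have "\<bar>s - 1\<bar> * (1 / (4 * m)) = (1 - 1 / p) * (1 / (4 * (1 / p)))" using m1 by (simp add: sp)
      also have "\<dots> = (p - 1) / 4" using p(2) by (simp add: field_simps)
      finally have "\<bar>s - 1\<bar> * (1 / (4 * m)) = (p - 1) / 4" .
      also have "\<dots> \<le> 2/3 * ((p - 1) * (p + 1))"
      proof -
        have "(p - 1) * (1/4) \<le> (p - 1) * (2/3 * (p + 1))" using False p by (intro mult_left_mono) auto
        then show ?thesis by (simp add: algebra_simps)
      qed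
      also have "(p - 1) * (p + 1) = q - 1" using p(1) by (simp add: power2_eq_square algebra_simps)
      also have "\<dots> \<le> \<bar>q - 1\<bar>" by simp
      finally show ?thesis by simp
    qed
    finally show ?thesis by (simp add: ts t_def[symmetric] q_def[symmetric])
  qed
qed

section \<open>Third moments and the deletion of four rows\<close>

lemma sum_square_cubed_le:
  fixes f :: "'a \<Rightarrow> real"
  shows "(\<Sum>x\<in>A. (f x)\<^sup>2) ^ 3 \<le> real (card A) * (\<Sum>x\<in>A. \<bar>f x\<bar> ^ 3)\<^sup>2"
proof -
  define a where "a = (\<Sum>x\<in>A. \<bar>f x\<bar>)"
  define q where "q = (\<Sum>x\<in>A. (f x)\<^sup>2)"
  define t where "t = (\<Sum>x\<in>A. \<bar>f x\<bar> ^ 3)"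
  have nn: "0 \<le> a" "0 \<le> q" "0 \<le> t" unfolding a_def q_def t_def by (auto intro: sum_nonneg)
  \<comment> \<open>Cauchy-Schwarz with the square written as power 1/2 times power 3/2. Together
    with \<open>2\<close> this is Hoelder's inequality between the exponents 2 and 3.\<close>
  have 1: "q\<^sup>2 \<le> a * t"
  proof -
    have "(\<Sum>x\<in>A. sqrt \<bar>f x\<bar> * (sqrt \<bar>f x\<bar> * \<bar>f x\<bar>))\<^sup>2 \<le>
        (\<Sum>x\<in>A. (sqrt \<bar>f x\<bar>)\<^sup>2) * (\<Sum>x\<in>A. (sqrt \<bar>f x\<bar> * \<bar>f x\<bar>)\<^sup>2)"
      by (rule Cauchy_Schwarz_ineq_sum)
    moreover have "sqrt \<bar>f x\<bar> * (sqrt \<bar>f x\<bar> * \<bar>f x\<bar>) = (f x)\<^sup>2" for x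
    proof -
      have "sqrt \<bar>f x\<bar> * sqrt \<bar>f x\<bar> = \<bar>f x\<bar>" by simp
      then show ?thesis by (simp only: mult.assoc[symmetric] power2_eq_square abs_mult_self_eq)
    qed
    moreover have "(sqrt \<bar>f x\<bar> * \<bar>f x\<bar>)\<^sup>2 = \<bar>f x\<bar> ^ 3" for x
      by (simp add: power_mult_distrib) (simp add: power2_eq_square power3_eq_cube)
    ultimately show ?thesis by (simp add: a_def q_def t_def)
  qed
  have 2: "a\<^sup>2 \<le> real (card A) * q"
    using sum_square_le[of "\<lambda>x. \<bar>f x\<bar>" A] by (simp add: a_def q_def)
  have "q * q ^ 3 = (q\<^sup>2)\<^sup>2" by (simp add: power_even_eq flip: power_Suc)
  also have "\<dots> \<le> (a * t)\<^sup>2" using 1 nn by (intro power_mono) auto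
  also have "\<dots> = a\<^sup>2 * t\<^sup>2" by (rule power_mult_distrib)
  also have "\<dots> \<le> (real (card A) * q) * t\<^sup>2" using 2 by (intro mult_right_mono) auto
  finally have "q * q ^ 3 \<le> q * (real (card A) * t\<^sup>2)" by (simp add: ac_simps)
  then have "q > 0 \<Longrightarrow> q ^ 3 \<le> real (card A) * t\<^sup>2" by simp
  then show ?thesis using nn by (cases "q = 0") (auto simp: q_def[symmetric] t_def[symmetric])
qed

lemma dpow_2_cubed_le:
  "dpow I b 2 ^ 3 \<le> (real (card I))\<^sup>2 * (dpow I b 3)\<^sup>2"
proof -
  have "(\<Sum>x\<in>I\<times>I. (b (fst x) - b (snd x))\<^sup>2) ^ 3 \<le>
      real (card (I \<times> I)) * (\<Sum>x\<in>I\<times>I. \<bar>b (fst x) - b (snd x)\<bar> ^ 3)\<^sup>2"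
    by (rule sum_square_cubed_le)
  then show ?thesis
    by (simp add: dpow_def sum.cartesian_product split_def card_cartesian_product power2_eq_square)
qed

lemma dpow_permute:
  assumes "p permutes I" shows "dpow I (\<lambda>i. c (p i)) k = dpow I c k"
proof -
  have "(\<Sum>i\<in>I. \<Sum>j\<in>I. \<bar>c (p i) - c (p j)\<bar> ^ k) = (\<Sum>i\<in>I. \<Sum>j\<in>I. \<bar>c (p i) - c j\<bar> ^ k)"
  proof (rule sum.cong[OF refl])
    fix i
    show "(\<Sum>j\<in>I. \<bar>c (p i) - c (p j)\<bar> ^ k) = (\<Sum>j\<in>I. \<bar>c (p i) - c j\<bar> ^ k)"
      using sum.permute[OF assms, of "\<lambda>j. \<bar>c (p i) - c j\<bar> ^ k"] by (simp add: comp_def)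
  qed
  also have "\<dots> = (\<Sum>i\<in>I. \<Sum>j\<in>I. \<bar>c i - c j\<bar> ^ k)"
    using sum.permute[OF assms, of "\<lambda>i. \<Sum>j\<in>I. \<bar>c i - c j\<bar> ^ k"] by (simp add: comp_def)
  finally show ?thesis by (simp add: dpow_def)
qed

lemma dpow_subset_le:
  assumes "finite I" "J \<subseteq> I" shows "dpow J b k \<le> dpow I b k"
proof -
  have "dpow J b k \<le> (\<Sum>i\<in>J. \<Sum>j\<in>I. \<bar>b i - b j\<bar> ^ k)"
    unfolding dpow_def using assms by (intro sum_mono sum_mono2) auto
  also have "\<dots> \<le> dpow I b k"
    unfolding dpow_def using assms by (intro sum_mono2) (auto intro: sum_nonneg)
  finally show ?thesis .
qed

text \<open>The numerical assumption makes every single row negligible, so that deleting four rows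
  keeps at least half of the spread.\<close>

lemma dpow_row_small:
  assumes fin: "finite I" and n: "card I \<ge> 2" and a: "a \<in> I"
    and K: "dpow I b 2 * dpow I c 2 = 4 * (real (card I))\<^sup>2 * (real (card I) - 1)"
    and G: "dpow I b 3 * dpow I c 3 = 4 * (real (card I))\<^sup>2 * (real (card I) - 1) * \<Gamma>"
    and \<Gamma>: "0 \<le> \<Gamma>" "\<Gamma> < 1 / 512"
  shows "(\<Sum>m\<in>I. (b a - b m)\<^sup>2) \<le> dpow I b 2 / 16"
proof (rule ccontr)
  assume neg: "\<not> ?thesis"
  define n' where "n' = real (card I)"
  have n': "n' \<ge> 2" using n by (simp add: n'_def)
  define k where "k = 4 * n'\<^sup>2 * (n' - 1)"
  have k: "k > 0" using n' by (simp add: k_def)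
  define \<beta> where "\<beta> = (\<Sum>m\<in>I. (b a - b m)\<^sup>2)"
  have nn: "0 \<le> dpow I b 3" "0 \<le> dpow I c 3" "0 \<le> dpow I c 2" "0 \<le> dpow I b 2" by (auto intro: dpow_nonneg)
  have "\<beta> ^ 3 \<le> n' * (\<Sum>m\<in>I. \<bar>b a - b m\<bar> ^ 3)\<^sup>2"
    unfolding \<beta>_def n'_def by (rule sum_square_cubed_le)
  also have "\<dots> \<le> n' * (dpow I b 3)\<^sup>2"
  proof (intro mult_left_mono power_mono)
    show "(\<Sum>m\<in>I. \<bar>b a - b m\<bar> ^ 3) \<le> dpow I b 3"
      unfolding dpow_def using fin a by (intro member_le_sum[of a I "\<lambda>i. \<Sum>j\<in>I. \<bar>b i - b j\<bar> ^ 3"]) (auto intro: sum_nonneg)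
  qed (use n' in \<open>auto intro: sum_nonneg\<close>)
  finally have 1: "\<beta> ^ 3 \<le> n' * (dpow I b 3)\<^sup>2" .
  have \<beta>0: "\<beta> \<ge> 0" unfolding \<beta>_def by (intro sum_nonneg) auto
  \<comment> \<open>One row has \<open>n'\<close> entries, the full matrix of differences
    \<open>n'\<close> squared. The factor \<open>n'\<close> saved in \<open>1\<close> is decisive:
    multiplied with the cubic estimate for \<open>c\<close> it leaves
    \<open>256 * (n' - 1) \<le> n'\<close>.\<close>
  have "(k / 16) ^ 3 = (dpow I b 2 / 16 * dpow I c 2) ^ 3" using K by (simp add: k_def n'_def)
  also have "\<dots> \<le> (\<beta> * dpow I c 2) ^ 3"
    using neg nn by (intro power_mono mult_right_mono) (auto simp: \<beta>_def)
  also have "\<dots> = \<beta> ^ 3 * dpow I c 2 ^ 3" by (rule power_mult_distrib)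
  also have "\<dots> \<le> (n' * (dpow I b 3)\<^sup>2) * (n'\<^sup>2 * (dpow I c 3)\<^sup>2)"
    using 1 dpow_2_cubed_le[of I c] \<beta>0 nn n' by (intro mult_mono) (auto simp: n'_def)
  also have "\<dots> = n' ^ 3 * (dpow I b 3 * dpow I c 3)\<^sup>2" by (simp add: power2_eq_square power3_eq_cube)
  also have "\<dots> = k\<^sup>2 * (n' ^ 3 * \<Gamma>\<^sup>2)" unfolding G by (simp add: k_def n'_def power_mult_distrib)
  finally have "k\<^sup>2 * (k / 4096) \<le> k\<^sup>2 * (n' ^ 3 * \<Gamma>\<^sup>2)" by (simp add: power2_eq_square power3_eq_cube)
  then have "k / 4096 \<le> n' ^ 3 * \<Gamma>\<^sup>2" using k by simp
  also have "\<dots> \<le> n' ^ 3 * (1/512)\<^sup>2" using \<Gamma> n' by (intro mult_left_mono power_mono) auto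
  finally have "k / 4096 * 2 ^ 18 \<le> n' ^ 3" by (simp add: power2_eq_square)
  moreover have "k / 4096 * 2 ^ 18 = n'\<^sup>2 * (256 * (n' - 1))" by (simp add: k_def)
  moreover have "n' ^ 3 = n'\<^sup>2 * n'" by (simp add: power2_eq_square power3_eq_cube)
  ultimately have "n'\<^sup>2 * (256 * (n' - 1)) \<le> n'\<^sup>2 * n'" by simp
  then have "256 * (n' - 1) \<le> n'" using n' by simp
  then show False using n' by simp
qed

lemma dpow_delete:
  assumes fin: "finite I" and A: "A \<subseteq> I"
  shows "dpow I b 2 \<le> dpow (I - A) b 2 + 2 * (\<Sum>a\<in>A. \<Sum>m\<in>I. (b a - b m)\<^sup>2)"
proof -
  let ?J = "I - A"
  have s: "(\<Sum>i\<in>I. f i) = (\<Sum>i\<in>?J. f i) + (\<Sum>i\<in>A. f i)" for f :: "'a \<Rightarrow> real"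
    using sum.subset_diff[OF A fin, of f] by simp
  have "dpow I b 2 = (\<Sum>i\<in>?J. \<Sum>m\<in>I. (b i - b m)\<^sup>2) + (\<Sum>a\<in>A. \<Sum>m\<in>I. (b a - b m)\<^sup>2)"
    by (simp add: dpow_def s[of "\<lambda>i. \<Sum>m\<in>I. (b i - b m)\<^sup>2"])
  also have "(\<Sum>i\<in>?J. \<Sum>m\<in>I. (b i - b m)\<^sup>2) = dpow ?J b 2 + (\<Sum>i\<in>?J. \<Sum>a\<in>A. (b i - b a)\<^sup>2)"
    by (simp add: dpow_def s sum.distrib)
  also have "(\<Sum>i\<in>?J. \<Sum>a\<in>A. (b i - b a)\<^sup>2) \<le> (\<Sum>i\<in>I. \<Sum>a\<in>A. (b i - b a)\<^sup>2)"
    using fin by (intro sum_mono2) (auto intro: sum_nonneg)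
  also have "\<dots> = (\<Sum>a\<in>A. \<Sum>m\<in>I. (b a - b m)\<^sup>2)"
    by (subst sum.swap) (simp add: power2_commute)
  finally show ?thesis by simp
qed

text \<open>Four rows at 1/16 each, counted in both orders of the pair, remove at most one
  half.\<close>

lemma dpow_delete_ge:
  assumes fin: "finite I" and A: "A \<subseteq> I" "card A \<le> 4"
    and row: "\<And>a. a \<in> A \<Longrightarrow> (\<Sum>m\<in>I. (b a - b m)\<^sup>2) \<le> dpow I b 2 / 16"
  shows "dpow (I - A) b 2 \<ge> dpow I b 2 / 2"
proof -
  have "(\<Sum>a\<in>A. \<Sum>m\<in>I. (b a - b m)\<^sup>2) \<le> (\<Sum>a\<in>A. dpow I b 2 / 16)" by (rule sum_mono) (rule row)
  also have "\<dots> \<le> 4 * (dpow I b 2 / 16)" using A(2) dpow_nonneg[of I b 2] by (simp only: sum_constant) (intro mult_right_mono, auto)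
  finally show ?thesis using dpow_delete[OF fin A(1), of b] by simp
qed

lemma stat_comp_stabiliser:
  assumes "finite I" "A \<subseteq> I" "s permutes (I - A)"
  shows "stat I b c (p \<circ> s) = stat (I - A) b (\<lambda>i. c (p i)) s + (\<Sum>a\<in>A. b a * c (p a))"
proof -
  have "(\<Sum>a\<in>A. b a * c (p (s a))) = (\<Sum>a\<in>A. b a * c (p a))"
    by (intro sum.cong refl) (use assms(3) in \<open>auto simp: permutes_def\<close>)
  then show ?thesis
    unfolding stat_def using sum.subset_diff[OF assms(2,1), of "\<lambda>i. b i * c ((p \<circ> s) i)"] by simp
qed

text \<open>By Hoelder's inequality a statistic of variance 1 has third moment at least of order
  \<open>1 / sqrt (card I)\<close>. Hence a small \<Gamma> makes \<open>card I\<close> large without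
  a separate hypothesis.\<close>

lemma card_ge_of_third_small:
  assumes n: "card I \<ge> 2"
    and K: "dpow I b 2 * dpow I c 2 = 4 * (real (card I))\<^sup>2 * (real (card I) - 1)"
    and G: "dpow I b 3 * dpow I c 3 = 4 * (real (card I))\<^sup>2 * (real (card I) - 1) * \<Gamma>"
  shows "2 \<le> real (card I) * \<Gamma>\<^sup>2"
proof -
  define n' where "n' = real (card I)"
  have n': "n' \<ge> 2" using n by (simp add: n'_def)
  define k where "k = 4 * n'\<^sup>2 * (n' - 1)"
  have k: "k > 0" using n' by (simp add: k_def)
  have "k ^ 3 = dpow I b 2 ^ 3 * dpow I c 2 ^ 3" using K by (simp add: k_def n'_def flip: power_mult_distrib)
  also have "\<dots> \<le> (n'\<^sup>2 * (dpow I b 3)\<^sup>2) * (n'\<^sup>2 * (dpow I c 3)\<^sup>2)"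
    unfolding n'_def using dpow_nonneg by (intro mult_mono dpow_2_cubed_le) auto
  also have "\<dots> = n' ^ 4 * (dpow I b 3 * dpow I c 3)\<^sup>2" by (simp add: power2_eq_square power4_eq_xxxx)
  also have "\<dots> = k\<^sup>2 * (n' ^ 4 * \<Gamma>\<^sup>2)" unfolding G by (simp add: k_def n'_def power_mult_distrib)
  finally have "k\<^sup>2 * k \<le> k\<^sup>2 * (n' ^ 4 * \<Gamma>\<^sup>2)" by (simp add: power2_eq_square power3_eq_cube)
  then have "k \<le> n' ^ 4 * \<Gamma>\<^sup>2" using k by simp
  then have "n'\<^sup>2 * (4 * (n' - 1)) \<le> n'\<^sup>2 * (n' * (n' * \<Gamma>\<^sup>2))"
    by (simp add: k_def power2_eq_square power4_eq_xxxx ac_simps)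
  then have "4 * (n' - 1) \<le> n' * (n' * \<Gamma>\<^sup>2)" using n' by simp
  moreover have "n' * 2 \<le> 4 * (n' - 1)" using n' by simp
  ultimately have "n' * 2 \<le> n' * (n' * \<Gamma>\<^sup>2)" by linarith
  then show ?thesis using n' by (simp add: n'_def)
qed

text \<open>Given the values of \<open>p\<close> on \<open>A\<close>, the statistic is a constant
  plus a linear statistic over the other rows. Each of the two spreads keeps one half, so the
  variance is at least 1/4, while the third moment at most doubles. The perturbation is the constant
  \<open>r\<close>, whose Dirichlet form vanishes. The constants are 2 r / (1/2) and 4 * 2 \<Gamma>
  / (1/8).\<close>

lemma stat_concentration_stabiliser:
  assumes fin: "finite I" and n: "card I \<ge> 1000" and A: "A \<subseteq> I" "card A = 4" and p: "p permutes I"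
    and K: "dpow I b 2 * dpow I c 2 = 4 * (real (card I))\<^sup>2 * (real (card I) - 1)"
    and G: "dpow I b 3 * dpow I c 3 = 4 * (real (card I))\<^sup>2 * (real (card I) - 1) * \<Gamma>"
    and \<Gamma>: "0 \<le> \<Gamma>" "\<Gamma> < 1 / 512" and r: "0 \<le> r"
  shows "pavg (I - A) (\<lambda>s. of_bool (\<bar>stat I b c (p \<circ> s) - w\<bar> \<le> r)) \<le> 4 * r + 64 * \<Gamma>"
proof -
  let ?J = "I - A" and ?c = "\<lambda>i. c (p i)"
  have fJ: "finite ?J" using fin by simp
  have fA: "finite A" using fin A finite_subset by blast
  have cJ: "card ?J = card I - 4" using A fA by (simp add: card_Diff_subset)
  define n0 where "n0 = real (card I)"
  have n0: "n0 \<ge> 1000" using n by (simp add: n0_def)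
  have rJ: "real (card ?J) = n0 - 4" using cJ n by (simp add: n0_def of_nat_diff)
  define k where "k = 4 * n0\<^sup>2 * (n0 - 1)"
  define k' where "k' = 4 * (n0 - 4)\<^sup>2 * (n0 - 4 - 1)"
  have k': "k' > 0" using n0 by (simp add: k'_def)
  have kk: "k' \<le> k" unfolding k_def k'_def using n0 by (intro mult_mono power_mono) auto
  \<comment> \<open>The normalising denominators for n and n - 4 rows differ by a factor below 1.331
    once n is at least 1000.\<close>
  have kk2: "k \<le> 2 * k'"
  proof -
    have "n0\<^sup>2 * (n0 - 1) \<le> (1.1 * (n0 - 4))\<^sup>2 * (1.1 * (n0 - 5))"
      using n0 by (intro mult_mono power_mono) auto
    also have "\<dots> = 1.331 * ((n0 - 4)\<^sup>2 * (n0 - 5))"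
      unfolding power_mult_distrib by (simp add: power2_eq_square[of "1.1"] del: right_diff_distrib_numeral)
    also have "\<dots> \<le> 2 * ((n0 - 4)\<^sup>2 * (n0 - 5))"
      using n0 by (intro mult_right_mono) auto
    finally have "4 * (n0\<^sup>2 * (n0 - 1)) \<le> 4 * (2 * ((n0 - 4)\<^sup>2 * (n0 - 5)))"
      by (rule mult_left_mono) simp
    moreover have "n0 - 4 - 1 = n0 - 5" by simp
    ultimately show ?thesis unfolding k_def k'_def by (simp only: mult.assoc mult.left_commute[of 2 4])
  qed
  have G': "dpow I c 3 * dpow I b 3 = 4 * (real (card I))\<^sup>2 * (real (card I) - 1) * \<Gamma>"
    and K': "dpow I c 2 * dpow I b 2 = 4 * (real (card I))\<^sup>2 * (real (card I) - 1)"
    using G K by (simp_all add: mult.commute)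
  have n2: "card I \<ge> 2" using n by simp
  have b2: "dpow ?J b 2 \<ge> dpow I b 2 / 2"
    using A by (intro dpow_delete_ge fin dpow_row_small[OF fin n2 _ K G \<Gamma>]) auto
  have "(\<Sum>m\<in>I. (?c a - ?c m)\<^sup>2) \<le> dpow I ?c 2 / 16" if "a \<in> A" for a
  proof -
    have "p a \<in> I" using that A(1) permutes_in_image[OF p] by auto
    from dpow_row_small[OF fin n2 this K' G' \<Gamma>]
    show ?thesis using sum.permute[OF p, of "\<lambda>m. (c (p a) - c m)\<^sup>2"]
      by (simp add: comp_def dpow_permute[OF p])
  qed
  then have c2: "dpow ?J ?c 2 \<ge> dpow I c 2 / 2"
    using dpow_delete_ge[OF fin A(1), of ?c] A by (simp add: dpow_permute[OF p])
  have c3: "dpow ?J ?c 3 \<le> dpow I c 3"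
    using dpow_subset_le[OF fin, of ?J ?c 3] by (simp add: dpow_permute[OF p])
  have b3: "dpow ?J b 3 \<le> dpow I b 3"
    using dpow_subset_le[OF fin, of ?J b 3] by simp
  define v where "v = stat_var ?J b ?c"
  define \<Gamma>' where "\<Gamma>' = stat_third ?J b ?c"
  have v': "v = dpow ?J b 2 * dpow ?J ?c 2 / k'"
    and \<Gamma>'': "\<Gamma>' = dpow ?J b 3 * dpow ?J ?c 3 / k'"
    by (simp_all only: v_def \<Gamma>'_def stat_var_def stat_third_def rJ k'_def)
  have "k / 4 = (dpow I b 2 / 2) * (dpow I c 2 / 2)" using K by (simp add: k_def n0_def)
  also have "\<dots> \<le> dpow ?J b 2 * dpow ?J ?c 2"
    using b2 c2 dpow_nonneg by (intro mult_mono) auto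
  also have "\<dots> = k' * v" using k' by (simp add: v')
  finally have "k' * (1/4) \<le> k' * v" using kk by simp
  then have v: "v \<ge> 1/4" using k' by simp
  have "k' * \<Gamma>' = dpow ?J b 3 * dpow ?J ?c 3" using k' by (simp add: \<Gamma>'')
  also have "\<dots> \<le> dpow I b 3 * dpow I c 3" using b3 c3 dpow_nonneg by (intro mult_mono) auto
  also have "\<dots> = k * \<Gamma>" using G by (simp add: k_def n0_def)
  also have "\<dots> \<le> k' * (2 * \<Gamma>)" using mult_right_mono[OF kk2 \<Gamma>(1)] by simp
  finally have G2: "\<Gamma>' \<le> 2 * \<Gamma>" using k' by simp
  have "sqrt ((1/2)\<^sup>2) \<le> sqrt v" using v by (intro real_sqrt_le_mono) (simp add: power2_eq_square)
  then have sv: "1/2 \<le> sqrt v" by simp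
  define w' where "w' = w - (\<Sum>a\<in>A. b a * c (p a))"
  have "pavg ?J (\<lambda>s. of_bool (\<bar>stat I b c (p \<circ> s) - w\<bar> \<le> r)) =
      pavg ?J (\<lambda>s. of_bool (\<bar>stat ?J b ?c s - w'\<bar> \<le> \<bar>r\<bar>))"
    using r by (intro pavg_cong) (simp add: stat_comp_stabiliser[OF fin A(1)] w'_def algebra_simps)
  also have "\<dots> \<le> 2 * (sqrt (pavg ?J (\<lambda>s. r\<^sup>2)) + sqrt (dirichlet ?J (\<lambda>s. r))) / sqrt v + 4 * \<Gamma>' / sqrt v ^ 3"
    unfolding v_def \<Gamma>'_def
    by (rule stat_concentration[OF fJ]) (use n v in \<open>auto simp: cJ v_def\<close>)
  also have "\<dots> = 2 * r / sqrt v + 4 * \<Gamma>' / sqrt v ^ 3"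
    using r fJ by (simp add: pavg_const dirichlet_def)
  also have "2 * r / sqrt v \<le> 2 * r / (1/2)"
    using r sv v by (intro divide_left_mono) auto
  also have "4 * \<Gamma>' / sqrt v ^ 3 \<le> 4 * (2 * \<Gamma>) / (1/2) ^ 3"
    using sv G2 \<Gamma>(1) by (intro frac_le power_mono) auto
  finally show ?thesis by (simp add: power3_eq_cube)
qed

section \<open>Stein's method for a linear permutation statistic\<close>

lemma square_times_le_cubes:
  assumes "0 \<le> (x::real)" "0 \<le> y" shows "x\<^sup>2 * y \<le> x ^ 3 + y ^ 3"
proof (cases "y \<le> x")
  case True
  then have "x\<^sup>2 * y \<le> x\<^sup>2 * x" by (intro mult_left_mono) auto
  also have "\<dots> = x ^ 3" by (simp add: power2_eq_square power3_eq_cube)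
  finally show ?thesis using assms(2) zero_le_power[of y 3] by linarith
next
  case False
  then have "x\<^sup>2 * y \<le> y\<^sup>2 * y" using assms by (intro mult_right_mono power_mono) auto
  also have "\<dots> = y ^ 3" by (simp add: power2_eq_square power3_eq_cube)
  finally show ?thesis using assms(1) zero_le_power[of x 3] by linarith
qed

lemma swap_four:
  assumes "distinct [i, j, k, l]"
  defines "\<tau> \<equiv> swap i k \<circ> swap j l"
  shows "\<tau> i = k" "\<tau> j = l" "\<tau> k = i" "\<tau> l = j"
  using assms by (auto simp: Transposition.transpose_def)

text \<open>One swap step of Stein's method, compared with \<open>f'(T)\<close>.  Conjugating by the double
  transposition moves the rows \<open>i, j\<close> onto the values at \<open>k, l\<close>; all the quantities other than
  \<open>T\<close> are then measurable with respect to the four rows \<open>i, j, k, l\<close>.\<close>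

lemma stein_swap_term:
  fixes b c :: "'a \<Rightarrow> real" and \<mu> :: real
  assumes fin: "finite I" and n: "card I \<ge> 1000"
    and ijkl: "i \<in> I" "j \<in> I" "k \<in> I" "l \<in> I" "distinct [i, j, k, l]"
    and K: "dpow I b 2 * dpow I c 2 = 4 * (real (card I))\<^sup>2 * (real (card I) - 1)"
    and G: "dpow I b 3 * dpow I c 3 = 4 * (real (card I))\<^sup>2 * (real (card I) - 1) * \<Gamma>"
    and \<Gamma>: "0 \<le> \<Gamma>" "\<Gamma> < 1 / 512"
  defines "W \<equiv> dpow I c 2 / (real (card I) * (real (card I) - 1))"
    and "Y \<equiv> dpow I c 3 / (real (card I) * (real (card I) - 1))"
    and "T \<equiv> \<lambda>p. stat I b c p - \<mu>"
  shows "\<bar>pavg I (\<lambda>p. (b i - b j) * (c (p i) - c (p j)) * (stein z (T p) - stein z (T (p \<circ> swap i j))))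
      - pavg I (\<lambda>p. ((b i - b j) * (c (p k) - c (p l)))\<^sup>2 * stein' z (T p))\<bar> \<le>
    12 * Y * (5 * \<bar>b i - b j\<bar> ^ 3 + 2 * \<bar>b i - b k\<bar> ^ 3 + 2 * \<bar>b j - b l\<bar> ^ 3)
      + 192 * \<Gamma> * W * (b i - b j)\<^sup>2"
proof -
  define \<tau> where "\<tau> = swap i k \<circ> swap j l"
  have \<tau>: "\<tau> permutes I" unfolding \<tau>_def using ijkl by (intro permutes_compose permutes_swap_id)
  have \<tau>v: "\<tau> i = k" "\<tau> j = l" using swap_four[OF ijkl(5)] by (simp_all add: \<tau>_def)
  define D where "D p = (b i - b j) * (c (p k) - c (p l))" for p
  \<comment> \<open>\<open>r\<close> bounds the displacement of \<open>T\<close> under both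
    permutations that occur: one summand for each of the three swaps. Like \<open>D\<close> it
    depends only on the values of \<open>p\<close> at \<open>i\<close>, \<open>j\<close>,
    \<open>k\<close>, \<open>l\<close>.\<close>
  define r where "r p = \<bar>(b i - b k) * (c (p i) - c (p k))\<bar> + \<bar>(b j - b l) * (c (p j) - c (p l))\<bar> + \<bar>D p\<bar>" for p
  define M where "M p = stein_g z (T p + r p) - stein_g z (T p - r p) + of_bool (\<bar>T p - z\<bar> \<le> r p)" for p
  have eq: "pavg I (\<lambda>p. (b i - b j) * (c (p i) - c (p j)) * (stein z (T p) - stein z (T (p \<circ> swap i j)))) =
     pavg I (\<lambda>p. D p * (stein z (T (p \<circ> \<tau>)) - stein z (T (p \<circ> \<tau> \<circ> swap i j))))"
    using pavg_comp_right[OF \<tau>, of "\<lambda>p. (b i - b j) * (c (p i) - c (p j)) * (stein z (T p) - stein z (T (p \<circ> swap i j)))"]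
    by (simp add: \<tau>v D_def)
  have step: "\<bar>D p * (stein z (T (p \<circ> \<tau>)) - stein z (T (p \<circ> \<tau> \<circ> swap i j))) - (D p)\<^sup>2 * stein' z (T p)\<bar>
      \<le> (D p)\<^sup>2 * M p" for p
  proof -
    define u where "u = T (p \<circ> \<tau>) - T p"
    define v where "v = T (p \<circ> \<tau> \<circ> swap i j) - T p"
    have 1: "T p - T (p \<circ> swap i k) = (b i - b k) * (c (p i) - c (p k))"
      using stat_swap[OF fin ijkl(1) ijkl(3), of b c p] by (simp add: T_def)
    have 2: "T (p \<circ> swap i k) - T (p \<circ> \<tau>) = (b j - b l) * (c (p j) - c (p l))"
      using stat_swap[OF fin ijkl(2) ijkl(4), of b c "p \<circ> swap i k"] ijkl(5)
      by (simp add: T_def \<tau>_def comp_assoc) (auto simp: Transposition.transpose_def)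
    have 3: "T (p \<circ> \<tau>) - T (p \<circ> \<tau> \<circ> swap i j) = D p"
      using stat_swap[OF fin ijkl(1) ijkl(2), of b c "p \<circ> \<tau>"] by (simp add: T_def D_def \<tau>v)
    have uv: "u - v = D p" using 3 by (simp add: u_def v_def)
    have "\<bar>u\<bar> \<le> \<bar>(b i - b k) * (c (p i) - c (p k))\<bar> + \<bar>(b j - b l) * (c (p j) - c (p l))\<bar>"
      using 1 2 unfolding u_def by linarith
    then have "\<bar>u\<bar> \<le> r p" "\<bar>v\<bar> \<le> r p" using uv unfolding r_def by linarith+
    from stein_increment[OF this, of z "T p"]
    have "\<bar>stein z (T (p \<circ> \<tau>)) - stein z (T (p \<circ> \<tau> \<circ> swap i j)) - D p * stein' z (T p)\<bar> \<le> \<bar>D p\<bar> * M p"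
      by (simp only: uv M_def) (simp add: u_def v_def)
    from mult_left_mono[OF this, of "\<bar>D p\<bar>"]
    show ?thesis by (simp add: abs_mult[symmetric] power2_eq_square right_diff_distrib mult.assoc)
  qed
  have "\<bar>pavg I (\<lambda>p. D p * (stein z (T (p \<circ> \<tau>)) - stein z (T (p \<circ> \<tau> \<circ> swap i j)))) -
     pavg I (\<lambda>p. (D p)\<^sup>2 * stein' z (T p))\<bar> \<le> pavg I (\<lambda>p. (D p)\<^sup>2 * M p)"
    unfolding pavg_diff[symmetric]
    by (rule order_trans[OF pavg_abs pavg_mono]) (rule step)
  \<comment> \<open>With the four values frozen, concentration bounds the probability of the jump by
    \<open>N\<close> and, through \<open>sum_mono_increment_le\<close>, the mean increment of
    \<open>stein_g\<close> by \<open>2 * N\<close>. The sum \<open>3 * N\<close> is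
    \<open>12 * r p + 192 * \<Gamma>\<close>.\<close>
  also have "pavg I (\<lambda>p. (D p)\<^sup>2 * M p) \<le> pavg I (\<lambda>p. (D p)\<^sup>2 * (12 * r p + 192 * \<Gamma>))"
  proof -
    define A where "A = {i, j, k, l}"
    let ?J = "I - A"
    have A: "A \<subseteq> I" "card A = 4" using ijkl by (auto simp: A_def)
    have fJ: "finite ?J" using fin by simp
    have "pavg I (\<lambda>p. (D p)\<^sup>2 * M p) = pavg I (\<lambda>p. pavg ?J (\<lambda>s. (D (p \<circ> s))\<^sup>2 * M (p \<circ> s)))"
      using pavg_pavg_subset[OF fin, of ?J "\<lambda>p. (D p)\<^sup>2 * M p"] by simp
    also have "\<dots> \<le> pavg I (\<lambda>p. (D p)\<^sup>2 * (12 * r p + 192 * \<Gamma>))"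
    proof (rule pavg_mono)
      fix p assume p: "p permutes I"
      have r0: "0 \<le> r p" by (simp add: r_def)
      define t where "t s = T (p \<circ> s)" for s
      define N where "N = 4 * r p + 64 * \<Gamma>"
      have inv: "D (p \<circ> s) = D p \<and> r (p \<circ> s) = r p" if "s permutes ?J" for s
      proof -
        have "s i = i" "s j = j" "s k = k" "s l = l" using that by (auto simp: permutes_def A_def)
        then show ?thesis by (simp add: D_def r_def)
      qed
      have cc: "pavg ?J (\<lambda>s. of_bool (\<bar>t s - w\<bar> \<le> r p)) \<le> N" for w
      proof -
        have "pavg ?J (\<lambda>s. of_bool (\<bar>t s - w\<bar> \<le> r p)) = pavg ?J (\<lambda>s. of_bool (\<bar>stat I b c (p \<circ> s) - (w + \<mu>)\<bar> \<le> r p))"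
          by (rule pavg_cong) (simp add: t_def T_def algebra_simps)
        also have "\<dots> \<le> N" unfolding N_def
          by (rule stat_concentration_stabiliser[OF fin n A p K G \<Gamma> r0])
        finally show ?thesis .
      qed
      have "(\<Sum>s | s permutes ?J. stein_g z (t s + r p) - stein_g z (t s - r p)) \<le> 2 * (N * fact (card ?J))"
      proof (rule sum_mono_increment_le)
        show "finite {s. s permutes ?J}" using fJ by (rule finite_permutations)
        show "(\<Sum>s | s permutes ?J. of_bool (\<bar>t s - w\<bar> \<le> r p)) \<le> N * fact (card ?J)" for w
          using cc[of w] by (simp add: pavg_def divide_le_eq)
      qed (use stein_g_mono stein_g_abs_le_1 r0 in auto)
      then have g: "pavg ?J (\<lambda>s. stein_g z (t s + r p) - stein_g z (t s - r p)) \<le> 2 * N"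
        by (simp add: pavg_def divide_le_eq)
      have "pavg ?J (\<lambda>s. (D (p \<circ> s))\<^sup>2 * M (p \<circ> s)) =
         pavg ?J (\<lambda>s. (D p)\<^sup>2 * ((stein_g z (t s + r p) - stein_g z (t s - r p)) + of_bool (\<bar>t s - z\<bar> \<le> r p)))"
        by (rule pavg_cong) (simp add: inv M_def t_def)
      also have "\<dots> = (D p)\<^sup>2 * (pavg ?J (\<lambda>s. stein_g z (t s + r p) - stein_g z (t s - r p)) + pavg ?J (\<lambda>s. of_bool (\<bar>t s - z\<bar> \<le> r p)))"
        by (simp only: pavg_cmult pavg_add)
      also have "\<dots> \<le> (D p)\<^sup>2 * (2 * N + N)"
        by (intro mult_left_mono add_mono g cc) simp
      finally show "pavg ?J (\<lambda>s. (D (p \<circ> s))\<^sup>2 * M (p \<circ> s)) \<le> (D p)\<^sup>2 * (12 * r p + 192 * \<Gamma>)"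
        by (simp add: N_def)
    qed
    finally show ?thesis .
  qed
  also have "\<dots> \<le> 12 * Y * (5 * \<bar>b i - b j\<bar> ^ 3 + 2 * \<bar>b i - b k\<bar> ^ 3 + 2 * \<bar>b j - b l\<bar> ^ 3)
      + 192 * \<Gamma> * W * (b i - b j)\<^sup>2"
  proof -
    define \<beta> where "\<beta> x y = \<bar>b x - b y\<bar>" for x y
    define \<gamma> where "\<gamma> p x y = \<bar>c (p x) - c (p y)\<bar>" for p :: "'a \<Rightarrow> 'a" and x y
    have nn: "0 \<le> \<beta> x y" "0 \<le> \<gamma> p x y" for x y and p :: "'a \<Rightarrow> 'a" by (simp_all add: \<beta>_def \<gamma>_def)
    \<comment> \<open>Mixed products of differences are dominated by pure cubes, separately in
      \<open>b\<close> and in \<open>c\<close>, because only the averages of pure powers over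
      \<open>p\<close> are known exactly.\<close>
    have pw: "(D p)\<^sup>2 * (12 * r p + 192 * \<Gamma>) \<le>
       12 * ((\<beta> i j ^ 3 + \<beta> i k ^ 3) * (\<gamma> p k l ^ 3 + \<gamma> p i k ^ 3) +
        (\<beta> i j ^ 3 + \<beta> j l ^ 3) * (\<gamma> p k l ^ 3 + \<gamma> p j l ^ 3) + \<beta> i j ^ 3 * \<gamma> p k l ^ 3) +
       192 * \<Gamma> * \<beta> i j ^ 2 * \<gamma> p k l ^ 2" for p
    proof -
      have D2: "(D p)\<^sup>2 = \<beta> i j ^ 2 * \<gamma> p k l ^ 2" by (simp add: D_def \<beta>_def \<gamma>_def power_mult_distrib)
      have t: "(\<beta> i j ^ 2 * \<gamma> p k l ^ 2) * (\<beta> x y * \<gamma> p x y) \<le> (\<beta> i j ^ 3 + \<beta> x y ^ 3) * (\<gamma> p k l ^ 3 + \<gamma> p x y ^ 3)" for x y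
      proof -
        have "(\<beta> i j ^ 2 * \<gamma> p k l ^ 2) * (\<beta> x y * \<gamma> p x y) = (\<beta> i j ^ 2 * \<beta> x y) * (\<gamma> p k l ^ 2 * \<gamma> p x y)" by simp
        also have "\<dots> \<le> (\<beta> i j ^ 3 + \<beta> x y ^ 3) * (\<gamma> p k l ^ 3 + \<gamma> p x y ^ 3)"
          using nn by (intro mult_mono square_times_le_cubes) auto
        finally show ?thesis .
      qed
      have "(D p)\<^sup>2 * r p = (\<beta> i j ^ 2 * \<gamma> p k l ^ 2) * (\<beta> i k * \<gamma> p i k) + (\<beta> i j ^ 2 * \<gamma> p k l ^ 2) * (\<beta> j l * \<gamma> p j l)
          + \<beta> i j ^ 3 * \<gamma> p k l ^ 3"
        unfolding D2 by (simp add: r_def D_def \<beta>_def \<gamma>_def abs_mult distrib_left) (simp add: power2_eq_square power3_eq_cube)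
      also have "\<dots> \<le> (\<beta> i j ^ 3 + \<beta> i k ^ 3) * (\<gamma> p k l ^ 3 + \<gamma> p i k ^ 3) +
        (\<beta> i j ^ 3 + \<beta> j l ^ 3) * (\<gamma> p k l ^ 3 + \<gamma> p j l ^ 3) + \<beta> i j ^ 3 * \<gamma> p k l ^ 3"
        by (intro add_mono t order_refl)
      finally have "12 * ((D p)\<^sup>2 * r p) \<le> 12 * ((\<beta> i j ^ 3 + \<beta> i k ^ 3) * (\<gamma> p k l ^ 3 + \<gamma> p i k ^ 3) +
        (\<beta> i j ^ 3 + \<beta> j l ^ 3) * (\<gamma> p k l ^ 3 + \<gamma> p j l ^ 3) + \<beta> i j ^ 3 * \<gamma> p k l ^ 3)" by simp
      then show ?thesis using D2 by (simp add: distrib_left)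
    qed
    have e3: "pavg I (\<lambda>p. \<gamma> p x y ^ 3) = Y" if "x \<in> I" "y \<in> I" "x \<noteq> y" for x y
      unfolding \<gamma>_def Y_def using that by (intro pavg_dpow fin) auto
    have e2: "pavg I (\<lambda>p. \<gamma> p x y ^ 2) = W" if "x \<in> I" "y \<in> I" "x \<noteq> y" for x y
      unfolding \<gamma>_def W_def using that by (intro pavg_dpow fin) auto
    have "pavg I (\<lambda>p. (D p)\<^sup>2 * (12 * r p + 192 * \<Gamma>)) \<le>
       pavg I (\<lambda>p. 12 * ((\<beta> i j ^ 3 + \<beta> i k ^ 3) * (\<gamma> p k l ^ 3 + \<gamma> p i k ^ 3) +
        (\<beta> i j ^ 3 + \<beta> j l ^ 3) * (\<gamma> p k l ^ 3 + \<gamma> p j l ^ 3) + \<beta> i j ^ 3 * \<gamma> p k l ^ 3) +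
       192 * \<Gamma> * \<beta> i j ^ 2 * \<gamma> p k l ^ 2)" by (intro pavg_mono pw)
    also have "\<dots> = 12 * ((\<beta> i j ^ 3 + \<beta> i k ^ 3) * (Y + Y) + (\<beta> i j ^ 3 + \<beta> j l ^ 3) * (Y + Y) + \<beta> i j ^ 3 * Y)
       + 192 * \<Gamma> * \<beta> i j ^ 2 * W"
      using ijkl by (simp only: pavg_add pavg_cmult) (simp add: e3 e2)
    finally show ?thesis by (simp add: \<beta>_def algebra_simps)
  qed
  finally show ?thesis unfolding eq by (simp only: D_def)
qed

text \<open>The previous estimate is summed over all \<open>k\<close>, \<open>l\<close> away from
  \<open>i\<close>, \<open>j\<close>. The random squares \<open>(c (p k) - c (p l))^2\<close> then
  add up to the spread of \<open>c\<close> over all rows but two, which is almost independent of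
  \<open>p\<close>, so it separates from the mean of \<open>stein'\<close>. This is the purpose of
  the rows \<open>k\<close>, \<open>l\<close>.\<close>

lemma stein_pair_term:
  fixes b c :: "'a \<Rightarrow> real" and \<mu> :: real
  assumes fin: "finite I" and n: "card I \<ge> 1000" and ij: "i \<in> I" "j \<in> I"
    and K: "dpow I b 2 * dpow I c 2 = 4 * (real (card I))\<^sup>2 * (real (card I) - 1)"
    and G: "dpow I b 3 * dpow I c 3 = 4 * (real (card I))\<^sup>2 * (real (card I) - 1) * \<Gamma>"
    and \<Gamma>: "0 \<le> \<Gamma>" "\<Gamma> < 1 / 512"
  defines "W \<equiv> dpow I c 2 / (real (card I) * (real (card I) - 1))"
    and "Y \<equiv> dpow I c 3 / (real (card I) * (real (card I) - 1))"
    and "T \<equiv> \<lambda>p. stat I b c p - \<mu>"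
  shows "\<bar>(real (card I) - 2) * (real (card I) - 3) *
      pavg I (\<lambda>p. (b i - b j) * (c (p i) - c (p j)) * (stein z (T p) - stein z (T (p \<circ> swap i j))))
      - (b i - b j)\<^sup>2 * dpow I c 2 * pavg I (\<lambda>p. stein' z (T p))\<bar> \<le>
    8 * real (card I) * W * (b i - b j)\<^sup>2 +
    (\<Sum>k\<in>I. \<Sum>l\<in>I. 12 * Y * (5 * \<bar>b i - b j\<bar> ^ 3 + 2 * \<bar>b i - b k\<bar> ^ 3 + 2 * \<bar>b j - b l\<bar> ^ 3)
      + 192 * \<Gamma> * W * (b i - b j)\<^sup>2)"
proof -
  define n0 where "n0 = real (card I)"
  have n0: "n0 \<ge> 1000" using n by (simp add: n0_def)
  have W0: "W \<ge> 0" and Y0: "Y \<ge> 0" unfolding W_def Y_def using n dpow_nonneg by (auto intro!: divide_nonneg_nonneg)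
  define e where "e k l = 12 * Y * (5 * \<bar>b i - b j\<bar> ^ 3 + 2 * \<bar>b i - b k\<bar> ^ 3 + 2 * \<bar>b j - b l\<bar> ^ 3)
      + 192 * \<Gamma> * W * (b i - b j)\<^sup>2" for k l
  have e0: "e k l \<ge> 0" for k l unfolding e_def using W0 Y0 \<Gamma> by (intro add_nonneg_nonneg mult_nonneg_nonneg) auto
  define H where "H = pavg I (\<lambda>p. (b i - b j) * (c (p i) - c (p j)) * (stein z (T p) - stein z (T (p \<circ> swap i j))))"
  define F where "F p = stein' z (T p)" for p
  have F2: "\<bar>F p\<bar> \<le> 2" for p unfolding F_def by (rule stein'_abs_le_2)
  show ?thesis
  proof (cases "i = j")
    case True
    then have "H = 0" unfolding H_def using fin by (simp add: pavg_const)
    moreover have "0 \<le> (\<Sum>k\<in>I. \<Sum>l\<in>I. e k l)" by (intro sum_nonneg e0)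
    ultimately show ?thesis using True W0 unfolding H_def[symmetric] by (simp add: e_def)
  next
    case False
    define J where "J = I - {i, j}"
    define q where "q k l p = (c (p k) - c (p l))\<^sup>2" for k l p
    have fJ: "finite J" using fin by (simp add: J_def)
    have cJ: "real (card J) = n0 - 2"
      using fin ij False n by (simp add: J_def card_Diff_subset n0_def of_nat_diff)
    have cJk: "real (card (J - {k})) = n0 - 3" if "k \<in> J" for k
      using that fJ cJ n0 by (simp add: of_nat_diff card_Diff_singleton Suc_leI card_gt_0_iff)
    have "(n0 - 2) * (n0 - 3) * H = (\<Sum>k\<in>J. \<Sum>l\<in>J-{k}. H)"
      using cJ cJk by simp
    moreover have "(\<Sum>k\<in>J. \<Sum>l\<in>J-{k}. pavg I (\<lambda>p. ((b i - b j) * (c (p k) - c (p l)))\<^sup>2 * F p)) =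
       (b i - b j)\<^sup>2 * pavg I (\<lambda>p. dpow J (\<lambda>i. c (p i)) 2 * F p)"
    proof -
      have "(\<Sum>k\<in>J. \<Sum>l\<in>J-{k}. pavg I (\<lambda>p. ((b i - b j) * (c (p k) - c (p l)))\<^sup>2 * F p)) =
         (\<Sum>k\<in>J. \<Sum>l\<in>J. pavg I (\<lambda>p. ((b i - b j) * (c (p k) - c (p l)))\<^sup>2 * F p))"
        using fJ fin by (intro sum.cong[OF refl] sum.mono_neutral_left) (auto simp: pavg_const)
      also have "\<dots> = pavg I (\<lambda>p. \<Sum>k\<in>J. \<Sum>l\<in>J. ((b i - b j) * (c (p k) - c (p l)))\<^sup>2 * F p)"
        by (simp only: pavg_sum)
      also have "\<dots> = pavg I (\<lambda>p. (b i - b j)\<^sup>2 * (dpow J (\<lambda>i. c (p i)) 2 * F p))"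
        by (rule pavg_cong) (simp add: dpow_def power_mult_distrib sum_distrib_left sum_distrib_right mult.assoc)
      finally show ?thesis by (simp only: pavg_cmult)
    qed
    ultimately have "\<bar>(n0 - 2) * (n0 - 3) * H - (b i - b j)\<^sup>2 * pavg I (\<lambda>p. dpow J (\<lambda>i. c (p i)) 2 * F p)\<bar> =
       \<bar>\<Sum>k\<in>J. \<Sum>l\<in>J-{k}. H - pavg I (\<lambda>p. ((b i - b j) * (c (p k) - c (p l)))\<^sup>2 * F p)\<bar>"
      by (simp only: sum_subtractf)
    also have "\<dots> \<le> (\<Sum>k\<in>J. \<Sum>l\<in>J-{k}. e k l)"
    proof (intro order_trans[OF sum_abs] sum_mono)
      fix k l assume kl: "k \<in> J" "l \<in> J - {k}"
      show "\<bar>H - pavg I (\<lambda>p. ((b i - b j) * (c (p k) - c (p l)))\<^sup>2 * F p)\<bar> \<le> e k l"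
        unfolding H_def F_def e_def T_def W_def Y_def
        by (rule stein_swap_term[OF fin n ij]) (use kl False K G \<Gamma> in \<open>auto simp: J_def\<close>)
    qed
    also have "\<dots> \<le> (\<Sum>k\<in>J. \<Sum>l\<in>I. e k l)"
      using fin by (intro sum_mono sum_mono2 e0) (auto simp: J_def)
    also have "\<dots> \<le> (\<Sum>k\<in>I. \<Sum>l\<in>I. e k l)"
      using fin by (intro sum_mono2 sum_nonneg e0) (auto simp: J_def)
    finally have 1: "\<bar>(n0 - 2) * (n0 - 3) * H - (b i - b j)\<^sup>2 * pavg I (\<lambda>p. dpow J (\<lambda>i. c (p i)) 2 * F p)\<bar>
      \<le> (\<Sum>k\<in>I. \<Sum>l\<in>I. e k l)" .
    \<comment> \<open>Correction for the two missing rows: their pairs occur in both orders and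
      \<open>stein'\<close> is at most 2, hence the factor 4.\<close>
    have "\<bar>pavg I (\<lambda>p. dpow J (\<lambda>i. c (p i)) 2 * F p) - dpow I c 2 * pavg I F\<bar> =
       \<bar>pavg I (\<lambda>p. (dpow J (\<lambda>i. c (p i)) 2 - dpow I c 2) * F p)\<bar>"
      by (simp add: left_diff_distrib pavg_diff pavg_cmult)
    also have "\<dots> \<le> pavg I (\<lambda>p. (\<Sum>a\<in>{i,j}. \<Sum>m\<in>I. 4 * \<bar>c (p a) - c (p m)\<bar> ^ 2))"
    proof (rule order_trans[OF pavg_abs pavg_mono])
      fix p assume p: "p permutes I"
      have "\<bar>dpow J (\<lambda>i. c (p i)) 2 - dpow I c 2\<bar> \<le> 2 * (\<Sum>a\<in>{i,j}. \<Sum>m\<in>I. (c (p a) - c (p m))\<^sup>2)"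
        using dpow_delete[OF fin, of "{i,j}" "\<lambda>i. c (p i)"] ij dpow_subset_le[OF fin, of J "\<lambda>i. c (p i)" 2]
        unfolding dpow_permute[OF p] J_def[symmetric] by (auto simp: J_def)
      from mult_mono[OF this F2[of p]]
      show "\<bar>(dpow J (\<lambda>i. c (p i)) 2 - dpow I c 2) * F p\<bar> \<le> (\<Sum>a\<in>{i,j}. \<Sum>m\<in>I. 4 * \<bar>c (p a) - c (p m)\<bar> ^ 2)"
        by (simp add: abs_mult sum_nonneg flip: sum_distrib_left)
    qed
    also have "\<dots> = (\<Sum>a\<in>{i,j}. \<Sum>m\<in>I. 4 * pavg I (\<lambda>p. \<bar>c (p a) - c (p m)\<bar> ^ 2))"
      by (simp only: pavg_sum pavg_cmult)
    also have "\<dots> \<le> (\<Sum>a\<in>{i,j}. \<Sum>m\<in>I. 4 * W)"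
    proof (intro sum_mono mult_left_mono)
      fix a m assume "a \<in> {i, j}" "m \<in> I"
      then show "pavg I (\<lambda>p. \<bar>c (p a) - c (p m)\<bar> ^ 2) \<le> W"
        using pavg_dpow[OF fin, of a m 2 c] ij W0 fin by (cases "a = m") (auto simp: W_def pavg_const)
    qed simp
    also have "\<dots> = 8 * n0 * W" using False by (simp add: n0_def)
    finally have 2: "\<bar>pavg I (\<lambda>p. dpow J (\<lambda>i. c (p i)) 2 * F p) - dpow I c 2 * pavg I F\<bar> \<le> 8 * n0 * W" .
    have "\<bar>(b i - b j)\<^sup>2 * pavg I (\<lambda>p. dpow J (\<lambda>i. c (p i)) 2 * F p) - (b i - b j)\<^sup>2 * dpow I c 2 * pavg I F\<bar>
       \<le> 8 * n0 * W * (b i - b j)\<^sup>2"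
    proof -
      have "\<bar>(b i - b j)\<^sup>2 * pavg I (\<lambda>p. dpow J (\<lambda>i. c (p i)) 2 * F p) - (b i - b j)\<^sup>2 * dpow I c 2 * pavg I F\<bar>
         = (b i - b j)\<^sup>2 * \<bar>pavg I (\<lambda>p. dpow J (\<lambda>i. c (p i)) 2 * F p) - dpow I c 2 * pavg I F\<bar>"
        by (simp add: abs_mult mult.assoc flip: right_diff_distrib)
      then show ?thesis using mult_left_mono[OF 2, of "(b i - b j)\<^sup>2"] by (simp add: mult.commute)
    qed
    with 1 have "\<bar>(n0 - 2) * (n0 - 3) * H - (b i - b j)\<^sup>2 * dpow I c 2 * pavg I F\<bar> \<le>
       8 * n0 * W * (b i - b j)\<^sup>2 + (\<Sum>k\<in>I. \<Sum>l\<in>I. e k l)" by linarith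
    then show ?thesis by (simp add: H_def F_def[abs_def] n0_def e_def)
  qed
qed

text \<open>For \<Gamma> at least 1/512 the claim is trivial. Otherwise \<open>X\<close>, the mean
  of the statistic times the Stein solution, is compared with \<open>F\<close>, the mean of the
  derivative, by summing \<open>stein_pair_term\<close> over \<open>i\<close>, \<open>j\<close>;
  Stein's equation identifies \<open>F - X\<close> with the error of the distribution
  function.\<close>

lemma stat_CLT_normalized:
  fixes b c :: "'a \<Rightarrow> real"
  assumes fin: "finite I" and n: "card I \<ge> 2" and var: "stat_var I b c = 1"
  shows "\<bar>pavg I (\<lambda>p. of_bool (stat I b c p - stat_mean I b c \<le> z)) - \<Phi> z\<bar> \<le> 512 * stat_third I b c"
proof -
  define n0 where "n0 = real (card I)"
  define \<Gamma> where "\<Gamma> = stat_third I b c"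
  have kpos: "4 * n0\<^sup>2 * (n0 - 1) > 0" using n by (simp add: n0_def)
  have K: "dpow I b 2 * dpow I c 2 = 4 * (real (card I))\<^sup>2 * (real (card I) - 1)"
    using var kpos by (simp add: stat_var_def n0_def)
  have G: "dpow I b 3 * dpow I c 3 = 4 * (real (card I))\<^sup>2 * (real (card I) - 1) * \<Gamma>"
  proof -
    have "\<Gamma> = dpow I b 3 * dpow I c 3 / (4 * n0\<^sup>2 * (n0 - 1))" by (simp only: \<Gamma>_def stat_third_def n0_def)
    moreover have "4 * n0\<^sup>2 * (n0 - 1) \<noteq> 0" using kpos by (rule less_imp_neq[symmetric])
    ultimately show ?thesis unfolding n0_def[symmetric] by (simp only: nonzero_mult_div_cancel_left times_divide_eq_right not_False_eq_True)
  qed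
  have \<Gamma>0: "0 \<le> \<Gamma>" using stat_third_pos[OF fin n, of b c] var by (simp add: \<Gamma>_def)
  define T where "T = (\<lambda>p. stat I b c p - stat_mean I b c)"
  define P where "P = pavg I (\<lambda>p. of_bool (T p \<le> z))"
  have P01: "0 \<le> P" "P \<le> 1"
    using pavg_mono[of I "\<lambda>p. of_bool (T p \<le> z)" "\<lambda>_. 1"] fin
    by (auto simp: P_def pavg_const intro: pavg_nonneg)
  show ?thesis
  proof (cases "\<Gamma> < 1 / 512")
    case False
    then show ?thesis using P01 \<Phi>_nonneg[of z] \<Phi>_le_1[of z] by (simp add: P_def T_def \<Gamma>_def abs_le_iff)
  next
    case True
    \<comment> \<open>Together with \<Gamma> below 1/512 this forces \<open>n0\<close> above 2 *
      512^2, which exceeds 500000.\<close>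
    have n\<Gamma>: "2 \<le> n0 * \<Gamma>\<^sup>2" unfolding n0_def by (rule card_ge_of_third_small[OF n K G])
    have npos: "n0 > 0" using n by (simp add: n0_def)
    have "n0 * \<Gamma>\<^sup>2 \<le> n0 * (1/512)\<^sup>2" using True \<Gamma>0 npos by (intro mult_left_mono power_mono) auto
    then have n0: "n0 \<ge> 500000" using n\<Gamma> by (simp add: power2_eq_square)
    then have n1000: "card I \<ge> 1000" by (simp add: n0_def)
    define W where "W = dpow I c 2 / (real (card I) * (real (card I) - 1))"
    define Y where "Y = dpow I c 3 / (real (card I) * (real (card I) - 1))"
    define e where "e i j k l = 12 * Y * (5 * \<bar>b i - b j\<bar> ^ 3 + 2 * \<bar>b i - b k\<bar> ^ 3 + 2 * \<bar>b j - b l\<bar> ^ 3)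
      + 192 * \<Gamma> * W * (b i - b j)\<^sup>2" for i j k l
    define m where "m = (n0 - 2) * (n0 - 3)"
    define H where "H i j = pavg I (\<lambda>p. (b i - b j) * (c (p i) - c (p j)) * (stein z (T p) - stein z (T (p \<circ> swap i j))))" for i j
    define F where "F = pavg I (\<lambda>p. stein' z (T p))"
    define X where "X = pavg I (\<lambda>p. T p * stein z (T p))"
    have WB: "dpow I b 2 * W = 4 * n0"
    proof -
      have "dpow I b 2 * W = 4 * n0\<^sup>2 * (n0 - 1) / (n0 * (n0 - 1))" using K by (simp add: W_def n0_def)
      also have "\<dots> = 4 * n0" using n0 by (simp add: power2_eq_square)
      finally show ?thesis .
    qed
    have YB: "dpow I b 3 * Y = 4 * n0 * \<Gamma>"
    proof -
      have "dpow I b 3 * Y = 4 * n0\<^sup>2 * (n0 - 1) * \<Gamma> / (n0 * (n0 - 1))" using G by (simp add: Y_def n0_def)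
      also have "\<dots> = 4 * n0 * \<Gamma>" using n0 by (simp add: power2_eq_square)
      finally show ?thesis .
    qed
    have pt: "\<bar>m * H i j - (b i - b j)\<^sup>2 * dpow I c 2 * F\<bar> \<le> 8 * n0 * W * (b i - b j)\<^sup>2 + (\<Sum>k\<in>I. \<Sum>l\<in>I. e i j k l)"
      if "i \<in> I" "j \<in> I" for i j
      unfolding m_def n0_def H_def T_def F_def W_def Y_def e_def
      by (rule stein_pair_term[OF fin n1000 that K G \<Gamma>0 True])
    have XH: "4 * n0 * X = (\<Sum>i\<in>I. \<Sum>j\<in>I. H i j)"
      using pavg_stat_mult[OF fin, of b c "\<lambda>p. stein z (T p)"] npos
      by (simp add: X_def H_def T_def n0_def)
    have "m * (4 * n0 * X) - dpow I b 2 * dpow I c 2 * F = (\<Sum>i\<in>I. \<Sum>j\<in>I. m * H i j - (b i - b j)\<^sup>2 * dpow I c 2 * F)"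
      unfolding XH by (simp add: sum_subtractf sum_distrib_left dpow_def[of I b] sum_distrib_right)
    also have "\<bar>\<dots>\<bar> \<le> (\<Sum>i\<in>I. \<Sum>j\<in>I. 8 * n0 * W * (b i - b j)\<^sup>2 + (\<Sum>k\<in>I. \<Sum>l\<in>I. e i j k l))"
      by (intro order_trans[OF sum_abs] sum_mono pt)
    also have "\<dots> = 8 * n0 * (dpow I b 2 * W) + (\<Sum>i\<in>I. \<Sum>j\<in>I. \<Sum>k\<in>I. \<Sum>l\<in>I. e i j k l)"
      by (simp add: sum.distrib dpow_def[of I b] sum_distrib_left sum_distrib_right ac_simps)
    also have "(\<Sum>i\<in>I. \<Sum>j\<in>I. \<Sum>k\<in>I. \<Sum>l\<in>I. e i j k l) = 108 * n0\<^sup>2 * (dpow I b 3 * Y) + 192 * \<Gamma> * n0\<^sup>2 * (dpow I b 2 * W)"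
    proof -
      have s1: "(\<Sum>i\<in>I. \<Sum>j\<in>I. \<Sum>k\<in>I. \<Sum>l\<in>I. \<bar>b i - b j\<bar> ^ 3) = n0\<^sup>2 * dpow I b 3"
        by (simp add: dpow_def n0_def power2_eq_square mult.assoc flip: sum_distrib_left)
      have s2: "(\<Sum>i\<in>I. \<Sum>j\<in>I. \<Sum>k\<in>I. \<Sum>l\<in>I. \<bar>b i - b k\<bar> ^ 3) = n0\<^sup>2 * dpow I b 3"
        by (simp add: dpow_def n0_def power2_eq_square mult.assoc flip: sum_distrib_left)
      have s3: "(\<Sum>i\<in>I. \<Sum>j\<in>I. \<Sum>k\<in>I. \<Sum>l\<in>I. \<bar>b j - b l\<bar> ^ 3) = n0\<^sup>2 * dpow I b 3"
        by (simp add: dpow_def n0_def power2_eq_square mult.assoc flip: sum_distrib_left)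
      have s4: "(\<Sum>i\<in>I. \<Sum>j\<in>I. \<Sum>k\<in>I. \<Sum>l\<in>I. (b i - b j)\<^sup>2) = n0\<^sup>2 * dpow I b 2"
        by (simp add: dpow_def n0_def power2_eq_square mult.assoc flip: sum_distrib_left)
      have "(\<Sum>i\<in>I. \<Sum>j\<in>I. \<Sum>k\<in>I. \<Sum>l\<in>I. e i j k l) =
        12 * Y * (5 * (\<Sum>i\<in>I. \<Sum>j\<in>I. \<Sum>k\<in>I. \<Sum>l\<in>I. \<bar>b i - b j\<bar> ^ 3) + 2 * (\<Sum>i\<in>I. \<Sum>j\<in>I. \<Sum>k\<in>I. \<Sum>l\<in>I. \<bar>b i - b k\<bar> ^ 3) + 2 * (\<Sum>i\<in>I. \<Sum>j\<in>I. \<Sum>k\<in>I. \<Sum>l\<in>I. \<bar>b j - b l\<bar> ^ 3))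
        + 192 * \<Gamma> * W * (\<Sum>i\<in>I. \<Sum>j\<in>I. \<Sum>k\<in>I. \<Sum>l\<in>I. (b i - b j)\<^sup>2)"
        unfolding e_def by (simp only: sum.distrib sum_distrib_left[symmetric])
      then show ?thesis unfolding s1 s2 s3 s4 by (simp add: algebra_simps)
    qed
    finally have "\<bar>m * (4 * n0 * X) - dpow I b 2 * dpow I c 2 * F\<bar> \<le> 32 * n0\<^sup>2 + 1200 * n0 ^ 3 * \<Gamma>"
      unfolding YB WB by (simp add: power2_eq_square power3_eq_cube algebra_simps)
    moreover have "m * (4 * n0 * X) - dpow I b 2 * dpow I c 2 * F = 4 * n0 * (m * X - n0 * (n0 - 1) * F)"
      unfolding K by (simp add: n0_def power2_eq_square algebra_simps)
    moreover have "\<bar>4 * n0 * (m * X - n0 * (n0 - 1) * F)\<bar> = 4 * n0 * \<bar>m * X - n0 * (n0 - 1) * F\<bar>"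
      using npos by (simp add: abs_mult)
    moreover have "32 * n0\<^sup>2 + 1200 * n0 ^ 3 * \<Gamma> = 4 * n0 * (8 * n0 + 300 * n0\<^sup>2 * \<Gamma>)"
      by (simp add: power2_eq_square power3_eq_cube algebra_simps)
    ultimately have "4 * n0 * \<bar>m * X - n0 * (n0 - 1) * F\<bar> \<le> 4 * n0 * (8 * n0 + 300 * n0\<^sup>2 * \<Gamma>)"
      by (simp only:)
    then have 1: "\<bar>m * X - n0 * (n0 - 1) * F\<bar> \<le> 8 * n0 + 300 * n0\<^sup>2 * \<Gamma>" using npos by simp
    have F2: "\<bar>F\<bar> \<le> 2"
      unfolding F_def using pavg_mono[of I "\<lambda>p. \<bar>stein' z (T p)\<bar>" "\<lambda>_. 2"] stein'_abs_le_2 fin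
      by (intro order_trans[OF pavg_abs]) (simp add: pavg_const)
    \<comment> \<open>The spreads are normalised by \<open>n0 * (n0 - 1)\<close>, whereas
      \<open>(n0 - 2) * (n0 - 3)\<close> pairs \<open>k\<close>, \<open>l\<close> were available;
      the difference is of lower order.\<close>
    have mn: "n0 * (n0 - 1) - m = 4 * n0 - 6" by (simp add: m_def algebra_simps)
    have "m * X - m * F = (m * X - n0 * (n0 - 1) * F) + (4 * n0 - 6) * F"
      unfolding mn[symmetric] by (simp add: algebra_simps)
    moreover have "\<bar>(4 * n0 - 6) * F\<bar> \<le> (4 * n0) * 2"
      unfolding abs_mult using F2 n0 by (intro mult_mono) auto
    ultimately have 2: "\<bar>m * X - m * F\<bar> \<le> 16 * n0 + 300 * n0\<^sup>2 * \<Gamma>" using 1 by linarith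
    have m: "m \<ge> 0.99 * n0\<^sup>2"
    proof -
      have "5 * n0 \<le> 0.01 * (n0 * n0)" using n0 mult_right_mono[of 500 n0 n0] by simp
      then show ?thesis by (simp add: m_def power2_eq_square algebra_simps)
    qed
    \<comment> \<open>All terms of lower order are absorbed into the third moment, which is at least
      of order \<open>1 / sqrt n0\<close>.\<close>
    have "16 * n0 \<le> n0\<^sup>2 * \<Gamma>"
    proof -
      have "n0 * \<Gamma>\<^sup>2 \<le> n0 * (\<Gamma> * (1/512))" unfolding power2_eq_square using True \<Gamma>0 npos by (intro mult_left_mono) auto
      then have "16 \<le> n0 * \<Gamma>" using n\<Gamma> by simp
      from mult_left_mono[OF this, of n0] show ?thesis using npos by (simp add: power2_eq_square ac_simps)
    qed
    then have "\<bar>m * X - m * F\<bar> \<le> 301 * (n0\<^sup>2 * \<Gamma>)" using 2 by linarith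
    also have "\<dots> \<le> m * (512 * \<Gamma>)"
    proof -
      have "301 * (n0\<^sup>2 * \<Gamma>) \<le> 0.99 * n0\<^sup>2 * (512 * \<Gamma>)" using \<Gamma>0 by simp
      also have "\<dots> \<le> m * (512 * \<Gamma>)" using m \<Gamma>0 by (intro mult_right_mono) auto
      finally show ?thesis .
    qed
    finally have le: "\<bar>m * X - m * F\<bar> \<le> m * (512 * \<Gamma>)" .
    have mpos: "m > 0" unfolding m_def using n0 by simp
    have "\<bar>m * X - m * F\<bar> = m * \<bar>X - F\<bar>"
      using mpos by (simp add: abs_mult flip: right_diff_distrib)
    with le mpos have XF: "\<bar>X - F\<bar> \<le> 512 * \<Gamma>" by (simp only: mult_le_cancel_left_pos)
    have "F = pavg I (\<lambda>p. T p * stein z (T p) + (of_bool (T p \<le> z) - \<Phi> z))"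
      unfolding F_def by (rule pavg_cong) (simp add: stein'_def stein_g_def)
    also have "\<dots> = X + (P - \<Phi> z)" by (simp only: pavg_add pavg_diff X_def P_def pavg_const[OF fin])
    finally have "P - \<Phi> z = F - X" by simp
    then show ?thesis using XF by (simp add: P_def T_def \<Gamma>_def abs_minus_commute)
  qed
qed

lemma dpow_scale: "dpow I (\<lambda>i. t * b i) k = \<bar>t\<bar> ^ k * dpow I b k"
proof -
  have "\<bar>t * b i - t * b j\<bar> ^ k = \<bar>t\<bar> ^ k * \<bar>b i - b j\<bar> ^ k" for i j
    by (simp add: abs_mult power_mult_distrib flip: right_diff_distrib)
  then show ?thesis by (simp add: dpow_def sum_distrib_left)
qed

text \<open>The events for \<open>stat + R\<close> and for \<open>stat\<close> differ only where the
  statistic is within \<open>\<bar>R p\<bar>\<close> of \<open>z\<close>, and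
  \<open>stat_concentration\<close> covers exactly this event; 516 is 512 + 4.\<close>

lemma stat_CLT_perturbed:
  assumes fin: "finite I" and n: "card I \<ge> 2" and v: "stat_var I b c > 0"
  defines "\<sigma> \<equiv> sqrt (stat_var I b c)"
  shows "\<bar>pavg I (\<lambda>p. of_bool (stat I b c p + R p \<le> z)) - \<Phi> ((z - stat_mean I b c) / \<sigma>)\<bar> \<le>
    516 * stat_third I b c / \<sigma> ^ 3 + 2 * (sqrt (pavg I (\<lambda>p. (R p)\<^sup>2)) + sqrt (dirichlet I R)) / \<sigma>"
proof -
  have \<sigma>: "\<sigma> > 0" using v by (simp add: \<sigma>_def)
  have \<sigma>2: "\<sigma>\<^sup>2 = stat_var I b c" using v by (simp add: \<sigma>_def)
  define b' where "b' = (\<lambda>i. (1 / \<sigma>) * b i)"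
  have st: "stat I b' c p = stat I b c p / \<sigma>" for p
    by (simp add: stat_def b'_def sum_divide_distrib)
  have sm: "stat_mean I b' c = stat_mean I b c / \<sigma>"
    by (simp add: stat_mean_def b'_def flip: sum_divide_distrib)
  have "stat_var I b' c = (1 / \<sigma>)\<^sup>2 * stat_var I b c"
    unfolding stat_var_def b'_def dpow_scale power2_abs by (simp add: ac_simps)
  also have "\<dots> = 1" unfolding \<sigma>2[symmetric] using \<sigma> by (simp add: power2_eq_square)
  finally have v1: "stat_var I b' c = 1" .
  have th: "stat_third I b' c = stat_third I b c / \<sigma> ^ 3"
    unfolding stat_third_def b'_def dpow_scale using \<sigma> by (simp add: power_divide ac_simps)
  have "pavg I (\<lambda>p. of_bool (stat I b' c p - stat_mean I b' c \<le> (z - stat_mean I b c) / \<sigma>)) =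
      pavg I (\<lambda>p. of_bool (stat I b c p \<le> z))"
    using \<sigma> by (intro pavg_cong) (simp add: st sm divide_le_cancel flip: diff_divide_distrib)
  then have 1: "\<bar>pavg I (\<lambda>p. of_bool (stat I b c p \<le> z)) - \<Phi> ((z - stat_mean I b c) / \<sigma>)\<bar> \<le> 512 * stat_third I b c / \<sigma> ^ 3"
    using stat_CLT_normalized[OF fin n v1, of "(z - stat_mean I b c) / \<sigma>"] by (simp add: th)
  have "\<bar>pavg I (\<lambda>p. of_bool (stat I b c p + R p \<le> z)) - pavg I (\<lambda>p. of_bool (stat I b c p \<le> z))\<bar>
    \<le> pavg I (\<lambda>p. of_bool (\<bar>stat I b c p - z\<bar> \<le> \<bar>R p\<bar>))"
    unfolding pavg_diff[symmetric]
    by (rule order_trans[OF pavg_abs pavg_mono]) (auto simp: of_bool_def)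
  also have "\<dots> \<le> 2 * (sqrt (pavg I (\<lambda>p. (R p)\<^sup>2)) + sqrt (dirichlet I R)) / \<sigma> + 4 * stat_third I b c / \<sigma> ^ 3"
    unfolding \<sigma>_def by (rule stat_concentration[OF fin n v])
  finally have 2: "\<bar>pavg I (\<lambda>p. of_bool (stat I b c p + R p \<le> z)) - pavg I (\<lambda>p. of_bool (stat I b c p \<le> z))\<bar>
    \<le> 2 * (sqrt (pavg I (\<lambda>p. (R p)\<^sup>2)) + sqrt (dirichlet I R)) / \<sigma> + 4 * stat_third I b c / \<sigma> ^ 3" .
  have "512 * stat_third I b c / \<sigma> ^ 3 + 4 * stat_third I b c / \<sigma> ^ 3 = 516 * stat_third I b c / \<sigma> ^ 3"
    by (simp flip: add_divide_distrib)
  with 1 2 show ?thesis by linarith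
qed

lemma sum_swap3: "(\<Sum>x\<in>A. \<Sum>y\<in>B. \<Sum>z\<in>C. f x y z) = (\<Sum>z\<in>C. \<Sum>x\<in>A. \<Sum>y\<in>B. f x y z)"
proof -
  have "(\<Sum>x\<in>A. \<Sum>y\<in>B. \<Sum>z\<in>C. f x y z) = (\<Sum>x\<in>A. \<Sum>z\<in>C. \<Sum>y\<in>B. f x y z)"
    by (intro sum.cong refl sum.swap)
  also have "\<dots> = (\<Sum>z\<in>C. \<Sum>x\<in>A. \<Sum>y\<in>B. f x y z)" by (rule sum.swap)
  finally show ?thesis .
qed

section \<open>Sums over subsets\<close>

definition subsets :: "'a set \<Rightarrow> nat \<Rightarrow> 'a set set" where
  "subsets I d = {A. A \<subseteq> I \<and> card A = d}"

definition upsum :: "'a set \<Rightarrow> nat \<Rightarrow> ('a set \<Rightarrow> real) \<Rightarrow> 'a set \<Rightarrow> real" where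
  "upsum I d a J = (\<Sum>A | A \<in> subsets I d \<and> J \<subseteq> A. a A)"

text \<open>Energy of the marginals of order \<open>s\<close>. For the coefficients coming from a
  tensor its root is the seminorm of order \<open>s\<close> up to a weight, see
  \<open>tensor_seminorm_level\<close>.\<close>

definition level :: "'a set \<Rightarrow> nat \<Rightarrow> ('a set \<Rightarrow> real) \<Rightarrow> nat \<Rightarrow> real" where
  "level I d a s = (\<Sum>J\<in>subsets I s. (upsum I d a J)\<^sup>2)"

text \<open>The forward difference of order \<open>s\<close> at 0; for the correlations this is
  \<open>\<Sigma>\<^sub>s\<close>.\<close>

definition alt_diff :: "(nat \<Rightarrow> real) \<Rightarrow> nat \<Rightarrow> real" where
  "alt_diff \<delta> s = (\<Sum>t=0..s. real (s choose t) * (-1) ^ (s - t) * \<delta> t)"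

lemma finite_subsets: "finite I \<Longrightarrow> finite (subsets I d)"
  unfolding subsets_def by (rule finite_subset[of _ "Pow I"]) auto

lemma card_subsets: "finite I \<Longrightarrow> card (subsets I d) = card I choose d"
  unfolding subsets_def by (rule n_subsets)

lemma card_subsets_above:
  assumes fin: "finite I" and J: "J \<subseteq> I" "card J \<le> d"
  shows "card {A \<in> subsets I d. J \<subseteq> A} = (card I - card J) choose (d - card J)"
proof -
  have fJ: "finite J" using fin J finite_subset by blast
  have "bij_betw (\<lambda>B. B \<union> J) (subsets (I - J) (d - card J)) {A \<in> subsets I d. J \<subseteq> A}"
  proof (rule bij_betwI[where g = "\<lambda>A. A - J"])
    show "(\<lambda>B. B \<union> J) \<in> subsets (I - J) (d - card J) \<rightarrow> {A \<in> subsets I d. J \<subseteq> A}"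
    proof
      fix B assume B: "B \<in> subsets (I - J) (d - card J)"
      then have "finite B" using fin finite_subset unfolding subsets_def by blast
      then have "card (B \<union> J) = card B + card J" using fJ B by (intro card_Un_disjoint) (auto simp: subsets_def)
      then show "B \<union> J \<in> {A \<in> subsets I d. J \<subseteq> A}" using B J by (auto simp: subsets_def)
    qed
    show "(\<lambda>A. A - J) \<in> {A \<in> subsets I d. J \<subseteq> A} \<rightarrow> subsets (I - J) (d - card J)"
      using fJ by (auto simp: subsets_def card_Diff_subset)
  qed (auto simp: subsets_def)
  then have "card {A \<in> subsets I d. J \<subseteq> A} = card (subsets (I - J) (d - card J))"
    by (simp add: bij_betw_same_card)
  also have "\<dots> = (card I - card J) choose (d - card J)"
    using fin J fJ by (simp add: card_subsets card_Diff_subset)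
  finally show ?thesis .
qed

lemma card_subsets_within:
  assumes "finite B" shows "card {J \<in> subsets I s. J \<subseteq> B \<inter> I} = card (B \<inter> I) choose s"
proof -
  have "{J \<in> subsets I s. J \<subseteq> B \<inter> I} = {J. J \<subseteq> B \<inter> I \<and> card J = s}" by (auto simp: subsets_def)
  then show ?thesis using n_subsets[of "B \<inter> I" s] assms by simp
qed

text \<open>Newton's forward formula. It expands a function of an overlap in binomials of the
  overlap, and these count common subsets.\<close>

lemma binomial_inversion:
  assumes "t \<le> d"
  shows "\<delta> t = (\<Sum>s\<le>d. real (t choose s) * alt_diff \<delta> s)"
proof -
  have "(\<Sum>s\<le>d. real (t choose s) * alt_diff \<delta> s) = (\<Sum>s\<le>t. real (t choose s) * alt_diff \<delta> s)"
    using assms by (intro sum.mono_neutral_right) (auto simp: binomial_eq_0)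
  also have "\<dots> = (\<Sum>s\<le>t. \<Sum>r\<le>s. real (t choose s) * real (s choose r) * (-1) ^ (s - r) * \<delta> r)"
    by (simp add: alt_diff_def sum_distrib_left atLeast0AtMost mult.assoc)
  also have "\<dots> = (\<Sum>s\<le>t. \<Sum>r\<le>t. real (t choose s) * real (s choose r) * (-1) ^ (s - r) * \<delta> r)"
    by (intro sum.cong[OF refl] sum.mono_neutral_left) (auto simp: binomial_eq_0)
  also have "\<dots> = (\<Sum>r\<le>t. \<Sum>s\<le>t. real (t choose s) * real (s choose r) * (-1) ^ (s - r) * \<delta> r)"
    by (rule sum.swap)
  also have "\<dots> = (\<Sum>r\<le>t. \<Sum>s\<in>{r..t}. real (t choose s) * real (s choose r) * (-1) ^ (s - r) * \<delta> r)"
    by (intro sum.cong[OF refl] sum.mono_neutral_right) (auto simp: binomial_eq_0)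
  also have "\<dots> = (\<Sum>r\<le>t. if r = t then \<delta> t else 0)"
  proof (intro sum.cong refl)
    fix r assume "r \<in> {..t}"
    then have r: "r \<le> t" by simp
    have "(\<Sum>s\<in>{r..t}. real (t choose s) * real (s choose r) * (-1) ^ (s - r) * \<delta> r) =
       (\<Sum>s\<in>{r..t}. real (t choose r) * \<delta> r * (real ((t - r) choose (s - r)) * (-1) ^ (s - r)))"
    proof (intro sum.cong refl)
      fix s assume "s \<in> {r..t}"
      then have "(t choose s) * (s choose r) = (t choose r) * ((t - r) choose (s - r))"
        by (intro choose_mult) auto
      then have "real (t choose s) * real (s choose r) = real (t choose r) * real ((t - r) choose (s - r))"
        by (metis of_nat_mult)
      then show "real (t choose s) * real (s choose r) * (-1) ^ (s - r) * \<delta> r =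
          real (t choose r) * \<delta> r * (real ((t - r) choose (s - r)) * (-1) ^ (s - r))" by simp
    qed
    also have "\<dots> = real (t choose r) * \<delta> r * (\<Sum>s\<in>{r..t}. real ((t - r) choose (s - r)) * (-1) ^ (s - r))"
      by (simp add: sum_distrib_left)
    also have "(\<Sum>s\<in>{r..t}. real ((t - r) choose (s - r)) * (-1) ^ (s - r)) = (\<Sum>u\<le>t - r. real ((t - r) choose u) * (-1) ^ u)"
      by (rule sum.reindex_bij_witness[where i = "\<lambda>u. u + r" and j = "\<lambda>s. s - r"]) (use r in auto)
    also have "\<dots> = (if r = t then 1 else 0)"
    proof (cases "r = t")
      case False
      then have "0 < t - r" using r by simp
      from choose_alternating_sum[OF this, where ?'a = real] show ?thesis using False by (simp add: mult.commute)
    qed simp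
    finally show "(\<Sum>s\<in>{r..t}. real (t choose s) * real (s choose r) * (-1) ^ (s - r) * \<delta> r) = (if r = t then \<delta> t else 0)"
      by auto
  qed
  also have "\<dots> = \<delta> t" by simp
  finally show ?thesis ..
qed

text \<open>\<open>card (A \<inter> B) choose s\<close> counts the \<open>s\<close>-sets contained
  in both \<open>A\<close> and \<open>B\<close>, so each order of Newton's expansion becomes a sum
  of squares of marginals. Applied to covariances, this is where the seminorms and the weights
  \<open>\<Sigma>\<^sub>s\<close> meet.\<close>

lemma overlap_quadratic_form:
  assumes fin: "finite I"
  shows "(\<Sum>A\<in>subsets I d. \<Sum>B\<in>subsets I d. a A * a B * \<delta> (card (A \<inter> B))) =
    (\<Sum>s\<le>d. alt_diff \<delta> s * level I d a s)"
proof -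
  let ?K = "subsets I d"
  have fK: "finite ?K" by (rule finite_subsets[OF fin])
  have lev: "level I d a s = (\<Sum>A\<in>?K. \<Sum>B\<in>?K. a A * a B * real (card (A \<inter> B) choose s))" for s
  proof -
    have "level I d a s = (\<Sum>J\<in>subsets I s. (\<Sum>A\<in>?K. of_bool (J \<subseteq> A) * a A) * (\<Sum>B\<in>?K. of_bool (J \<subseteq> B) * a B))"
      unfolding level_def upsum_def power2_eq_square using fK by (simp add: sum.inter_filter of_bool_def if_distrib[of "\<lambda>x. x * _"] cong: if_cong)
    also have "\<dots> = (\<Sum>J\<in>subsets I s. \<Sum>A\<in>?K. \<Sum>B\<in>?K. a A * a B * of_bool (J \<subseteq> A \<inter> B))"
      by (simp add: sum_product ac_simps flip: of_bool_conj)
    also have "\<dots> = (\<Sum>A\<in>?K. \<Sum>B\<in>?K. \<Sum>J\<in>subsets I s. a A * a B * of_bool (J \<subseteq> A \<inter> B))"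
      by (rule sum_swap3[symmetric])
    also have "\<dots> = (\<Sum>A\<in>?K. \<Sum>B\<in>?K. a A * a B * real (card (A \<inter> B) choose s))"
    proof (intro sum.cong refl)
      fix A B assume AB: "A \<in> ?K" "B \<in> ?K"
      have fA: "finite (A \<inter> B)" "A \<inter> B \<inter> I = A \<inter> B" using AB fin finite_subset by (auto simp: subsets_def)
      have "(\<Sum>J\<in>subsets I s. of_bool (J \<subseteq> A \<inter> B)) = real (card {J \<in> subsets I s. J \<subseteq> A \<inter> B})"
        using finite_subsets[OF fin] by (simp add: of_bool_def sum.inter_filter[symmetric])
      also have "\<dots> = real (card (A \<inter> B) choose s)"
        using card_subsets_within[OF fA(1), of I s] fA(2) by simp
      finally show "(\<Sum>J\<in>subsets I s. a A * a B * of_bool (J \<subseteq> A \<inter> B)) = a A * a B * real (card (A \<inter> B) choose s)"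
        by (simp flip: sum_distrib_left)
    qed
    finally show ?thesis .
  qed
  have "(\<Sum>A\<in>?K. \<Sum>B\<in>?K. a A * a B * \<delta> (card (A \<inter> B))) =
    (\<Sum>A\<in>?K. \<Sum>B\<in>?K. \<Sum>s\<le>d. alt_diff \<delta> s * (a A * a B * real (card (A \<inter> B) choose s)))"
  proof (intro sum.cong refl)
    fix A B assume AB: "A \<in> ?K" "B \<in> ?K"
    have "finite A" using AB fin finite_subset by (auto simp: subsets_def)
    then have "card (A \<inter> B) \<le> d" using AB card_mono[of A "A \<inter> B"] by (auto simp: subsets_def)
    from binomial_inversion[OF this, of \<delta>]
    show "a A * a B * \<delta> (card (A \<inter> B)) = (\<Sum>s\<le>d. alt_diff \<delta> s * (a A * a B * real (card (A \<inter> B) choose s)))"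
      by (simp add: sum_distrib_left ac_simps)
  qed
  also have "\<dots> = (\<Sum>s\<le>d. \<Sum>A\<in>?K. \<Sum>B\<in>?K. alt_diff \<delta> s * (a A * a B * real (card (A \<inter> B) choose s)))"
    by (rule sum_swap3)
  also have "\<dots> = (\<Sum>s\<le>d. alt_diff \<delta> s * level I d a s)"
    by (simp add: lev sum_distrib_left)
  finally show ?thesis .
qed

lemma subsets_finite: "finite I \<Longrightarrow> A \<in> subsets I d \<Longrightarrow> finite A"
  unfolding subsets_def using finite_subset by blast

lemma sum_subsets_1: "(\<Sum>J\<in>subsets I 1. F J) = (\<Sum>k\<in>I. F {k})"
proof -
  have "subsets I 1 = (\<lambda>k. {k}) ` I" unfolding subsets_def by (auto simp: card_1_singleton_iff)
  then show ?thesis by (simp add: sum.reindex)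
qed

lemma subsets_0: "subsets I 0 = {{}}" if "finite I"
  using that finite_subset by (fastforce simp: subsets_def card_eq_0_iff)

lemma level_0: "finite I \<Longrightarrow> level I d a 0 = (\<Sum>A\<in>subsets I d. a A)\<^sup>2"
  by (simp add: level_def subsets_0 upsum_def)

lemma level_1: "level I d a 1 = (\<Sum>k\<in>I. (upsum I d a {k})\<^sup>2)"
  unfolding level_def by (rule sum_subsets_1)

lemma level_nonneg: "0 \<le> level I d a s"
  unfolding level_def by (intro sum_nonneg) auto

lemma upsum_diff: "upsum I d (\<lambda>A. f A - g A) J = upsum I d f J - upsum I d g J"
  by (simp add: upsum_def sum_subtractf)

lemma sum_upsum:
  assumes fin: "finite I"
  shows "(\<Sum>J\<in>subsets I s. upsum I d f J) = real (d choose s) * (\<Sum>A\<in>subsets I d. f A)"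
proof -
  have "(\<Sum>J\<in>subsets I s. upsum I d f J) = (\<Sum>A\<in>subsets I d. \<Sum>J | J \<in> subsets I s \<and> J \<subseteq> A. f A)"
    unfolding upsum_def using finite_subsets[OF fin] by (intro sum.swap_restrict) auto
  also have "\<dots> = (\<Sum>A\<in>subsets I d. real (d choose s) * f A)"
  proof (intro sum.cong refl)
    fix A assume A: "A \<in> subsets I d"
    then have "A \<inter> I = A" "card A = d" by (auto simp: subsets_def)
    then show "(\<Sum>J | J \<in> subsets I s \<and> J \<subseteq> A. f A) = real (d choose s) * f A"
      using card_subsets_within[OF subsets_finite[OF fin A], of I s] by simp
  qed
  finally show ?thesis by (simp add: sum_distrib_left)
qed

lemma sum_upsum_singleton:
  assumes "finite I"
  shows "(\<Sum>k\<in>I. upsum I d f {k}) = real d * (\<Sum>A\<in>subsets I d. f A)"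
  using sum_upsum[OF assms, of d f 1] by (simp only: sum_subsets_1) simp

lemma upsum_square_le:
  assumes fin: "finite I" and J: "J \<subseteq> I" "card J \<le> d"
  shows "(upsum I d f J)\<^sup>2 \<le> real ((card I - card J) choose (d - card J)) * upsum I d (\<lambda>A. (f A)\<^sup>2) J"
  using sum_square_le[of f "{A \<in> subsets I d. J \<subseteq> A}"]
  unfolding upsum_def by (simp add: card_subsets_above[OF assms])

lemma level_le_sum_squares:
  assumes fin: "finite I" and s: "s \<le> d"
  shows "level I d f s \<le> real ((card I - s) choose (d - s)) * real (d choose s) * (\<Sum>A\<in>subsets I d. (f A)\<^sup>2)"
proof -
  have "level I d f s \<le> (\<Sum>J\<in>subsets I s. real ((card I - s) choose (d - s)) * upsum I d (\<lambda>A. (f A)\<^sup>2) J)"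
    unfolding level_def
  proof (rule sum_mono)
    fix J assume "J \<in> subsets I s"
    then have J: "J \<subseteq> I" "card J = s" by (auto simp: subsets_def)
    then show "(upsum I d f J)\<^sup>2 \<le> real ((card I - s) choose (d - s)) * upsum I d (\<lambda>A. (f A)\<^sup>2) J"
      using upsum_square_le[OF fin J(1), of d f] s by simp
  qed
  also have "\<dots> = real ((card I - s) choose (d - s)) * real (d choose s) * (\<Sum>A\<in>subsets I d. (f A)\<^sup>2)"
    by (simp add: sum_upsum[OF fin] mult.assoc flip: sum_distrib_left)
  finally show ?thesis .
qed

text \<open>Summing the marginals of the \<open>s\<close>-sets through \<open>k\<close> counts every
  \<open>A\<close> through \<open>k\<close> exactly \<open>(d - 1) choose (s - 1)\<close> times, so
  the one-point marginal is recovered from order \<open>s\<close>; Cauchy-Schwarz and double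
  counting finish. Quantities built from order 1 can thus be paid for by any higher order.\<close>

lemma level_1_le:
  assumes fin: "finite I" and s: "1 \<le> s" "s \<le> d"
  shows "level I d a 1 \<le> real ((card I - 1) choose (s - 1)) * real s * level I d a s"
proof -
  have step: "(upsum I d a {k})\<^sup>2 \<le> real ((card I - 1) choose (s - 1)) * upsum I s (\<lambda>J. (upsum I d a J)\<^sup>2) {k}"
    if k: "k \<in> I" for k
  proof -
    have "upsum I s (upsum I d a) {k} = (\<Sum>J | J \<in> subsets I s \<and> {k} \<subseteq> J. \<Sum>A | A \<in> subsets I d \<and> J \<subseteq> A. a A)"
      unfolding upsum_def ..
    also have "\<dots> = (\<Sum>A\<in>subsets I d. \<Sum>J | J \<in> {J \<in> subsets I s. {k} \<subseteq> J} \<and> J \<subseteq> A. a A)"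
      using finite_subsets[OF fin] by (intro sum.swap_restrict) auto
    also have "\<dots> = (\<Sum>A\<in>subsets I d. if k \<in> A then real ((d - 1) choose (s - 1)) * a A else 0)"
    proof (intro sum.cong refl)
      fix A assume A: "A \<in> subsets I d"
      have e: "{J. J \<in> {J \<in> subsets I s. {k} \<subseteq> J} \<and> J \<subseteq> A} = {J \<in> subsets A s. {k} \<subseteq> J}"
        using A by (auto simp: subsets_def)
      show "(\<Sum>J | J \<in> {J \<in> subsets I s. {k} \<subseteq> J} \<and> J \<subseteq> A. a A) = (if k \<in> A then real ((d - 1) choose (s - 1)) * a A else 0)"
      proof (cases "k \<in> A")
        case True
        then show ?thesis unfolding e
          using card_subsets_above[OF subsets_finite[OF fin A], of "{k}" s] s A by (simp add: subsets_def)
      next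
        case False
        then have "{J \<in> subsets A s. {k} \<subseteq> J} = {}" by (auto simp: subsets_def)
        then show ?thesis unfolding e using False by (simp only: sum.empty if_False)
      qed
    qed
    also have "\<dots> = (\<Sum>A | A \<in> subsets I d \<and> k \<in> A. real ((d - 1) choose (s - 1)) * a A)"
      using finite_subsets[OF fin] by (rule sum.inter_filter[symmetric])
    also have "\<dots> = real ((d - 1) choose (s - 1)) * upsum I d a {k}"
      by (simp add: upsum_def flip: sum_distrib_left)
    finally have e: "real ((d - 1) choose (s - 1)) * upsum I d a {k} = upsum I s (upsum I d a) {k}" ..
    have "1 \<le> (d - 1) choose (s - 1)" using s by (simp add: Suc_leI zero_less_binomial)
    then have "1 * \<bar>upsum I d a {k}\<bar> \<le> real ((d - 1) choose (s - 1)) * \<bar>upsum I d a {k}\<bar>"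
      by (intro mult_right_mono) auto
    then have "\<bar>upsum I d a {k}\<bar> \<le> \<bar>upsum I s (upsum I d a) {k}\<bar>" by (simp add: abs_mult flip: e)
    then have "(upsum I d a {k})\<^sup>2 \<le> (upsum I s (upsum I d a) {k})\<^sup>2" by (simp add: abs_le_square_iff)
    also have "\<dots> \<le> real ((card I - 1) choose (s - 1)) * upsum I s (\<lambda>J. (upsum I d a J)\<^sup>2) {k}"
      using upsum_square_le[OF fin, of "{k}" s "upsum I d a"] k s by simp
    finally show ?thesis .
  qed
  have "level I d a 1 \<le> (\<Sum>k\<in>I. real ((card I - 1) choose (s - 1)) * upsum I s (\<lambda>J. (upsum I d a J)\<^sup>2) {k})"
    unfolding level_1 by (intro sum_mono step)
  also have "\<dots> = real ((card I - 1) choose (s - 1)) * real s * level I d a s"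
    by (simp add: sum_upsum_singleton[OF fin] level_def mult.assoc flip: sum_distrib_left)
  finally show ?thesis .
qed

section \<open>Projection onto additive functions of a set\<close>

definition pair_count :: "nat \<Rightarrow> nat \<Rightarrow> real" where
  "pair_count n d = real ((n - 1) choose (d - 1)) * (real d - 1) / (real n - 1)"

text \<open>The count is the binomial of n - 2 over d - 2. The quotient form gives the correct value
  0 for d = 1, where truncated subtraction would give 1.\<close>

lemma card_subsets_pair:
  assumes fin: "finite I" and kl: "k \<in> I" "l \<in> I" "k \<noteq> l" and d: "1 \<le> d"
  shows "real (card {A \<in> subsets I d. {k, l} \<subseteq> A}) = pair_count (card I) d"
proof -
  have n: "2 \<le> card I" using card_mono[OF fin, of "{k, l}"] kl by auto
  show ?thesis
  proof (cases "d = 1")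
    case True
    have "{A \<in> subsets I d. {k, l} \<subseteq> A} = {}"
    proof -
      have "False" if "A \<in> subsets I d" "{k, l} \<subseteq> A" for A
      proof -
        have "card {k, l} \<le> card A" using that subsets_finite[OF fin that(1)] by (intro card_mono) auto
        then show False using that True kl by (simp add: subsets_def)
      qed
      then show ?thesis by blast
    qed
    then show ?thesis using True by (simp only: card.empty pair_count_def) simp
  next
    case False
    then have d2: "2 \<le> d" using d by simp
    have "card {A \<in> subsets I d. {k, l} \<subseteq> A} = (card I - 2) choose (d - 2)"
      using card_subsets_above[OF fin, of "{k, l}" d] kl d2 by (simp add: numeral_2_eq_2)
    moreover have "(d - 1) * ((card I - 1) choose (d - 1)) = (card I - 1) * ((card I - 2) choose (d - 2))"
      using times_binomial_minus1_eq[of "d - 1" "card I - 1"] d2 by (simp add: numeral_2_eq_2)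
    then have "(real d - 1) * real ((card I - 1) choose (d - 1)) = (real (card I) - 1) * real ((card I - 2) choose (d - 2))"
    proof -
      have "real (d - 1) = real d - 1" "real (card I - 1) = real (card I) - 1" using d n by (simp_all add: of_nat_diff)
      moreover have "real (d - 1) * real ((card I - 1) choose (d - 1)) = real (card I - 1) * real ((card I - 2) choose (d - 2))"
        using \<open>(d - 1) * ((card I - 1) choose (d - 1)) = (card I - 1) * ((card I - 2) choose (d - 2))\<close>
        by (simp only: of_nat_mult[symmetric])
      ultimately show ?thesis by simp
    qed
    ultimately show ?thesis using n by (simp add: pair_count_def field_simps)
  qed
qed

lemma upsum_linear:
  assumes fin: "finite I" and k: "k \<in> I" and d: "1 \<le> d"
  shows "upsum I d (\<lambda>A. \<Sum>l\<in>A. v l) {k} =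
    (real ((card I - 1) choose (d - 1)) - pair_count (card I) d) * v k + pair_count (card I) d * (\<Sum>l\<in>I. v l)"
proof -
  let ?B = "{A \<in> subsets I d. {k} \<subseteq> A}"
  have "upsum I d (\<lambda>A. \<Sum>l\<in>A. v l) {k} = (\<Sum>A\<in>?B. \<Sum>l | l \<in> I \<and> l \<in> A. v l)"
    unfolding upsum_def by (intro sum.cong refl) (auto simp: subsets_def intro!: sum.cong)
  also have "\<dots> = (\<Sum>l\<in>I. \<Sum>A | A \<in> ?B \<and> l \<in> A. v l)"
    using finite_subsets[OF fin] fin by (intro sum.swap_restrict) auto
  also have "\<dots> = (\<Sum>l\<in>I. (if l = k then (real ((card I - 1) choose (d - 1)) - pair_count (card I) d) * v k else 0) + pair_count (card I) d * v l)"
  proof (intro sum.cong refl)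
    fix l assume l: "l \<in> I"
    have e: "{A. A \<in> ?B \<and> l \<in> A} = {A \<in> subsets I d. {k, l} \<subseteq> A}" by auto
    show "(\<Sum>A | A \<in> ?B \<and> l \<in> A. v l) =
      (if l = k then (real ((card I - 1) choose (d - 1)) - pair_count (card I) d) * v k else 0) + pair_count (card I) d * v l"
    proof (cases "l = k")
      case True
      then show ?thesis unfolding e using card_subsets_above[OF fin, of "{k}" d] k d by (simp add: algebra_simps)
    next
      case False
      then show ?thesis unfolding e using card_subsets_pair[OF fin k l _ d] by simp
    qed
  qed
  also have "\<dots> = (real ((card I - 1) choose (d - 1)) - pair_count (card I) d) * v k + pair_count (card I) d * (\<Sum>l\<in>I. v l)"
    using fin k by (simp add: sum.distrib sum_distrib_left)
  finally show ?thesis .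
qed

text \<open>The coefficients of the projection onto linear statistics: the remainder
  \<open>a A - (\<Sum>k\<in>A. v k)\<close> has vanishing one-point marginals, which determines \<open>v\<close>.\<close>

definition marg_gap :: "nat \<Rightarrow> nat \<Rightarrow> real" where
  "marg_gap n d = real ((n - 1) choose (d - 1)) * (real n - real d) / (real n - 1)"

definition lin_coeff :: "'a set \<Rightarrow> nat \<Rightarrow> ('a set \<Rightarrow> real) \<Rightarrow> 'a \<Rightarrow> real" where
  "lin_coeff I d a k =
    (upsum I d a {k} - (real d - 1) / (real (card I) - 1) * (\<Sum>A\<in>subsets I d. a A)) / marg_gap (card I) d"

definition lin_rest :: "'a set \<Rightarrow> nat \<Rightarrow> ('a set \<Rightarrow> real) \<Rightarrow> 'a set \<Rightarrow> real" where
  "lin_rest I d a A = a A - (\<Sum>k\<in>A. lin_coeff I d a k)"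

text \<open>This is the factor with which \<open>v k\<close> enters its own marginal in
  \<open>upsum_linear\<close>; dividing by it inverts the marginal map on additive functions up to a
  multiple of the total.\<close>

lemma marg_gap_eq:
  assumes "2 \<le> n" shows "marg_gap n d = real ((n - 1) choose (d - 1)) - pair_count n d"
  using assms by (simp add: marg_gap_def pair_count_def field_simps)

lemma marg_gap_ge:
  assumes "2 \<le> n" "1 \<le> d" "2 * d \<le> n"
  shows "marg_gap n d \<ge> real ((n - 1) choose (d - 1)) / 2" "marg_gap n d > 0"
proof -
  have "1/2 \<le> (real n - real d) / (real n - 1)" using assms by (simp add: field_simps)
  from mult_left_mono[OF this, of "real ((n - 1) choose (d - 1))"]
  show "marg_gap n d \<ge> real ((n - 1) choose (d - 1)) / 2" by (simp add: marg_gap_def)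
  moreover have "real ((n - 1) choose (d - 1)) > 0" using assms by simp
  ultimately show "marg_gap n d > 0" by linarith
qed

lemma sum_lin_coeff:
  assumes fin: "finite I" and n: "2 \<le> card I" and d: "1 \<le> d" "2 * d \<le> card I"
  shows "(\<Sum>k\<in>I. lin_coeff I d a k) = (\<Sum>A\<in>subsets I d. a A) / real ((card I - 1) choose (d - 1))"
proof -
  let ?n = "real (card I)" and ?N = "\<Sum>A\<in>subsets I d. a A" and ?m = "real ((card I - 1) choose (d - 1))"
  have m: "?m > 0" using d by simp
  have nd: "?n - real d > 0" "?n - 1 > 0" using n d by simp_all
  have "(\<Sum>k\<in>I. lin_coeff I d a k) = (real d * ?N - ?n * ((real d - 1) / (?n - 1) * ?N)) / marg_gap (card I) d"
    by (simp add: lin_coeff_def sum_subtractf sum_upsum_singleton[OF fin] flip: sum_divide_distrib)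
  also have "real d * ?N - ?n * ((real d - 1) / (?n - 1) * ?N) = ?N * (?n - real d) / (?n - 1)"
    using nd by (simp add: field_simps)
  also have "\<dots> / marg_gap (card I) d = ?N / ?m"
    using nd m by (simp add: marg_gap_def)
  finally show ?thesis .
qed

lemma upsum_lin_rest:
  assumes fin: "finite I" and n: "2 \<le> card I" and d: "1 \<le> d" "2 * d \<le> card I" and k: "k \<in> I"
  shows "upsum I d (lin_rest I d a) {k} = 0"
proof -
  let ?N = "\<Sum>A\<in>subsets I d. a A" and ?m = "real ((card I - 1) choose (d - 1))"
  have m: "?m > 0" using d by simp
  have g: "marg_gap (card I) d > 0" by (rule marg_gap_ge[OF n d])
  have "upsum I d (lin_rest I d a) {k} = upsum I d a {k} - upsum I d (\<lambda>A. \<Sum>l\<in>A. lin_coeff I d a l) {k}"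
    by (simp add: lin_rest_def[abs_def] upsum_diff)
  also have "upsum I d (\<lambda>A. \<Sum>l\<in>A. lin_coeff I d a l) {k} =
     marg_gap (card I) d * lin_coeff I d a k + pair_count (card I) d * (?N / ?m)"
    unfolding upsum_linear[OF fin k d(1)] marg_gap_eq[OF n] sum_lin_coeff[OF fin n d] ..
  also have "marg_gap (card I) d * lin_coeff I d a k = upsum I d a {k} - (real d - 1) / (real (card I) - 1) * ?N"
    using g by (simp add: lin_coeff_def)
  also have "pair_count (card I) d * (?N / ?m) = (real d - 1) / (real (card I) - 1) * ?N"
    using m by (simp add: pair_count_def)
  finally show ?thesis by simp
qed

text \<open>Order 0 vanishes together with order 1, since the one-point marginals add up to
  \<open>d\<close> times the total.\<close>

lemma level_lin_rest_01:
  assumes fin: "finite I" and n: "2 \<le> card I" and d: "1 \<le> d" "2 * d \<le> card I" and s: "s < 2"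
    and q: "\<And>A. A \<in> subsets I d \<Longrightarrow> f A = lin_rest I d a A"
  shows "level I d f s = 0"
proof -
  have u: "upsum I d f {k} = 0" if "k \<in> I" for k
    using upsum_lin_rest[OF fin n d that, of a] q by (simp add: upsum_def)
  have "real d * (\<Sum>A\<in>subsets I d. f A) = 0"
    using sum_upsum_singleton[OF fin, of d f] u by simp
  then have "(\<Sum>A\<in>subsets I d. f A) = 0" using d by simp
  then have "level I d f 0 = 0" "level I d f 1 = 0" using u by (simp_all add: level_0[OF fin] level_1 del: One_nat_def)
  then show ?thesis using s by (cases "s = 0") (auto simp: less_2_cases_iff)
qed

lemma level_triangle: "sqrt (level I d (\<lambda>A. f A - g A) s) \<le> sqrt (level I d f s) + sqrt (level I d g s)"
proof -
  have "L2_set (\<lambda>J. upsum I d f J + (- upsum I d g J)) (subsets I s) \<le>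
      L2_set (upsum I d f) (subsets I s) + L2_set (\<lambda>J. - upsum I d g J) (subsets I s)"
    by (rule L2_set_triangle_ineq)
  then show ?thesis by (simp add: level_def L2_set_def upsum_diff)
qed

text \<open>The correction by the total is no larger than the marginals themselves: by
  Cauchy-Schwarz \<open>n * e^2\<close> is at most the level of order 1. This gives a factor 4, and
  \<open>marg_gap\<close>, being at least half of the binomial, gives another 4.\<close>

lemma sum_lin_coeff_squares:
  assumes fin: "finite I" and n: "2 \<le> card I" and d: "1 \<le> d" "2 * d \<le> card I"
  shows "(\<Sum>k\<in>I. (lin_coeff I d a k)\<^sup>2) \<le> 16 * level I d a 1 / (real ((card I - 1) choose (d - 1)))\<^sup>2"
proof -
  let ?n = "real (card I)" and ?m = "real ((card I - 1) choose (d - 1))"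
  define e where "e = (real d - 1) / (?n - 1) * (\<Sum>A\<in>subsets I d. a A)"
  define L where "L = level I d a 1"
  have m: "?m > 0" using d by simp
  have L: "L = (\<Sum>k\<in>I. (upsum I d a {k})\<^sup>2)" by (simp add: L_def level_1 del: One_nat_def)
  have "?n * \<bar>e\<bar> \<le> real d * \<bar>\<Sum>A\<in>subsets I d. a A\<bar>"
  proof -
    have "?n * ((real d - 1) / (?n - 1)) \<le> real d" using n d by (simp add: field_simps)
    moreover have "(real d - 1) / (?n - 1) \<ge> 0" using n d by simp
    ultimately have "?n * (\<bar>(real d - 1) / (?n - 1)\<bar> * \<bar>\<Sum>A\<in>subsets I d. a A\<bar>) \<le> real d * \<bar>\<Sum>A\<in>subsets I d. a A\<bar>"
      using mult_right_mono[of "?n * ((real d - 1) / (?n - 1))" "real d" "\<bar>\<Sum>A\<in>subsets I d. a A\<bar>"]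
      by (simp only: abs_of_nonneg mult.assoc abs_ge_zero)
    then show ?thesis unfolding e_def by (simp only: abs_mult)
  qed
  also have "\<dots> = \<bar>\<Sum>k\<in>I. upsum I d a {k}\<bar>" by (simp add: sum_upsum_singleton[OF fin] abs_mult)
  finally have "(?n * \<bar>e\<bar>)\<^sup>2 \<le> \<bar>\<Sum>k\<in>I. upsum I d a {k}\<bar>\<^sup>2" by (intro power_mono) auto
  also have "\<dots> \<le> ?n * L" using sum_square_le[of "\<lambda>k. upsum I d a {k}" I] by (simp add: L)
  finally have "?n * (?n * e\<^sup>2) \<le> ?n * L" by (simp add: power_mult_distrib power2_eq_square[of ?n] mult.assoc)
  then have ne: "?n * e\<^sup>2 \<le> L" using n by simp
  have "(\<Sum>k\<in>I. (upsum I d a {k} - e)\<^sup>2) \<le> (\<Sum>k\<in>I. 2 * (upsum I d a {k})\<^sup>2 + 2 * e\<^sup>2)"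
  proof (rule sum_mono)
    fix k
    show "(upsum I d a {k} - e)\<^sup>2 \<le> 2 * (upsum I d a {k})\<^sup>2 + 2 * e\<^sup>2"
      using zero_le_power2[of "upsum I d a {k} + e"] by (simp add: power2_diff power2_sum)
  qed
  also have "\<dots> = 2 * L + 2 * (?n * e\<^sup>2)" by (simp add: sum.distrib L sum_distrib_left)
  also have "\<dots> \<le> 4 * L" using ne by simp
  finally have s4: "(\<Sum>k\<in>I. (upsum I d a {k} - e)\<^sup>2) \<le> 4 * L" .
  have L0: "L \<ge> 0" unfolding L_def by (rule level_nonneg)
  have g: "marg_gap (card I) d \<ge> ?m / 2" by (rule marg_gap_ge[OF n d])
  have "(\<Sum>k\<in>I. (lin_coeff I d a k)\<^sup>2) = (\<Sum>k\<in>I. (upsum I d a {k} - e)\<^sup>2) / (marg_gap (card I) d)\<^sup>2"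
    by (simp add: lin_coeff_def e_def power_divide flip: sum_divide_distrib)
  also have "\<dots> \<le> 4 * L / (?m / 2)\<^sup>2"
    using s4 g m L0 by (intro frac_le power_mono) auto
  also have "\<dots> = 16 * L / ?m\<^sup>2" by (simp add: power_divide)
  finally show ?thesis by (simp add: L_def)
qed

text \<open>Order \<open>s\<close> of any function is bounded by its l2 norm, the l2 norm of the
  additive part by order 1 of \<open>a\<close>, and order 1 by order \<open>s\<close> through
  \<open>level_1_le\<close>. The binomials growing with \<open>card I\<close> cancel in
  \<open>cm\<close>, and only factors depending on \<open>d\<close> remain.\<close>

lemma level_linear_le:
  assumes fin: "finite I" and n: "2 \<le> card I" and d: "1 \<le> d" "2 * d \<le> card I" and s: "1 \<le> s" "s \<le> d"
  shows "level I d (\<lambda>A. \<Sum>k\<in>A. lin_coeff I d a k) s \<le> (4 * real d * 2 ^ d)\<^sup>2 * level I d a s"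
proof -
  let ?m = "real ((card I - 1) choose (d - 1))"
  let ?v = "lin_coeff I d a"
  have m: "?m > 0" using d by simp
  have "(\<Sum>A\<in>subsets I d. (\<Sum>k\<in>A. ?v k)\<^sup>2) \<le> (\<Sum>A\<in>subsets I d. real d * (\<Sum>k | k \<in> I \<and> k \<in> A. (?v k)\<^sup>2))"
  proof (rule sum_mono)
    fix A assume A: "A \<in> subsets I d"
    then have "{k. k \<in> I \<and> k \<in> A} = A" "card A = d" by (auto simp: subsets_def)
    then show "(\<Sum>k\<in>A. ?v k)\<^sup>2 \<le> real d * (\<Sum>k | k \<in> I \<and> k \<in> A. (?v k)\<^sup>2)"
      using sum_square_le[of ?v A] by simp
  qed
  also have "\<dots> = real d * (\<Sum>k\<in>I. \<Sum>A | A \<in> subsets I d \<and> k \<in> A. (?v k)\<^sup>2)"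
    unfolding sum_distrib_left[symmetric]
    using finite_subsets[OF fin] fin by (subst sum.swap_restrict) auto
  also have "\<dots> = real d * (\<Sum>k\<in>I. ?m * (?v k)\<^sup>2)"
    using card_subsets_above[OF fin, of "{_}" d] d by simp
  also have "\<dots> = real d * ?m * (\<Sum>k\<in>I. (?v k)\<^sup>2)" by (simp add: sum_distrib_left mult.assoc)
  also have "\<dots> \<le> real d * ?m * (16 * level I d a 1 / ?m\<^sup>2)"
    by (intro mult_left_mono sum_lin_coeff_squares[OF fin n d]) auto
  also have "\<dots> = 16 * real d * level I d a 1 / ?m" using m by (simp add: power2_eq_square)
  also have "\<dots> \<le> 16 * real d * (real ((card I - 1) choose (s - 1)) * real s * level I d a s) / ?m"
    using m by (intro divide_right_mono mult_left_mono level_1_le[OF fin s]) auto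
  finally have 1: "(\<Sum>A\<in>subsets I d. (\<Sum>k\<in>A. ?v k)\<^sup>2) \<le> 16 * real d * (real ((card I - 1) choose (s - 1)) * real s * level I d a s) / ?m" .
  have "((card I - 1) choose (d - 1)) * ((d - 1) choose (s - 1)) = ((card I - 1) choose (s - 1)) * ((card I - 1 - (s - 1)) choose (d - 1 - (s - 1)))"
    using s d by (intro choose_mult) auto
  moreover have "card I - 1 - (s - 1) = card I - s" "d - 1 - (s - 1) = d - s" using s by auto
  ultimately have cm: "real ((card I - s) choose (d - s)) * real ((card I - 1) choose (s - 1)) = ?m * real ((d - 1) choose (s - 1))"
    by (metis of_nat_mult mult.commute)
  have "level I d (\<lambda>A. \<Sum>k\<in>A. ?v k) s \<le> real ((card I - s) choose (d - s)) * real (d choose s) *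
      (16 * real d * (real ((card I - 1) choose (s - 1)) * real s * level I d a s) / ?m)"
    by (rule order_trans[OF level_le_sum_squares[OF fin s(2)]]) (intro mult_left_mono 1, simp)
  also have "\<dots> = (real ((card I - s) choose (d - s)) * real ((card I - 1) choose (s - 1))) * (real (d choose s) * 16 * real d * real s * level I d a s) / ?m"
    by simp
  also have "\<dots> = real ((d - 1) choose (s - 1)) * real (d choose s) * 16 * real d * real s * level I d a s"
    unfolding cm using m by simp
  also have "\<dots> \<le> 2 ^ d * 2 ^ d * 16 * real d * real d * level I d a s"
  proof (intro mult_right_mono mult_mono level_nonneg)
    have "(d - 1) choose (s - 1) \<le> 2 ^ (d - 1)" by (rule binomial_le_pow2)
    also have "(2::nat) ^ (d - 1) \<le> 2 ^ d" by (intro power_increasing) auto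
    finally show "real ((d - 1) choose (s - 1)) \<le> 2 ^ d" by (metis of_nat_le_iff of_nat_numeral of_nat_power)
    show "real (d choose s) \<le> 2 ^ d" using binomial_le_pow2[of d s] by (metis of_nat_le_iff of_nat_numeral of_nat_power)
  qed (use s in auto)
  also have "\<dots> = (4 * real d * 2 ^ d)\<^sup>2 * level I d a s" by (simp add: power_mult_distrib power2_eq_square)
  finally show ?thesis .
qed

lemma level_lin_rest_le:
  assumes fin: "finite I" and n: "2 \<le> card I" and d: "1 \<le> d" "2 * d \<le> card I" and s: "1 \<le> s" "s \<le> d"
  shows "level I d (lin_rest I d a) s \<le> (5 * real d * 2 ^ d)\<^sup>2 * level I d a s"
proof -
  have "sqrt (level I d (lin_rest I d a) s) \<le> sqrt (level I d a s) + sqrt (level I d (\<lambda>A. \<Sum>k\<in>A. lin_coeff I d a k) s)"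
    unfolding lin_rest_def[abs_def] by (rule level_triangle)
  also have "\<dots> \<le> sqrt (level I d a s) + sqrt ((4 * real d * 2 ^ d)\<^sup>2 * level I d a s)"
    by (intro add_left_mono real_sqrt_le_mono level_linear_le assms)
  also have "\<dots> = (1 + 4 * real d * 2 ^ d) * sqrt (level I d a s)"
    by (simp add: real_sqrt_mult distrib_right)
  also have "\<dots> \<le> (5 * real d * 2 ^ d) * sqrt (level I d a s)"
  proof (intro mult_right_mono)
    have "1 * 1 \<le> real d * 2 ^ d" using d by (intro mult_mono) auto
    then show "1 + 4 * real d * 2 ^ d \<le> 5 * real d * 2 ^ d" by simp
  qed (simp add: level_nonneg)
  also have "\<dots> = sqrt ((5 * real d * 2 ^ d)\<^sup>2 * level I d a s)" by (simp add: real_sqrt_mult)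
  finally show ?thesis by simp
qed

section \<open>Permutations acting on marginals\<close>

lemma permutes_image_subsets:
  assumes "p permutes I" shows "bij_betw (\<lambda>A. p ` A) (subsets I d) (subsets I d)"
proof (rule bij_betwI[where g = "\<lambda>A. inv p ` A"])
  have i: "inj p" "inj (inv p)" using assms permutes_inv permutes_inj by blast+
  show "(`) p \<in> subsets I d \<rightarrow> subsets I d"
    using permutes_in_image[OF assms] i by (auto simp: subsets_def card_image inj_on_subset)
  show "(`) (inv p) \<in> subsets I d \<rightarrow> subsets I d"
    using permutes_in_image[OF permutes_inv[OF assms]] i by (auto simp: subsets_def card_image inj_on_subset)
qed (auto simp: image_comp permutes_inv_o[OF assms])

lemma upsum_image:
  assumes "p permutes I"
  shows "upsum I d (\<lambda>A. f (p ` A)) J = upsum I d f (p ` J)"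
proof -
  have inj: "inj p" using assms permutes_inj by blast
  have b: "inj_on (\<lambda>A. p ` A) (subsets I d)" "(\<lambda>A. p ` A) ` subsets I d = subsets I d"
    using permutes_image_subsets[OF assms, of d] by (auto simp: bij_betw_def)
  have "bij_betw (\<lambda>A. p ` A) {A. A \<in> subsets I d \<and> J \<subseteq> A} {A. A \<in> subsets I d \<and> p ` J \<subseteq> A}"
  proof (rule bij_betw_imageI)
    show "inj_on (\<lambda>A. p ` A) {A. A \<in> subsets I d \<and> J \<subseteq> A}"
      by (rule inj_on_subset[OF b(1)]) auto
    show "(\<lambda>A. p ` A) ` {A. A \<in> subsets I d \<and> J \<subseteq> A} = {A. A \<in> subsets I d \<and> p ` J \<subseteq> A}"
    proof (intro equalityI subsetI)
      fix B assume B: "B \<in> {A. A \<in> subsets I d \<and> p ` J \<subseteq> A}"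
      then have "B \<in> (\<lambda>A. p ` A) ` subsets I d" unfolding b(2) by simp
      then obtain A where A: "B = p ` A" "A \<in> subsets I d" by (rule imageE)
      then have "J \<subseteq> A" using B inj by (simp add: inj_image_subset_iff)
      then show "B \<in> (\<lambda>A. p ` A) ` {A. A \<in> subsets I d \<and> J \<subseteq> A}" using A by simp
    next
      fix B assume "B \<in> (\<lambda>A. p ` A) ` {A. A \<in> subsets I d \<and> J \<subseteq> A}"
      then obtain A where A: "B = p ` A" "A \<in> subsets I d" "J \<subseteq> A" by auto
      have "p ` A \<in> (\<lambda>A. p ` A) ` subsets I d" using A(2) by (rule imageI)
      then have "p ` A \<in> subsets I d" by (simp only: b(2))
      then show "B \<in> {A. A \<in> subsets I d \<and> p ` J \<subseteq> A}" using A by auto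
    qed
  qed
  then show ?thesis unfolding upsum_def by (rule sum.reindex_bij_betw)
qed

text \<open>Only marginals at sets meeting {i, j} can change, and their change is bounded by the
  values at \<open>J\<close> and at its swapped copy. Over all pairs the weight \<open>h\<close> of
  a fixed \<open>J\<close> totals \<open>2 * card I * s\<close>.\<close>

lemma sum_level_swap:
  assumes fin: "finite I"
  shows "(\<Sum>i\<in>I. \<Sum>j\<in>I. level I d (\<lambda>A. f A - f (swap i j ` A)) s) \<le> 8 * real (card I) * real s * level I d f s"
proof -
  let ?S = "subsets I s"
  define u where "u = upsum I d f"
  define h where "h i j J = (of_bool (i \<in> J) + of_bool (j \<in> J) :: real)" for i j :: 'a and J
  have "level I d (\<lambda>A. f A - f (swap i j ` A)) s \<le> 4 * (\<Sum>J\<in>?S. h i j J * (u J)\<^sup>2)" if ij: "i \<in> I" "j \<in> I" for i j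
  proof -
    have p: "swap i j permutes I" using ij by (rule permutes_swap_id)
    have "(u J - u (swap i j ` J))\<^sup>2 \<le> 2 * (h i j J * (u J)\<^sup>2) + 2 * (h i j (swap i j ` J) * (u (swap i j ` J))\<^sup>2)" for J
    proof (cases "i \<in> J \<or> j \<in> J")
      case False
      then have "swap i j ` J = J" by (auto simp: Transposition.transpose_def image_iff)
      then show ?thesis by (simp add: h_def)
    next
      case True
      then have "i \<in> swap i j ` J \<or> j \<in> swap i j ` J" by (auto simp: Transposition.transpose_def image_iff)
      then have h: "1 \<le> h i j J" "1 \<le> h i j (swap i j ` J)" using True by (auto simp: h_def)
      have "(u J - u (swap i j ` J))\<^sup>2 \<le> 2 * (u J)\<^sup>2 + 2 * (u (swap i j ` J))\<^sup>2"
        using zero_le_power2[of "u J + u (swap i j ` J)"] by (simp add: power2_diff power2_sum)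
      also have "\<dots> \<le> 2 * (h i j J * (u J)\<^sup>2) + 2 * (h i j (swap i j ` J) * (u (swap i j ` J))\<^sup>2)"
        using mult_right_mono[OF h(1), of "(u J)\<^sup>2"] mult_right_mono[OF h(2), of "(u (swap i j ` J))\<^sup>2"] by simp
      finally show ?thesis .
    qed
    then have "level I d (\<lambda>A. f A - f (swap i j ` A)) s \<le>
      (\<Sum>J\<in>?S. 2 * (h i j J * (u J)\<^sup>2) + 2 * (h i j (swap i j ` J) * (u (swap i j ` J))\<^sup>2))"
      unfolding level_def upsum_diff upsum_image[OF p] u_def by (intro sum_mono)
    also have "\<dots> = 2 * (\<Sum>J\<in>?S. h i j J * (u J)\<^sup>2) + 2 * (\<Sum>J\<in>?S. h i j (swap i j ` J) * (u (swap i j ` J))\<^sup>2)"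
      by (simp add: sum.distrib sum_distrib_left)
    also have "(\<Sum>J\<in>?S. h i j (swap i j ` J) * (u (swap i j ` J))\<^sup>2) = (\<Sum>J\<in>?S. h i j J * (u J)\<^sup>2)"
      by (rule sum.reindex_bij_betw[OF permutes_image_subsets[OF p]])
    finally show ?thesis by simp
  qed
  then have "(\<Sum>i\<in>I. \<Sum>j\<in>I. level I d (\<lambda>A. f A - f (swap i j ` A)) s) \<le> (\<Sum>i\<in>I. \<Sum>j\<in>I. 4 * (\<Sum>J\<in>?S. h i j J * (u J)\<^sup>2))"
    by (intro sum_mono) auto
  also have "\<dots> = 4 * (\<Sum>J\<in>?S. (\<Sum>i\<in>I. \<Sum>j\<in>I. h i j J) * (u J)\<^sup>2)"
    by (simp add: sum_distrib_right sum_swap3[where C = ?S] flip: sum_distrib_left)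
  also have "(\<Sum>J\<in>?S. (\<Sum>i\<in>I. \<Sum>j\<in>I. h i j J) * (u J)\<^sup>2) = (\<Sum>J\<in>?S. (2 * real (card I) * real s) * (u J)\<^sup>2)"
  proof (intro sum.cong refl)
    fix J assume J: "J \<in> ?S"
    then have e: "I \<inter> J = J" "card J = s" by (auto simp: subsets_def)
    have "(\<Sum>i\<in>I. of_bool (i \<in> J)) = real s" using fin e by (simp add: of_bool_def sum.inter_restrict[symmetric])
    then have "(\<Sum>i\<in>I. \<Sum>j\<in>I. h i j J) = 2 * real (card I) * real s"
      by (simp add: h_def sum.distrib flip: sum_distrib_left)
    then show "(\<Sum>i\<in>I. \<Sum>j\<in>I. h i j J) * (u J)\<^sup>2 = (2 * real (card I) * real s) * (u J)\<^sup>2" by simp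
  qed
  also have "4 * \<dots> = 8 * real (card I) * real s * level I d f s"
    by (simp add: level_def u_def flip: sum_distrib_left)
  finally show ?thesis .
qed

lemma level_one:
  assumes fin: "finite I" and s: "s \<le> d"
  shows "level I d (\<lambda>A. 1) s = real (card I choose s) * (real ((card I - s) choose (d - s)))\<^sup>2"
proof -
  have "upsum I d (\<lambda>A. 1) J = real ((card I - s) choose (d - s))" if "J \<in> subsets I s" for J
    using that card_subsets_above[OF fin, of J d] s by (simp add: upsum_def subsets_def)
  then show ?thesis unfolding level_def by (simp add: card_subsets[OF fin])
qed

lemma level_cmult: "level I d (\<lambda>A. c * f A) s = c\<^sup>2 * level I d f s"
  unfolding level_def upsum_def
  by (simp add: power_mult_distrib flip: sum_distrib_left)

text \<open>Constant coefficients, as needed for the second moment of the mean of the whole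
  field.\<close>

lemma level_average:
  assumes fin: "finite I" and s: "s \<le> d" "d \<le> card I"
  shows "level I d (\<lambda>A. 1 / real (card I choose d)) s = (real (d choose s))\<^sup>2 / real (card I choose s)"
proof -
  let ?n = "card I"
  have "(?n choose d) * (d choose s) = (?n choose s) * ((?n - s) choose (d - s))"
    using s by (intro choose_mult) auto
  then have cm: "real (?n choose s) * real ((?n - s) choose (d - s)) = real (?n choose d) * real (d choose s)"
    by (metis of_nat_mult)
  have pos: "real (?n choose d) > 0" "real (?n choose s) > 0" using s by auto
  have "level I d (\<lambda>A. 1 / real (?n choose d)) s = (1 / real (?n choose d))\<^sup>2 * level I d (\<lambda>A. 1) s"
    using level_cmult[of I d "1 / real (?n choose d)" "\<lambda>A. 1" s] by simp
  also have "\<dots> = (real (?n choose s) * real ((?n - s) choose (d - s)))\<^sup>2 / ((real (?n choose d))\<^sup>2 * real (?n choose s))"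
    using pos by (simp add: level_one[OF fin s(1)] power2_eq_square field_simps)
  also have "\<dots> = (real (d choose s))\<^sup>2 / real (?n choose s)"
    unfolding cm using pos by (simp add: power_mult_distrib)
  finally show ?thesis .
qed

section \<open>Exchangeable families indexed by subsets\<close>

lemma abs_sum_cubed_le:
  fixes f :: "'a \<Rightarrow> real"
  shows "\<bar>\<Sum>x\<in>A. f x\<bar> ^ 3 \<le> (real (card A))\<^sup>2 * (\<Sum>x\<in>A. \<bar>f x\<bar> ^ 3)"
proof -
  define a where "a = (\<Sum>x\<in>A. \<bar>f x\<bar>)"
  define q where "q = (\<Sum>x\<in>A. (f x)\<^sup>2)"
  define t where "t = (\<Sum>x\<in>A. \<bar>f x\<bar> ^ 3)"
  have nn: "0 \<le> a" "0 \<le> q" "0 \<le> t" unfolding a_def q_def t_def by (auto intro: sum_nonneg)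
  have 1: "a\<^sup>2 \<le> real (card A) * q"
    using sum_square_le[of "\<lambda>x. \<bar>f x\<bar>" A] by (simp add: a_def q_def)
  have "(a ^ 3)\<^sup>2 = (a\<^sup>2) ^ 3" by (simp flip: power_mult)
  also have "\<dots> \<le> (real (card A) * q) ^ 3" using 1 by (intro power_mono) auto
  also have "\<dots> = real (card A) ^ 3 * q ^ 3" by (rule power_mult_distrib)
  also have "\<dots> \<le> real (card A) ^ 3 * (real (card A) * t\<^sup>2)"
    using sum_square_cubed_le[of f A] by (intro mult_left_mono) (auto simp: q_def t_def)
  also have "\<dots> = ((real (card A))\<^sup>2 * t)\<^sup>2" by (simp add: power2_eq_square power3_eq_cube)
  finally have "a ^ 3 \<le> (real (card A))\<^sup>2 * t"
    by (rule power2_le_imp_le) (use nn in auto)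
  moreover have "\<bar>\<Sum>x\<in>A. f x\<bar> ^ 3 \<le> a ^ 3" unfolding a_def by (intro power_mono sum_abs) auto
  ultimately show ?thesis by (simp add: t_def)
qed

lemma dpow_3_le:
  assumes fin: "finite I"
  shows "dpow I f 3 \<le> 8 * real (card I) * (\<Sum>i\<in>I. \<bar>f i\<bar> ^ 3)"
proof -
  have "\<bar>f i - f j\<bar> ^ 3 \<le> 4 * (\<bar>f i\<bar> ^ 3 + \<bar>f j\<bar> ^ 3)" for i j
  proof -
    have "\<bar>\<Sum>b\<in>UNIV. if b then f i else - f j\<bar> ^ 3 \<le> (real (card (UNIV::bool set)))\<^sup>2 * (\<Sum>b\<in>UNIV. \<bar>if b then f i else - f j\<bar> ^ 3)"
      by (rule abs_sum_cubed_le)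
    then show ?thesis by (simp add: UNIV_bool)
  qed
  then have "dpow I f 3 \<le> (\<Sum>i\<in>I. \<Sum>j\<in>I. 4 * (\<bar>f i\<bar> ^ 3 + \<bar>f j\<bar> ^ 3))"
    unfolding dpow_def by (intro sum_mono)
  also have "\<dots> = 8 * real (card I) * (\<Sum>i\<in>I. \<bar>f i\<bar> ^ 3)"
    by (simp add: sum.distrib algebra_simps flip: sum_distrib_left)
  finally show ?thesis .
qed

lemma dpow_affine: "dpow I (\<lambda>i. (f i - e) / g) k = dpow I f k / \<bar>g\<bar> ^ k"
proof -
  have "\<bar>(f i - e) / g - (f j - e) / g\<bar> ^ k = \<bar>f i - f j\<bar> ^ k / \<bar>g\<bar> ^ k" for i j
    by (simp add: power_divide flip: diff_divide_distrib)
  then show ?thesis by (simp add: dpow_def sum_divide_distrib)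
qed

lemma dpow_2_eq:
  assumes "finite I" shows "dpow I f 2 = 2 * real (card I) * (\<Sum>i\<in>I. (f i)\<^sup>2) - 2 * (\<Sum>i\<in>I. f i)\<^sup>2"
  using sum_pairwise_diff_square[OF assms, of f] by (simp add: dpow_def)

text \<open>Jensen's inequality, obtained from the nonnegative variance of the root; integrability
  comes from \<open>sqrt y \<le> 1 + y\<close>.\<close>

lemma (in prob_space) expectation_sqrt_le:
  assumes int: "integrable M Y" and nn: "\<And>\<omega>. 0 \<le> Y \<omega>"
  shows "integrable M (\<lambda>\<omega>. sqrt (Y \<omega>))" "expectation (\<lambda>\<omega>. sqrt (Y \<omega>)) \<le> sqrt (expectation Y)"
proof -
  have le: "sqrt y \<le> 1 + y" if "0 \<le> y" for y
    using that sqrt_le_D[of "sqrt y" "1 + y"] by (intro real_le_lsqrt) (auto simp: power2_eq_square algebra_simps)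
  show i: "integrable M (\<lambda>\<omega>. sqrt (Y \<omega>))"
    by (rule Bochner_Integration.integrable_bound[of M "\<lambda>\<omega>. 1 + Y \<omega>"]) (use int nn le in auto)
  define c where "c = expectation (\<lambda>\<omega>. sqrt (Y \<omega>))"
  have "0 \<le> expectation (\<lambda>\<omega>. (sqrt (Y \<omega>) - c)\<^sup>2)" by simp
  also have "\<dots> = expectation (\<lambda>\<omega>. Y \<omega> - 2 * c * sqrt (Y \<omega>) + c\<^sup>2)"
    by (rule Bochner_Integration.integral_cong) (simp_all add: power2_diff nn)
  also have "\<dots> = expectation Y - c\<^sup>2"
    using int i by (simp add: prob_space c_def power2_eq_square)
  finally have "c\<^sup>2 \<le> expectation Y" by simp
  then show "expectation (\<lambda>\<omega>. sqrt (Y \<omega>)) \<le> sqrt (expectation Y)" by (simp add: c_def real_le_rsqrt)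
qed

lemma (in prob_space) integral_pavg:
  assumes "finite I" "\<And>p. p permutes I \<Longrightarrow> integrable M (F p)"
  shows "expectation (\<lambda>\<omega>. pavg I (\<lambda>p. F p \<omega>)) = pavg I (\<lambda>p. expectation (F p))"
    "integrable M (\<lambda>\<omega>. pavg I (\<lambda>p. F p \<omega>))"
proof -
  have int: "integrable M (\<lambda>\<omega>. \<Sum>p | p permutes I. F p \<omega>)"
    using assms by (intro Bochner_Integration.integrable_sum) auto
  then show "integrable M (\<lambda>\<omega>. pavg I (\<lambda>p. F p \<omega>))" unfolding pavg_def by (rule integrable_divide_zero)
  show "expectation (\<lambda>\<omega>. pavg I (\<lambda>p. F p \<omega>)) = pavg I (\<lambda>p. expectation (F p))"
    unfolding pavg_def using assms by (simp add: Bochner_Integration.integral_sum)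
qed

text \<open>Interface between tensors and the probabilistic argument. Exchangeability enters through
  its consequences: equal third moments, covariances that depend on the overlap alone, and
  permutation-invariant laws of linear forms.\<close>

locale exch_sets = prob_space M for M :: "'a measure" +
  fixes n d :: nat and x :: "nat set \<Rightarrow> 'a \<Rightarrow> real" and \<delta> :: "nat \<Rightarrow> real" and m3 :: real
  fixes I K
  defines I_def: "I \<equiv> {1..n}" and K_def: "K \<equiv> subsets I d"
  assumes d1: "1 \<le> d" and nd: "2 * d \<le> n"
    and meas [measurable]: "A \<in> K \<Longrightarrow> x A \<in> borel_measurable M"
    and int3: "A \<in> K \<Longrightarrow> integrable M (\<lambda>\<omega>. \<bar>x A \<omega>\<bar> ^ 3)"
    and third: "A \<in> K \<Longrightarrow> expectation (\<lambda>\<omega>. \<bar>x A \<omega>\<bar> ^ 3) = m3"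
    and mean: "A \<in> K \<Longrightarrow> expectation (x A) = 0"
    and var: "A \<in> K \<Longrightarrow> expectation (\<lambda>\<omega>. (x A \<omega>)\<^sup>2) \<le> 1"
    and cor: "A \<in> K \<Longrightarrow> B \<in> K \<Longrightarrow> expectation (\<lambda>\<omega>. x A \<omega> * x B \<omega>) = \<delta> (card (A \<inter> B))"
    and exch: "p permutes I \<Longrightarrow> prob {\<omega>\<in>space M. (\<Sum>A\<in>K. a A * x (p ` A) \<omega>) \<le> z} =
        prob {\<omega>\<in>space M. (\<Sum>A\<in>K. a A * x A \<omega>) \<le> z}"
begin

lemma finI: "finite I" and cardI: "card I = n" and finK: "finite K" and cardK: "card K = n choose d"
  by (auto simp: I_def K_def finite_subsets card_subsets)

lemma n2: "2 \<le> card I"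
  using d1 nd by (simp add: cardI)

lemma dn: "2 * d \<le> card I"
  using nd by (simp add: cardI)

abbreviation Sg :: "nat \<Rightarrow> real" where "Sg \<equiv> alt_diff \<delta>"

lemma imageK: "p permutes I \<Longrightarrow> A \<in> K \<Longrightarrow> p ` A \<in> K"
  unfolding K_def using permutes_image_subsets[of p I d] by (auto simp: bij_betw_def)

lemma int1: "A \<in> K \<Longrightarrow> integrable M (x A)"
  by (rule Bochner_Integration.integrable_bound[of M "\<lambda>\<omega>. 1 + \<bar>x A \<omega>\<bar> ^ 3"])
    (use int3 square_times_le_cubes[of 1 "\<bar>x A _\<bar>"] in auto)

lemma int2: "A \<in> K \<Longrightarrow> integrable M (\<lambda>\<omega>. (x A \<omega>)\<^sup>2)"
  by (rule Bochner_Integration.integrable_bound[of M "\<lambda>\<omega>. 1 + \<bar>x A \<omega>\<bar> ^ 3"])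
    (use int3 square_times_le_cubes[of "\<bar>x A _\<bar>" 1] in \<open>auto simp: add.commute\<close>)

lemma intm: "A \<in> K \<Longrightarrow> B \<in> K \<Longrightarrow> integrable M (\<lambda>\<omega>. x A \<omega> * x B \<omega>)"
proof (rule Bochner_Integration.integrable_bound[of M "\<lambda>\<omega>. (x A \<omega>)\<^sup>2 + (x B \<omega>)\<^sup>2"])
  assume AB: "A \<in> K" "B \<in> K"
  show "integrable M (\<lambda>\<omega>. (x A \<omega>)\<^sup>2 + (x B \<omega>)\<^sup>2)" using AB int2 by auto
  show "(\<lambda>\<omega>. x A \<omega> * x B \<omega>) \<in> borel_measurable M" using AB by measurable
  have "\<bar>y * z\<bar> \<le> y\<^sup>2 + z\<^sup>2" for y z :: real
  proof -
    have "0 \<le> \<bar>y\<bar> * \<bar>z\<bar>" by simp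
    moreover have "2 * (\<bar>y\<bar> * \<bar>z\<bar>) \<le> y\<^sup>2 + z\<^sup>2" using sum_squares_bound[of "\<bar>y\<bar>" "\<bar>z\<bar>"] by (simp add: mult.assoc)
    ultimately show ?thesis unfolding abs_mult by linarith
  qed
  then show "AE \<omega> in M. norm (x A \<omega> * x B \<omega>) \<le> norm ((x A \<omega>)\<^sup>2 + (x B \<omega>)\<^sup>2)" by auto
qed

text \<open>A permutation preserves overlaps, so the second moment is the same for every
  \<open>p\<close> and \<open>overlap_quadratic_form\<close> evaluates it.\<close>

lemma mean_square_linear:
  assumes p: "p permutes I"
  shows "integrable M (\<lambda>\<omega>. (\<Sum>A\<in>K. f A * x (p ` A) \<omega>)\<^sup>2)"
    and "expectation (\<lambda>\<omega>. (\<Sum>A\<in>K. f A * x (p ` A) \<omega>)\<^sup>2) = (\<Sum>s\<le>d. Sg s * level I d f s)"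
proof -
  have e: "(\<Sum>A\<in>K. f A * x (p ` A) \<omega>)\<^sup>2 = (\<Sum>A\<in>K. \<Sum>B\<in>K. f A * f B * (x (p ` A) \<omega> * x (p ` B) \<omega>))" for \<omega>
    by (simp add: power2_eq_square sum_product ac_simps)
  have i: "integrable M (\<lambda>\<omega>. x (p ` A) \<omega> * x (p ` B) \<omega>)" if "A \<in> K" "B \<in> K" for A B
    using that by (intro intm imageK p)
  show "integrable M (\<lambda>\<omega>. (\<Sum>A\<in>K. f A * x (p ` A) \<omega>)\<^sup>2)" unfolding e using i by auto
  have "expectation (\<lambda>\<omega>. (\<Sum>A\<in>K. f A * x (p ` A) \<omega>)\<^sup>2) = (\<Sum>A\<in>K. \<Sum>B\<in>K. f A * f B * expectation (\<lambda>\<omega>. x (p ` A) \<omega> * x (p ` B) \<omega>))"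
    unfolding e using i by (subst Bochner_Integration.integral_sum) (auto intro!: sum.cong Bochner_Integration.integral_sum)
  also have "\<dots> = (\<Sum>A\<in>K. \<Sum>B\<in>K. f A * f B * \<delta> (card (A \<inter> B)))"
  proof (intro sum.cong refl)
    fix A B assume AB: "A \<in> K" "B \<in> K"
    have inj: "inj p" using p permutes_inj by blast
    have "card (p ` A \<inter> p ` B) = card (A \<inter> B)"
      by (metis card_image image_Int inj inj_on_subset subset_UNIV)
    then show "f A * f B * expectation (\<lambda>\<omega>. x (p ` A) \<omega> * x (p ` B) \<omega>) = f A * f B * \<delta> (card (A \<inter> B))"
      using cor[OF imageK[OF p AB(1)] imageK[OF p AB(2)]] by simp
  qed
  also have "\<dots> = (\<Sum>s\<le>d. Sg s * level I d f s)"
    unfolding K_def by (rule overlap_quadratic_form[OF finI])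
  finally show "expectation (\<lambda>\<omega>. (\<Sum>A\<in>K. f A * x (p ` A) \<omega>)\<^sup>2) = (\<Sum>s\<le>d. Sg s * level I d f s)" .
qed

lemma mean_square_id:
  "integrable M (\<lambda>\<omega>. (\<Sum>A\<in>K. f A * x A \<omega>)\<^sup>2)"
  "expectation (\<lambda>\<omega>. (\<Sum>A\<in>K. f A * x A \<omega>)\<^sup>2) = (\<Sum>s\<le>d. Sg s * level I d f s)"
  using mean_square_linear[OF permutes_id, of f] by simp_all

text \<open>Two explicit \<open>d\<close>-sets with overlap \<open>t\<close> fit into
  \<open>I\<close> because \<open>2 * d \<le> n\<close>; the product is then bounded by half the sum
  of squares.\<close>

lemma \<delta>_bound:
  assumes "t \<le> d" shows "\<bar>\<delta> t\<bar> \<le> 1"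
proof -
  define A where "A = {1..d}"
  define B where "B = {1..t} \<union> {d + 1..2 * d - t}"
  have A: "A \<in> K" using nd by (auto simp: A_def K_def subsets_def I_def)
  have "card B = t + (2 * d - t - d)" unfolding B_def using assms by (subst card_Un_disjoint) auto
  then have B: "B \<in> K" using nd assms by (auto simp: B_def K_def subsets_def I_def)
  have AB: "A \<inter> B = {1..t}" using assms by (auto simp: A_def B_def)
  have "\<bar>\<delta> t\<bar> = \<bar>expectation (\<lambda>\<omega>. x A \<omega> * x B \<omega>)\<bar>" using cor[OF A B] AB by simp
  also have "\<dots> \<le> expectation (\<lambda>\<omega>. \<bar>x A \<omega> * x B \<omega>\<bar>)" by simp
  also have "\<dots> \<le> expectation (\<lambda>\<omega>. (x A \<omega>)\<^sup>2 / 2 + (x B \<omega>)\<^sup>2 / 2)"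
  proof (rule integral_mono)
    have "\<bar>y * z\<bar> \<le> y\<^sup>2 / 2 + z\<^sup>2 / 2" for y z :: real
      using sum_squares_bound[of "\<bar>y\<bar>" "\<bar>z\<bar>"] by (simp add: abs_mult)
    then show "\<bar>x A \<omega> * x B \<omega>\<bar> \<le> (x A \<omega>)\<^sup>2 / 2 + (x B \<omega>)\<^sup>2 / 2" for \<omega> .
  qed (use intm[OF A B] int2[OF A] int2[OF B] in auto)
  also have "\<dots> \<le> 1" using int2[OF A] int2[OF B] var[OF A] var[OF B] by simp
  finally show ?thesis .
qed

lemma alt_diff_bound:
  assumes "\<And>t. t \<le> s \<Longrightarrow> \<bar>f t\<bar> \<le> (1::real)" shows "\<bar>alt_diff f s\<bar> \<le> 2 ^ s"
proof -
  have "\<bar>alt_diff f s\<bar> \<le> (\<Sum>t=0..s. real (s choose t))"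
    unfolding alt_diff_def
  proof (rule order_trans[OF sum_abs sum_mono])
    fix t assume "t \<in> {0..s}"
    then have "real (s choose t) * \<bar>f t\<bar> \<le> real (s choose t) * 1" using assms by (intro mult_left_mono) auto
    then show "\<bar>real (s choose t) * (- 1) ^ (s - t) * f t\<bar> \<le> real (s choose t)"
      by (simp add: abs_mult power_abs)
  qed
  also have "\<dots> = real (\<Sum>t\<le>s. s choose t)" by (simp add: atLeast0AtMost)
  also have "\<dots> = 2 ^ s" by (simp add: choose_row_sum del: of_nat_sum)
  finally show ?thesis .
qed

lemma Sg_bound: "s \<le> d \<Longrightarrow> \<bar>Sg s\<bar> \<le> 2 ^ s"
  using \<delta>_bound by (intro alt_diff_bound) auto

definition X :: "nat \<Rightarrow> 'a \<Rightarrow> real" where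
  "X k \<omega> = upsum I d (\<lambda>A. x A \<omega>) {k}"

definition \<mu> :: "'a \<Rightarrow> real" where
  "\<mu> \<omega> = (\<Sum>A\<in>K. x A \<omega>) / real (n choose d)"

definition mu1 :: real where
  "mu1 = real ((n - 1) choose (d - 1))"

lemma mu1_pos: "mu1 > 0"
  using nd d1 by (simp add: mu1_def)

lemma choose_mu1: "real d * real (n choose d) = real n * mu1"
proof -
  have "d * (n choose d) = n * ((n - 1) choose (d - 1))" using d1 by (intro times_binomial_minus1_eq) auto
  then show ?thesis unfolding mu1_def by (metis of_nat_mult)
qed

lemma choose_pos: "real (n choose d) > 0"
  using nd by simp

lemma sum_X: "(\<Sum>k\<in>I. X k \<omega>) = real n * mu1 * \<mu> \<omega>"
proof -
  have "(\<Sum>k\<in>I. X k \<omega>) = real d * real (n choose d) * \<mu> \<omega>"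
    unfolding X_def sum_upsum_singleton[OF finI] \<mu>_def K_def[symmetric] using choose_pos by simp
  then show ?thesis by (simp add: choose_mu1)
qed

lemma measurable_X [measurable]: "X k \<in> borel_measurable M"
  unfolding X_def[abs_def] upsum_def by (intro borel_measurable_sum meas) (simp add: K_def)

lemma measurable_\<mu> [measurable]: "\<mu> \<in> borel_measurable M"
  unfolding \<mu>_def[abs_def] by measurable

lemma \<mu>_moments:
  "integrable M \<mu>" "expectation \<mu> = 0" "integrable M (\<lambda>\<omega>. (\<mu> \<omega>)\<^sup>2)"
  "expectation (\<lambda>\<omega>. (\<mu> \<omega>)\<^sup>2) = (\<Sum>s\<le>d. Sg s * ((real (d choose s))\<^sup>2 / real (n choose s)))"
proof -
  show "integrable M \<mu>" unfolding \<mu>_def[abs_def] using int1 by auto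
  show "expectation \<mu> = 0" unfolding \<mu>_def[abs_def] using int1 mean by (simp add: Bochner_Integration.integral_sum)
  have e: "(\<mu> \<omega>)\<^sup>2 = (\<Sum>A\<in>K. 1 / real (card I choose d) * x A \<omega>)\<^sup>2" for \<omega>
    by (simp add: \<mu>_def cardI sum_divide_distrib)
  show "integrable M (\<lambda>\<omega>. (\<mu> \<omega>)\<^sup>2)" unfolding e by (rule mean_square_id)
  show "expectation (\<lambda>\<omega>. (\<mu> \<omega>)\<^sup>2) = (\<Sum>s\<le>d. Sg s * ((real (d choose s))\<^sup>2 / real (n choose s)))"
    unfolding e mean_square_id using level_average[OF finI, of _ d] nd by (simp add: cardI)
qed

lemma X_third:
  assumes "k \<in> I"
  shows "integrable M (\<lambda>\<omega>. \<bar>X k \<omega>\<bar> ^ 3)" "expectation (\<lambda>\<omega>. \<bar>X k \<omega>\<bar> ^ 3) \<le> mu1 ^ 3 * m3"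
proof -
  let ?B = "{A \<in> K. {k} \<subseteq> A}"
  have c: "real (card ?B) = mu1"
    using card_subsets_above[OF finI, of "{k}" d] assms d1 by (simp add: K_def mu1_def cardI)
  have b: "\<bar>X k \<omega>\<bar> ^ 3 \<le> mu1\<^sup>2 * (\<Sum>A\<in>?B. \<bar>x A \<omega>\<bar> ^ 3)" for \<omega>
    using abs_sum_cubed_le[of "\<lambda>A. x A \<omega>" ?B] unfolding X_def upsum_def K_def[symmetric] c .
  have i: "integrable M (\<lambda>\<omega>. mu1\<^sup>2 * (\<Sum>A\<in>?B. \<bar>x A \<omega>\<bar> ^ 3))" using int3 by auto
  show iX: "integrable M (\<lambda>\<omega>. \<bar>X k \<omega>\<bar> ^ 3)"
    by (rule Bochner_Integration.integrable_bound[OF i]) (use b in \<open>auto intro!: AE_I2 order_trans[OF _ abs_ge_self]\<close>)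
  have "expectation (\<lambda>\<omega>. \<bar>X k \<omega>\<bar> ^ 3) \<le> expectation (\<lambda>\<omega>. mu1\<^sup>2 * (\<Sum>A\<in>?B. \<bar>x A \<omega>\<bar> ^ 3))"
    by (intro integral_mono iX i b)
  also have "\<dots> = mu1\<^sup>2 * (\<Sum>A\<in>?B. m3)" using int3 third by (simp add: Bochner_Integration.integral_sum)
  also have "\<dots> = mu1 ^ 3 * m3" using c by (simp add: power2_eq_square power3_eq_cube)
  finally show "expectation (\<lambda>\<omega>. \<bar>X k \<omega>\<bar> ^ 3) \<le> mu1 ^ 3 * m3" .
qed

end

section \<open>Almost nonnegativity of the finite differences of the correlations\<close>

lemma sum_Pow_card:
  fixes g :: "nat \<Rightarrow> real"
  assumes "finite S"
  shows "(\<Sum>W\<in>Pow S. g (card W)) = (\<Sum>t\<le>card S. real (card S choose t) * g t)"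
proof -
  have "(\<Sum>W\<in>Pow S. g (card W)) = (\<Sum>t\<le>card S. \<Sum>W | W \<in> Pow S \<and> card W = t. g (card W))"
    using assms by (intro sum.group[symmetric]) (auto intro: card_mono)
  also have "\<dots> = (\<Sum>t\<le>card S. real (card S choose t) * g t)"
  proof (intro sum.cong refl)
    fix t
    have "(\<Sum>W | W \<in> Pow S \<and> card W = t. g (card W)) = (\<Sum>W | W \<subseteq> S \<and> card W = t. g t)" by (intro sum.cong) auto
    then show "(\<Sum>W | W \<in> Pow S \<and> card W = t. g (card W)) = real (card S choose t) * g t"
      using n_subsets[OF assms, of t] by simp
  qed
  finally show ?thesis .
qed

text \<open>For fixed \<open>U\<close> the substitution of \<open>sym_diff U W\<close> for
  \<open>U'\<close> turns the sign into that of \<open>W\<close> alone, so the inner sum is the same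
  for each of the \<open>2 ^ card S\<close> sets \<open>U\<close>.\<close>

lemma alt_diff_sym_diff:
  assumes fin: "finite S"
  shows "(\<Sum>U\<in>Pow S. \<Sum>U'\<in>Pow S. (-1) ^ (card U + card U') * h (card S - card (sym_diff U U') + c)) =
    2 ^ card S * alt_diff (\<lambda>t. h (t + c)) (card S)"
proof -
  define s where "s = card S"
  have "(\<Sum>U'\<in>Pow S. (-1) ^ (card U + card U') * h (s - card (sym_diff U U') + c)) = alt_diff (\<lambda>t. h (t + c)) s"
    if U: "U \<in> Pow S" for U
  proof -
    have fU: "finite U" using U fin finite_subset by auto
    have bij: "bij_betw (\<lambda>W. sym_diff U W) (Pow S) (Pow S)"
      by (rule bij_betwI[where g = "\<lambda>W. sym_diff U W"]) (use U in auto)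
    have "(\<Sum>U'\<in>Pow S. (-1) ^ (card U + card U') * h (s - card (sym_diff U U') + c)) =
       (\<Sum>W\<in>Pow S. (-1) ^ (card U + card (sym_diff U W)) * h (s - card (sym_diff U (sym_diff U W)) + c))"
      by (rule sum.reindex_bij_betw[OF bij, symmetric])
    also have "\<dots> = (\<Sum>W\<in>Pow S. (-1) ^ card W * h (s - card W + c))"
    proof (intro sum.cong refl)
      fix W assume "W \<in> Pow S"
      then have fW: "finite W" using fin finite_subset by auto
      have 1: "sym_diff U (sym_diff U W) = W" by auto
      have 2: "card (sym_diff U W) = card (U - W) + card (W - U)" using fU fW by (intro card_Un_disjoint) auto
      have "card U + card (sym_diff U W) + card (W - U) + card (W - U) + card (U \<inter> W) * 0 = card U + card (U - W) + 3 * card (W - U)"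
        using 2 by simp
      have 3: "card U = card (U \<inter> W) + card (U - W)" using fU by (metis card_Int_Diff)
      have 4: "card W = card (U \<inter> W) + card (W - U)" using fW by (metis card_Int_Diff Int_commute)
      have "card U + card (sym_diff U W) = card W + 2 * card (U - W)" using 2 3 4 by simp
      then have "(-1) ^ (card U + card (sym_diff U W)) = ((-1) ^ card W :: real)" by (simp add: power_add)
      then show "(-1) ^ (card U + card (sym_diff U W)) * h (s - card (sym_diff U (sym_diff U W)) + c) = (-1) ^ card W * h (s - card W + c)"
        by (simp only: 1)
    qed
    also have "\<dots> = (\<Sum>t\<le>s. real (s choose t) * ((-1) ^ t * h (s - t + c)))"
      unfolding s_def by (rule sum_Pow_card[OF fin])
    also have "\<dots> = (\<Sum>t\<le>s. real (s choose t) * (-1) ^ (s - t) * h (t + c))"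
      by (rule sum.reindex_bij_witness[where i = "\<lambda>t. s - t" and j = "\<lambda>t. s - t"])
        (auto simp: binomial_symmetric[symmetric])
    finally show ?thesis by (simp add: alt_diff_def atLeast0AtMost)
  qed
  then show ?thesis using fin by (simp add: s_def card_Pow)
qed

context exch_sets
begin

text \<open>\<open>\<Sigma>\<^sub>s\<close> is, up to a diagonal correction, the second moment of an average of \<open>s\<close>-fold
  signed differences over pairwise disjoint blocks \<open>F k\<close>.\<close>

lemma Sg_block_bound:
  assumes s: "s \<le> d" and k: "2 * s + k0 * (d - s) \<le> n"
  shows "0 \<le> real k0 * (alt_diff (\<lambda>t. \<delta> (t + (d - s))) s + (real k0 - 1) * Sg s)"
proof -
  define L where "L = d - s"
  define S where "S = {1..s}"
  \<comment> \<open>Each varying position \<open>r\<close> has two possible points,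
    \<open>2 * r - 1\<close> and \<open>2 * r\<close>. The sets coded by \<open>U\<close> and
    \<open>U'\<close> agree exactly in the positions outside the symmetric difference, and the
    blocks \<open>F k\<close> lie behind all of these points.\<close>
  define e where "e U r = (if r \<in> U then 2 * r - 1 else 2 * r)" for U and r :: nat
  define F where "F k = {2 * s + k * L + 1..2 * s + (k + 1) * L}" for k
  define Q where "Q U k = e U ` S \<union> F k" for U k
  have finS: "finite S" "card S = s" by (auto simp: S_def)
  have e_eq: "e U r = e U' r' \<longleftrightarrow> r = r' \<and> (r \<in> U \<longleftrightarrow> r' \<in> U')" if "r \<in> S" "r' \<in> S" for U U' r r'
  proof -
    have "1 \<le> r" "1 \<le> r'" using that by (auto simp: S_def)
    then show ?thesis by (cases "r \<in> U"; cases "r' \<in> U'") (simp_all add: e_def, presburger+)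
  qed
  have e_rng: "e U ` S \<subseteq> {1..2 * s}" for U by (auto simp: e_def S_def)
  have F_rng: "F k \<subseteq> {2 * s + 1..n}" if "k < k0" for k
  proof -
    have "(k + 1) * L \<le> k0 * L" using that by (intro mult_right_mono) auto
    then show ?thesis using assms(2) by (auto simp: F_def L_def)
  qed
  have F_disj: "F k \<inter> F l = {}" if "k \<noteq> l" for k l
  proof -
    have *: "F k \<inter> F l = {}" if "k < l" for k l
    proof -
      have "(k + 1) * L \<le> l * L" using that by (intro mult_right_mono) auto
      then show ?thesis by (auto simp: F_def)
    qed
    show ?thesis using *[of k l] *[of l k] that by (cases "k < l") auto
  qed
  have ef: "e U ` S \<inter> F k = {}" if "k < k0" for U k
  proof -
    have "{1..2 * s} \<inter> {2 * s + 1..n} = {}" by auto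
    then show ?thesis using e_rng[of U] F_rng[OF that] by blast
  qed
  have cF: "card (F k) = L" for k by (simp add: F_def)
  have cap: "card (Q U k \<inter> Q U' l) = s - card (sym_diff U U') + (if k = l then L else 0)"
    if U: "U \<in> Pow S" "U' \<in> Pow S" and kl: "k < k0" "l < k0" for U U' k l
  proof -
    have "Q U k \<inter> Q U' l = (e U ` S \<inter> e U' ` S) \<union> (F k \<inter> F l)"
      using ef[OF kl(1), of U'] ef[OF kl(2), of U] unfolding Q_def by blast
    moreover have "(e U ` S \<inter> e U' ` S) \<inter> (F k \<inter> F l) = {}"
      using ef[OF kl(1), of U] by blast
    ultimately have "card (Q U k \<inter> Q U' l) = card (e U ` S \<inter> e U' ` S) + card (F k \<inter> F l)"
      using finS by (simp add: card_Un_disjoint F_def)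
    moreover have "card (F k \<inter> F l) = (if k = l then L else 0)" using F_disj[of k l] cF by auto
    moreover have "e U ` S \<inter> e U' ` S = e U ` (S - sym_diff U U')"
    proof (intro equalityI subsetI)
      fix y assume y: "y \<in> e U ` S \<inter> e U' ` S"
      then obtain r r' where r: "r \<in> S" "y = e U r" "r' \<in> S" "y = e U' r'" by auto
      then have "r = r'" "r \<in> U \<longleftrightarrow> r' \<in> U'" using e_eq[of r r' U U'] by auto
      then show "y \<in> e U ` (S - sym_diff U U')" using r by blast
    next
      fix y assume "y \<in> e U ` (S - sym_diff U U')"
      then obtain r where r: "r \<in> S" "y = e U r" "r \<notin> sym_diff U U'" by auto
      then have "y = e U' r" by (auto simp: e_def)
      then show "y \<in> e U ` S \<inter> e U' ` S" using r by blast
    qed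
    moreover have "inj_on (e U) (S - sym_diff U U')" using e_eq by (auto simp: inj_on_def)
    moreover have "card (S - sym_diff U U') = s - card (sym_diff U U')"
      using U finS finite_subset[of _ S] by (subst card_Diff_subset) auto
    ultimately show ?thesis by (simp add: card_image)
  qed
  have QK: "Q U k \<in> K" if "U \<in> Pow S" "k < k0" for U k
  proof -
    have "card (Q U k) = s + L" using cap[OF that(1) that(1) that(2) that(2)] by simp
    moreover have "Q U k \<subseteq> {1..n}" using e_rng[of U] F_rng[OF that(2)] nd s by (auto simp: Q_def)
    ultimately show ?thesis using s by (simp add: K_def subsets_def I_def L_def)
  qed
  \<comment> \<open>Nonnegativity of the second moment of \<open>G\<close> is the whole argument.
    Equal blocks overlap in \<open>L\<close> further points and give the shifted difference,
    distinct blocks give \<open>Sg s\<close>, each with the factor \<open>2 ^ s\<close>.\<close>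
  define G where "G \<omega> = (\<Sum>k<k0. \<Sum>U\<in>Pow S. (-1) ^ card U * x (Q U k) \<omega>)" for \<omega>
  have G2: "(G \<omega>)\<^sup>2 = (\<Sum>k<k0. \<Sum>l<k0. \<Sum>U\<in>Pow S. \<Sum>U'\<in>Pow S. (-1) ^ (card U + card U') * (x (Q U k) \<omega> * x (Q U' l) \<omega>))" for \<omega>
    unfolding G_def power2_eq_square by (simp add: sum_product power_add ac_simps)
  have "0 \<le> expectation (\<lambda>\<omega>. (G \<omega>)\<^sup>2)" by simp
  also have "\<dots> = (\<Sum>k<k0. \<Sum>l<k0. \<Sum>U\<in>Pow S. \<Sum>U'\<in>Pow S. (-1) ^ (card U + card U') * expectation (\<lambda>\<omega>. x (Q U k) \<omega> * x (Q U' l) \<omega>))"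
  proof -
    have "integrable M (\<lambda>\<omega>. x (Q U k) \<omega> * x (Q U' l) \<omega>)" if "U \<subseteq> S" "U' \<subseteq> S" "k < k0" "l < k0" for U U' k l
      using that by (intro intm QK) auto
    then have i: "integrable M (\<lambda>\<omega>. (-1) ^ (card U + card U') * (x (Q U k) \<omega> * x (Q U' l) \<omega>))"
      if "U \<in> Pow S" "U' \<in> Pow S" "k \<in> {..<k0}" "l \<in> {..<k0}" for U U' k l using that by simp
    have "expectation (\<lambda>\<omega>. (G \<omega>)\<^sup>2) = (\<Sum>k<k0. \<Sum>l<k0. \<Sum>U\<in>Pow S. \<Sum>U'\<in>Pow S.
        expectation (\<lambda>\<omega>. (-1) ^ (card U + card U') * (x (Q U k) \<omega> * x (Q U' l) \<omega>)))"
      unfolding G2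
      by (intro trans[OF Bochner_Integration.integral_sum] sum.cong[OF refl] refl Bochner_Integration.integrable_sum i)
    then show ?thesis by simp
  qed
  also have "\<dots> = (\<Sum>k<k0. \<Sum>l<k0. 2 ^ s * alt_diff (\<lambda>t. \<delta> (t + (if k = l then L else 0))) s)"
  proof (intro sum.cong refl)
    fix k l assume kl: "k \<in> {..<k0}" "l \<in> {..<k0}"
    have "(\<Sum>U\<in>Pow S. \<Sum>U'\<in>Pow S. (-1) ^ (card U + card U') * expectation (\<lambda>\<omega>. x (Q U k) \<omega> * x (Q U' l) \<omega>)) =
       (\<Sum>U\<in>Pow S. \<Sum>U'\<in>Pow S. (-1) ^ (card U + card U') * \<delta> (card S - card (sym_diff U U') + (if k = l then L else 0)))"
    proof (intro sum.cong refl)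
      fix U U' assume U: "U \<in> Pow S" "U' \<in> Pow S"
      have "expectation (\<lambda>\<omega>. x (Q U k) \<omega> * x (Q U' l) \<omega>) = \<delta> (card (Q U k \<inter> Q U' l))"
        using kl U by (intro cor QK) auto
      also have "card (Q U k \<inter> Q U' l) = card S - card (sym_diff U U') + (if k = l then L else 0)"
        using cap[OF U] kl finS by auto
      finally show "(-1) ^ (card U + card U') * expectation (\<lambda>\<omega>. x (Q U k) \<omega> * x (Q U' l) \<omega>) =
         (-1) ^ (card U + card U') * \<delta> (card S - card (sym_diff U U') + (if k = l then L else 0))" by simp
    qed
    also have "\<dots> = 2 ^ s * alt_diff (\<lambda>t. \<delta> (t + (if k = l then L else 0))) s"
      using alt_diff_sym_diff[OF finS(1), of \<delta> "if k = l then L else 0"] finS(2) by simp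
    finally show "(\<Sum>U\<in>Pow S. \<Sum>U'\<in>Pow S. (-1) ^ (card U + card U') * expectation (\<lambda>\<omega>. x (Q U k) \<omega> * x (Q U' l) \<omega>)) =
       2 ^ s * alt_diff (\<lambda>t. \<delta> (t + (if k = l then L else 0))) s" .
  qed
  also have "\<dots> = (\<Sum>k<k0. \<Sum>l<k0. 2 ^ s * Sg s + (if k = l then 2 ^ s * (alt_diff (\<lambda>t. \<delta> (t + L)) s - Sg s) else 0))"
    by (intro sum.cong refl) (auto simp: algebra_simps)
  also have "\<dots> = 2 ^ s * (real k0 * (alt_diff (\<lambda>t. \<delta> (t + L)) s + (real k0 - 1) * Sg s))"
    by (simp add: sum.distrib algebra_simps)
  finally have "0 \<le> 2 ^ s * (real k0 * (alt_diff (\<lambda>t. \<delta> (t + L)) s + (real k0 - 1) * Sg s))" .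
  then show ?thesis unfolding L_def by (metis not_le mult_pos_neg zero_less_power zero_less_numeral)
qed

text \<open>Negative values are possible only up to order 1 / n: with about n / d disjoint blocks,
  \<open>Sg_block_bound\<close> leaves \<open>(k0 - 1) * (- Sg s) \<le> 2 ^ d\<close>. For n below 6
  d the crude bound on \<open>Sg\<close> suffices. This is the origin of the summand added to
  \<open>\<Sigma>\<^sub>s\<close> under the root in E3.\<close>

lemma Sg_abs_le:
  assumes s: "s \<le> d"
  shows "\<bar>Sg s\<bar> \<le> Sg s + 16 * real d ^ 2 * 2 ^ d / real n"
proof (cases "Sg s \<ge> 0")
  case True
  then show ?thesis by simp
next
  case False
  have np: "real n > 0" "real d \<ge> 1" using nd d1 by auto
  have ps: "(2::real) ^ s \<le> 2 ^ d" using s by (intro power_increasing) auto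
  have "- 2 * Sg s \<le> 16 * real d ^ 2 * 2 ^ d / real n"
  proof (cases "n \<ge> 6 * d")
    case False
    have "- Sg s \<le> 2 ^ d" using Sg_bound[OF s] ps by linarith
    then have "- 2 * Sg s \<le> 2 * 2 ^ d" by simp
    moreover have "real n \<le> 6 * real d" using False by simp
    ultimately have "- 2 * Sg s * real n \<le> (2 * 2 ^ d) * (6 * real d)"
      by (rule mult_mono) auto
    also have "\<dots> \<le> 16 * real d ^ 2 * 2 ^ d"
    proof -
      have "12 * real d * 1 \<le> 16 * real d * real d" using np(2) by (intro mult_mono) auto
      then have "12 * real d \<le> 16 * (real d * real d)" by simp
      then show ?thesis by (simp add: power2_eq_square)
    qed
    finally show ?thesis using np by (simp add: field_simps)
  next
    case True
    \<comment> \<open>One block fewer than n div d, to leave room for the \<open>2 * s\<close>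
      varying points: \<open>k0 * (d - s) + 2 * s \<le> (k0 + 1) * d\<close>.\<close>
    define k0 where "k0 = n div d - 1"
    have nd6: "6 \<le> n div d" using True d1 by (simp add: less_eq_div_iff_mult_less_eq)
    have "k0 * (d - s) + 2 * s \<le> n"
    proof -
      have "(n div d) * d \<le> n" by simp
      then have "(k0 + 1) * d \<le> n" using nd6 by (simp add: k0_def)
      moreover have "k0 * (d - s) + 2 * s \<le> (k0 + 1) * d"
      proof -
        have "1 * s \<le> k0 * s" using nd6 by (intro mult_right_mono) (auto simp: k0_def)
        moreover have "k0 * (d - s) + k0 * s = k0 * d" using s by (simp flip: distrib_left)
        ultimately show ?thesis using s unfolding add_mult_distrib by linarith
      qed
      ultimately show ?thesis by simp
    qed
    then have b: "0 \<le> real k0 * (alt_diff (\<lambda>t. \<delta> (t + (d - s))) s + (real k0 - 1) * Sg s)"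
      by (intro Sg_block_bound s) simp
    have k5: "real k0 \<ge> 5" using nd6 by (simp add: k0_def)
    have "\<bar>alt_diff (\<lambda>t. \<delta> (t + (d - s))) s\<bar> \<le> 2 ^ s"
      using s by (intro alt_diff_bound \<delta>_bound) auto
    moreover have "0 \<le> alt_diff (\<lambda>t. \<delta> (t + (d - s))) s + (real k0 - 1) * Sg s"
      using b k5 by (simp add: zero_le_mult_iff)
    ultimately have "(real k0 - 1) * (- Sg s) \<le> 2 ^ d" using ps unfolding abs_le_iff mult_minus_right by linarith
    moreover have "real n / (2 * real d) \<le> real k0 - 1"
    proof -
      have "n < (n div d + 1) * d" using d1 by (metis dividend_less_div_times add_mult_distrib mult_1 add.commute less_le_trans zero_less_one)
      then have "real n \<le> (real (n div d) + 1) * real d" by (metis of_nat_less_iff of_nat_mult of_nat_add of_nat_1 less_imp_le)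
      also have "\<dots> = (real k0 + 2) * real d" using nd6 by (simp add: k0_def of_nat_diff)
      also have "\<dots> \<le> (2 * (real k0 - 1)) * real d" using k5 by (intro mult_right_mono) auto
      finally show ?thesis using np by (simp add: field_simps)
    qed
    ultimately have "real n / (2 * real d) * (- Sg s) \<le> 2 ^ d"
      using \<open>\<not> 0 \<le> Sg s\<close> mult_right_mono[of "real n / (2 * real d)" "real k0 - 1" "- Sg s"] by linarith
    then have "- 2 * Sg s * real n \<le> 4 * real d * 2 ^ d" using np by (simp add: field_simps)
    also have "\<dots> \<le> 16 * real d ^ 2 * 2 ^ d"
    proof (intro mult_right_mono)
      show "4 * real d \<le> 16 * real d ^ 2" 
      proof -
        have "4 * real d * 1 \<le> 16 * real d * real d" using np(2) by (intro mult_mono) auto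
        then show ?thesis by (simp add: power2_eq_square)
      qed
    qed simp
    finally show ?thesis using np by (simp add: field_simps)
  qed
  then show ?thesis using False by simp
qed

end

section \<open>Normal approximation of a linear form conditionally on the field\<close>

locale exch_sets_form = exch_sets +
  fixes a :: "nat set \<Rightarrow> real" and \<rho> :: real
  assumes lev1: "level I d a 1 = (real d)\<^sup>2" and \<delta>1: "\<delta> 1 > 0" and \<rho>: "0 < \<rho>" "\<rho> \<le> 1"
begin

definition N0 :: real where "N0 = (\<Sum>A\<in>K. a A)"

definition v :: "nat \<Rightarrow> real" where "v = lin_coeff I d a"

definition V :: "'a \<Rightarrow> real" where "V \<omega> = stat_var I v (\<lambda>k. X k \<omega>)"

definition \<Gamma> :: "'a \<Rightarrow> real" where "\<Gamma> \<omega> = stat_third I v (\<lambda>k. X k \<omega>)"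

definition v0 :: real where "v0 = (real d)\<^sup>2 * \<delta> 1"

text \<open>The factor \<rho> will be the falling factorial (n - 1) ... (n - d + 1) divided by n^(d
  - 1). It converts averages over subsets into averages over all tuples, diagonal ones included, as
  in the oscillation of a tensor.\<close>

definition avg_sq :: "'a \<Rightarrow> real" where
  "avg_sq \<omega> = (\<Sum>k\<in>I. (\<rho> / mu1 * X k \<omega>)\<^sup>2) / real n"

definition osc :: real where "osc = expectation (\<lambda>\<omega>. \<bar>avg_sq \<omega> - \<delta> 1\<bar>)"

text \<open>Finite-population correction: the product of \<open>mu1 / marg_gap\<close> squared with
  \<open>n / (n - 1)\<close>. It is at least 1 and tends to 1; \<open>Gfac\<close> includes \<rho>
  as well.\<close>

definition gfac :: real where "gfac = real n * (real n - 1) / (real n - real d)\<^sup>2"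

definition Gfac :: real where "Gfac = gfac / \<rho>\<^sup>2"

definition Z :: "(nat \<Rightarrow> nat) \<Rightarrow> 'a \<Rightarrow> real" where
  "Z p \<omega> = (\<Sum>A\<in>K. a A * x (p ` A) \<omega>)"

definition R :: "(nat \<Rightarrow> nat) \<Rightarrow> 'a \<Rightarrow> real" where
  "R p \<omega> = (\<Sum>A\<in>K. lin_rest I d a A * x (p ` A) \<omega>)"

lemma v0_pos: "v0 > 0"
  using \<delta>1 d1 by (simp add: v0_def)

lemma n_pos: "real n > 0" "real n - 1 > 0" "real n - real d > 0" "real n - real d \<le> real n - 1"
  using n2 nd d1 by (simp_all add: cardI)

lemma gfac_ge: "gfac \<ge> 1" and Gfac_ge: "Gfac \<ge> 1" "Gfac \<ge> gfac"
proof -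
  have "(real n - real d)\<^sup>2 \<le> (real n - 1) * real n"
    unfolding power2_eq_square using n_pos by (intro mult_mono) auto
  then show g: "gfac \<ge> 1" using n_pos by (simp add: gfac_def mult.commute)
  have "\<rho>\<^sup>2 \<le> 1" using \<rho> by (simp add: power_le_one)
  then show "Gfac \<ge> gfac" using g \<rho> unfolding Gfac_def by (simp add: le_divide_eq mult_left_le)
  with g show "Gfac \<ge> 1" by linarith
qed

text \<open>Cauchy-Schwarz over the points: \<open>d * N0\<close> is the total of the one-point
  marginals, whose squares add up to \<open>d^2\<close>.\<close>

lemma N0_le: "0 \<le> N0\<^sup>2 / real n" "N0\<^sup>2 / real n \<le> 1"
proof -
  have "(real d * N0)\<^sup>2 \<le> real n * (real d)\<^sup>2"
    using sum_square_le[of "\<lambda>k. upsum I d a {k}" I] lev1 sum_upsum_singleton[OF finI, of d a]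
    by (simp add: level_1 N0_def K_def cardI del: One_nat_def)
  then have "N0\<^sup>2 \<le> real n" using d1 by (simp add: power_mult_distrib mult.commute)
  then show "N0\<^sup>2 / real n \<le> 1" using n_pos by simp
qed simp

lemma dpow_v: "dpow I v 2 = 2 * (real d)\<^sup>2 * (real n - N0\<^sup>2) / (marg_gap n d)\<^sup>2"
proof -
  have "dpow I v 2 = dpow I (\<lambda>k. upsum I d a {k}) 2 / (marg_gap n d)\<^sup>2"
    unfolding v_def lin_coeff_def[abs_def] dpow_affine by (simp add: cardI)
  also have "dpow I (\<lambda>k. upsum I d a {k}) 2 = 2 * (real d)\<^sup>2 * (real n - N0\<^sup>2)"
    using lev1 unfolding dpow_2_eq[OF finI] sum_upsum_singleton[OF finI] level_1
    by (simp add: N0_def K_def cardI power_mult_distrib algebra_simps)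
  finally show ?thesis .
qed

text \<open>\<open>dpow\<close> ignores additive constants, so the centring inside
  \<open>lin_coeff\<close> disappears and the conditional variance becomes explicit in
  \<open>avg_sq\<close>, which the oscillation controls, and in the mean of the field.\<close>

lemma V_eq: "V \<omega> = (real d)\<^sup>2 * (1 - N0\<^sup>2 / real n) * gfac * (avg_sq \<omega> / \<rho>\<^sup>2 - (\<mu> \<omega>)\<^sup>2)"
proof -
  have X2: "(\<Sum>k\<in>I. (X k \<omega>)\<^sup>2) = real n * avg_sq \<omega> * mu1\<^sup>2 / \<rho>\<^sup>2"
  proof -
    have "avg_sq \<omega> = (\<rho> / mu1)\<^sup>2 * (\<Sum>k\<in>I. (X k \<omega>)\<^sup>2) / real n"
      unfolding avg_sq_def power_mult_distrib by (simp add: sum_distrib_left)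
    then show ?thesis using n_pos mu1_pos \<rho> by (simp add: power_divide)
  qed
  have "dpow I (\<lambda>k. X k \<omega>) 2 = 2 * (real n)\<^sup>2 * mu1\<^sup>2 * (avg_sq \<omega> / \<rho>\<^sup>2 - (\<mu> \<omega>)\<^sup>2)"
    unfolding dpow_2_eq[OF finI] sum_X X2
    by (simp add: cardI power_mult_distrib right_diff_distrib power2_eq_square[of "real n"])
  then have "V \<omega> = (2 * (real d)\<^sup>2 * (real n - N0\<^sup>2) / (marg_gap n d)\<^sup>2) * (2 * (real n)\<^sup>2 * mu1\<^sup>2 * (avg_sq \<omega> / \<rho>\<^sup>2 - (\<mu> \<omega>)\<^sup>2))
      / (4 * (real n)\<^sup>2 * (real n - 1))"
    by (simp add: V_def stat_var_def dpow_v cardI)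
  also have "\<dots> = (real d)\<^sup>2 * (real n - N0\<^sup>2) * (mu1\<^sup>2 / (marg_gap n d)\<^sup>2 / (real n - 1)) * (avg_sq \<omega> / \<rho>\<^sup>2 - (\<mu> \<omega>)\<^sup>2)"
    using n_pos by simp
  also have "mu1\<^sup>2 / (marg_gap n d)\<^sup>2 / (real n - 1) = gfac / real n"
  proof -
    have "marg_gap n d = mu1 * (real n - real d) / (real n - 1)" by (simp add: marg_gap_def mu1_def)
    then show ?thesis using n_pos mu1_pos by (simp add: gfac_def power_mult_distrib power_divide power2_eq_square)
  qed
  also have "(real d)\<^sup>2 * (real n - N0\<^sup>2) * (gfac / real n) * (avg_sq \<omega> / \<rho>\<^sup>2 - (\<mu> \<omega>)\<^sup>2)
    = (real d)\<^sup>2 * ((real n - N0\<^sup>2) / real n) * gfac * (avg_sq \<omega> / \<rho>\<^sup>2 - (\<mu> \<omega>)\<^sup>2)" by simp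
  also have "(real n - N0\<^sup>2) / real n = 1 - N0\<^sup>2 / real n" using n_pos by (simp add: diff_divide_distrib)
  finally show ?thesis .
qed

definition vdev :: "'a \<Rightarrow> real" where
  "vdev \<omega> = Gfac * (\<bar>avg_sq \<omega> - \<delta> 1\<bar> / \<delta> 1) + (Gfac - 1) + N0\<^sup>2 / real n + gfac * ((\<mu> \<omega>)\<^sup>2 / \<delta> 1)"

lemma V_dev: "\<bar>V \<omega> / v0 - 1\<bar> \<le> vdev \<omega>"
proof -
  define q where "q = 1 - N0\<^sup>2 / real n"
  have q: "0 \<le> q" "q \<le> 1" using N0_le by (auto simp: q_def)
  define y where "y = avg_sq \<omega> / \<delta> 1 - 1"
  define m where "m = (\<mu> \<omega>)\<^sup>2 / \<delta> 1"
  have m: "m \<ge> 0" using \<delta>1 by (simp add: m_def)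
  have "V \<omega> / v0 = q * gfac * (avg_sq \<omega> / \<rho>\<^sup>2 - (\<mu> \<omega>)\<^sup>2) / \<delta> 1"
    using d1 unfolding V_eq v0_def q_def[symmetric] by simp
  also have "\<dots> = q * Gfac * (avg_sq \<omega> / \<delta> 1) - q * gfac * m"
    by (simp add: Gfac_def m_def right_diff_distrib diff_divide_distrib)
  also have "avg_sq \<omega> / \<delta> 1 = y + 1" by (simp add: y_def)
  finally have e: "V \<omega> / v0 - 1 = q * (Gfac * y) + q * (Gfac - 1) - (1 - q) - q * (gfac * m)"
    by (simp add: algebra_simps)
  have "\<bar>q * (Gfac * y)\<bar> \<le> Gfac * \<bar>y\<bar>"
    using q Gfac_ge by (simp add: abs_mult mult_left_le_one_le)
  moreover have "0 \<le> q * (Gfac - 1)" "q * (Gfac - 1) \<le> Gfac - 1"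
    using q Gfac_ge by (auto simp: mult_left_le_one_le)
  moreover have "0 \<le> q * (gfac * m)" "q * (gfac * m) \<le> gfac * m"
    using q gfac_ge m by (auto simp: mult_left_le_one_le)
  ultimately have "\<bar>V \<omega> / v0 - 1\<bar> \<le> Gfac * \<bar>y\<bar> + (Gfac - 1) + (1 - q) + gfac * m"
    unfolding e using q by linarith
  moreover have "\<bar>y\<bar> = \<bar>avg_sq \<omega> - \<delta> 1\<bar> / \<delta> 1"
    using \<delta>1 by (simp add: y_def diff_divide_distrib[of _ "\<delta> 1" "\<delta> 1", simplified, symmetric] field_simps)
  ultimately show ?thesis by (simp add: vdev_def q_def m_def)
qed

text \<open>The additive part is collected by \<open>k\<close>: the images under \<open>p\<close> of
  the sets through \<open>k\<close> are the sets through \<open>p k\<close>, so their entries add up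
  to \<open>X (p k)\<close>.\<close>

lemma Z_eq: "Z p \<omega> = stat I v (\<lambda>k. X k \<omega>) p + R p \<omega>" if p: "p permutes I"
proof -
  have "(\<Sum>A\<in>K. (\<Sum>k\<in>A. v k) * x (p ` A) \<omega>) = (\<Sum>A\<in>K. \<Sum>k | k \<in> I \<and> k \<in> A. v k * x (p ` A) \<omega>)"
  proof (intro sum.cong refl)
    fix A assume "A \<in> K"
    then have "{k. k \<in> I \<and> k \<in> A} = A" by (auto simp: K_def subsets_def)
    then show "(\<Sum>k\<in>A. v k) * x (p ` A) \<omega> = (\<Sum>k | k \<in> I \<and> k \<in> A. v k * x (p ` A) \<omega>)"
      by (simp add: sum_distrib_right)
  qed
  also have "\<dots> = (\<Sum>k\<in>I. \<Sum>A | A \<in> K \<and> k \<in> A. v k * x (p ` A) \<omega>)"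
    using finK finI by (intro sum.swap_restrict)
  also have "\<dots> = (\<Sum>k\<in>I. v k * upsum I d (\<lambda>A. x (p ` A) \<omega>) {k})"
    by (simp add: upsum_def K_def sum_distrib_left)
  also have "\<dots> = stat I v (\<lambda>k. X k \<omega>) p"
    by (simp add: stat_def X_def upsum_image[OF p, of d "\<lambda>A. x A \<omega>"])
  finally show ?thesis
    by (simp add: Z_def R_def lin_rest_def left_diff_distrib sum_subtractf v_def)
qed

lemma stat_mean_eq: "stat_mean I v (\<lambda>k. X k \<omega>) = N0 * \<mu> \<omega>"
proof -
  have "(\<Sum>k\<in>I. v k) = N0 / mu1"
    using sum_lin_coeff[OF finI n2 d1 dn, of a] by (simp only: v_def cardI N0_def K_def mu1_def)
  then show ?thesis using n_pos mu1_pos by (simp add: stat_mean_def sum_X cardI)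
qed

definition err :: "'a \<Rightarrow> real" where
  "err \<omega> = 2 * vdev \<omega> + 1500 / sqrt v0 ^ 3 * \<Gamma> \<omega> +
    3 / sqrt v0 * (sqrt (pavg I (\<lambda>p. (R p \<omega>)\<^sup>2)) + sqrt (dirichlet I (\<lambda>p. R p \<omega>)))"

lemma dirichlet_nonneg: "0 \<le> dirichlet I F"
  unfolding dirichlet_def by (intro divide_nonneg_nonneg sum_nonneg pavg_nonneg) auto

lemma \<Gamma>_nonneg: "0 \<le> \<Gamma> \<omega>"
  unfolding \<Gamma>_def stat_third_def using dpow_nonneg n_pos by (intro divide_nonneg_nonneg mult_nonneg_nonneg) (auto simp: cardI)

text \<open>If the conditional variance is below half of \<open>v0\<close>, twice its relative
  deviation is at least 1 and there is nothing to show. Otherwise \<open>stat_CLT_perturbed\<close>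
  applies and \<open>\<Phi>_scale\<close> replaces the conditional variance by
  \<open>v0\<close>.\<close>

lemma pointwise_bound:
  "\<bar>pavg I (\<lambda>p. of_bool (Z p \<omega> \<le> z)) - \<Phi> ((z - N0 * \<mu> \<omega>) / sqrt v0)\<bar> \<le> err \<omega>"
proof -
  define w where "w = sqrt v0"
  have w: "w > 0" "w\<^sup>2 = v0" using v0_pos by (auto simp: w_def)
  define \<eta> where "\<eta> = sqrt (pavg I (\<lambda>p. (R p \<omega>)\<^sup>2)) + sqrt (dirichlet I (\<lambda>p. R p \<omega>))"
  have \<eta>: "\<eta> \<ge> 0" unfolding \<eta>_def using dirichlet_nonneg by (intro add_nonneg_nonneg real_sqrt_ge_zero pavg_nonneg) auto
  define P where "P = pavg I (\<lambda>p. of_bool (Z p \<omega> \<le> z))"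
  define y where "y = z - N0 * \<mu> \<omega>"
  have tail: "1500 / w ^ 3 * \<Gamma> \<omega> \<ge> 0" "3 / w * \<eta> \<ge> 0" using w \<eta> \<Gamma>_nonneg by auto
  have "\<bar>P - \<Phi> (y / w)\<bar> \<le> 2 * \<bar>V \<omega> / v0 - 1\<bar> + 1500 / w ^ 3 * \<Gamma> \<omega> + 3 / w * \<eta>"
  proof (cases "V \<omega> / v0 \<ge> 1 / 2")
    case False
    have "0 \<le> P" "P \<le> 1"
      using pavg_mono[of I "\<lambda>p. of_bool (Z p \<omega> \<le> z)" "\<lambda>_. 1"] finI
      by (auto simp: P_def pavg_const intro: pavg_nonneg)
    then have "\<bar>P - \<Phi> (y / w)\<bar> \<le> 1" using \<Phi>_nonneg[of "y / w"] \<Phi>_le_1[of "y / w"] by linarith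
    moreover have "1 \<le> 2 * \<bar>u - 1\<bar>" if "\<not> 1 / 2 \<le> u" for u :: real
    proof -
      have "u < 1 / 2" using that by simp
      then have "1 / 2 < - (u - 1)" by simp
      then have "1 / 2 < \<bar>u - 1\<bar>" using abs_ge_minus_self[of "u - 1"] by (rule less_le_trans)
      then show ?thesis by simp
    qed
    then have "1 \<le> 2 * \<bar>V \<omega> / v0 - 1\<bar>" using False by blast
    ultimately show ?thesis using tail by linarith
  next
    case True
    define \<sigma> where "\<sigma> = sqrt (V \<omega>)"
    have Vp: "V \<omega> > 0" "V \<omega> \<ge> v0 / 2" using True v0_pos by (auto simp: field_simps) 
    \<comment> \<open>1.42 is a rational upper bound for the root of 2; its cube times 516 is below
      1500, its double below 3.\<close>
    have "(w / 1.42)\<^sup>2 \<le> V \<omega>" using Vp(2) w v0_pos by (simp add: power_divide power2_eq_square[of "1.42"])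
    then have \<sigma>: "w / 1.42 \<le> \<sigma>" unfolding \<sigma>_def by (rule real_le_rsqrt)
    have \<sigma>p: "\<sigma> > 0" using Vp by (simp add: \<sigma>_def)
    have "\<bar>P - \<Phi> (y / \<sigma>)\<bar> \<le> 516 * \<Gamma> \<omega> / \<sigma> ^ 3 + 2 * \<eta> / \<sigma>"
    proof -
      have "P = pavg I (\<lambda>p. of_bool (stat I v (\<lambda>k. X k \<omega>) p + R p \<omega> \<le> z))"
        unfolding P_def by (rule pavg_cong) (simp add: Z_eq)
      then show ?thesis
        using stat_CLT_perturbed[OF finI n2, of v "\<lambda>k. X k \<omega>" "\<lambda>p. R p \<omega>" z] Vp
        by (simp add: stat_mean_eq \<eta>_def y_def \<sigma>_def V_def \<Gamma>_def)
    qed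
    also have "516 * \<Gamma> \<omega> / \<sigma> ^ 3 \<le> 516 * \<Gamma> \<omega> / (w / 1.42) ^ 3"
      using \<sigma> w \<Gamma>_nonneg by (intro divide_left_mono power_mono mult_pos_pos) (use \<sigma>p in auto)
    also have "\<dots> \<le> 1500 / w ^ 3 * \<Gamma> \<omega>"
    proof -
      have "516 * \<Gamma> \<omega> / (w / 1.42) ^ 3 = (516 * 1.42 ^ 3) * (\<Gamma> \<omega> / w ^ 3)" by (simp add: power_divide)
      also have "\<dots> \<le> 1500 * (\<Gamma> \<omega> / w ^ 3)" using w \<Gamma>_nonneg by (intro mult_right_mono) (auto simp: power3_eq_cube)
      finally show ?thesis by simp
    qed
    also have "2 * \<eta> / \<sigma> \<le> 2 * \<eta> / (w / 1.42)" using \<sigma> w \<eta> \<sigma>p by (intro divide_left_mono) auto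
    also have "\<dots> \<le> 3 / w * \<eta>" using w \<eta> by (simp add: field_simps)
    finally have 1: "\<bar>P - \<Phi> (y / \<sigma>)\<bar> \<le> 1500 / w ^ 3 * \<Gamma> \<omega> + 3 / w * \<eta>" by simp
    have "\<bar>\<Phi> (y / \<sigma>) - \<Phi> (y / w)\<bar> \<le> 2 / 3 * \<bar>V \<omega> / v0 - 1\<bar>"
      unfolding \<sigma>_def w_def by (rule \<Phi>_scale[OF Vp(1) v0_pos])
    then show ?thesis using 1 abs_ge_zero[of "V \<omega> / v0 - 1"] by linarith
  qed
  also have "\<dots> \<le> err \<omega>" using V_dev[of \<omega>] by (simp add: err_def w_def \<eta>_def)
  finally show ?thesis by (simp add: P_def y_def w_def)
qed

definition Qrest :: real where
  "Qrest = (\<Sum>s\<le>d. \<bar>Sg s\<bar> * level I d (lin_rest I d a) s)"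

lemma Qrest_nonneg: "0 \<le> Qrest"
  unfolding Qrest_def by (intro sum_nonneg mult_nonneg_nonneg level_nonneg) auto

lemma R_moments:
  "integrable M (\<lambda>\<omega>. pavg I (\<lambda>p. (R p \<omega>)\<^sup>2))"
  "expectation (\<lambda>\<omega>. pavg I (\<lambda>p. (R p \<omega>)\<^sup>2)) \<le> Qrest"
proof -
  have i: "integrable M (\<lambda>\<omega>. (R p \<omega>)\<^sup>2)" if "p permutes I" for p
    unfolding R_def by (rule mean_square_linear[OF that])
  show "integrable M (\<lambda>\<omega>. pavg I (\<lambda>p. (R p \<omega>)\<^sup>2))" by (intro integral_pavg finI i)
  have "expectation (\<lambda>\<omega>. pavg I (\<lambda>p. (R p \<omega>)\<^sup>2)) = pavg I (\<lambda>p. expectation (\<lambda>\<omega>. (R p \<omega>)\<^sup>2))"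
    by (intro integral_pavg finI i)
  also have "\<dots> = pavg I (\<lambda>p. \<Sum>s\<le>d. Sg s * level I d (lin_rest I d a) s)"
    unfolding R_def by (intro pavg_cong mean_square_linear)
  also have "\<dots> \<le> Qrest"
    unfolding pavg_const[OF finI] Qrest_def by (intro sum_mono mult_right_mono level_nonneg) auto
  finally show "expectation (\<lambda>\<omega>. pavg I (\<lambda>p. (R p \<omega>)\<^sup>2)) \<le> Qrest" .
qed

text \<open>A swap in \<open>p\<close> can be shifted to the coefficients, so the increment is again
  a linear form with a second moment that does not depend on \<open>p\<close>. Summed over the pairs
  and divided by \<open>4 * n\<close>, order \<open>s\<close> costs only the factor
  \<open>2 * s\<close>.\<close>

lemma dirichlet_moments:
  "integrable M (\<lambda>\<omega>. dirichlet I (\<lambda>p. R p \<omega>))"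
  "expectation (\<lambda>\<omega>. dirichlet I (\<lambda>p. R p \<omega>)) \<le> 2 * real d * Qrest"
proof -
  let ?r = "lin_rest I d a"
  have e: "R p \<omega> - R (p \<circ> swap i j) \<omega> = (\<Sum>A\<in>K. (?r A - ?r (swap i j ` A)) * x (p ` A) \<omega>)"
    if ij: "i \<in> I" "j \<in> I" for i j p \<omega>
  proof -
    have "R (p \<circ> swap i j) \<omega> = (\<Sum>A\<in>K. ?r (swap i j ` (swap i j ` A)) * x (p ` (swap i j ` A)) \<omega>)"
      by (simp add: R_def image_comp comp_assoc)
    also have "\<dots> = (\<Sum>A\<in>K. ?r (swap i j ` A) * x (p ` A) \<omega>)"
      unfolding K_def by (rule sum.reindex_bij_betw[OF permutes_image_subsets[OF permutes_swap_id[OF ij]]])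
    finally show ?thesis by (simp add: R_def left_diff_distrib sum_subtractf)
  qed
  have i: "integrable M (\<lambda>\<omega>. (R p \<omega> - R (p \<circ> swap i j) \<omega>)\<^sup>2)" if "p permutes I" "i \<in> I" "j \<in> I" for p i j
    unfolding e[OF that(2,3)] by (rule mean_square_linear[OF that(1)])
  have i2: "integrable M (\<lambda>\<omega>. pavg I (\<lambda>p. (R p \<omega> - R (p \<circ> swap i j) \<omega>)\<^sup>2))" if "i \<in> I" "j \<in> I" for i j
    using that by (intro integral_pavg finI i)
  show "integrable M (\<lambda>\<omega>. dirichlet I (\<lambda>p. R p \<omega>))"
    unfolding dirichlet_def by (intro integrable_divide_zero Bochner_Integration.integrable_sum i2)
  have "expectation (\<lambda>\<omega>. dirichlet I (\<lambda>p. R p \<omega>)) =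
     (\<Sum>i\<in>I. \<Sum>j\<in>I. expectation (\<lambda>\<omega>. pavg I (\<lambda>p. (R p \<omega> - R (p \<circ> swap i j) \<omega>)\<^sup>2))) / (4 * real n)"
    unfolding dirichlet_def cardI integral_divide_zero
    by (intro arg_cong2[where f = "(/)"] trans[OF Bochner_Integration.integral_sum] sum.cong[OF refl] refl Bochner_Integration.integrable_sum i2)
  also have "\<dots> \<le> (\<Sum>i\<in>I. \<Sum>j\<in>I. \<Sum>s\<le>d. \<bar>Sg s\<bar> * level I d (\<lambda>A. ?r A - ?r (swap i j ` A)) s) / (4 * real n)"
  proof (intro divide_right_mono sum_mono)
    fix i j assume ij: "i \<in> I" "j \<in> I"
    have "expectation (\<lambda>\<omega>. pavg I (\<lambda>p. (R p \<omega> - R (p \<circ> swap i j) \<omega>)\<^sup>2)) = pavg I (\<lambda>p. expectation (\<lambda>\<omega>. (R p \<omega> - R (p \<circ> swap i j) \<omega>)\<^sup>2))"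
      using ij by (intro integral_pavg finI i)
    also have "\<dots> = pavg I (\<lambda>p. \<Sum>s\<le>d. Sg s * level I d (\<lambda>A. ?r A - ?r (swap i j ` A)) s)"
      unfolding e[OF ij] by (intro pavg_cong mean_square_linear)
    also have "\<dots> \<le> (\<Sum>s\<le>d. \<bar>Sg s\<bar> * level I d (\<lambda>A. ?r A - ?r (swap i j ` A)) s)"
      unfolding pavg_const[OF finI] by (intro sum_mono mult_right_mono level_nonneg) auto
    finally show "expectation (\<lambda>\<omega>. pavg I (\<lambda>p. (R p \<omega> - R (p \<circ> swap i j) \<omega>)\<^sup>2)) \<le>
       (\<Sum>s\<le>d. \<bar>Sg s\<bar> * level I d (\<lambda>A. ?r A - ?r (swap i j ` A)) s)" .
  qed simp
  also have "(\<Sum>i\<in>I. \<Sum>j\<in>I. \<Sum>s\<le>d. \<bar>Sg s\<bar> * level I d (\<lambda>A. ?r A - ?r (swap i j ` A)) s) =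
     (\<Sum>s\<le>d. \<bar>Sg s\<bar> * (\<Sum>i\<in>I. \<Sum>j\<in>I. level I d (\<lambda>A. ?r A - ?r (swap i j ` A)) s))"
    unfolding sum_swap3[where C = "{..d}"] by (simp add: sum_distrib_left)
  also have "\<dots> \<le> (\<Sum>s\<le>d. \<bar>Sg s\<bar> * (8 * real n * real d * level I d ?r s))"
  proof (intro sum_mono mult_left_mono)
    fix s assume "s \<in> {..d}"
    then have "8 * real n * real s * level I d ?r s \<le> 8 * real n * real d * level I d ?r s"
      by (intro mult_right_mono mult_left_mono level_nonneg) auto
    then show "(\<Sum>i\<in>I. \<Sum>j\<in>I. level I d (\<lambda>A. ?r A - ?r (swap i j ` A)) s) \<le> 8 * real n * real d * level I d ?r s"
      using sum_level_swap[OF finI, of d ?r s] by (simp add: cardI)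
  qed simp
  also have "\<dots> = 8 * real n * real d * Qrest" by (simp add: Qrest_def sum_distrib_left ac_simps)
  finally have "expectation (\<lambda>\<omega>. dirichlet I (\<lambda>p. R p \<omega>)) \<le> 8 * real n * real d * Qrest / (4 * real n)"
    by (simp add: divide_right_mono)
  also have "\<dots> = 2 * real d * Qrest" using n_pos by simp
  finally show "expectation (\<lambda>\<omega>. dirichlet I (\<lambda>p. R p \<omega>)) \<le> 2 * real d * Qrest" .
qed

text \<open>Orders 0 and 1 are absent because the remainder has no one-point marginals; this is why
  the sum in E3 starts at 2.\<close>

lemma Qrest_le: "Qrest \<le> (5 * real d * 2 ^ d)\<^sup>2 * (\<Sum>s=2..d. \<bar>Sg s\<bar> * level I d a s)"
proof -
  have "Qrest = (\<Sum>s=2..d. \<bar>Sg s\<bar> * level I d (lin_rest I d a) s)"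
    unfolding Qrest_def using level_lin_rest_01[OF finI n2 d1 dn, of _ "lin_rest I d a" a]
    by (intro sum.mono_neutral_right) auto
  also have "\<dots> \<le> (\<Sum>s=2..d. \<bar>Sg s\<bar> * ((5 * real d * 2 ^ d)\<^sup>2 * level I d a s))"
    using level_lin_rest_le[OF finI n2 d1 dn, of _ a] by (intro sum_mono mult_left_mono) auto
  also have "\<dots> = (5 * real d * 2 ^ d)\<^sup>2 * (\<Sum>s=2..d. \<bar>Sg s\<bar> * level I d a s)"
    by (simp only: sum_distrib_left mult.left_commute)
  finally show ?thesis .
qed

text \<open>256 is 16 * 2 * 2^3: two uses of \<open>dpow_3_le\<close> against the denominator of
  \<open>stat_third\<close> give 64 / 4, then 2 bounds \<open>n / (n - 1)\<close> and 2^3 the cube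
  of \<open>mu1 / marg_gap\<close>.\<close>

lemma \<Gamma>_moments:
  "integrable M \<Gamma>"
  "expectation \<Gamma> \<le> 256 * m3 * (\<Sum>k\<in>I. \<bar>upsum I d a {k}\<bar> ^ 3)"
proof -
  define g where "g = marg_gap n d"
  have g: "g \<ge> mu1 / 2" unfolding g_def mu1_def using marg_gap_ge[of n d] n2 d1 nd by (simp add: cardI)
  then have gp: "g > 0" using mu1_pos by linarith
  define t where "t = (\<Sum>k\<in>I. \<bar>upsum I d a {k}\<bar> ^ 3)"
  have t0: "t \<ge> 0" unfolding t_def by (intro sum_nonneg) auto
  define n1 where "n1 = real n - 1"
  have n1: "n1 > 0" using n_pos by (simp add: n1_def)
  define C where "C = 64 * (real n)\<^sup>2 * t / g ^ 3 / (4 * (real n)\<^sup>2 * n1)"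
  have C0: "C \<ge> 0" unfolding C_def using t0 gp n1 by simp
  have b: "\<Gamma> \<omega> \<le> C * (\<Sum>k\<in>I. \<bar>X k \<omega>\<bar> ^ 3)" for \<omega>
  proof -
    have "dpow I v 3 = dpow I (\<lambda>k. upsum I d a {k}) 3 / g ^ 3"
      unfolding v_def lin_coeff_def[abs_def] dpow_affine using gp by (simp add: cardI g_def)
    also have "\<dots> \<le> 8 * real n * t / g ^ 3"
      using dpow_3_le[OF finI, of "\<lambda>k. upsum I d a {k}"] gp by (intro divide_right_mono) (auto simp: t_def cardI)
    finally have "dpow I v 3 * dpow I (\<lambda>k. X k \<omega>) 3 \<le> (8 * real n * t / g ^ 3) * (8 * real n * (\<Sum>k\<in>I. \<bar>X k \<omega>\<bar> ^ 3))"
      using dpow_3_le[OF finI, of "\<lambda>k. X k \<omega>"] dpow_nonneg gp t0 by (intro mult_mono) (auto simp: cardI)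
    then have "\<Gamma> \<omega> \<le> ((8 * real n * t / g ^ 3) * (8 * real n * (\<Sum>k\<in>I. \<bar>X k \<omega>\<bar> ^ 3))) / (4 * (real n)\<^sup>2 * (real n - 1))"
      unfolding \<Gamma>_def stat_third_def cardI using n_pos by (intro divide_right_mono) auto
    also have "\<dots> = C * (\<Sum>k\<in>I. \<bar>X k \<omega>\<bar> ^ 3)" unfolding n1_def[symmetric] by (simp add: C_def power2_eq_square)
    finally show ?thesis .
  qed
  have i: "integrable M (\<lambda>\<omega>. C * (\<Sum>k\<in>I. \<bar>X k \<omega>\<bar> ^ 3))" using X_third(1) by auto
  have m: "\<Gamma> \<in> borel_measurable M" unfolding \<Gamma>_def[abs_def] stat_third_def dpow_def by measurable
  show i\<Gamma>: "integrable M \<Gamma>"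
    by (rule Bochner_Integration.integrable_bound[OF i m]) (use b \<Gamma>_nonneg in \<open>auto intro!: AE_I2 order_trans[OF _ abs_ge_self]\<close>)
  have "expectation \<Gamma> \<le> expectation (\<lambda>\<omega>. C * (\<Sum>k\<in>I. \<bar>X k \<omega>\<bar> ^ 3))" by (intro integral_mono i\<Gamma> i b)
  also have "\<dots> = C * (\<Sum>k\<in>I. expectation (\<lambda>\<omega>. \<bar>X k \<omega>\<bar> ^ 3))"
    using X_third(1) by (simp add: Bochner_Integration.integral_sum)
  also have "\<dots> \<le> C * (\<Sum>k\<in>I. mu1 ^ 3 * m3)" using C0 X_third(2) by (intro mult_left_mono sum_mono) auto
  also have "\<dots> = 16 * (real n / (real n - 1)) * (mu1 / g) ^ 3 * m3 * t"
    unfolding n1_def[symmetric] using n_pos gp n1 by (simp add: C_def cardI power_divide power2_eq_square)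
  also have "\<dots> \<le> 16 * 2 * 2 ^ 3 * m3 * t"
  proof (intro mult_right_mono mult_mono power_mono)
    show "real n / (real n - 1) \<le> 2" using n2 n_pos by (simp add: cardI divide_le_eq)
    show "mu1 / g \<le> 2" using g gp by (simp add: divide_le_eq)
    have "{1..d} \<in> K" using nd by (auto simp: K_def subsets_def I_def)
    then have "m3 = expectation (\<lambda>\<omega>. \<bar>x {1..d} \<omega>\<bar> ^ 3)" using third by simp
    also have "\<dots> \<ge> 0" by simp
    finally show "m3 \<ge> 0" .
  qed (use n_pos mu1_pos gp t0 in auto)
  finally show "expectation \<Gamma> \<le> 256 * m3 * (\<Sum>k\<in>I. \<bar>upsum I d a {k}\<bar> ^ 3)" by (simp add: t_def)
qed

end

section \<open>From the conditional to the unconditional law\<close>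

lemma \<Phi>_measurable [measurable]: "\<Phi> \<in> borel_measurable borel"
  by (rule borel_measurable_mono) (auto intro: monoI \<Phi>_mono)

lemma cdf_centered_normal:
  assumes "0 < V" shows "cdf (centered_normal V) x = \<Phi> (x / sqrt V)"
proof -
  define s where "s = sqrt V"
  have s: "s > 0" using assms by (simp add: s_def)
  have "distributed std_normal_distribution lborel (\<lambda>x. x) std_normal_density"
    unfolding distributed_def by (simp add: distr_id2)
  from std.normal_density_affine[OF this, of s 0] s
  have "distributed std_normal_distribution lborel (\<lambda>x. s * x) (normal_density 0 s)" by simp
  then have e: "centered_normal V = distr std_normal_distribution lborel (\<lambda>x. s * x)"
    using assms by (simp add: distributed_def centered_normal_def s_def)
  have "cdf (centered_normal V) x = measure std_normal_distribution ((\<lambda>x. s * x) -` {..x} \<inter> space std_normal_distribution)"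
    unfolding e cdf_def by (rule measure_distr) auto
  also have "(\<lambda>x. s * x) -` {..x} \<inter> space std_normal_distribution = {..x / s}"
    using s by (auto simp: field_simps)
  finally show ?thesis by (simp add: \<Phi>_def cdf_def s_def)
qed

lemma cdf_centered_normal_0: "cdf (centered_normal 0) x = of_bool (0 \<le> x)"
  by (simp add: centered_normal_def cdf_def measure_return)

text \<open>In the degenerate case the limit jumps at 0, where \<Phi> is 1/2, so the distance is at
  most 1/2 while the relative error of the variance is 1.\<close>

lemma centered_normal_diff:
  assumes V: "0 \<le> V" and v: "0 < v"
  shows "\<bar>cdf (centered_normal V) x - \<Phi> (x / sqrt v)\<bar> \<le> 2 / 3 * \<bar>V / v - 1\<bar>"
proof (cases "V = 0")
  case False
  then show ?thesis using \<Phi>_scale[of V v x] V v by (simp add: cdf_centered_normal)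
next
  case True
  have "\<bar>cdf (centered_normal V) x - \<Phi> (x / sqrt v)\<bar> \<le> 1 / 2"
  proof (cases "0 \<le> x")
    case True
    then have "1/2 \<le> \<Phi> (x / sqrt v)" using \<Phi>_mono[of 0 "x / sqrt v"] v by (simp add: \<Phi>_half)
    then show ?thesis using True \<open>V = 0\<close> \<Phi>_le_1[of "x / sqrt v"] by (simp add: cdf_centered_normal_0)
  next
    case False
    then have "\<Phi> (x / sqrt v) \<le> 1/2" using \<Phi>_mono[of "x / sqrt v" 0] v by (simp add: \<Phi>_half divide_nonpos_pos)
    then show ?thesis using False \<open>V = 0\<close> \<Phi>_nonneg[of "x / sqrt v"] by (simp add: cdf_centered_normal_0)
  qed
  then show ?thesis using True by simp
qed

context exch_sets_form
begin

lemma X_square_integrable: "k \<in> I \<Longrightarrow> integrable M (\<lambda>\<omega>. (X k \<omega>)\<^sup>2)"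
  by (rule Bochner_Integration.integrable_bound[of M "\<lambda>\<omega>. 1 + \<bar>X k \<omega>\<bar> ^ 3"])
    (use X_third(1) square_times_le_cubes[of "\<bar>X k _\<bar>" 1] in \<open>auto simp: add.commute\<close>)

lemma vdev_moments:
  "integrable M vdev"
  "expectation vdev = Gfac * (osc / \<delta> 1) + (Gfac - 1) + N0\<^sup>2 / real n + gfac * (expectation (\<lambda>\<omega>. (\<mu> \<omega>)\<^sup>2) / \<delta> 1)"
proof -
  have "integrable M avg_sq"
    unfolding avg_sq_def[abs_def] power_mult_distrib using X_square_integrable
    by (intro integrable_divide_zero Bochner_Integration.integrable_sum integrable_mult_right) auto
  then have i: "integrable M (\<lambda>\<omega>. \<bar>avg_sq \<omega> - \<delta> 1\<bar>)" by auto
  show "integrable M vdev" unfolding vdev_def[abs_def] using i \<mu>_moments(3) by auto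
  show "expectation vdev = Gfac * (osc / \<delta> 1) + (Gfac - 1) + N0\<^sup>2 / real n + gfac * (expectation (\<lambda>\<omega>. (\<mu> \<omega>)\<^sup>2) / \<delta> 1)"
    unfolding vdev_def[abs_def] osc_def using i \<mu>_moments(3) by (simp add: prob_space)
qed

text \<open>\<open>pointwise_bound\<close> integrated: by \<open>exch\<close> every permuted form
  has the same distribution function, so averaging over \<open>p\<close> and over the probability
  space returns that of the original form. The roots in the error pass through the expectation by
  Jensen's inequality.\<close>

lemma cdf_bound:
  defines "m2 \<equiv> expectation (\<lambda>\<omega>. (\<mu> \<omega>)\<^sup>2)"
  shows "\<bar>prob {\<omega>\<in>space M. (\<Sum>A\<in>K. a A * x A \<omega>) \<le> z} - \<Phi> (z / sqrt v0)\<bar> \<le>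
    2 * (Gfac * (osc / \<delta> 1) + (Gfac - 1) + N0\<^sup>2 / real n + gfac * (m2 / \<delta> 1))
    + 384000 * m3 * (\<Sum>k\<in>I. \<bar>upsum I d a {k}\<bar> ^ 3) / sqrt v0 ^ 3
    + 3 / sqrt v0 * (sqrt Qrest + sqrt (2 * real d * Qrest)) + N0\<^sup>2 * m2 / (4 * v0)"
proof -
  define w where "w = sqrt v0"
  have w: "w > 0" "w\<^sup>2 = v0" using v0_pos by (auto simp: w_def)
  define P where "P = prob {\<omega>\<in>space M. (\<Sum>A\<in>K. a A * x A \<omega>) \<le> z}"
  have mZ [measurable]: "Z p \<in> borel_measurable M" if "p permutes I" for p
    unfolding Z_def[abs_def] using imageK[OF that] by (intro borel_measurable_sum borel_measurable_times meas) auto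
  have i1: "integrable M (\<lambda>\<omega>. of_bool (Z p \<omega> \<le> z) :: real)" if "p permutes I" for p
    using mZ[OF that] by (intro integrable_const_bound[of _ 1]) auto
  have "expectation (\<lambda>\<omega>. of_bool (Z p \<omega> \<le> z) :: real) = P" if p: "p permutes I" for p
  proof -
    have "expectation (\<lambda>\<omega>. of_bool (Z p \<omega> \<le> z) :: real) = expectation (indicator {\<omega>\<in>space M. Z p \<omega> \<le> z})"
      by (rule Bochner_Integration.integral_cong) (auto simp: indicator_def)
    also have "\<dots> = prob {\<omega>\<in>space M. Z p \<omega> \<le> z}" using mZ[OF p] by simp
    also have "\<dots> = P" unfolding Z_def P_def by (rule exch[OF p])
    finally show ?thesis .
  qed
  then have EP: "expectation (\<lambda>\<omega>. pavg I (\<lambda>p. of_bool (Z p \<omega> \<le> z))) = P"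
    using integral_pavg(1)[OF finI i1] by (simp add: pavg_const[OF finI] cong: pavg_cong)
  have iP: "integrable M (\<lambda>\<omega>. pavg I (\<lambda>p. of_bool (Z p \<omega> \<le> z)))" by (intro integral_pavg finI i1)
  have i\<Phi>: "integrable M (\<lambda>\<omega>. \<Phi> ((z - N0 * \<mu> \<omega>) / w))"
    by (rule integrable_const_bound[of _ 1]) (use \<Phi>_nonneg \<Phi>_le_1 in auto)
  have sR: "integrable M (\<lambda>\<omega>. sqrt (pavg I (\<lambda>p. (R p \<omega>)\<^sup>2)))"
      "expectation (\<lambda>\<omega>. sqrt (pavg I (\<lambda>p. (R p \<omega>)\<^sup>2))) \<le> sqrt Qrest"
  proof -
    have nn: "0 \<le> pavg I (\<lambda>p. (R p \<omega>)\<^sup>2)" for \<omega> by (rule pavg_nonneg) simp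
    show "integrable M (\<lambda>\<omega>. sqrt (pavg I (\<lambda>p. (R p \<omega>)\<^sup>2)))" by (rule expectation_sqrt_le[OF R_moments(1) nn])
    show "expectation (\<lambda>\<omega>. sqrt (pavg I (\<lambda>p. (R p \<omega>)\<^sup>2))) \<le> sqrt Qrest"
      by (rule order_trans[OF expectation_sqrt_le(2)[OF R_moments(1) nn] real_sqrt_le_mono[OF R_moments(2)]])
  qed
  have sD: "integrable M (\<lambda>\<omega>. sqrt (dirichlet I (\<lambda>p. R p \<omega>)))"
      "expectation (\<lambda>\<omega>. sqrt (dirichlet I (\<lambda>p. R p \<omega>))) \<le> sqrt (2 * real d * Qrest)"
  proof -
    show "integrable M (\<lambda>\<omega>. sqrt (dirichlet I (\<lambda>p. R p \<omega>)))"
      by (rule expectation_sqrt_le[OF dirichlet_moments(1) dirichlet_nonneg])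
    show "expectation (\<lambda>\<omega>. sqrt (dirichlet I (\<lambda>p. R p \<omega>))) \<le> sqrt (2 * real d * Qrest)"
      by (rule order_trans[OF expectation_sqrt_le(2)[OF dirichlet_moments(1) dirichlet_nonneg] real_sqrt_le_mono[OF dirichlet_moments(2)]])
  qed
  have ierr: "integrable M err"
    unfolding err_def[abs_def] using vdev_moments(1) \<Gamma>_moments(1) sR(1) sD(1) by auto
  have "expectation err = 2 * expectation vdev + 1500 / w ^ 3 * expectation \<Gamma> +
     3 / w * (expectation (\<lambda>\<omega>. sqrt (pavg I (\<lambda>p. (R p \<omega>)\<^sup>2))) + expectation (\<lambda>\<omega>. sqrt (dirichlet I (\<lambda>p. R p \<omega>))))"
    unfolding err_def[abs_def] w_def using vdev_moments(1) \<Gamma>_moments(1) sR(1) sD(1) by simp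
  also have "\<dots> \<le> 2 * expectation vdev + 1500 / w ^ 3 * (256 * m3 * (\<Sum>k\<in>I. \<bar>upsum I d a {k}\<bar> ^ 3)) +
     3 / w * (sqrt Qrest + sqrt (2 * real d * Qrest))"
    using w \<Gamma>_moments(2) sR(2) sD(2) by (intro add_mono mult_left_mono order_refl) auto
  finally have Eerr: "expectation err \<le> 2 * expectation vdev + 384000 * m3 * (\<Sum>k\<in>I. \<bar>upsum I d a {k}\<bar> ^ 3) / w ^ 3 +
     3 / w * (sqrt Qrest + sqrt (2 * real d * Qrest))" by simp
  have "\<bar>P - expectation (\<lambda>\<omega>. \<Phi> ((z - N0 * \<mu> \<omega>) / w))\<bar> =
      \<bar>expectation (\<lambda>\<omega>. pavg I (\<lambda>p. of_bool (Z p \<omega> \<le> z)) - \<Phi> ((z - N0 * \<mu> \<omega>) / w))\<bar>"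
    using iP i\<Phi> by (simp add: EP)
  also have "\<dots> \<le> expectation (\<lambda>\<omega>. \<bar>pavg I (\<lambda>p. of_bool (Z p \<omega> \<le> z)) - \<Phi> ((z - N0 * \<mu> \<omega>) / w)\<bar>)" by simp
  also have "\<dots> \<le> expectation err"
    using pointwise_bound[of _ z] iP i\<Phi> ierr by (intro integral_mono) (auto simp: w_def)
  finally have 1: "\<bar>P - expectation (\<lambda>\<omega>. \<Phi> ((z - N0 * \<mu> \<omega>) / w))\<bar> \<le> expectation err" .
  \<comment> \<open>Second-order remainder: the linear term has mean zero since the field is
    centred, so removing the random centre costs only the second moment of
    \<open>\<mu>\<close>.\<close>
  define h where "h \<omega> = \<Phi> ((z - N0 * \<mu> \<omega>) / w) - \<Phi> (z / w) + N0 * \<mu> \<omega> / w * \<phi> (z / w)" for \<omega>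
  have hb: "\<bar>h \<omega>\<bar> \<le> N0\<^sup>2 / (4 * v0) * (\<mu> \<omega>)\<^sup>2" for \<omega>
    using \<Phi>_Taylor[of "z / w" "N0 * \<mu> \<omega> / w"] w
    by (simp add: h_def diff_divide_distrib power_divide power_mult_distrib)
  have ih: "integrable M h" unfolding h_def[abs_def] using i\<Phi> \<mu>_moments(1) by auto
  have "expectation h = expectation (\<lambda>\<omega>. \<Phi> ((z - N0 * \<mu> \<omega>) / w)) - \<Phi> (z / w)"
    unfolding h_def[abs_def] using i\<Phi> \<mu>_moments(1,2) by (simp add: prob_space)
  then have "\<bar>expectation (\<lambda>\<omega>. \<Phi> ((z - N0 * \<mu> \<omega>) / w)) - \<Phi> (z / w)\<bar> = \<bar>expectation h\<bar>" by simp
  also have "\<dots> \<le> expectation (\<lambda>\<omega>. \<bar>h \<omega>\<bar>)" by simp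
  also have "\<dots> \<le> expectation (\<lambda>\<omega>. N0\<^sup>2 / (4 * v0) * (\<mu> \<omega>)\<^sup>2)"
    using hb ih \<mu>_moments(3) by (intro integral_mono) auto
  also have "\<dots> = N0\<^sup>2 * m2 / (4 * v0)" by (simp add: m2_def)
  finally have 2: "\<bar>expectation (\<lambda>\<omega>. \<Phi> ((z - N0 * \<mu> \<omega>) / w)) - \<Phi> (z / w)\<bar> \<le> N0\<^sup>2 * m2 / (4 * v0)" .
  show ?thesis using 1 2 Eerr unfolding vdev_moments(2) P_def[symmetric] w_def[symmetric] m2_def by linarith
qed

end

section \<open>Collecting the error terms\<close>

lemma sqrt_sum_le_sum_sqrt:
  fixes f :: "'a \<Rightarrow> real"
  assumes "\<And>x. x \<in> A \<Longrightarrow> 0 \<le> f x" shows "sqrt (\<Sum>x\<in>A. f x) \<le> (\<Sum>x\<in>A. sqrt (f x))"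
  using L2_set_le_sum[of A "\<lambda>x. sqrt (f x)"] assms by (simp add: L2_set_def)

lemma sum_split_01: "1 \<le> d \<Longrightarrow> (\<Sum>s\<le>d. f s) = f 0 + f 1 + (\<Sum>s=2..d. f s)" for f :: "nat \<Rightarrow> real"
proof -
  assume "1 \<le> d"
  then have "{..d} = {0, 1} \<union> {2..d}" by auto
  then have "(\<Sum>s\<le>d. f s) = (\<Sum>s\<in>{0, 1}. f s) + (\<Sum>s=2..d. f s)"
    by (simp only:) (rule sum.union_disjoint, auto)
  then show ?thesis by simp
qed

lemma powr_split: "0 \<le> (t::real) \<Longrightarrow> t powr \<alpha> * t powr (1 - \<alpha>) = t"
  by (cases "t = 0") (simp_all flip: powr_add)

text \<open>How the exponent \<alpha> enters: a lower bound \<open>t powr \<alpha>\<close> for the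
  variance parameter \<open>D\<close> trades the quotient for a pure power of
  \<open>t\<close>.\<close>

lemma divide_le_powr:
  assumes "0 \<le> (t::real)" "t powr \<alpha> \<le> D" "0 < D"
  shows "t / D \<le> t powr (1 - \<alpha>)"
proof -
  have "t = t powr \<alpha> * t powr (1 - \<alpha>)" using powr_split[OF assms(1)] by simp
  also have "\<dots> \<le> D * t powr (1 - \<alpha>)" using assms by (intro mult_right_mono) auto
  finally show ?thesis using assms by (simp add: divide_le_eq mult.commute)
qed

text \<open>Bookkeeping over abstract variables: \<open>aP\<close> and \<open>aF\<close> stand for
  the distances of the form and of the target normal law to the normal law of variance
  \<open>v0\<close>. The delicate coefficient is that of \<open>T\<close>, where 1/4 from the shift
  and 2/3 from the comparison of variances must add up to at most 1.\<close>

lemma error_budget: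
  fixes aP aF go G N gm X2 X3 X4 RV T Q0 y S c \<epsilon> E2 yy E3 D :: real
  assumes "aP \<le> 2 * (go + (G - 1) + N + gm) + X2 + X3 + X4" "aF \<le> 2 / 3 * RV" "RV \<le> T + Q0 + y"
    "go \<le> 5 / 4 * S" "gm \<le> 5 / 4 * (Q0 + c / 72)" "G - 1 \<le> 5 * \<epsilon>" "\<epsilon> \<le> c / 720" "X2 \<le> E2" "X3 \<le> yy" "yy + y \<le> E3"
    "X4 \<le> T / 4 + Q0 / 4 + N / 2" "Q0 \<le> D + c / 40" "0 \<le> S" "0 \<le> D" "0 \<le> N" "0 \<le> T" "0 \<le> y" "0 \<le> c"
  shows "aP + aF \<le> 5 * S + 5 * D + T + 6 * c + 4 * N + E2 + E3"
  using assms by argo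

context exch_sets_form
begin

lemma Gfac_le:
  assumes e: "real d ^ 2 / real n \<le> 1 / 20" and \<rho>e: "1 - real d ^ 2 / real n \<le> \<rho>"
  shows "Gfac - 1 \<le> 5 * (real d ^ 2 / real n)"
proof -
  define \<epsilon> where "\<epsilon> = real d ^ 2 / real n"
  have \<epsilon>: "0 \<le> \<epsilon>" "\<epsilon> \<le> 1 / 20" using e by (auto simp: \<epsilon>_def)
  have "real d \<le> real d ^ 2" using d1 by (simp add: self_le_power)
  then have "real d / real n \<le> \<epsilon>" unfolding \<epsilon>_def by (intro divide_right_mono) auto
  moreover have "(real n - real d) / real n = 1 - real d / real n" using n_pos by (simp add: diff_divide_distrib)
  ultimately have u: "1 - \<epsilon> \<le> (real n - real d) / real n" by simp
  have "1 - 4 * \<epsilon> \<le> ((1 - \<epsilon>) * (1 - \<epsilon>))\<^sup>2"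
  proof -
    have "1 - 2 * \<epsilon> \<le> (1 - \<epsilon>) * (1 - \<epsilon>)" by (simp add: algebra_simps)
    then have "(1 - 2 * \<epsilon>)\<^sup>2 \<le> ((1 - \<epsilon>) * (1 - \<epsilon>))\<^sup>2" using \<epsilon> by (intro power_mono) auto
    moreover have "1 - 4 * \<epsilon> \<le> (1 - 2 * \<epsilon>)\<^sup>2" by (simp add: power2_eq_square algebra_simps)
    ultimately show ?thesis by linarith
  qed
  also have "\<dots> \<le> ((real n - real d) / real n * \<rho>)\<^sup>2"
    using u \<rho>e \<epsilon> n_pos by (intro power_mono mult_mono) (auto simp: \<epsilon>_def[symmetric])
  finally have 1: "1 - 4 * \<epsilon> \<le> ((real n - real d) / real n * \<rho>)\<^sup>2" .
  have "Gfac \<le> (real n)\<^sup>2 / (real n - real d)\<^sup>2 / \<rho>\<^sup>2"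
    unfolding Gfac_def gfac_def using n_pos by (intro divide_right_mono) (auto simp: power2_eq_square)
  also have "\<dots> = 1 / ((real n - real d) / real n * \<rho>)\<^sup>2"
    by (simp add: power_divide power_mult_distrib)
  also have "\<dots> \<le> 1 / (1 - 4 * \<epsilon>)" using 1 \<epsilon> n_pos \<rho> by (intro divide_left_mono mult_pos_pos) auto
  also have "\<dots> \<le> 1 + 5 * \<epsilon>"
  proof -
    have "\<epsilon> * (20 * \<epsilon>) \<le> \<epsilon> * 1" using \<epsilon> by (intro mult_left_mono) auto
    then have "1 \<le> (1 + 5 * \<epsilon>) * (1 - 4 * \<epsilon>)" by (simp add: algebra_simps)
    then show ?thesis using \<epsilon> by (simp add: divide_le_eq)
  qed
  finally show ?thesis by (simp add: \<epsilon>_def)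
qed

text \<open>Orders 0 and 1 are kept exactly. From order 2 on the denominator is at least (n / d)^2,
  and the three factors \<open>2 ^ d\<close> come from \<open>Sg\<close>, from one of the two
  binomials and from the sum over the other.\<close>

lemma \<mu>_square:
  "\<bar>expectation (\<lambda>\<omega>. (\<mu> \<omega>)\<^sup>2) - (\<delta> 0 + (\<delta> 1 - \<delta> 0) * (real d ^ 2 / real n))\<bar> \<le> 8 ^ d * real d ^ 2 / (real n)\<^sup>2"
proof -
  let ?c = "\<lambda>s. Sg s * ((real (d choose s))\<^sup>2 / real (n choose s))"
  have Sg01: "Sg 0 = \<delta> 0" "Sg 1 = \<delta> 1 - \<delta> 0" by (simp_all add: alt_diff_def)
  have "(\<Sum>s\<le>d. ?c s) = (?c 0 + ?c 1) + (\<Sum>s=2..d. ?c s)"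
    by (rule sum_split_01[OF d1])
  also have "?c 0 + ?c 1 = \<delta> 0 + (\<delta> 1 - \<delta> 0) * (real d ^ 2 / real n)"
    using Sg01 by simp
  finally have "\<bar>expectation (\<lambda>\<omega>. (\<mu> \<omega>)\<^sup>2) - (\<delta> 0 + (\<delta> 1 - \<delta> 0) * (real d ^ 2 / real n))\<bar> = \<bar>\<Sum>s=2..d. ?c s\<bar>"
    by (simp add: \<mu>_moments(4))
  also have "\<dots> \<le> (\<Sum>s=2..d. 2 ^ d * 2 ^ d * (real (d choose s) * (real d ^ 2 / (real n)\<^sup>2)))"
  proof (rule order_trans[OF sum_abs sum_mono])
    fix s assume s: "s \<in> {2..d}"
    have sn: "s \<le> n" using s nd by auto
    \<comment> \<open>The exponent is lowered from \<open>s\<close> to 2 because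
      \<open>n / d\<close> is at least 1, and \<open>s \<le> d\<close> allows the comparison with
      the standard lower bound for binomials.\<close>
    have "(real n / real d)\<^sup>2 \<le> (real n / real d) ^ s" using s nd d1 by (intro power_increasing) auto
    also have "\<dots> \<le> (real n / real s) ^ s" using s d1 by (intro power_mono divide_left_mono) auto
    also have "\<dots> \<le> real (n choose s)" using binomial_ge_n_over_k_pow_k[OF sn, where 'a = real] by simp
    finally have c: "(real n)\<^sup>2 / (real d)\<^sup>2 \<le> real (n choose s)" by (simp add: power_divide)
    have p2: "real (d choose s) \<le> 2 ^ d" using binomial_le_pow2[of d s] by (metis of_nat_le_iff of_nat_numeral of_nat_power)
    have "\<bar>Sg s\<bar> \<le> 2 ^ s" using s by (intro Sg_bound) auto
    also have "\<dots> \<le> 2 ^ d" using s by (intro power_increasing) auto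
    finally have sg: "\<bar>Sg s\<bar> \<le> 2 ^ d" .
    have "(real (d choose s))\<^sup>2 / real (n choose s) \<le> (2 ^ d * real (d choose s)) / ((real n)\<^sup>2 / (real d)\<^sup>2)"
      using c p2 n_pos d1 by (intro frac_le) (auto simp: power2_eq_square mult_right_mono)
    then have "\<bar>Sg s\<bar> * ((real (d choose s))\<^sup>2 / real (n choose s)) \<le> 2 ^ d * ((2 ^ d * real (d choose s)) / ((real n)\<^sup>2 / (real d)\<^sup>2))"
      using sg by (intro mult_mono) auto
    then show "\<bar>?c s\<bar> \<le> 2 ^ d * 2 ^ d * (real (d choose s) * (real d ^ 2 / (real n)\<^sup>2))"
      by (simp add: abs_mult)
  qed
  also have "\<dots> = 2 ^ d * 2 ^ d * ((\<Sum>s=2..d. real (d choose s)) * (real d ^ 2 / (real n)\<^sup>2))"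
    by (simp only: sum_distrib_left[symmetric] sum_distrib_right[symmetric])
  also have "\<dots> \<le> 2 ^ d * 2 ^ d * (2 ^ d * (real d ^ 2 / (real n)\<^sup>2))"
  proof (intro mult_left_mono mult_right_mono)
    have "(\<Sum>s=2..d. real (d choose s)) \<le> (\<Sum>s\<le>d. real (d choose s))" by (intro sum_mono2) auto
    also have "\<dots> = 2 ^ d" using choose_row_sum[of d] by (metis of_nat_numeral of_nat_power of_nat_sum)
    finally show "(\<Sum>s=2..d. real (d choose s)) \<le> 2 ^ d" .
  qed auto
  also have "\<dots> = 8 ^ d * real d ^ 2 / (real n)\<^sup>2" by (simp flip: power_mult_distrib mult.assoc)
  finally show ?thesis .
qed

definition ysum :: real where
  "ysum = (\<Sum>s=2..d. sqrt \<bar>Sg s\<bar> * sqrt (level I d a s)) / sqrt v0"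

lemma ysum_nonneg: "0 \<le> ysum"
  unfolding ysum_def using v0_pos level_nonneg by (intro divide_nonneg_pos sum_nonneg mult_nonneg_nonneg) auto

lemma sum_high_le: "(\<Sum>s=2..d. \<bar>Sg s\<bar> * level I d a s) \<le> (ysum * sqrt v0)\<^sup>2"
proof -
  have "sqrt (\<Sum>s=2..d. \<bar>Sg s\<bar> * level I d a s) \<le> ysum * sqrt v0"
  proof -
    have "sqrt (\<Sum>s=2..d. \<bar>Sg s\<bar> * level I d a s) \<le> (\<Sum>s=2..d. sqrt (\<bar>Sg s\<bar> * level I d a s))"
      by (rule sqrt_sum_le_sum_sqrt) (simp add: level_nonneg)
    then show ?thesis using v0_pos by (simp add: ysum_def real_sqrt_mult)
  qed
  then show ?thesis by (rule sqrt_le_D)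
qed

lemma rest_le: "3 / sqrt v0 * (sqrt Qrest + sqrt (2 * real d * Qrest)) \<le> 45 * real d ^ 2 * 2 ^ d * ysum"
proof -
  define w where "w = sqrt v0"
  have w: "w > 0" using v0_pos by (simp add: w_def)
  have "Qrest \<le> (5 * real d * 2 ^ d)\<^sup>2 * (ysum * w)\<^sup>2"
    unfolding w_def by (rule order_trans[OF Qrest_le]) (intro mult_left_mono sum_high_le, simp)
  also have "\<dots> = (5 * real d * 2 ^ d * (ysum * w))\<^sup>2" by (simp only: power_mult_distrib)
  finally have q: "sqrt Qrest \<le> 5 * real d * 2 ^ d * (ysum * w)"
    using ysum_nonneg w by (intro real_le_lsqrt) (auto simp: Qrest_nonneg)
  have "sqrt (2 * real d) \<le> 2 * real d" using d1 by (intro real_le_lsqrt) (auto simp: power2_eq_square)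
  then have d3: "1 + sqrt (2 * real d) \<le> 3 * real d" using d1 by simp
  have "sqrt Qrest + sqrt (2 * real d * Qrest) = (1 + sqrt (2 * real d)) * sqrt Qrest"
    by (simp add: real_sqrt_mult distrib_right)
  also have "\<dots> \<le> (3 * real d) * (5 * real d * 2 ^ d * (ysum * w))"
    using d3 q Qrest_nonneg by (intro mult_mono) auto
  finally have "3 / w * (sqrt Qrest + sqrt (2 * real d * Qrest)) \<le> 3 / w * ((3 * real d) * (5 * real d * 2 ^ d * (ysum * w)))"
    using w by (intro mult_left_mono) auto
  also have "\<dots> = 45 * real d ^ 2 * 2 ^ d * ysum" using w by (simp add: power2_eq_square)
  finally show ?thesis by (simp add: w_def)
qed

definition var_form :: real where
  "var_form = expectation (\<lambda>\<omega>. (\<Sum>A\<in>K. a A * x A \<omega>)\<^sup>2)"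

text \<open>In the exact variance the orders 0 and 1 give \<open>v0\<close> up to multiples of
  \<open>\<delta> 0\<close>; all higher orders are collected in \<open>ysum\<close>, where
  \<open>\<Sigma>\<^sub>s\<close> enters by absolute value.\<close>

lemma var_form_ratio:
  "\<bar>var_form / v0 - 1\<bar> \<le> \<bar>\<delta> 0 / v0 * (N0\<^sup>2 - 1)\<bar> + \<bar>\<delta> 0\<bar> / \<delta> 1 + ysum\<^sup>2"
proof -
  have Sg01: "Sg 0 = \<delta> 0" "Sg 1 = \<delta> 1 - \<delta> 0" by (simp_all add: alt_diff_def)
  have l0: "level I d a 0 = N0\<^sup>2" using level_0[OF finI, of d a] by (simp add: N0_def K_def)
  define H where "H = (\<Sum>s=2..d. Sg s * level I d a s)"
  have "var_form = (Sg 0 * level I d a 0 + Sg 1 * level I d a 1) + H"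
    unfolding var_form_def mean_square_id H_def by (rule sum_split_01[OF d1])
  also have "Sg 0 * level I d a 0 + Sg 1 * level I d a 1 = \<delta> 0 * N0\<^sup>2 + (\<delta> 1 - \<delta> 0) * (real d)\<^sup>2"
    using Sg01 l0 lev1 by simp
  finally have "var_form - v0 = \<delta> 0 * (N0\<^sup>2 - 1) - \<delta> 0 * ((real d)\<^sup>2 - 1) + H"
    by (simp add: v0_def algebra_simps)
  then have "var_form / v0 - 1 = \<delta> 0 / v0 * (N0\<^sup>2 - 1) - \<delta> 0 * ((real d)\<^sup>2 - 1) / v0 + H / v0"
    using v0_pos by (simp add: field_simps)
  moreover have "\<bar>\<delta> 0 * ((real d)\<^sup>2 - 1) / v0\<bar> \<le> \<bar>\<delta> 0\<bar> / \<delta> 1"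
  proof -
    have "\<bar>\<delta> 0 * ((real d)\<^sup>2 - 1) / v0\<bar> = \<bar>\<delta> 0\<bar> * ((real d)\<^sup>2 - 1) / v0"
      using v0_pos d1 by (simp add: abs_mult)
    also have "\<dots> \<le> \<bar>\<delta> 0\<bar> * (real d)\<^sup>2 / v0" using v0_pos by (intro divide_right_mono mult_left_mono) auto
    also have "\<dots> = \<bar>\<delta> 0\<bar> / \<delta> 1" using d1 by (simp add: v0_def)
    finally show ?thesis .
  qed
  moreover have "\<bar>H / v0\<bar> \<le> ysum\<^sup>2"
  proof -
    have "\<bar>H\<bar> \<le> (\<Sum>s=2..d. \<bar>Sg s\<bar> * level I d a s)"
      unfolding H_def by (rule order_trans[OF sum_abs]) (simp add: abs_mult level_nonneg)
    also have "\<dots> \<le> ysum\<^sup>2 * v0" using sum_high_le v0_pos by (simp add: power_mult_distrib)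
    finally show ?thesis using v0_pos by (simp add: divide_le_eq)
  qed
  ultimately show ?thesis by linarith
qed

text \<open>The hypothesis controls \<open>B\<close> instead of
  \<open>\<bar>\<delta> 0\<bar>\<close>. If \<open>\<bar>\<delta> 0\<bar> powr \<alpha>\<close>
  exceeds \<open>\<delta> 1\<close>, then \<open>B\<close> is below
  \<open>\<bar>\<delta> 0\<bar>\<close>, so the power obtained for \<open>B\<close> is dominated by
  the one for \<open>\<bar>\<delta> 0\<bar>\<close> and only the error \<open>e\<close> is left
  over.\<close>

lemma delta_0_ratio:
  fixes B \<alpha> r e :: real
  assumes \<alpha>: "0 < \<alpha>" "\<alpha> < 1" and B: "0 \<le> B" "B powr \<alpha> \<le> \<delta> 1" and de: "\<bar>\<delta> 0\<bar> \<le> B + e" and e: "0 \<le> e"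
  shows "\<bar>\<delta> 0\<bar> / \<delta> 1 \<le> \<bar>\<delta> 0\<bar> powr (1 - \<alpha>) + e / \<delta> 1"
proof (cases "\<bar>\<delta> 0\<bar> powr \<alpha> \<le> \<delta> 1")
  case True
  then have "\<bar>\<delta> 0\<bar> / \<delta> 1 \<le> \<bar>\<delta> 0\<bar> powr (1 - \<alpha>)" using \<delta>1 by (intro divide_le_powr) auto
  then show ?thesis using e \<delta>1 by (simp add: add_increasing2)
next
  case False
  then have lt: "B powr \<alpha> < \<bar>\<delta> 0\<bar> powr \<alpha>" using B by linarith
  have "B \<le> \<bar>\<delta> 0\<bar>"
  proof (rule ccontr)
    assume "\<not> ?thesis"
    then have "\<bar>\<delta> 0\<bar> powr \<alpha> \<le> B powr \<alpha>" using \<alpha> by (intro powr_mono2) auto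
    then show False using lt by simp
  qed
  then have "B powr (1 - \<alpha>) \<le> \<bar>\<delta> 0\<bar> powr (1 - \<alpha>)" using \<alpha> B by (intro powr_mono2) auto
  moreover have "B / \<delta> 1 \<le> B powr (1 - \<alpha>)" using B \<delta>1 by (intro divide_le_powr) auto
  moreover have "\<bar>\<delta> 0\<bar> / \<delta> 1 \<le> B / \<delta> 1 + e / \<delta> 1"
    using de \<delta>1 by (simp add: divide_right_mono flip: add_divide_distrib)
  ultimately show ?thesis by linarith
qed

text \<open>The comparison passes through the normal law of variance \<open>v0\<close>:
  \<open>cdf_bound\<close> estimates the distance from the form to it, \<open>var_form_ratio\<close>
  the distance from it to the target. A right side of at least 1 leaves nothing to show, and this
  supplies every smallness condition used.\<close>

lemma final_bound:
  fixes \<kappa> \<alpha> B r :: real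
  assumes \<kappa>: "\<kappa> = 20 * real d ^ 3 * 18 ^ d * fact (2 * d)" and \<alpha>: "0 < \<alpha>" "\<alpha> < 1"
    and B: "B = r\<^sup>2 * expectation (\<lambda>\<omega>. (\<mu> \<omega>)\<^sup>2)" and r: "1 - real d ^ 2 / real n \<le> r" "0 \<le> r" "r \<le> 1"
    and \<rho>e: "1 - real d ^ 2 / real n \<le> \<rho>"
    and h1: "osc powr \<alpha> \<le> \<delta> 1" and h2: "B powr \<alpha> \<le> \<delta> 1" and h3: "(\<kappa> / real n) powr \<alpha> \<le> \<delta> 1"
  shows "\<bar>prob {\<omega>\<in>space M. (\<Sum>A\<in>K. a A * x A \<omega>) \<le> z} - cdf (centered_normal var_form) z\<bar> \<le>
      (5 * osc powr (1 - \<alpha>) + 5 * \<bar>\<delta> 0\<bar> powr (1 - \<alpha>) + \<bar>\<delta> 0 / (real d ^ 2 * \<delta> 1) * (N0\<^sup>2 - 1)\<bar>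
        + 6 * \<kappa> / real n powr (1 - \<alpha>) + 4 * (N0\<^sup>2 / real n))
      + 2 ^ 36 * (m3 / \<delta> 1 powr (3 / 2)) * (\<Sum>k\<in>I. \<bar>upsum I d a {k} / real d\<bar> ^ 3)
      + 3 * \<kappa> * (1 / (real d * sqrt (\<delta> 1))) *
        (\<Sum>s=2..d. sqrt (Sg s + 16 * real d ^ 2 * 2 ^ d / real n) * sqrt (level I d a s))"
proof -
  define P where "P = prob {\<omega>\<in>space M. (\<Sum>A\<in>K. a A * x A \<omega>) \<le> z}"
  define E1 where "E1 = 5 * osc powr (1 - \<alpha>) + 5 * \<bar>\<delta> 0\<bar> powr (1 - \<alpha>) + \<bar>\<delta> 0 / (real d ^ 2 * \<delta> 1) * (N0\<^sup>2 - 1)\<bar>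
        + 6 * \<kappa> / real n powr (1 - \<alpha>) + 4 * (N0\<^sup>2 / real n)"
  define E2 where "E2 = 2 ^ 36 * (m3 / \<delta> 1 powr (3 / 2)) * (\<Sum>k\<in>I. \<bar>upsum I d a {k} / real d\<bar> ^ 3)"
  define E3 where "E3 = 3 * \<kappa> * (1 / (real d * sqrt (\<delta> 1))) *
        (\<Sum>s=2..d. sqrt (Sg s + 16 * real d ^ 2 * 2 ^ d / real n) * sqrt (level I d a s))"
  define m2 where "m2 = expectation (\<lambda>\<omega>. (\<mu> \<omega>)\<^sup>2)"
  have m20: "m2 \<ge> 0" by (simp add: m2_def)
  have dr: "real d \<ge> 1" using d1 by simp
  have osc0: "osc \<ge> 0" by (simp add: osc_def)
  have d3: "real d ^ 2 \<le> real d ^ 3" "1 \<le> real d ^ 3" "1 \<le> real d ^ 2" using dr by (auto intro: power_increasing)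
  have fct: "(2::real) \<le> fact (2 * d)"
  proof -
    have "(fact 2 :: real) \<le> fact (2 * d)" using d1 by (intro fact_mono) auto
    then show ?thesis by (simp add: fact_2)
  qed
  have p18: "8 ^ d * (9/4) \<le> (18::real) ^ d" "18 \<le> (18::real) ^ d" "2 ^ d \<le> (18::real) ^ d" "(8::real) \<le> 8 ^ d"
  proof -
    have "(9/4::real) ^ 1 \<le> (9/4) ^ d" using d1 by (intro power_increasing) auto
    then have "(8::real) ^ d * (9/4) \<le> 8 ^ d * (9/4) ^ d" by simp
    then show "8 ^ d * (9/4) \<le> (18::real) ^ d" by (simp flip: power_mult_distrib)
    show "18 \<le> (18::real) ^ d" "(8::real) \<le> 8 ^ d" using d1 by (auto intro: self_le_power)
    show "2 ^ d \<le> (18::real) ^ d" by (rule power_mono) auto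
  qed
  have \<kappa>1: "40 * (real d ^ 3 * 18 ^ d) \<le> \<kappa>"
  proof -
    have "(20 * real d ^ 3 * 18 ^ d) * 2 \<le> \<kappa>" unfolding \<kappa> by (intro mult_left_mono fct) auto
    then show ?thesis by simp
  qed
  have \<kappa>8: "90 * (8 ^ d * real d ^ 2) \<le> \<kappa>"
  proof -
    have "40 * (real d ^ 2 * (8 ^ d * (9/4))) \<le> 40 * (real d ^ 3 * 18 ^ d)"
      using p18 d3 by (intro mult_left_mono mult_mono) auto
    then show ?thesis using \<kappa>1 by (simp add: mult.commute)
  qed
  have \<kappa>d: "720 * real d ^ 2 \<le> \<kappa>"
  proof -
    have "90 * (8 * real d ^ 2) \<le> 90 * (8 ^ d * real d ^ 2)" using p18 by (intro mult_left_mono mult_right_mono) auto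
    then have "90 * (8 * real d ^ 2) \<le> \<kappa>" using \<kappa>8 by (rule order_trans)
    then show ?thesis by simp
  qed
  have \<kappa>ge1: "\<kappa> \<ge> 1" using \<kappa>d d3 by linarith
  have \<kappa>y: "45 * real d ^ 2 * 2 ^ d + 1 \<le> 3 * \<kappa>"
  proof -
    have "real d ^ 2 * 2 ^ d \<le> real d ^ 3 * 18 ^ d" using p18 d3 by (intro mult_mono) auto
    moreover have "0 \<le> real d ^ 3 * 18 ^ d" by simp
    ultimately have "45 * (real d ^ 2 * 2 ^ d) \<le> 2 * \<kappa>" using \<kappa>1 by linarith
    then have "45 * real d ^ 2 * 2 ^ d \<le> 2 * \<kappa>" by (simp only: mult.assoc)
    then show ?thesis using \<kappa>ge1 by linarith
  qed
  define \<nu> where "\<nu> = real n powr (1 - \<alpha>)"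
  have n1: "real n \<ge> 1" using n_pos by simp
  have \<nu>: "\<nu> > 0" "\<nu> \<le> real n"
    using n1 \<alpha> powr_mono[of "1 - \<alpha>" 1 "real n"] by (auto simp: \<nu>_def)
  \<comment> \<open>Read off from \<open>h3\<close>: since \<kappa> is at least 1, so is its
    power.\<close>
  have n\<delta>: "\<nu> \<le> real n * \<delta> 1"
  proof -
    have "1 \<le> \<kappa> powr \<alpha>" using \<kappa>ge1 \<alpha> by (simp add: ge_one_powr_ge_zero)
    then have "\<nu> * 1 \<le> \<nu> * \<kappa> powr \<alpha>" using \<nu> by (intro mult_left_mono) auto
    also have "\<dots> = real n * (\<kappa> / real n) powr \<alpha>"
      using \<kappa>ge1 n1 by (simp add: \<nu>_def powr_divide powr_diff)
    also have "\<dots> \<le> real n * \<delta> 1" using h3 by (intro mult_left_mono) auto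
    finally show ?thesis by simp
  qed
  have \<delta>11: "\<delta> 1 \<le> 1" using \<delta>_bound[OF d1] by simp
  have \<delta>01: "\<bar>\<delta> 0\<bar> \<le> 1" using \<delta>_bound[of 0] by simp
  define c where "c = \<kappa> / \<nu>"
  have c0: "c \<ge> 0" using \<kappa>ge1 \<nu> by (simp add: c_def)
  \<comment> \<open>Every term of order \<open>u / (n * \<delta> 1)\<close> is a small fraction of
    \<open>c\<close>, the quotient appearing in E1; the size of \<kappa> permits the denominators
    720 and 90 used below.\<close>
  have small: "u / (real n * \<delta> 1) \<le> c / t" if "0 \<le> u" "t * u \<le> \<kappa>" "t > 0" for u t
  proof -
    have "u / (real n * \<delta> 1) \<le> u / \<nu>" using n\<delta> \<nu> that n1 \<delta>1 by (intro divide_left_mono) auto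
    also have "\<dots> \<le> (\<kappa> / t) / \<nu>" using that \<nu> by (intro divide_right_mono) (auto simp: pos_le_divide_eq mult.commute)
    finally show ?thesis by (simp add: c_def mult.commute)
  qed
  have Pb: "0 \<le> P" "P \<le> 1" unfolding P_def by auto
  define w where "w = sqrt v0"
  have w: "w = real d * sqrt (\<delta> 1)" using d1 by (simp add: w_def v0_def real_sqrt_mult)
  have w0: "w > 0" using v0_pos by (simp add: w_def)
  \<comment> \<open>Here \<open>Sg_abs_le\<close> replaces the absolute value of \<open>Sg s\<close>
    by the radicand of the claim.\<close>
  have E3y: "3 * \<kappa> * ysum \<le> E3"
  proof -
    have "(\<Sum>s=2..d. sqrt \<bar>Sg s\<bar> * sqrt (level I d a s)) \<le> (\<Sum>s=2..d. sqrt (Sg s + 16 * real d ^ 2 * 2 ^ d / real n) * sqrt (level I d a s))"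
      by (intro sum_mono mult_right_mono real_sqrt_le_mono Sg_abs_le) (auto simp: level_nonneg)
    then have "3 * \<kappa> * (1 / w) * (\<Sum>s=2..d. sqrt \<bar>Sg s\<bar> * sqrt (level I d a s)) \<le> E3"
      unfolding E3_def w[symmetric] using \<kappa>ge1 w0 by (intro mult_left_mono) auto
    then show ?thesis by (simp add: ysum_def w_def)
  qed
  have m30: "m3 \<ge> 0"
  proof -
    have "{1..d} \<in> K" using nd by (auto simp: K_def subsets_def I_def)
    from third[OF this] show ?thesis by (metis (no_types, lifting) Bochner_Integration.integral_nonneg abs_ge_zero zero_le_power)
  qed
  define t3 where "t3 = (\<Sum>k\<in>I. \<bar>upsum I d a {k} / real d\<bar> ^ 3)"
  have t30: "t3 \<ge> 0" unfolding t3_def by (intro sum_nonneg) auto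
  have E2_ge: "384000 * m3 * (\<Sum>k\<in>I. \<bar>upsum I d a {k}\<bar> ^ 3) / w ^ 3 \<le> E2" and E20: "E2 \<ge> 0"
  proof -
    have "\<delta> 1 powr (3/2) = \<delta> 1 powr (1 + 1/2)" by simp
    also have "\<dots> = \<delta> 1 * sqrt (\<delta> 1)" unfolding powr_add using \<delta>1 by (simp add: powr_half_sqrt)
    also have "\<dots> = sqrt (\<delta> 1) ^ 3" using \<delta>1 by (simp add: power3_eq_cube)
    finally have pw: "\<delta> 1 powr (3/2) = sqrt (\<delta> 1) ^ 3" .
    have "t3 = (\<Sum>k\<in>I. \<bar>upsum I d a {k}\<bar> ^ 3) / real d ^ 3"
      unfolding t3_def using d1 by (simp add: power_divide sum_divide_distrib)
    then have e: "384000 * m3 * (\<Sum>k\<in>I. \<bar>upsum I d a {k}\<bar> ^ 3) / w ^ 3 = 384000 * (m3 / sqrt (\<delta> 1) ^ 3) * t3"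
      using d1 by (simp add: w power_mult_distrib)
    have "0 \<le> (m3 / sqrt (\<delta> 1) ^ 3) * t3" using m30 t30 \<delta>1 by simp
    then show "384000 * m3 * (\<Sum>k\<in>I. \<bar>upsum I d a {k}\<bar> ^ 3) / w ^ 3 \<le> E2" "E2 \<ge> 0"
      unfolding e E2_def pw t3_def[symmetric] by (simp_all add: mult.assoc)
  qed
  have E1c: "E1 \<ge> 6 * c"
    unfolding E1_def c_def \<nu>_def[symmetric] using N0_le by simp
  have E30: "E3 \<ge> 0" using E3y \<kappa>ge1 ysum_nonneg by (metis mult_nonneg_nonneg order_trans zero_le_numeral zero_le_one)
  have V0: "var_form \<ge> 0" by (simp add: var_form_def)
  have gauss: "\<bar>cdf (centered_normal var_form) z - \<Phi> (z / w)\<bar> \<le> 2/3 * \<bar>var_form / v0 - 1\<bar>"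
    unfolding w_def by (rule centered_normal_diff[OF V0 v0_pos])
  have cdf01: "0 \<le> cdf (centered_normal var_form) z" "cdf (centered_normal var_form) z \<le> 1"
    using V0 by (cases "var_form = 0"; simp add: cdf_centered_normal_0 cdf_centered_normal \<Phi>_nonneg \<Phi>_le_1)+
  have "\<bar>P - cdf (centered_normal var_form) z\<bar> \<le> E1 + E2 + E3"
  proof (cases "E1 + E2 + E3 < 1")
    case False
    then show ?thesis using Pb cdf01 by linarith
  next
    case True
    \<comment> \<open>The assumption that the claimed bound is below 1 now yields \<open>c\<close>
      below 1/6 and \<open>ysum\<close> at most 1, and from these the bounds for \<epsilon> and
      \<open>e2\<close>.\<close>
    have c6: "6 * c < 1" using True E1c E20 E30 by linarith
    have y1: "ysum \<le> 1"
    proof -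
      have "3 * \<kappa> * ysum < 1" using True E1c E20 E3y c0 by linarith
      moreover have "1 * ysum \<le> 3 * \<kappa> * ysum" using \<kappa>ge1 ysum_nonneg by (intro mult_right_mono) auto
      ultimately show ?thesis by linarith
    qed
    have y2: "ysum\<^sup>2 \<le> ysum" using y1 ysum_nonneg by (simp add: power2_eq_square mult_left_le)
    define \<epsilon> where "\<epsilon> = real d ^ 2 / real n"
    have \<epsilon>0: "\<epsilon> \<ge> 0" by (simp add: \<epsilon>_def)
    have \<epsilon>\<delta>: "\<epsilon> / \<delta> 1 \<le> c / 720" unfolding \<epsilon>_def using small[of "real d ^ 2" 720] \<kappa>d by simp
    have "\<epsilon> \<le> \<epsilon> / \<delta> 1" using \<epsilon>0 \<delta>1 \<delta>11 by (simp add: le_divide_eq mult_left_le)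
    then have \<epsilon>c: "\<epsilon> \<le> c / 720" using \<epsilon>\<delta> by linarith
    then have \<epsilon>20: "\<epsilon> \<le> 1 / 20" using c6 by linarith
    have G: "Gfac - 1 \<le> 5 * \<epsilon>" unfolding \<epsilon>_def using \<epsilon>20 \<rho>e by (intro Gfac_le) (auto simp: \<epsilon>_def)
    have G2: "Gfac \<le> 5/4" "gfac \<le> 5/4" using G \<epsilon>20 Gfac_ge by linarith+
    define e2 where "e2 = 8 ^ d * real d ^ 2 / (real n)\<^sup>2"
    have e20: "e2 \<ge> 0" by (simp add: e2_def)
    have mu: "\<bar>m2 - (\<delta> 0 + (\<delta> 1 - \<delta> 0) * \<epsilon>)\<bar> \<le> e2"
      unfolding m2_def \<epsilon>_def e2_def by (rule \<mu>_square)
    have d0e: "\<bar>\<delta> 0 - \<delta> 0 * \<epsilon>\<bar> \<le> \<bar>\<delta> 0\<bar>"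
    proof -
      have "\<bar>\<delta> 0 - \<delta> 0 * \<epsilon>\<bar> = \<bar>\<delta> 0\<bar> * \<bar>1 - \<epsilon>\<bar>" by (simp add: algebra_simps flip: abs_mult)
      also have "\<dots> \<le> \<bar>\<delta> 0\<bar> * 1" using \<epsilon>0 \<epsilon>20 by (intro mult_left_mono) auto
      finally show ?thesis by simp
    qed
    have m2u: "m2 \<le> \<bar>\<delta> 0\<bar> + \<delta> 1 * \<epsilon> + e2"
      using mu d0e by (simp add: left_diff_distrib abs_le_iff)
    have e2n: "e2 \<le> 8 ^ d * real d ^ 2 / real n"
      unfolding e2_def using n1 by (intro divide_left_mono) (auto simp: power2_eq_square)
    have e2c: "8 ^ d * real d ^ 2 / (real n * \<delta> 1) \<le> c / 90" using small[of "8 ^ d * real d ^ 2" 90] \<kappa>8 by simp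
    have e2\<delta>: "e2 / \<delta> 1 \<le> c / 90"
    proof -
      have "e2 / \<delta> 1 \<le> (8 ^ d * real d ^ 2 / real n) / \<delta> 1" using e2n \<delta>1 by (intro divide_right_mono) auto
      also have "\<dots> = 8 ^ d * real d ^ 2 / (real n * \<delta> 1)" by simp
      finally show ?thesis using e2c by (rule order_trans)
    qed
    have "e2 \<le> e2 / \<delta> 1" using e20 \<delta>1 \<delta>11 by (simp add: le_divide_eq mult_left_le)
    then have e2_1: "e2 \<le> 1/2" using e2\<delta> c6 by linarith
    have \<delta>\<epsilon>: "\<delta> 1 * \<epsilon> \<le> \<epsilon>" using \<delta>11 \<epsilon>0 \<delta>1 by (simp add: mult_left_le_one_le)
    have m22: "m2 \<le> 2" using m2u \<delta>01 \<delta>\<epsilon> \<epsilon>20 e2_1 by linarith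
    \<comment> \<open>\<open>B\<close> averages over all indices and \<mu> over the subsets only;
      the ratio \<open>r\<close> between the two averages is at least
      \<open>1 - \<epsilon>\<close>.\<close>
    have mB: "m2 \<le> B + 4 * \<epsilon>"
    proof -
      have "1 - 2 * \<epsilon> \<le> (1 - \<epsilon>)\<^sup>2" by (simp add: power2_eq_square algebra_simps)
      also have "\<dots> \<le> r\<^sup>2" using r(1)[folded \<epsilon>_def] \<epsilon>20 by (intro power_mono) auto
      finally have "(1 - 2 * \<epsilon>) * m2 \<le> r\<^sup>2 * m2" using m20 by (rule mult_right_mono)
      then have "m2 \<le> B + 2 * \<epsilon> * m2" by (simp add: B m2_def[symmetric] algebra_simps)
      moreover have "2 * \<epsilon> * m2 \<le> 2 * \<epsilon> * 2" using m22 \<epsilon>0 by (intro mult_left_mono) auto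
      ultimately show ?thesis by linarith
    qed
    have dB: "\<bar>\<delta> 0\<bar> \<le> B + (6 * \<epsilon> + e2)"
    proof -
      have "\<bar>\<delta> 1 - \<delta> 0\<bar> \<le> 2" using \<delta>01 \<delta>11 \<delta>1 by linarith
      then have "\<bar>\<delta> 1 - \<delta> 0\<bar> * \<epsilon> \<le> 2 * \<epsilon>" using \<epsilon>0 by (rule mult_right_mono)
      then have "\<bar>(\<delta> 1 - \<delta> 0) * \<epsilon>\<bar> \<le> 2 * \<epsilon>" using \<epsilon>0 by (simp add: abs_mult)
      then show ?thesis using mu mB m20 by linarith
    qed
    have B0: "B \<ge> 0" using m20 by (simp add: B m2_def[symmetric])
    have d0r: "\<bar>\<delta> 0\<bar> / \<delta> 1 \<le> \<bar>\<delta> 0\<bar> powr (1 - \<alpha>) + c / 40"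
    proof -
      have "(6 * \<epsilon> + e2) / \<delta> 1 = 6 * (\<epsilon> / \<delta> 1) + e2 / \<delta> 1" by (simp add: add_divide_distrib)
      also have "\<dots> \<le> c / 40" using \<epsilon>\<delta> e2\<delta> c0 by linarith
      finally show ?thesis
        using delta_0_ratio[OF \<alpha> B0 h2 dB] \<epsilon>0 e20 by linarith
    qed
    have oscr: "osc / \<delta> 1 \<le> osc powr (1 - \<alpha>)" using osc0 h1 \<delta>1 by (rule divide_le_powr)
    have m2r: "m2 / \<delta> 1 \<le> \<bar>\<delta> 0\<bar> / \<delta> 1 + c / 72"
    proof -
      have "m2 / \<delta> 1 \<le> (\<bar>\<delta> 0\<bar> + \<delta> 1 * \<epsilon> + e2) / \<delta> 1" using m2u \<delta>1 by (intro divide_right_mono) auto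
      also have "\<dots> = \<bar>\<delta> 0\<bar> / \<delta> 1 + \<epsilon> + e2 / \<delta> 1" using \<delta>1 by (simp add: add_divide_distrib)
      finally show ?thesis using \<epsilon>c e2\<delta> c0 by linarith
    qed
    define T where "T = \<bar>\<delta> 0 / v0 * (N0\<^sup>2 - 1)\<bar>"
    have T: "T = \<bar>\<delta> 0 / (real d ^ 2 * \<delta> 1) * (N0\<^sup>2 - 1)\<bar>" by (simp add: T_def v0_def)
    have v0\<delta>: "\<delta> 1 \<le> v0" using d3 \<delta>1 by (simp add: v0_def)
    \<comment> \<open>\<open>N0\<^sup>2\<close> may be as large as n, so its product with
      \<open>\<delta> 0\<close> need not be small. Writing it as \<open>N0\<^sup>2 - 1\<close> plus
      1 produces the term \<open>T\<close> that the claim contains explicitly.\<close>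
    have shift: "N0\<^sup>2 * m2 / (4 * v0) \<le> T / 4 + (\<bar>\<delta> 0\<bar> / \<delta> 1) / 4 + N0\<^sup>2 / real n / 2"
    proof -
      have "N0\<^sup>2 * m2 / v0 \<le> N0\<^sup>2 * (\<bar>\<delta> 0\<bar> + \<delta> 1 * \<epsilon> + e2) / v0"
        using m2u v0_pos by (intro divide_right_mono mult_left_mono) auto
      also have "\<dots> = N0\<^sup>2 * \<bar>\<delta> 0\<bar> / v0 + N0\<^sup>2 * (\<delta> 1 * \<epsilon>) / v0 + N0\<^sup>2 * e2 / v0"
        by (simp add: distrib_left add_divide_distrib)
      finally have s0: "N0\<^sup>2 * m2 / v0 \<le> N0\<^sup>2 * \<bar>\<delta> 0\<bar> / v0 + N0\<^sup>2 * (\<delta> 1 * \<epsilon>) / v0 + N0\<^sup>2 * e2 / v0" .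
      have s1: "N0\<^sup>2 * (\<delta> 1 * \<epsilon>) / v0 = N0\<^sup>2 / real n"
        using d1 \<delta>1 by (simp add: v0_def \<epsilon>_def)
      have s2: "N0\<^sup>2 * e2 / v0 \<le> N0\<^sup>2 / real n"
      proof -
        have "real n * e2 / v0 = 8 ^ d * real d ^ 2 / (real n * v0)"
          using n1 by (simp add: e2_def power2_eq_square)
        also have "\<dots> \<le> 8 ^ d * real d ^ 2 / (real n * \<delta> 1)"
          using v0\<delta> n1 \<delta>1 v0_pos by (intro divide_left_mono mult_left_mono) auto
        also have "\<dots> \<le> 1" using e2c c6 c0 by linarith
        finally have "N0\<^sup>2 / real n * (real n * e2 / v0) \<le> N0\<^sup>2 / real n * 1" by (intro mult_left_mono) auto
        then show ?thesis using n1 by simp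
      qed
      have s3: "N0\<^sup>2 * \<bar>\<delta> 0\<bar> / v0 \<le> T + \<bar>\<delta> 0\<bar> / \<delta> 1"
      proof -
        have "N0\<^sup>2 * \<bar>\<delta> 0\<bar> / v0 = \<bar>\<delta> 0\<bar> / v0 * (N0\<^sup>2 - 1) + \<bar>\<delta> 0\<bar> / v0"
          by (simp add: right_diff_distrib mult.commute)
        moreover have "\<bar>\<delta> 0\<bar> / v0 * (N0\<^sup>2 - 1) \<le> T" unfolding T_def abs_mult using v0_pos by (simp add: mult_left_mono divide_right_mono)
        moreover have "\<bar>\<delta> 0\<bar> / v0 \<le> \<bar>\<delta> 0\<bar> / \<delta> 1" using v0\<delta> \<delta>1 v0_pos by (intro divide_left_mono) auto
        ultimately show ?thesis by linarith
      qed
      have "N0\<^sup>2 * m2 / v0 \<le> (T + \<bar>\<delta> 0\<bar> / \<delta> 1) + N0\<^sup>2 / real n + N0\<^sup>2 / real n"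
        by (rule order_trans[OF s0]) (intro add_mono s3 s2 eq_refl[OF s1])
      then have "(N0\<^sup>2 * m2 / v0) / 4 \<le> ((T + \<bar>\<delta> 0\<bar> / \<delta> 1) + N0\<^sup>2 / real n + N0\<^sup>2 / real n) / 4"
        by (rule divide_right_mono) simp
      then show ?thesis by (simp add: add_divide_distrib mult.commute)
    qed
    have ratio: "\<bar>var_form / v0 - 1\<bar> \<le> T + \<bar>\<delta> 0\<bar> / \<delta> 1 + ysum"
      using var_form_ratio y2 unfolding T_def by linarith
    have g1: "Gfac * (osc / \<delta> 1) \<le> 5/4 * osc powr (1 - \<alpha>)"
      using G2 oscr osc0 \<delta>1 by (intro mult_mono) auto
    have g2: "gfac * (m2 / \<delta> 1) \<le> 5/4 * (\<bar>\<delta> 0\<bar> / \<delta> 1 + c / 72)"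
      using G2 m2r m20 \<delta>1 by (intro mult_mono) auto
    have rest: "3 / w * (sqrt Qrest + sqrt (2 * real d * Qrest)) \<le> 45 * real d ^ 2 * 2 ^ d * ysum"
      unfolding w_def by (rule rest_le)
    have ye: "45 * real d ^ 2 * 2 ^ d * ysum + ysum \<le> E3"
      using mult_right_mono[OF \<kappa>y ysum_nonneg] E3y by (simp add: distrib_right)
    have main: "\<bar>P - \<Phi> (z / w)\<bar> \<le>
      2 * (Gfac * (osc / \<delta> 1) + (Gfac - 1) + N0\<^sup>2 / real n + gfac * (m2 / \<delta> 1))
      + 384000 * m3 * (\<Sum>k\<in>I. \<bar>upsum I d a {k}\<bar> ^ 3) / w ^ 3
      + 3 / w * (sqrt Qrest + sqrt (2 * real d * Qrest)) + N0\<^sup>2 * m2 / (4 * v0)"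
      unfolding P_def w_def m2_def by (rule cdf_bound)
    define S where "S = osc powr (1 - \<alpha>)"
    define D where "D = \<bar>\<delta> 0\<bar> powr (1 - \<alpha>)"
    define N where "N = N0\<^sup>2 / real n"
    have nn: "S \<ge> 0" "D \<ge> 0" "N \<ge> 0" "T \<ge> 0" "\<bar>\<delta> 0\<bar> / \<delta> 1 \<ge> 0" using \<delta>1 by (auto simp: S_def D_def N_def T_def)
    have E1: "E1 = 5 * S + 5 * D + T + 6 * c + 4 * N"
      by (simp add: E1_def S_def D_def N_def T c_def \<nu>_def)
    define Q0 where "Q0 = \<bar>\<delta> 0\<bar> / \<delta> 1"
    define RV where "RV = \<bar>var_form / v0 - 1\<bar>"
    define go where "go = Gfac * (osc / \<delta> 1)"
    define gm where "gm = gfac * (m2 / \<delta> 1)"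
    define X2 where "X2 = 384000 * m3 * (\<Sum>k\<in>I. \<bar>upsum I d a {k}\<bar> ^ 3) / w ^ 3"
    define X3 where "X3 = 3 / w * (sqrt Qrest + sqrt (2 * real d * Qrest))"
    define X4 where "X4 = N0\<^sup>2 * m2 / (4 * v0)"
    define yy where "yy = 45 * real d ^ 2 * 2 ^ d * ysum"
    define F where "F = cdf (centered_normal var_form) z"
    define p where "p = \<Phi> (z / w)"
    define aP where "aP = \<bar>P - p\<bar>"
    define aF where "aF = \<bar>F - p\<bar>"
    have "\<bar>P - F\<bar> \<le> aP + aF" unfolding aP_def aF_def by (simp add: abs_triangle_ineq4[of "P - p" "F - p", simplified])
    also have "aP + aF \<le> 5 * S + 5 * D + T + 6 * c + 4 * N + E2 + E3"
      by (rule error_budget[OF main[folded go_def gm_def X2_def X3_def X4_def p_def, folded N_def, folded aP_def]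
        gauss[folded F_def p_def RV_def, folded aF_def] ratio[folded RV_def Q0_def] g1[folded go_def S_def]
        g2[folded gm_def Q0_def] G \<epsilon>c E2_ge[folded X2_def] rest[folded X3_def yy_def] ye[folded yy_def]
        shift[folded X4_def Q0_def N_def] d0r[folded Q0_def D_def] nn(1-4) ysum_nonneg c0])
    finally show ?thesis by (simp only: E1 F_def)
  qed
  then show ?thesis by (simp only: P_def E1_def E2_def E3_def)
qed

end

section \<open>Tensors and subsets\<close>

text \<open>The sizes agree on all four cells of the two Venn diagrams, so bijections between
  corresponding cells can be glued together.\<close>

lemma ex_permutation_two_sets:
  assumes fin: "finite U" and sub: "A \<subseteq> U" "B \<subseteq> U" "C \<subseteq> U" "D \<subseteq> U"
    and cards: "card A = card C" "card B = card D" "card (A \<inter> B) = card (C \<inter> D)"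
  obtains p where "p permutes U" "p ` A = C" "p ` B = D"
proof -
  have f: "finite A" "finite B" "finite C" "finite D" using fin sub finite_subset by blast+
  have c: "card (A - B) = card (C - D)" "card (B - A) = card (D - C)"
  proof -
    show "card (A - B) = card (C - D)" 
      using cards(1,3) card_Diff_subset_Int[of A B] card_Diff_subset_Int[of C D] f by simp
    show "card (B - A) = card (D - C)"
      using cards(2,3) card_Diff_subset_Int[of B A] card_Diff_subset_Int[of D C] f
      by (simp add: Int_commute[of B A] Int_commute[of D C])
  qed
  have "card (A \<union> B) = card (C \<union> D)"
    using cards card_Un_Int[OF f(1,2)] card_Un_Int[OF f(3,4)] by linarith
  then have cU: "card (U - (A \<union> B)) = card (U - (C \<union> D))"
  proof -
    have s: "A \<union> B \<subseteq> U" "C \<union> D \<subseteq> U" using sub by (simp_all only: Un_subset_iff simp_thms)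
    have g: "finite (A \<union> B)" "finite (C \<union> D)" using f by (simp_all only: finite_Un simp_thms)
    show ?thesis if "card (A \<union> B) = card (C \<union> D)"
      unfolding card_Diff_subset[OF g(1) s(1)] card_Diff_subset[OF g(2) s(2)] that by (rule refl)
  qed
  obtain f1 where f1: "bij_betw f1 (A \<inter> B) (C \<inter> D)" using finite_same_card_bij[OF finite_Int[OF disjI1[OF f(1)]] finite_Int[OF disjI1[OF f(3)]] cards(3)] ..
  obtain f2 where f2: "bij_betw f2 (A - B) (C - D)" using finite_same_card_bij[OF finite_Diff[OF f(1)] finite_Diff[OF f(3)] c(1)] ..
  obtain f3 where f3: "bij_betw f3 (B - A) (D - C)" using finite_same_card_bij[OF finite_Diff[OF f(2)] finite_Diff[OF f(4)] c(2)] ..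
  obtain f4 where f4: "bij_betw f4 (U - (A \<union> B)) (U - (C \<union> D))" using finite_same_card_bij[OF finite_Diff[OF fin] finite_Diff[OF fin] cU] ..
  define p where "p k = (if k \<in> A \<inter> B then f1 k else if k \<in> A - B then f2 k else if k \<in> B - A then f3 k
      else if k \<in> U then f4 k else k)" for k
  have b1: "bij_betw p (A \<inter> B) (C \<inter> D)" using f1 by (rule bij_betw_cong[THEN iffD1, rotated]) (simp add: p_def)
  have b2: "bij_betw p (A - B) (C - D)" using f2 by (rule bij_betw_cong[THEN iffD1, rotated]) (simp add: p_def)
  have b3: "bij_betw p (B - A) (D - C)" using f3 by (rule bij_betw_cong[THEN iffD1, rotated]) (simp add: p_def)
  have b4: "bij_betw p (U - (A \<union> B)) (U - (C \<union> D))"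
    using f4 by (rule bij_betw_cong[THEN iffD1, rotated]) (auto simp: p_def)
  have bA: "bij_betw p (A \<inter> B \<union> (A - B)) (C \<inter> D \<union> (C - D))"
    by (rule bij_betw_combine[OF b1 b2]) auto
  have bB: "bij_betw p (A \<inter> B \<union> (B - A)) (C \<inter> D \<union> (D - C))"
    by (rule bij_betw_combine[OF b1 b3]) auto
  have bAB: "bij_betw p ((A \<inter> B \<union> (A - B)) \<union> (B - A)) ((C \<inter> D \<union> (C - D)) \<union> (D - C))"
    by (rule bij_betw_combine[OF bA b3]) auto
  have "bij_betw p (((A \<inter> B \<union> (A - B)) \<union> (B - A)) \<union> (U - (A \<union> B))) (((C \<inter> D \<union> (C - D)) \<union> (D - C)) \<union> (U - (C \<union> D)))"
    by (rule bij_betw_combine[OF bAB b4]) auto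
  moreover have "((A \<inter> B \<union> (A - B)) \<union> (B - A)) \<union> (U - (A \<union> B)) = U" "((C \<inter> D \<union> (C - D)) \<union> (D - C)) \<union> (U - (C \<union> D)) = U"
    using sub by auto
  ultimately have "bij_betw p U U" by simp
  moreover have "p k = k" if "k \<notin> U" for k using that sub by (auto simp: p_def)
  ultimately have "p permutes U" by (rule bij_imp_permutes)
  moreover have "p ` A = C" using bA by (auto simp: bij_betw_def Int_Diff_Un)
  moreover have "p ` B = D" using bB by (metis (no_types, lifting) Int_Diff_Un Int_commute bij_betw_imp_surj_on)
  ultimately show ?thesis by (rule that)
qed

text \<open>An arbitrary enumeration of the set, used as a tensor index; for symmetric tensors the
  choice has no influence on the entry.\<close>

definition set_idx :: "nat \<Rightarrow> nat set \<Rightarrow> nat \<Rightarrow> nat" where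
  "set_idx d A = (SOME i. i \<in> extensional {1..d} \<and> bij_betw i {1..d} A)"

lemma set_idx:
  assumes "finite A" "card A = d"
  shows "set_idx d A \<in> extensional {1..d}" "bij_betw (set_idx d A) {1..d} A"
proof -
  obtain f where "bij_betw f {1..d} A" using assms finite_same_card_bij[of "{1..d}" A] by auto
  then have "restrict f {1..d} \<in> extensional {1..d} \<and> bij_betw (restrict f {1..d}) {1..d} A" by simp
  then have "set_idx d A \<in> extensional {1..d} \<and> bij_betw (set_idx d A) {1..d} A"
    unfolding set_idx_def by (rule someI[where P = "\<lambda>i. i \<in> extensional {1..d} \<and> bij_betw i {1..d} A"])
  then show "set_idx d A \<in> extensional {1..d}" "bij_betw (set_idx d A) {1..d} A" by auto
qed

lemma set_idx_in:
  assumes "A \<in> subsets {1..n} d"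
  shows "set_idx d A \<in> tensor_idx n d" "inj_on (set_idx d A) {1..d}" "set_idx d A ` {1..d} = A"
proof -
  have A: "A \<subseteq> {1..n}" "card A = d" using assms by (auto simp: subsets_def)
  then have "finite A" using finite_subset by blast
  note s = set_idx[OF this A(2)]
  show 2: "inj_on (set_idx d A) {1..d}" "set_idx d A ` {1..d} = A" using s(2) by (auto simp: bij_betw_def)
  show "set_idx d A \<in> tensor_idx n d" unfolding tensor_idx_def PiE_def using s(1) 2(2) A(1) by auto
qed

lemma tensor_idx_undefined:
  assumes "i \<in> tensor_idx n d" "r \<notin> {1..d}" shows "i r = undefined"
  using assms unfolding tensor_idx_def by (rule PiE_arb)

lemma image_idx_subsets:
  assumes "i \<in> tensor_idx n d" "inj_on i {1..d}" shows "i ` {1..d} \<in> subsets {1..n} d"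
  using assms by (auto simp: subsets_def tensor_idx_def card_image)

lemma symmetric_tensor_image:
  assumes T: "symmetric_tensor n d T" and i: "i \<in> tensor_idx n d" "inj_on i {1..d}"
    and j: "j \<in> tensor_idx n d" "inj_on j {1..d}" and im: "i ` {1..d} = j ` {1..d}"
  shows "T i = T j"
proof -
  define \<tau> where "\<tau> r = (if r \<in> {1..d} then inv_into {1..d} i (j r) else r)" for r
  have "bij_betw (inv_into {1..d} i \<circ> j) {1..d} {1..d}"
    using i(2) j(2) im by (intro bij_betw_trans[of j _ "i ` {1..d}"] bij_betw_inv_into) (auto simp: bij_betw_def)
  then have "bij_betw \<tau> {1..d} {1..d}" by (rule bij_betw_cong[THEN iffD1, rotated]) (simp add: \<tau>_def)
  then have p: "\<tau> permutes {1..d}" by (rule bij_imp_permutes) (simp only: \<tau>_def if_False)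
  have "i \<circ> \<tau> = j"
  proof
    fix r
    show "(i \<circ> \<tau>) r = j r"
    proof (cases "r \<in> {1..d}")
      case True
      then have "j r \<in> i ` {1..d}" using im by auto
      then show ?thesis using True by (simp add: \<tau>_def f_inv_into_f)
    next
      case False
      then have "i r = undefined" "j r = undefined" using tensor_idx_undefined[OF i(1)] tensor_idx_undefined[OF j(1)] by simp_all
      moreover have "\<tau> r = r" unfolding \<tau>_def using False by (rule if_not_P)
      ultimately show ?thesis by simp
    qed
  qed
  moreover have "T i = T (i \<circ> \<tau>)" using T p i(1) unfolding symmetric_tensor_def by blast
  ultimately show ?thesis by simp
qed

lemma symmetric_tensor_eq:
  assumes "symmetric_tensor n d T" "vanishing_diagonal n d T" "i \<in> tensor_idx n d"
  shows "T i = (if inj_on i {1..d} then T (set_idx d (i ` {1..d})) else 0)"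
proof (cases "inj_on i {1..d}")
  case True
  note K = image_idx_subsets[OF assms(3) True]
  show ?thesis using symmetric_tensor_image[OF assms(1,3) True set_idx_in(1,2)[OF K]] set_idx_in(3)[OF K] True by simp
next
  case False
  then show ?thesis using assms(2,3) by (auto simp: vanishing_diagonal_def diagonal_idx_def)
qed

lemma finite_tensor_idx: "finite (tensor_idx n d)"
  unfolding tensor_idx_def by (intro finite_PiE) auto

text \<open>For \<open>s = 0\<close> the prefix condition is void and \<open>j\<close> is irrelevant.\<close>

lemma sum_prefix_inj:
  fixes F :: "nat set \<Rightarrow> real"
  assumes s: "s \<le> d" and j: "j \<in> tensor_idx n s"
  shows "(\<Sum>i\<in>{i\<in>tensor_idx n d. \<forall>r\<in>{1..s}. i r = j r}. if inj_on i {1..d} then F (i ` {1..d}) else 0) =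
    (if inj_on j {1..s} then fact (d - s) * upsum {1..n} d F (j ` {1..s}) else 0)"
proof -
  let ?P = "{i\<in>tensor_idx n d. \<forall>r\<in>{1..s}. i r = j r}"
  have fP: "finite ?P" using finite_tensor_idx by simp
  show ?thesis
  proof (cases "inj_on j {1..s}")
    case False
    have "\<not> inj_on i {1..d}" if "i \<in> ?P" for i
    proof
      assume "inj_on i {1..d}"
      then have "inj_on i {1..s}" by (rule inj_on_subset) (use s in auto)
      then have "inj_on j {1..s}" using that by (subst inj_on_cong[of _ _ i]) auto
      then show False using False by simp
    qed
    then show ?thesis using False by (simp add: sum.neutral)
  next
    case True
    define Q where "Q = {i \<in> ?P. inj_on i {1..d}}"
    have fQ: "finite Q" unfolding Q_def by (rule finite_subset[OF _ fP]) blast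
    let ?J = "j ` {1..s}"
    let ?B = "{A. A \<in> subsets {1..n} d \<and> ?J \<subseteq> A}"
    have cJ: "card ?J = s" using True by (simp add: card_image)
    have img: "(\<lambda>i. i ` {1..d}) ` Q \<subseteq> ?B"
    proof
      fix A assume "A \<in> (\<lambda>i. i ` {1..d}) ` Q"
      then obtain i where i: "A = i ` {1..d}" "i \<in> Q" by auto
      then have "A \<in> subsets {1..n} d" using image_idx_subsets[of i n d] by (simp add: Q_def)
      moreover have "?J \<subseteq> A"
      proof
        fix y assume "y \<in> ?J"
        then obtain r where r: "r \<in> {1..s}" "y = j r" by auto
        then have "y = i r" "r \<in> {1..d}" using i s by (auto simp: Q_def)
        then show "y \<in> A" using i by simp
      qed
      ultimately show "A \<in> ?B" by simp
    qed
    \<comment> \<open>The injective indices with prefix \<open>j\<close> and image \<open>A\<close>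
      form one orbit: a fixed \<open>i0\<close> composed with the permutations of the last
      \<open>d - s\<close> positions.\<close>
    have cnt: "card {i \<in> Q. i ` {1..d} = A} = fact (d - s)" if A: "A \<in> ?B" for A
    proof -
      have A': "A \<subseteq> {1..n}" "card A = d" "finite A" using A finite_subset by (auto simp: subsets_def)
      have "card {s+1..d} = card (A - ?J)" using A A' cJ s by (simp add: card_Diff_subset)
      then obtain g where g: "bij_betw g {s+1..d} (A - ?J)"
        using finite_same_card_bij[of "{s+1..d}" "A - ?J"] A' by auto
      define i0 where "i0 r = (if r \<in> {1..s} then j r else if r \<in> {s+1..d} then g r else undefined)" for r
      have "bij_betw i0 {1..s} ?J" using True by (subst bij_betw_cong[of _ _ j]) (auto simp: i0_def bij_betw_def)
      moreover have "bij_betw i0 {s+1..d} (A - ?J)" using g by (subst bij_betw_cong[of _ _ g]) (auto simp: i0_def)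
      ultimately have "bij_betw i0 ({1..s} \<union> {s+1..d}) (?J \<union> (A - ?J))" by (rule bij_betw_combine) auto
      moreover have "{1..s} \<union> {s+1..d} = {1..d}" "?J \<union> (A - ?J) = A" using s A by auto
      ultimately have b0: "bij_betw i0 {1..d} A" by simp
      have i0: "i0 \<in> tensor_idx n d"
        unfolding tensor_idx_def using b0 A'(1) s by (auto simp: PiE_iff extensional_def i0_def bij_betw_def)
      have i0Q: "i0 \<in> Q" using i0 b0 by (auto simp: Q_def bij_betw_def i0_def)
      have "bij_betw (\<lambda>\<tau>. i0 \<circ> \<tau>) {\<tau>. \<tau> permutes {s+1..d}} {i \<in> Q. i ` {1..d} = A}"
      proof (rule bij_betw_imageI)
        show "inj_on (\<lambda>\<tau>. i0 \<circ> \<tau>) {\<tau>. \<tau> permutes {s+1..d}}"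
        proof (rule inj_onI)
          fix \<tau> \<tau>' assume \<tau>: "\<tau> \<in> {\<tau>. \<tau> permutes {s+1..d}}" "\<tau>' \<in> {\<tau>. \<tau> permutes {s+1..d}}" and e: "i0 \<circ> \<tau> = i0 \<circ> \<tau>'"
          show "\<tau> = \<tau>'"
          proof
            fix r
            show "\<tau> r = \<tau>' r"
            proof (cases "r \<in> {s+1..d}")
              case True
              then have "\<tau> r \<in> {s+1..d}" "\<tau>' r \<in> {s+1..d}" using permutes_in_image[OF CollectD[OF \<tau>(1)]] permutes_in_image[OF CollectD[OF \<tau>(2)]] by simp_all
              moreover have "i0 (\<tau> r) = i0 (\<tau>' r)" using fun_cong[OF e, of r] by simp
              moreover have "inj_on i0 {s+1..d}" using bij_betw_imp_inj_on[OF b0] by (rule inj_on_subset) auto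
              ultimately show ?thesis by (blast dest: inj_onD)
            next
              case False
              then show ?thesis using \<tau> by (simp add: permutes_not_in)
            qed
          qed
        qed
        show "(\<lambda>\<tau>. i0 \<circ> \<tau>) ` {\<tau>. \<tau> permutes {s+1..d}} = {i \<in> Q. i ` {1..d} = A}"
        proof (intro equalityI subsetI)
          fix i assume "i \<in> (\<lambda>\<tau>. i0 \<circ> \<tau>) ` {\<tau>. \<tau> permutes {s+1..d}}"
          then obtain \<tau> where \<tau>: "\<tau> permutes {s+1..d}" "i = i0 \<circ> \<tau>" by auto
          have \<tau>d: "\<tau> permutes {1..d}" using \<tau>(1) by (rule permutes_subset) auto
          have im: "i ` {1..d} = A" using b0 permutes_image[OF \<tau>d] unfolding \<tau>(2) image_comp[symmetric] by (simp add: bij_betw_def)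
          have "inj_on i {1..d}" unfolding \<tau>(2) using b0 permutes_image[OF \<tau>d] permutes_inj_on[OF \<tau>d]
            by (intro comp_inj_on) (auto simp: bij_betw_def)
          moreover have "i \<in> tensor_idx n d"
            unfolding tensor_idx_def PiE_iff
          proof (intro conjI ballI)
            show "i r \<in> {1..n}" if "r \<in> {1..d}" for r using im A'(1) that by blast
            show "i \<in> extensional {1..d}"
              using i0 \<tau>d unfolding \<tau>(2) tensor_idx_def by (auto simp: PiE_iff extensional_def permutes_not_in)
          qed
          moreover have "i r = j r" if "r \<in> {1..s}" for r
            using that \<tau>(1) unfolding \<tau>(2) by (simp add: permutes_not_in i0_def)
          ultimately show "i \<in> {i \<in> Q. i ` {1..d} = A}" using im by (simp add: Q_def)
        next
          fix i assume "i \<in> {i \<in> Q. i ` {1..d} = A}"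
          then have i: "i \<in> tensor_idx n d" "inj_on i {1..d}" "i ` {1..d} = A" "\<And>r. r \<in> {1..s} \<Longrightarrow> i r = j r"
            by (auto simp: Q_def)
          have "i ` {1..s} = ?J" using i(4) by auto
          moreover have "i ` {1..d} - i ` {1..s} = i ` ({1..d} - {1..s})"
            using i(2) s by (intro inj_on_image_set_diff[symmetric]) auto
          moreover have "{1..d} - {1..s} = {s+1..d}" by auto
          ultimately have im: "i ` {s+1..d} = A - ?J" using i(3) by simp
          have im0: "i0 ` {s+1..d} = A - ?J" using g by (auto simp: i0_def bij_betw_def image_iff)
          define \<tau> where "\<tau> r = (if r \<in> {s+1..d} then inv_into {s+1..d} i0 (i r) else r)" for r
          have inj: "inj_on i {s+1..d}" by (rule inj_on_subset[OF i(2)]) auto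
          have inj0: "inj_on i0 {s+1..d}" by (rule inj_on_subset[OF bij_betw_imp_inj_on[OF b0]]) auto
          have "bij_betw (inv_into {s+1..d} i0 \<circ> i) {s+1..d} {s+1..d}"
            using inj inj0 im im0 by (intro bij_betw_trans[of i _ "A - ?J"] bij_betw_inv_into) (auto simp: bij_betw_def)
          then have "bij_betw \<tau> {s+1..d} {s+1..d}" by (rule bij_betw_cong[THEN iffD1, rotated]) (simp add: \<tau>_def)
          then have p: "\<tau> permutes {s+1..d}" by (rule bij_imp_permutes) (auto simp: \<tau>_def)
          have "i = i0 \<circ> \<tau>"
          proof
            fix r
            consider "r \<in> {s+1..d}" | "r \<in> {1..s}" | "r \<notin> {1..d}" using s by fastforce
            then show "i r = (i0 \<circ> \<tau>) r"
            proof cases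
              case 1
              then have "i r \<in> i0 ` {s+1..d}" using im im0 by blast
              then show ?thesis using 1 by (simp add: \<tau>_def f_inv_into_f)
            next
              case 2
              then have "\<tau> r = r" by (simp add: \<tau>_def)
              moreover have "i0 r = j r" using 2 by (simp only: i0_def if_True)
              ultimately show ?thesis using i(4)[OF 2] by simp
            next
              case 3
              then have "\<tau> r = r" using s by (auto simp: \<tau>_def)
              moreover have "i r = undefined" "i0 r = undefined" using tensor_idx_undefined[OF i(1) 3] tensor_idx_undefined[OF i0 3] by simp_all
              ultimately show ?thesis by simp
            qed
          qed
          then show "i \<in> (\<lambda>\<tau>. i0 \<circ> \<tau>) ` {\<tau>. \<tau> permutes {s+1..d}}" using p by blast
        qed
      qed
      then have "card {i \<in> Q. i ` {1..d} = A} = card {\<tau>. \<tau> permutes {s+1..d}}" by (simp add: bij_betw_same_card)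
      also have "\<dots> = fact (d - s)" by (rule card_permutations) simp_all
      finally show ?thesis .
    qed
    have "(\<Sum>i\<in>?P. if inj_on i {1..d} then F (i ` {1..d}) else 0) = (\<Sum>i\<in>Q. F (i ` {1..d}))"
      unfolding Q_def using fP by (rule sum.inter_filter[symmetric])
    also have "\<dots> = (\<Sum>A\<in>?B. \<Sum>i | i \<in> Q \<and> i ` {1..d} = A. F (i ` {1..d}))"
      using fQ img finite_subsets[of "{1..n}" d] by (intro sum.group[symmetric]) auto
    also have "\<dots> = (\<Sum>A\<in>?B. fact (d - s) * F A)"
    proof (intro sum.cong refl)
      fix A assume A: "A \<in> ?B"
      have "(\<Sum>i | i \<in> Q \<and> i ` {1..d} = A. F (i ` {1..d})) = (\<Sum>i | i \<in> Q \<and> i ` {1..d} = A. F A)"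
        by (intro sum.cong) auto
      then show "(\<Sum>i | i \<in> Q \<and> i ` {1..d} = A. F (i ` {1..d})) = fact (d - s) * F A"
        using cnt[OF A] by simp
    qed
    finally show ?thesis using True by (simp add: upsum_def sum_distrib_left)
  qed
qed

lemma sum_tensor_inj:
  fixes F :: "nat set \<Rightarrow> real"
  shows "(\<Sum>i\<in>tensor_idx n d. if inj_on i {1..d} then F (i ` {1..d}) else 0) = fact d * (\<Sum>A\<in>subsets {1..n} d. F A)"
proof -
  have "(\<lambda>_. undefined) \<in> tensor_idx n 0" by (simp add: tensor_idx_def)
  from sum_prefix_inj[OF _ this, of d F] show ?thesis by (simp add: upsum_def)
qed

lemma sum_first_inj:
  fixes F :: "nat set \<Rightarrow> real"
  assumes d: "1 \<le> d" and k: "k \<in> {1..n}"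
  shows "(\<Sum>i\<in>{i\<in>tensor_idx n d. i 1 = k}. if inj_on i {1..d} then F (i ` {1..d}) else 0) = fact (d - 1) * upsum {1..n} d F {k}"
proof -
  have "(\<lambda>r\<in>{1..1}. k) \<in> tensor_idx n 1" using k by (simp add: tensor_idx_def)
  from sum_prefix_inj[OF d this, of F] show ?thesis by simp
qed

context
  fixes n d :: nat and T :: "(nat \<Rightarrow> nat) \<Rightarrow> real"
  assumes sym: "symmetric_tensor n d T" and van: "vanishing_diagonal n d T"
begin

lemma tensor_sum_eq:
  "(\<Sum>i\<in>tensor_idx n d. T i) = fact d * (\<Sum>A\<in>subsets {1..n} d. T (set_idx d A))"
  using sum_tensor_inj[of d "\<lambda>A. T (set_idx d A)" n] symmetric_tensor_eq[OF sym van] by (simp cong: sum.cong)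

lemma tensor_first_eq:
  assumes "1 \<le> d" "k \<in> {1..n}"
  shows "(\<Sum>i\<in>{i\<in>tensor_idx n d. i 1 = k}. T i) = fact (d - 1) * upsum {1..n} d (\<lambda>A. T (set_idx d A)) {k}"
proof -
  have "(\<Sum>i\<in>{i\<in>tensor_idx n d. i 1 = k}. T i) =
     (\<Sum>i\<in>{i\<in>tensor_idx n d. i 1 = k}. if inj_on i {1..d} then T (set_idx d (i ` {1..d})) else 0)"
    by (intro sum.cong refl symmetric_tensor_eq[OF sym van]) auto
  then show ?thesis using sum_first_inj[OF assms, of "\<lambda>A. T (set_idx d A)"] by simp
qed

text \<open>Each \<open>s\<close>-set comes from s! prefixes, and each prefix extends in (d - s)!
  ways to a given \<open>d\<close>-set. As the binomial times s! (d - s)! is d!, the weights in E3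
  are exactly those that turn the seminorm of order \<open>s\<close> into the root of a
  level.\<close>

lemma tensor_seminorm_level:
  assumes s: "1 \<le> s" "s \<le> d"
  shows "real (d choose s) * sqrt (fact s) * tensor_seminorm n d s T = sqrt (level {1..n} d (\<lambda>A. fact d * T (set_idx d A)) s)"
proof -
  let ?F = "\<lambda>A. T (set_idx d A)"
  have "(\<Sum>i\<in>{i\<in>tensor_idx n d. \<forall>r\<in>{1..s}. i r = j r}. T i) =
     (if inj_on j {1..s} then fact (d - s) * upsum {1..n} d ?F (j ` {1..s}) else 0)" if j: "j \<in> tensor_idx n s" for j
  proof -
    have "(\<Sum>i\<in>{i\<in>tensor_idx n d. \<forall>r\<in>{1..s}. i r = j r}. T i) =
       (\<Sum>i\<in>{i\<in>tensor_idx n d. \<forall>r\<in>{1..s}. i r = j r}. if inj_on i {1..d} then ?F (i ` {1..d}) else 0)"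
      by (intro sum.cong refl symmetric_tensor_eq[OF sym van]) auto
    then show ?thesis using sum_prefix_inj[OF s(2) j, of ?F] by simp
  qed
  then have "tensor_seminorm n d s T = sqrt (\<Sum>j\<in>tensor_idx n s. if inj_on j {1..s} then (fact (d - s) * upsum {1..n} d ?F (j ` {1..s}))\<^sup>2 else 0)"
    using s unfolding tensor_seminorm_def by (simp add: if_distrib[of "\<lambda>x. x\<^sup>2"] cong: sum.cong if_cong)
  also have "(\<Sum>j\<in>tensor_idx n s. if inj_on j {1..s} then (fact (d - s) * upsum {1..n} d ?F (j ` {1..s}))\<^sup>2 else 0) =
     fact s * (\<Sum>J\<in>subsets {1..n} s. (fact (d - s) * upsum {1..n} d ?F J)\<^sup>2)"
    by (rule sum_tensor_inj[where F = "\<lambda>J. (fact (d - s) * upsum {1..n} d ?F J)\<^sup>2"])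
  also have "\<dots> = fact s * (fact (d - s))\<^sup>2 * level {1..n} d ?F s"
    by (simp add: level_def power_mult_distrib mult.assoc flip: sum_distrib_left)
  finally have "real (d choose s) * sqrt (fact s) * tensor_seminorm n d s T =
      sqrt ((real (d choose s))\<^sup>2 * fact s * (fact s * (fact (d - s))\<^sup>2 * level {1..n} d ?F s))"
    by (simp add: real_sqrt_mult)
  also have "(real (d choose s))\<^sup>2 * fact s * (fact s * (fact (d - s))\<^sup>2 * level {1..n} d ?F s) =
      (fact s * fact (d - s) * real (d choose s))\<^sup>2 * level {1..n} d ?F s"
    by (simp add: power2_eq_square)
  also have "fact s * fact (d - s) * real (d choose s) = fact d"
    using binomial_fact_lemma[OF s(2)] by (metis of_nat_fact of_nat_mult)
  also have "(fact d)\<^sup>2 * level {1..n} d ?F s = level {1..n} d (\<lambda>A. fact d * ?F A) s"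
    by (simp add: level_cmult)
  finally show ?thesis .
qed

end

text \<open>A product of \<open>m\<close> factors \<open>(N - k) / n\<close>, each at least
  \<open>1 - d / n\<close> by the fourth assumption, estimated as in Bernoulli's inequality. It
  serves \<open>N = n\<close>, \<open>m = d\<close> and \<open>N = n - 1\<close>,
  \<open>m = d - 1\<close>.\<close>

lemma falling_ratio:
  fixes N m n d :: nat
  assumes "m \<le> d" "m \<le> N" "N \<le> n" "n + m \<le> N + d + 1" "0 < n"
  shows "1 - real m * (real d / real n) \<le> fact m * real (N choose m) / real n ^ m"
    "fact m * real (N choose m) / real n ^ m \<le> 1" "0 \<le> fact m * real (N choose m) / real n ^ m"
proof -
  have "1 - real m * (real d / real n) \<le> fact m * real (N choose m) / real n ^ m \<and> fact m * real (N choose m) / real n ^ m \<le> 1"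
    using assms(1,2,4)
  proof (induction m)
    case 0
    then show ?case by simp
  next
    case (Suc m)
    let ?f = "fact m * real (N choose m) / real n ^ m"
    have IH: "1 - real m * (real d / real n) \<le> ?f" "?f \<le> 1" using Suc by auto
    have f0: "?f \<ge> 0" by simp
    have "Suc m * (N choose Suc m) = (N choose m) * (N - m)"
      by (metis binomial_absorb_comp binomial_absorption mult.commute)
    then have "real (Suc m) * real (N choose Suc m) = real (N choose m) * (real N - real m)"
      using Suc.prems by (metis Suc_leD of_nat_diff of_nat_mult)
    then have "fact m * (real (Suc m) * real (N choose Suc m)) = fact m * real (N choose m) * (real N - real m)"
      by (simp only: mult.assoc)
    then have "fact (Suc m) * real (N choose Suc m) = fact m * real (N choose m) * (real N - real m)"
      by (simp only: fact_Suc mult_ac)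
    then have e: "fact (Suc m) * real (N choose Suc m) / real n ^ Suc m = ?f * ((real N - real m) / real n)"
      by (simp only: power_Suc times_divide_times_eq mult.commute[of "real n" "real n ^ m"])
    have q: "1 - real d / real n \<le> (real N - real m) / real n"
    proof -
      have "real n - real d \<le> real N - real m" using Suc.prems by simp
      then have "(real n - real d) / real n \<le> (real N - real m) / real n" by (rule divide_right_mono) simp
      then show ?thesis using assms(5) by (simp add: diff_divide_distrib)
    qed
    have q1: "(real N - real m) / real n \<le> 1" "0 \<le> (real N - real m) / real n" using Suc.prems assms by simp_all
    have "?f * (1 - real d / real n) \<le> ?f * ((real N - real m) / real n)" using q f0 by (rule mult_left_mono)
    moreover have "?f * (real d / real n) \<le> 1 * (real d / real n)" using IH(2) by (rule mult_right_mono) simp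
    moreover have "1 - real (Suc m) * u \<le> g * w"
      if "g * (1 - u) \<le> g * w" "g * u \<le> 1 * u" "1 - real m * u \<le> g" for g u w :: real
      using that by (simp add: algebra_simps)
    ultimately have "1 - real (Suc m) * (real d / real n) \<le> ?f * ((real N - real m) / real n)"
      using IH(1) by blast
    moreover have "?f * ((real N - real m) / real n) \<le> 1 * 1" using IH(2) q1 f0 by (intro mult_mono) auto
    ultimately show ?case unfolding e by simp
  qed
  then show "1 - real m * (real d / real n) \<le> fact m * real (N choose m) / real n ^ m"
    "fact m * real (N choose m) / real n ^ m \<le> 1" "0 \<le> fact m * real (N choose m) / real n ^ m" by auto
qed

lemma compose_tensor_idx:
  assumes "p permutes {1..n}" "i \<in> tensor_idx n d" shows "compose {1..d} p i \<in> tensor_idx n d"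
  using assms(2) permutes_in_image[OF assms(1)] unfolding tensor_idx_def by (auto simp: compose_def PiE_iff)

lemma symmetric_tensor_mult:
  "symmetric_tensor n d T \<Longrightarrow> symmetric_tensor n d U \<Longrightarrow> symmetric_tensor n d (\<lambda>i. T i * U i)"
  unfolding symmetric_tensor_def by metis

lemma vanishing_diagonal_mult:
  "vanishing_diagonal n d T \<Longrightarrow> vanishing_diagonal n d (\<lambda>i. T i * U i)"
  by (simp add: vanishing_diagonal_def)

definition shifted_set :: "nat \<Rightarrow> nat \<Rightarrow> nat set" where
  "shifted_set d t = {1..t} \<union> {d + 1..2 * d - t}"

lemma base_idx_in:
  assumes "d \<le> n" shows "base_idx d \<in> tensor_idx n d" "inj_on (base_idx d) {1..d}" "base_idx d ` {1..d} = {1..d}"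
  using assms by (auto simp: base_idx_def tensor_idx_def inj_on_def)

lemma shifted_idx_in:
  assumes "2 * d \<le> n" "t \<le> d"
  shows "shifted_idx d t \<in> tensor_idx n d" "inj_on (shifted_idx d t) {1..d}"
    "shifted_idx d t ` {1..d} = shifted_set d t"
proof -
  show "shifted_idx d t \<in> tensor_idx n d" using assms by (auto simp: shifted_idx_def tensor_idx_def)
  show "inj_on (shifted_idx d t) {1..d}" using assms by (auto simp: shifted_idx_def inj_on_def split: if_splits)
  have "y \<in> shifted_idx d t ` {1..d}" if "y \<in> {d + 1..2 * d - t}" for y
  proof (rule image_eqI[of _ _ "y - d + t"])
    show "y = shifted_idx d t (y - d + t)" using that assms by (auto simp: shifted_idx_def)
    show "y - d + t \<in> {1..d}" using that assms by auto
  qed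
  moreover have "y \<in> shifted_idx d t ` {1..d}" if "y \<in> {1..t}" for y
    by (rule image_eqI[of _ _ y]) (use that assms in \<open>auto simp: shifted_idx_def\<close>)
  moreover have "shifted_idx d t ` {1..d} \<subseteq> shifted_set d t"
    using assms by (auto simp: shifted_idx_def shifted_set_def)
  ultimately show "shifted_idx d t ` {1..d} = shifted_set d t" unfolding shifted_set_def by blast
qed

lemma (in prob_space) expectation_of_bool:
  "expectation (\<lambda>\<omega>. of_bool (P \<omega>) :: real) = prob {\<omega>\<in>space M. P \<omega>}"
proof -
  have "expectation (\<lambda>\<omega>. of_bool (P \<omega>) :: real) = expectation (indicator {\<omega>\<in>space M. P \<omega>})"
    by (rule Bochner_Integration.integral_cong) (auto simp: indicator_def)
  also have "\<dots> = prob ({\<omega>\<in>space M. P \<omega>} \<inter> space M)" by (rule Bochner_Integration.integral_indicator)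
  also have "{\<omega>\<in>space M. P \<omega>} \<inter> space M = {\<omega>\<in>space M. P \<omega>}" by blast
  finally show ?thesis .
qed

section \<open>Random tensors as exchangeable families indexed by sets\<close>

locale exchangeable_tensor = prob_space M for M :: "'a measure" +
  fixes n d :: nat and X :: "(nat \<Rightarrow> nat) \<Rightarrow> 'a \<Rightarrow> real"
  assumes d1: "1 \<le> d" and nd: "2 * d \<le> n"
    and meas [measurable]: "i \<in> tensor_idx n d \<Longrightarrow> X i \<in> borel_measurable M"
    and mean: "i \<in> tensor_idx n d \<Longrightarrow> expectation (X i) = 0"
    and var: "i \<in> tensor_idx n d \<Longrightarrow> expectation (\<lambda>\<omega>. (X i \<omega>)\<^sup>2) \<le> 1"
    and int3: "i \<in> tensor_idx n d \<Longrightarrow> integrable M (\<lambda>\<omega>. \<bar>X i \<omega>\<bar> ^ 3)"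
    and sym: "AE \<omega> in M. symmetric_tensor n d (\<lambda>i. X i \<omega>)"
    and exchg: "exchangeable M n d X"
    and van: "AE \<omega> in M. vanishing_diagonal n d (\<lambda>i. X i \<omega>)"
begin

abbreviation K :: "nat set set" where "K \<equiv> subsets {1..n} d"

definition x :: "nat set \<Rightarrow> 'a \<Rightarrow> real" where "x A = X (set_idx d A)"

lemma x_meas [measurable]: "A \<in> K \<Longrightarrow> x A \<in> borel_measurable M"
  unfolding x_def by (intro meas set_idx_in)

lemma integral_exch:
  assumes p: "p permutes {1..n}" and G: "G \<in> borel_measurable (PiM (tensor_idx n d) (\<lambda>_. borel))"
  shows "expectation (\<lambda>\<omega>. G (\<lambda>i\<in>tensor_idx n d. X i \<omega>)) =
    expectation (\<lambda>\<omega>. G (\<lambda>i\<in>tensor_idx n d. X (compose {1..d} p i) \<omega>) :: real)"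
proof -
  have 1: "(\<lambda>\<omega>. \<lambda>i\<in>tensor_idx n d. X i \<omega>) \<in> M \<rightarrow>\<^sub>M PiM (tensor_idx n d) (\<lambda>_. borel)"
    by (rule measurable_restrict) (rule meas)
  have 2: "(\<lambda>\<omega>. \<lambda>i\<in>tensor_idx n d. X (compose {1..d} p i) \<omega>) \<in> M \<rightarrow>\<^sub>M PiM (tensor_idx n d) (\<lambda>_. borel)"
    by (rule measurable_restrict) (rule meas[OF compose_tensor_idx[OF p]])
  have "tensor_law M n d X = tensor_law M n d (\<lambda>i. X (compose {1..d} p i))"
    using exchg p unfolding exchangeable_def by blast
  then have "integral\<^sup>L (tensor_law M n d X) G = integral\<^sup>L (tensor_law M n d (\<lambda>i. X (compose {1..d} p i))) G" by simp
  then show ?thesis unfolding tensor_law_def integral_distr[OF 1 G] integral_distr[OF 2 G] .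
qed

text \<open>Symmetry holds almost surely, so an entry of the tensor is identified with an entry of
  the set family up to one null set common to all indices.\<close>

lemma x_image: "AE \<omega> in M. \<forall>i\<in>tensor_idx n d. inj_on i {1..d} \<longrightarrow> X i \<omega> = x (i ` {1..d}) \<omega>"
  using sym
proof (rule eventually_mono, intro ballI impI)
  fix \<omega> i assume s: "symmetric_tensor n d (\<lambda>i. X i \<omega>)" and i: "i \<in> tensor_idx n d" "inj_on i {1..d}"
  note K = image_idx_subsets[OF i]
  show "X i \<omega> = x (i ` {1..d}) \<omega>"
    unfolding x_def using symmetric_tensor_image[OF s i set_idx_in(1,2)[OF K]] set_idx_in(3)[OF K] by simp
qed

text \<open>Permuting the chosen index of \<open>A\<close> enumerates the image set, though not
  necessarily by its chosen index; almost sure symmetry corrects this under the integral. An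
  arbitrary measurable \<open>G\<close> covers moments, covariances and distribution functions at
  once.\<close>

lemma integral_exch_image:
  assumes p: "p permutes {1..n}" and G [measurable]: "G \<in> borel_measurable (PiM K (\<lambda>_. borel))"
  shows "expectation (\<lambda>\<omega>. G (\<lambda>A\<in>K. x A \<omega>)) = expectation (\<lambda>\<omega>. G (\<lambda>A\<in>K. x (p ` A) \<omega>) :: real)"
proof -
  let ?T = "tensor_idx n d"
  have pK: "p ` A \<in> K" if "A \<in> K" for A
    using that permutes_image_subsets[OF p, of d] by (auto simp: bij_betw_def)
  have m: "(\<lambda>f. \<lambda>A\<in>K. f (set_idx d A)) \<in> PiM ?T (\<lambda>_. borel) \<rightarrow>\<^sub>M PiM K (\<lambda>_. borel :: real measure)"
    by (rule measurable_restrict) (rule measurable_component_singleton, rule set_idx_in(1))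
  have "(\<lambda>A\<in>K. (\<lambda>i\<in>?T. X i \<omega>) (set_idx d A)) = (\<lambda>A\<in>K. x A \<omega>)" for \<omega>
    by (rule restrict_ext) (simp add: set_idx_in(1) x_def)
  moreover have "(\<lambda>A\<in>K. (\<lambda>i\<in>?T. X (compose {1..d} p i) \<omega>) (set_idx d A)) = (\<lambda>A\<in>K. X (compose {1..d} p (set_idx d A)) \<omega>)" for \<omega>
    by (rule restrict_ext) (simp add: set_idx_in(1))
  ultimately have "expectation (\<lambda>\<omega>. G (\<lambda>A\<in>K. x A \<omega>)) = expectation (\<lambda>\<omega>. G (\<lambda>A\<in>K. X (compose {1..d} p (set_idx d A)) \<omega>))"
    using integral_exch[OF p measurable_compose[OF m G]] by simp
  also have "\<dots> = expectation (\<lambda>\<omega>. G (\<lambda>A\<in>K. x (p ` A) \<omega>))"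
  proof (rule integral_cong_AE)
    show "(\<lambda>\<omega>. G (\<lambda>A\<in>K. X (compose {1..d} p (set_idx d A)) \<omega>)) \<in> borel_measurable M"
      by (rule measurable_compose[OF _ G], rule measurable_restrict)
        (rule meas[OF compose_tensor_idx[OF p set_idx_in(1)]])
    show "(\<lambda>\<omega>. G (\<lambda>A\<in>K. x (p ` A) \<omega>)) \<in> borel_measurable M"
      by (rule measurable_compose[OF _ G], rule measurable_restrict) (rule x_meas[OF pK])
    show "AE \<omega> in M. G (\<lambda>A\<in>K. X (compose {1..d} p (set_idx d A)) \<omega>) = G (\<lambda>A\<in>K. x (p ` A) \<omega>)"
      using x_image
    proof (rule eventually_mono)
      fix \<omega> assume s: "\<forall>i\<in>?T. inj_on i {1..d} \<longrightarrow> X i \<omega> = x (i ` {1..d}) \<omega>"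
      have "(\<lambda>A\<in>K. X (compose {1..d} p (set_idx d A)) \<omega>) = (\<lambda>A\<in>K. x (p ` A) \<omega>)"
      proof (rule restrict_ext)
        fix A assume A: "A \<in> K"
        let ?i = "compose {1..d} p (set_idx d A)"
        have e: "?i r = (p \<circ> set_idx d A) r" if "r \<in> {1..d}" for r using that by (simp add: compose_def)
        have "inj_on (p \<circ> set_idx d A) {1..d}"
          using set_idx_in(2)[OF A] permutes_inj_on[OF p] by (rule comp_inj_on)
        then have "inj_on ?i {1..d}" using inj_on_cong[of "{1..d}" ?i "p \<circ> set_idx d A", OF e] by blast
        moreover have "?i ` {1..d} = p ` A"
        proof -
          have "?i ` {1..d} = (p \<circ> set_idx d A) ` {1..d}" by (rule image_cong[OF refl e])
          then show ?thesis using set_idx_in(3)[OF A] by (simp only: image_comp[symmetric])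
        qed
        ultimately show "X ?i \<omega> = x (p ` A) \<omega>" using s compose_tensor_idx[OF p set_idx_in(1)[OF A]] by auto
      qed
      then show "G (\<lambda>A\<in>K. X (compose {1..d} p (set_idx d A)) \<omega>) = G (\<lambda>A\<in>K. x (p ` A) \<omega>)" by (rule arg_cong)
    qed
  qed
  finally show ?thesis .
qed

lemma base_in: "base_idx d \<in> tensor_idx n d" "inj_on (base_idx d) {1..d}" "base_idx d ` {1..d} = {1..d}" "{1..d} \<in> K"
proof -
  have "d \<le> n" using nd by simp
  note b = base_idx_in[OF this]
  show "base_idx d \<in> tensor_idx n d" "inj_on (base_idx d) {1..d}" "base_idx d ` {1..d} = {1..d}" by (fact b)+
  show "{1..d} \<in> K" using image_idx_subsets[OF b(1,2)] b(3) by simp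
qed

lemma shifted_in:
  assumes "t \<le> d" shows "shifted_set d t \<in> K"
  using image_idx_subsets[OF shifted_idx_in(1,2)[OF nd assms]] shifted_idx_in(3)[OF nd assms] by simp

lemma third:
  assumes A: "A \<in> K"
  shows "expectation (\<lambda>\<omega>. \<bar>x A \<omega>\<bar> ^ 3) = expectation (\<lambda>\<omega>. \<bar>X (base_idx d) \<omega>\<bar> ^ 3)"
proof -
  have A': "A \<subseteq> {1..n}" "card A = d" using A by (auto simp: subsets_def)
  have d: "{1..d} \<subseteq> {1..n}" using nd by auto
  obtain p where p: "p permutes {1..n}" "p ` {1..d} = A" 
    by (rule ex_permutation_two_sets[of "{1..n}" "{1..d}" "{1..d}" A A]) (use A' d in auto)
  have "(\<lambda>f. \<bar>f {1..d}\<bar> ^ 3) \<in> borel_measurable (PiM K (\<lambda>_. borel :: real measure))" 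
    using base_in(4) by measurable
  from integral_exch_image[OF p(1) this]
  have "expectation (\<lambda>\<omega>. \<bar>x {1..d} \<omega>\<bar> ^ 3) = expectation (\<lambda>\<omega>. \<bar>x A \<omega>\<bar> ^ 3)"
    using base_in(4) p(2) by simp
  moreover have "expectation (\<lambda>\<omega>. \<bar>X (base_idx d) \<omega>\<bar> ^ 3) = expectation (\<lambda>\<omega>. \<bar>x {1..d} \<omega>\<bar> ^ 3)"
  proof (rule integral_cong_AE)
    show "AE \<omega> in M. \<bar>X (base_idx d) \<omega>\<bar> ^ 3 = \<bar>x {1..d} \<omega>\<bar> ^ 3"
      using x_image by (rule eventually_mono) (use base_in in auto)
  qed (use meas[OF base_in(1)] x_meas[OF base_in(4)] in measurable)
  ultimately show ?thesis by simp
qed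

text \<open>The overlap is the only invariant of a pair of \<open>d\<close>-sets under permutations,
  so the pair is an image of the two sets that represent the indices in the definition of
  \<open>corr\<close>.\<close>

lemma cor:
  assumes A: "A \<in> K" and B: "B \<in> K"
  shows "expectation (\<lambda>\<omega>. x A \<omega> * x B \<omega>) = corr M d X (card (A \<inter> B))"
proof -
  define t where "t = card (A \<inter> B)"
  have A': "A \<subseteq> {1..n}" "card A = d" using A by (auto simp: subsets_def)
  have B': "B \<subseteq> {1..n}" "card B = d" using B by (auto simp: subsets_def)
  have fA: "finite A" using A'(1) finite_subset by blast
  have t: "t \<le> d" using A' fA card_mono[of A "A \<inter> B"] by (simp add: t_def)
  note S = shifted_in[OF t] and s = shifted_idx_in[OF nd t]
  have S': "shifted_set d t \<subseteq> {1..n}" "card (shifted_set d t) = d" using S by (auto simp: subsets_def)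
  have d: "{1..d} \<subseteq> {1..n}" using nd by auto
  have "{1..d} \<inter> shifted_set d t = {1..t}" using t by (auto simp: shifted_set_def)
  then have it: "card ({1..d} \<inter> shifted_set d t) = card (A \<inter> B)" by (simp add: t_def)
  obtain p where p: "p permutes {1..n}" "p ` {1..d} = A" "p ` shifted_set d t = B"
    by (rule ex_permutation_two_sets[of "{1..n}" "{1..d}" "shifted_set d t" A B])
      (use A' B' S' d it in simp_all)
  have "(\<lambda>f. f {1..d} * f (shifted_set d t)) \<in> borel_measurable (PiM K (\<lambda>_. borel :: real measure))"
    using base_in(4) S by measurable
  from integral_exch_image[OF p(1) this]
  have "expectation (\<lambda>\<omega>. x {1..d} \<omega> * x (shifted_set d t) \<omega>) = expectation (\<lambda>\<omega>. x A \<omega> * x B \<omega>)"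
    using base_in(4) S p(2,3) by simp
  moreover have "corr M d X t = expectation (\<lambda>\<omega>. x {1..d} \<omega> * x (shifted_set d t) \<omega>)"
    unfolding corr_def
  proof (rule integral_cong_AE)
    show "AE \<omega> in M. X (base_idx d) \<omega> * X (shifted_idx d t) \<omega> = x {1..d} \<omega> * x (shifted_set d t) \<omega>"
      using x_image
    proof (rule eventually_mono)
      fix \<omega> assume e: "\<forall>i\<in>tensor_idx n d. inj_on i {1..d} \<longrightarrow> X i \<omega> = x (i ` {1..d}) \<omega>"
      have "X (base_idx d) \<omega> = x {1..d} \<omega>" using e base_in by auto
      moreover have "X (shifted_idx d t) \<omega> = x (shifted_set d t) \<omega>" using e s by auto
      ultimately show "X (base_idx d) \<omega> * X (shifted_idx d t) \<omega> = x {1..d} \<omega> * x (shifted_set d t) \<omega>" by simp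
    qed
  qed (use meas[OF base_in(1)] x_meas[OF base_in(4)] meas[OF s(1)] x_meas[OF S] in measurable)
  ultimately show ?thesis by (simp add: t_def)
qed

lemma exch_form:
  assumes p: "p permutes {1..n}"
  shows "prob {\<omega>\<in>space M. (\<Sum>A\<in>K. a A * x (p ` A) \<omega>) \<le> z} = prob {\<omega>\<in>space M. (\<Sum>A\<in>K. a A * x A \<omega>) \<le> z}"
proof -
  have "(\<lambda>f. (\<Sum>A\<in>K. a A * f A)) \<in> borel_measurable (PiM K (\<lambda>_. borel :: real measure))" by measurable
  then have "(\<lambda>f. of_bool ((\<Sum>A\<in>K. a A * f A) \<le> z) :: real) \<in> borel_measurable (PiM K (\<lambda>_. borel :: real measure))"
    by measurable
  from integral_exch_image[OF p this]
  have "expectation (\<lambda>\<omega>. of_bool ((\<Sum>A\<in>K. a A * x A \<omega>) \<le> z) :: real) = expectation (\<lambda>\<omega>. of_bool ((\<Sum>A\<in>K. a A * x (p ` A) \<omega>) \<le> z))"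
    by (simp cong: sum.cong)
  then show ?thesis by (simp only: expectation_of_bool)
qed

lemma exch_sets_x:
  "exch_sets M n d x (corr M d X) (expectation (\<lambda>\<omega>. \<bar>X (base_idx d) \<omega>\<bar> ^ 3))"
proof unfold_locales
  show "1 \<le> d" "2 * d \<le> n" by (fact d1 nd)+
  fix A assume A: "A \<in> K"
  show "x A \<in> borel_measurable M" by (rule x_meas[OF A])
  show "integrable M (\<lambda>\<omega>. \<bar>x A \<omega>\<bar> ^ 3)" "expectation (x A) = 0" "expectation (\<lambda>\<omega>. (x A \<omega>)\<^sup>2) \<le> 1"
    unfolding x_def using int3 mean var set_idx_in(1)[OF A] by blast+
  show "expectation (\<lambda>\<omega>. \<bar>x A \<omega>\<bar> ^ 3) = expectation (\<lambda>\<omega>. \<bar>X (base_idx d) \<omega>\<bar> ^ 3)" by (rule third[OF A])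
next
  fix A B assume "A \<in> K" "B \<in> K"
  then show "expectation (\<lambda>\<omega>. x A \<omega> * x B \<omega>) = corr M d X (card (A \<inter> B))" by (rule cor)
next
  fix p a z assume "p permutes {1..n}"
  then show "prob {\<omega>\<in>space M. (\<Sum>A\<in>K. a A * x (p ` A) \<omega>) \<le> z} = prob {\<omega>\<in>space M. (\<Sum>A\<in>K. a A * x A \<omega>) \<le> z}"
    by (rule exch_form)
qed

lemma AE_sum_eq: "AE \<omega> in M. (\<Sum>i\<in>tensor_idx n d. X i \<omega>) = fact d * (\<Sum>A\<in>K. x A \<omega>)"
  using sym van by eventually_elim (simp add: tensor_sum_eq x_def)

lemma AE_first_eq:
  "AE \<omega> in M. \<forall>k\<in>{1..n}. (\<Sum>i\<in>{i\<in>tensor_idx n d. i 1 = k}. X i \<omega>) = fact (d - 1) * upsum {1..n} d (\<lambda>A. x A \<omega>) {k}"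
  using sym van
proof eventually_elim
  case (elim \<omega>)
  show ?case unfolding x_def using tensor_first_eq[OF elim d1] by blast
qed

lemma AE_inner_eq:
  assumes "symmetric_tensor n d \<theta>" "vanishing_diagonal n d \<theta>"
  shows "AE \<omega> in M. tensor_inner n d \<theta> (\<lambda>i. X i \<omega>) = (\<Sum>A\<in>K. fact d * \<theta> (set_idx d A) * x A \<omega>)"
  using sym
proof eventually_elim
  case (elim \<omega>)
  show ?case
    using tensor_sum_eq[OF symmetric_tensor_mult[OF assms(1) elim] vanishing_diagonal_mult[OF assms(2)]]
    by (simp add: tensor_inner_def x_def sum_distrib_left mult.assoc)
qed

end

context exchangeable_tensor
begin

text \<open>\<open>final_bound\<close> for the coefficients \<open>a A\<close>, that is d! times the
  entry of \<theta> at \<open>A\<close>; the normalisation of the first seminorm then becomes a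
  level of order 1 equal to \<open>d^2\<close>. What remains is to identify set quantities with
  tensor quantities, almost surely where the field is involved.\<close>

lemma kolmogorov_inner:
  fixes \<theta> :: "(nat \<Rightarrow> nat) \<Rightarrow> real" and \<kappa> \<alpha> B :: real
  assumes \<theta>: "symmetric_tensor n d \<theta>" "vanishing_diagonal n d \<theta>" and norm1: "tensor_seminorm n d 1 \<theta> = 1"
    and \<kappa>: "\<kappa> = 20 * real d ^ 3 * 18 ^ d * fact (2 * d)"
    and B: "B = expectation (\<lambda>\<omega>. (1 / real n ^ d * (\<Sum>i\<in>tensor_idx n d. X i \<omega>))\<^sup>2)"
    and \<alpha>: "0 < \<alpha>" "\<alpha> < 1"
    and h1: "oscillation M n d X powr \<alpha> \<le> corr M d X 1" and h2: "B powr \<alpha> \<le> corr M d X 1"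
    and h3: "(\<kappa> / real n) powr \<alpha> \<le> corr M d X 1"
  shows "kolmogorov_dist (distr M borel (\<lambda>\<omega>. tensor_inner n d \<theta> (\<lambda>i. X i \<omega>)))
          (centered_normal (variance (\<lambda>\<omega>. tensor_inner n d \<theta> (\<lambda>i. X i \<omega>)))) \<le>
      (5 * oscillation M n d X powr (1 - \<alpha>) + 5 * \<bar>corr M d X 0\<bar> powr (1 - \<alpha>)
        + \<bar>corr M d X 0 / (real d ^ 2 * corr M d X 1) * (tensor_seminorm n d 0 \<theta> ^ 2 - 1)\<bar>
        + 6 * \<kappa> / real n powr (1 - \<alpha>) + 4 * (tensor_seminorm n d 0 \<theta> ^ 2 / real n))
      + 2 ^ 36 * (expectation (\<lambda>\<omega>. \<bar>X (base_idx d) \<omega>\<bar> ^ 3) / corr M d X 1 powr (3 / 2))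
        * (\<Sum>j=1..n. \<bar>\<Sum>i\<in>{i\<in>tensor_idx n d. i 1 = j}. \<theta> i\<bar> ^ 3)
      + 3 * \<kappa> * (1 / (real d * sqrt (corr M d X 1)))
        * (\<Sum>s=2..d. real (d choose s) * sqrt (fact s)
             * sqrt (corr_Sigma M d X s + 16 * real d ^ 2 * 2 ^ d / real n) * tensor_seminorm n d s \<theta>)"
    (is "kolmogorov_dist (distr M borel ?Y) _ \<le> ?E1 + ?E2 + ?E3")
proof -
  define a where "a A = fact d * \<theta> (set_idx d A)" for A
  \<comment> \<open>Proportions of injective indices: \<rho> among the continuations of a fixed
    first entry, \<open>r\<close> among all indices.\<close>
  define \<rho> where "\<rho> = fact (d - 1) * real ((n - 1) choose (d - 1)) / real n ^ (d - 1)"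
  define r where "r = fact d * real (n choose d) / real n ^ d"
  define m3 where "m3 = expectation (\<lambda>\<omega>. \<bar>X (base_idx d) \<omega>\<bar> ^ 3)"
  have n0: "0 < n" using d1 nd by simp
  have r: "1 - real d ^ 2 / real n \<le> r" "0 \<le> r" "r \<le> 1"
    using falling_ratio[of d d n n] d1 nd n0 by (simp_all add: r_def power2_eq_square)
  have \<rho>1: "1 - real (d - 1) * (real d / real n) \<le> \<rho>" "\<rho> \<le> 1"
    using falling_ratio(1,2)[of "d - 1" d "n - 1" n] d1 nd n0 by (simp_all add: \<rho>_def)
  have "real (d - 1) * (real d / real n) \<le> real d * (real d / real n)" by (intro mult_right_mono) auto
  then have \<rho>e: "1 - real d ^ 2 / real n \<le> \<rho>" using \<rho>1(1) by (simp add: power2_eq_square)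
  have \<rho>0: "0 < \<rho>" using d1 nd n0 by (simp add: \<rho>_def)
  \<comment> \<open>Strict positivity comes from \<open>h3\<close>, since
    \<open>\<kappa> / n\<close> is positive.\<close>
  have \<delta>1: "corr M d X 1 > 0"
  proof -
    have "\<kappa> / real n > 0" using d1 n0 by (simp add: \<kappa>)
    then have "\<kappa> / real n \<noteq> 0" by (rule less_imp_neq[symmetric])
    then have "(\<kappa> / real n) powr \<alpha> > 0" unfolding powr_gt_zero .
    then show ?thesis using h3 by linarith
  qed
  have lev: "real (d choose s) * sqrt (fact s) * tensor_seminorm n d s \<theta> = sqrt (level {1..n} d a s)"
    if "1 \<le> s" "s \<le> d" for s
    unfolding a_def by (rule tensor_seminorm_level[OF \<theta> that])
  have "sqrt (level {1..n} d a 1) = real d" using lev[of 1] d1 norm1 by simp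
  then have lev1: "level {1..n} d a 1 = (real d)\<^sup>2" by (metis real_sqrt_eq_iff real_sqrt_unique of_nat_0_le_iff real_sqrt_abs abs_of_nat)
  interpret F: exch_sets_form M n d x "corr M d X" m3 "{1..n}" "subsets {1..n} d" a \<rho>
    by (intro exch_sets_form.intro exch_sets_x[folded m3_def] exch_sets_form_axioms.intro)
      (fact lev1 \<delta>1 \<rho>0 \<rho>1(2))+
  have osc: "F.osc = oscillation M n d X"
    unfolding F.osc_def oscillation_def
  proof (rule integral_cong_AE)
    show "AE \<omega> in M. \<bar>F.avg_sq \<omega> - corr M d X 1\<bar> =
      \<bar>1 / real n * (\<Sum>j=1..n. (1 / real n ^ (d - 1) * (\<Sum>i\<in>{i\<in>tensor_idx n d. i 1 = j}. X i \<omega>))\<^sup>2) - corr M d X 1\<bar>"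
      using AE_first_eq
    proof (rule eventually_mono)
      fix \<omega> assume e: "\<forall>k\<in>{1..n}. (\<Sum>i\<in>{i\<in>tensor_idx n d. i 1 = k}. X i \<omega>) = fact (d - 1) * upsum {1..n} d (\<lambda>A. x A \<omega>) {k}"
      have "\<rho> / F.mu1 = fact (d - 1) / real n ^ (d - 1)" 
        using F.mu1_pos by (simp add: \<rho>_def F.mu1_def)
      then have "\<rho> / F.mu1 * F.X k \<omega> = 1 / real n ^ (d - 1) * (\<Sum>i\<in>{i\<in>tensor_idx n d. i 1 = k}. X i \<omega>)"
        if "k \<in> {1..n}" for k
        using bspec[OF e that] by (simp add: F.X_def)
      then have "F.avg_sq \<omega> = 1 / real n * (\<Sum>j=1..n. (1 / real n ^ (d - 1) * (\<Sum>i\<in>{i\<in>tensor_idx n d. i 1 = j}. X i \<omega>))\<^sup>2)"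
        unfolding F.avg_sq_def by simp
      then show "\<bar>F.avg_sq \<omega> - corr M d X 1\<bar> =
        \<bar>1 / real n * (\<Sum>j=1..n. (1 / real n ^ (d - 1) * (\<Sum>i\<in>{i\<in>tensor_idx n d. i 1 = j}. X i \<omega>))\<^sup>2) - corr M d X 1\<bar>"
        by simp
    qed
    show "(\<lambda>\<omega>. \<bar>F.avg_sq \<omega> - corr M d X 1\<bar>) \<in> borel_measurable M"
      unfolding F.avg_sq_def F.X_def upsum_def by measurable
  qed measurable
  have Bm: "B = r\<^sup>2 * expectation (\<lambda>\<omega>. (F.\<mu> \<omega>)\<^sup>2)"
  proof -
    have "B = expectation (\<lambda>\<omega>. r\<^sup>2 * (F.\<mu> \<omega>)\<^sup>2)"
      unfolding B
    proof (rule integral_cong_AE)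
      show "AE \<omega> in M. (1 / real n ^ d * (\<Sum>i\<in>tensor_idx n d. X i \<omega>))\<^sup>2 = r\<^sup>2 * (F.\<mu> \<omega>)\<^sup>2"
        using AE_sum_eq
      proof (rule eventually_mono)
        fix \<omega> assume e: "(\<Sum>i\<in>tensor_idx n d. X i \<omega>) = fact d * (\<Sum>A\<in>K. x A \<omega>)"
        have "n choose d \<noteq> 0" using nd by simp
        then have "1 / real n ^ d * (\<Sum>i\<in>tensor_idx n d. X i \<omega>) = r * F.\<mu> \<omega>"
          unfolding e r_def F.\<mu>_def by simp
        then show "(1 / real n ^ d * (\<Sum>i\<in>tensor_idx n d. X i \<omega>))\<^sup>2 = r\<^sup>2 * (F.\<mu> \<omega>)\<^sup>2" by (simp only: power_mult_distrib)
      qed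
      show "(\<lambda>\<omega>. r\<^sup>2 * (F.\<mu> \<omega>)\<^sup>2) \<in> borel_measurable M" unfolding F.\<mu>_def by measurable
    qed measurable
    then show ?thesis by simp
  qed
  have Yeq: "AE \<omega> in M. ?Y \<omega> = (\<Sum>A\<in>K. a A * x A \<omega>)" unfolding a_def by (rule AE_inner_eq[OF \<theta>])
  have Ym [measurable]: "?Y \<in> borel_measurable M" unfolding tensor_inner_def by measurable
  have "expectation ?Y = expectation (\<lambda>\<omega>. \<Sum>A\<in>K. a A * x A \<omega>)"
    by (rule integral_cong_AE[OF Ym _ Yeq]) measurable
  also have "\<dots> = 0" using F.int1 F.mean by (simp add: Bochner_Integration.integral_sum)
  \<comment> \<open>The form is centred, so its variance is the second moment that
    \<open>var_form\<close> denotes.\<close>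
  finally have "variance ?Y = expectation (\<lambda>\<omega>. (?Y \<omega>)\<^sup>2)" by simp
  also have "\<dots> = F.var_form" unfolding F.var_form_def
    by (rule integral_cong_AE) (use Yeq in \<open>auto elim: eventually_mono\<close>)
  finally have V: "variance ?Y = F.var_form" .
  have cdf: "cdf (distr M borel ?Y) z = prob {\<omega>\<in>space M. (\<Sum>A\<in>K. a A * x A \<omega>) \<le> z}" for z
  proof -
    have "cdf (distr M borel ?Y) z = prob (?Y -` {..z} \<inter> space M)" unfolding cdf_def by (rule measure_distr) simp_all
    also have "\<dots> = prob {\<omega>\<in>space M. (\<Sum>A\<in>K. a A * x A \<omega>) \<le> z}"
      by (rule finite_measure_eq_AE) (use Yeq in \<open>auto elim: eventually_mono\<close>)
    finally show ?thesis .
  qed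
  have N0: "F.N0\<^sup>2 = tensor_seminorm n d 0 \<theta> ^ 2"
    using tensor_sum_eq[OF \<theta>] by (simp add: F.N0_def a_def tensor_seminorm_def flip: sum_distrib_left)
  have first: "upsum {1..n} d a {k} / real d = (\<Sum>i\<in>{i\<in>tensor_idx n d. i 1 = k}. \<theta> i)" if "k \<in> {1..n}" for k
  proof -
    have "upsum {1..n} d a {k} = fact d * upsum {1..n} d (\<lambda>A. \<theta> (set_idx d A)) {k}"
      by (simp add: upsum_def a_def sum_distrib_left)
    moreover have "fact d = real d * fact (d - 1)" using d1 by (intro fact_reduce) simp
    ultimately show ?thesis using tensor_first_eq[OF \<theta> d1 that] d1 by simp
  qed
  have E2: "?E2 = 2 ^ 36 * (m3 / corr M d X 1 powr (3 / 2)) * (\<Sum>k\<in>{1..n}. \<bar>upsum {1..n} d a {k} / real d\<bar> ^ 3)"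
    using first by (simp add: m3_def)
  have "(\<Sum>s=2..d. real (d choose s) * sqrt (fact s)
             * sqrt (corr_Sigma M d X s + 16 * real d ^ 2 * 2 ^ d / real n) * tensor_seminorm n d s \<theta>) =
        (\<Sum>s=2..d. sqrt (F.Sg s + 16 * real d ^ 2 * 2 ^ d / real n) * sqrt (level {1..n} d a s))"
  proof (intro sum.cong refl)
    fix s assume "s \<in> {2..d}"
    then have "sqrt (level {1..n} d a s) = real (d choose s) * sqrt (fact s) * tensor_seminorm n d s \<theta>" using lev[of s] by simp
    moreover have "corr_Sigma M d X s = F.Sg s" by (simp add: corr_Sigma_def alt_diff_def)
    ultimately show "real (d choose s) * sqrt (fact s)
             * sqrt (corr_Sigma M d X s + 16 * real d ^ 2 * 2 ^ d / real n) * tensor_seminorm n d s \<theta> =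
         sqrt (F.Sg s + 16 * real d ^ 2 * 2 ^ d / real n) * sqrt (level {1..n} d a s)" by (simp only: ac_simps)
  qed
  then have E3: "?E3 = 3 * \<kappa> * (1 / (real d * sqrt (corr M d X 1))) *
        (\<Sum>s=2..d. sqrt (F.Sg s + 16 * real d ^ 2 * 2 ^ d / real n) * sqrt (level {1..n} d a s))" by simp
  show ?thesis
    unfolding kolmogorov_dist_def V
  proof (rule cSUP_least)
    fix z
    show "\<bar>cdf (distr M borel ?Y) z - cdf (centered_normal F.var_form) z\<bar> \<le> ?E1 + ?E2 + ?E3"
      using F.final_bound[OF \<kappa> \<alpha> Bm r \<rho>e, unfolded osc, OF h1 h2 h3, of z] unfolding cdf N0 E2 E3 .
  qed simp
qed

end

theorem theorem1p4:
  fixes n d :: nat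
    and M :: "'a measure"
    and X :: "(nat \<Rightarrow> nat) \<Rightarrow> 'a \<Rightarrow> real"
    and \<theta> :: "(nat \<Rightarrow> nat) \<Rightarrow> real"
    and \<kappa> B \<alpha> :: real
  assumes "d \<ge> 1" and "n \<ge> 2 * d"
    and "random_tensor M n d X"
    and A1: "\<forall>i\<in>tensor_idx n d. (\<integral>\<omega>. X i \<omega> \<partial>M) = 0"
            "\<forall>i\<in>tensor_idx n d. (\<integral>\<omega>. (X i \<omega>)\<^sup>2 \<partial>M) \<le> 1"
            "\<forall>i\<in>tensor_idx n d. integrable M (\<lambda>\<omega>. \<bar>X i \<omega>\<bar> ^ 3)"
    and A2: "AE \<omega> in M. symmetric_tensor n d (\<lambda>i. X i \<omega>)"
            "exchangeable M n d X"
            "AE \<omega> in M. vanishing_diagonal n d (\<lambda>i. X i \<omega>)"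
    and A3: "symmetric_tensor n d \<theta>"
            "vanishing_diagonal n d \<theta>"
    and "tensor_seminorm n d 1 \<theta> = 1"
    and \<kappa>: "\<kappa> = 20 * real d ^ 3 * 18 ^ d * fact (2 * d)"
    and B: "B = (\<integral>\<omega>. (1 / real n ^ d * (\<Sum>i\<in>tensor_idx n d. X i \<omega>))\<^sup>2 \<partial>M)"
    and "0 < \<alpha>" and "\<alpha> < 1"
    and "corr M d X 1 \<ge>
           Max {oscillation M n d X powr \<alpha>, B powr \<alpha>, (\<kappa> / real n) powr \<alpha>}"
  shows
    "let \<sigma>2 = prob_space.variance M (\<lambda>\<omega>. tensor_inner n d \<theta> (\<lambda>i. X i \<omega>));
         E1 = 5 * oscillation M n d X powr (1 - \<alpha>) + 5 * \<bar>corr M d X 0\<bar> powr (1 - \<alpha>)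
              + \<bar>corr M d X 0 / (real d ^ 2 * corr M d X 1)
                  * (tensor_seminorm n d 0 \<theta> ^ 2 - 1)\<bar>
              + 6 * \<kappa> / real n powr (1 - \<alpha>)
              + 4 * (tensor_seminorm n d 0 \<theta> ^ 2 / real n);
         E2 = 2 ^ 36 * ((\<integral>\<omega>. \<bar>X (base_idx d) \<omega>\<bar> ^ 3 \<partial>M) / corr M d X 1 powr (3 / 2))
              * (\<Sum>j=1..n. \<bar>\<Sum>i\<in>{i\<in>tensor_idx n d. i 1 = j}. \<theta> i\<bar> ^ 3);
         E3 = 3 * \<kappa> * (1 / (real d * sqrt (corr M d X 1)))
              * (\<Sum>s=2..d. real (d choose s) * sqrt (fact s)
                   * sqrt (corr_Sigma M d X s + 16 * real d ^ 2 * 2 ^ d / real n)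
                   * tensor_seminorm n d s \<theta>)
     in kolmogorov_dist (distr M borel (\<lambda>\<omega>. tensor_inner n d \<theta> (\<lambda>i. X i \<omega>)))
          (centered_normal \<sigma>2)
        \<le> E1 + E2 + E3"
proof -
  interpret prob_space M using assms(3) by (simp add: random_tensor_def)
  interpret T: exchangeable_tensor M n d X
    by unfold_locales (use assms(1-3) A1 A2 in \<open>auto simp: random_tensor_def\<close>)
  have "oscillation M n d X powr \<alpha> \<le> corr M d X 1" "B powr \<alpha> \<le> corr M d X 1" "(\<kappa> / real n) powr \<alpha> \<le> corr M d X 1"
    using assms(17) by simp_all
  from T.kolmogorov_inner[OF A3 assms(12) \<kappa> B assms(15,16) this]
  show ?thesis unfolding Let_def .
qed

end
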